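(* Let $n\ge 1$ and $r\ge 1$ be integers, and let $S^{2n+1}\{p^r\}$ be the homotopy fibre of the $p^r$-power map on $S^{2n+1}$, equipped with its homotopy associative, homotopy commutative $H$-space structure. Then $H\exp(S^{2n+1}\{p^r\})=p^r$; that is, the $p^r$-power map on $S^{2n+1}\{p^r\}$ is null homotopic, and for every $0\le l<r$ the $p^l$-power map on $S^{2n+1}\{p^r\}$ is not null homotopic.
   Context: Standing assumptions: all spaces have a non-degenerate basepoint, are simply connected, have the homotopy type of a $CW$-complex, and are localised at an odd prime $p>3$ (in particular spheres denote $p$-localised spheres, and all maps are based). On the $p$-local odd sphere $S^{2n+1}$ the degree $p^r$ map and the $p^r$-power map coincide up to homotopy. The mod $p^r$ Moore space $P^{2n+1}(p^r)$ is the homotopy cofibre of the degree $p^r$ map on $S^{2n}$. The $H$-structure on $S^{2n+1}\{p^r\}$ is the one it carries as a universal space of $P^{2n+1}(p^r)$: $S^{2n+1}\{p^r\}$ is a homotopy associative, homotopy commutative $H$-space, with the inclusion $i\colon P^{2n+1}(p^r)\to S^{2n+1}\{p^r\}$ of the bottom two cells, such that any map $f\colon P^{2n+1}(p^r)\to Y$ to a $p$-local homotopy associative, homotopy commutative $H$-space $Y$ extends along $i$ to an $H$-map $\overline{f}\colon S^{2n+1}\{p^r\}\to Y$, unique up to homotopy. For a homotopy associative $H$-space $X$, the $k$-power map is the composite $X\to X^k\to X$ of the $k$-fold diagonal and the iterated multiplication. The mod-$p$ $H$-exponent $H\exp(X)$ is $p^k$ if $k$ is the minimal integer for which the $p^k$-power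 map on $X$ is null homotopic. *)

theory Defs
  imports "HOL-Homology.Homology" "HOL-Computational_Algebra.Primes"
begin

section \<open>Based spaces\<close>

text \<open>A based space is a pair of a topology and a point of its carrier.\<close>

definition based_map ::
  "'a topology \<Rightarrow> 'a \<Rightarrow> 'b topology \<Rightarrow> 'b \<Rightarrow> ('a \<Rightarrow> 'b) \<Rightarrow> bool" where
  "based_map X x0 Y y0 f \<longleftrightarrow>
     x0 \<in> topspace X \<and> y0 \<in> topspace Y \<and> continuous_map X Y f \<and> f x0 = y0"

definition based_homotopic ::
  "'a topology \<Rightarrow> 'a \<Rightarrow> 'b topology \<Rightarrow> 'b \<Rightarrow> ('a \<Rightarrow> 'b) \<Rightarrow> ('a \<Rightarrow> 'b) \<Rightarrow> bool" where
  "based_homotopic X x0 Y y0 f g \<longleftrightarrow> homotopic_with (\<lambda>h. h x0 = y0) X Y f g"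

definition null_homotopic ::
  "'a topology \<Rightarrow> 'a \<Rightarrow> 'b topology \<Rightarrow> 'b \<Rightarrow> ('a \<Rightarrow> 'b) \<Rightarrow> bool" where
  "null_homotopic X x0 Y y0 f \<longleftrightarrow> based_homotopic X x0 Y y0 f (\<lambda>_. y0)"

definition homotopy_equivalence :: "'a topology \<Rightarrow> 'b topology \<Rightarrow> ('a \<Rightarrow> 'b) \<Rightarrow> bool" where
  "homotopy_equivalence X Y f \<longleftrightarrow>
     continuous_map X Y f \<and>
     (\<exists>g. continuous_map Y X g \<and>
          homotopic_with (\<lambda>_. True) X X (g \<circ> f) id \<and>
          homotopic_with (\<lambda>_. True) Y Y (f \<circ> g) id)"

abbreviation unit_interval :: "real topology" where
  "unit_interval \<equiv> top_of_set {0..1}"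

text \<open>The basepoint is non-degenerate if \<open>(X, {x0})\<close> is an NDR pair.\<close>

definition nondegenerate_basepoint :: "'a topology \<Rightarrow> 'a \<Rightarrow> bool" where
  "nondegenerate_basepoint X x0 \<longleftrightarrow>
     x0 \<in> topspace X \<and>
     (\<exists>u h. continuous_map X unit_interval u \<and>
            {x \<in> topspace X. u x = 0} = {x0} \<and>
            continuous_map (prod_topology unit_interval X) X h \<and>
            (\<forall>x \<in> topspace X. h (0, x) = x) \<and>
            (\<forall>t \<in> {0..1}. h (t, x0) = x0) \<and>
            (\<forall>x \<in> topspace X. u x < 1 \<longrightarrow> h (1, x) = x0))"

text \<open>As for \<^const>\<open>simply_connected\<close>, freely homotopic loops are used; path-connectedness
  is the case of constant loops.\<close>

definition simply_connected_space :: "'a topology \<Rightarrow> bool" where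
  "simply_connected_space X \<longleftrightarrow>
     topspace X \<noteq> {} \<and>
     (\<forall>f g. pathin X f \<and> f 0 = f 1 \<and> pathin X g \<and> g 0 = g 1
        \<longrightarrow> homotopic_with (\<lambda>h. h 0 = h 1) unit_interval X f g)"


section \<open>CW complexes\<close>

definition disc :: "nat \<Rightarrow> (nat \<Rightarrow> real) topology" where
  "disc m = subtopology (Euclidean_space m) {x. (\<Sum>i<m. (x i)\<^sup>2) \<le> 1}"

definition disc_interior :: "nat \<Rightarrow> (nat \<Rightarrow> real) set" where
  "disc_interior m = {x \<in> topspace (disc m). (\<Sum>i<m. (x i)\<^sup>2) < 1}"

definition disc_boundary :: "nat \<Rightarrow> (nat \<Rightarrow> real) set" where
  "disc_boundary m = {x \<in> topspace (disc m). (\<Sum>i<m. (x i)\<^sup>2) = 1}"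

text \<open>A cell is given by its dimension and its characteristic map.\<close>

type_synonym 'a cell = "nat \<times> ((nat \<Rightarrow> real) \<Rightarrow> 'a)"

definition open_cell :: "'a cell \<Rightarrow> 'a set" where
  "open_cell c = snd c ` disc_interior (fst c)"

definition closed_cell :: "'a cell \<Rightarrow> 'a set" where
  "closed_cell c = snd c ` topspace (disc (fst c))"

definition cw_structure :: "'a topology \<Rightarrow> 'a cell set \<Rightarrow> bool" where
  "cw_structure X C \<longleftrightarrow>
     Hausdorff_space X \<and>
     (\<forall>c \<in> C. continuous_map (disc (fst c)) X (snd c) \<and>
              embedding_map (subtopology (disc (fst c)) (disc_interior (fst c))) X (snd c)) \<and>
     (\<forall>c \<in> C. \<forall>c' \<in> C. c \<noteq> c' \<longrightarrow> open_cell c \<inter> open_cell c' = {}) \<and>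
     (\<Union>c \<in> C. open_cell c) = topspace X \<and>
     (\<forall>c \<in> C. \<exists>D. finite D \<and> D \<subseteq> {c' \<in> C. fst c' < fst c} \<and>
              snd c ` disc_boundary (fst c) \<subseteq> (\<Union>c' \<in> D. open_cell c')) \<and>
     (\<forall>A. A \<subseteq> topspace X \<longrightarrow> (\<forall>c \<in> C. closedin X (A \<inter> closed_cell c)) \<longrightarrow> closedin X A)"

definition skeleton :: "'a topology \<Rightarrow> 'a cell set \<Rightarrow> nat \<Rightarrow> 'a topology" where
  "skeleton X C m = subtopology X (\<Union>c \<in> {c \<in> C. fst c \<le> m}. open_cell c)"

text \<open>Taking the complex on the type of \<open>X\<close> loses no generality: a CW complex homotopy
  equivalent to \<open>X\<close> can be replaced by one with no more points than \<open>X\<close>. (A space with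
  a non-contractible component of CW type has at least continuum many points, and a
  homotopy equivalence out of \<open>X\<close> has image in a subcomplex with at most \<open>|X|\<close> cells
  that still dominates \<open>X\<close>.)\<close>

definition cw_homotopy_type :: "'a topology \<Rightarrow> bool" where
  "cw_homotopy_type X \<longleftrightarrow>
     (\<exists>(K :: 'a topology) C. cw_structure K C \<and> K homotopy_equivalent_space X)"


section \<open>Localisation at a prime\<close>

definition p_local_group :: "nat \<Rightarrow> ('g, 'm) monoid_scheme \<Rightarrow> bool" where
  "p_local_group p G \<longleftrightarrow>
     (\<forall>q::nat. prime q \<longrightarrow> q \<noteq> p \<longrightarrow>
        bij_betw (\<lambda>x. x [^]\<^bsub>G\<^esub> q) (carrier G) (carrier G))"

text \<open>For abelian groups this says that \<open>h\<close> is \<open>G \<rightarrow> G \<otimes> \<int>\<^sub>(\<^sub>p\<^sub>)\<close> up to isomorphism.\<close>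

definition p_localising_hom ::
  "nat \<Rightarrow> ('g, 'm) monoid_scheme \<Rightarrow> ('h, 'l) monoid_scheme \<Rightarrow> ('g \<Rightarrow> 'h) \<Rightarrow> bool" where
  "p_localising_hom p G H h \<longleftrightarrow>
     h \<in> hom G H \<and> p_local_group p H \<and>
     (\<forall>x \<in> carrier G. h x = \<one>\<^bsub>H\<^esub> \<longrightarrow> (\<exists>k::nat. coprime k p \<and> x [^]\<^bsub>G\<^esub> k = \<one>\<^bsub>G\<^esub>)) \<and>
     (\<forall>y \<in> carrier H. \<exists>k::nat. coprime k p \<and> y [^]\<^bsub>H\<^esub> k \<in> h ` carrier G)"

text \<open>For a simply connected space it is equivalent to ask that the reduced integral homology
  groups or that the homotopy groups be \<open>p\<close>-local.\<close>

definition p_local_space :: "nat \<Rightarrow> 'a topology \<Rightarrow> 'a \<Rightarrow> bool" where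
  "p_local_space p X x0 \<longleftrightarrow>
     nondegenerate_basepoint X x0 \<and> simply_connected_space X \<and> cw_homotopy_type X \<and>
     (\<forall>k. p_local_group p (reduced_homology_group k X))"

text \<open>\<open>(X, x0)\<close> is a \<open>p\<close>-localisation of the \<open>m\<close>-sphere: it receives a map from the sphere
  that localises integral homology. Meant for \<open>m \<ge> 2\<close>.\<close>

definition p_local_sphere :: "nat \<Rightarrow> nat \<Rightarrow> 'a topology \<Rightarrow> 'a \<Rightarrow> bool" where
  "p_local_sphere p m X x0 \<longleftrightarrow>
     p_local_space p X x0 \<and>
     (\<exists>l. based_map (nsphere m) (\<lambda>i. if i = 0 then 1 else 0) X x0 l \<and>
          (\<forall>k. p_localising_hom p (reduced_homology_group k (nsphere m))
                 (reduced_homology_group k X) (hom_induced k (nsphere m) {} X {} l)))"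

definition sphere_map_of_degree :: "nat \<Rightarrow> 'a topology \<Rightarrow> 'a \<Rightarrow> nat \<Rightarrow> ('a \<Rightarrow> 'a) \<Rightarrow> bool" where
  "sphere_map_of_degree m X x0 k f \<longleftrightarrow>
     based_map X x0 X x0 f \<and>
     (\<forall>z \<in> carrier (reduced_homology_group (int m) X).
        hom_induced (int m) X {} X {} f z = z [^]\<^bsub>reduced_homology_group (int m) X\<^esub> k)"


section \<open>Homotopy fibres and cofibres\<close>

text \<open>The space of paths in \<open>X\<close> with the compact-open topology.\<close>

definition paths :: "'a topology \<Rightarrow> (real \<Rightarrow> 'a) set" where
  "paths X = {\<gamma> \<in> extensional {0..1}. pathin X \<gamma>}"

definition path_space :: "'a topology \<Rightarrow> (real \<Rightarrow> 'a) topology" where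
  "path_space X =
     topology_generated_by
       {{\<gamma> \<in> paths X. \<gamma> ` C \<subseteq> U} | C U. compact C \<and> C \<subseteq> {0..1} \<and> openin X U}"

definition homotopy_fibre ::
  "'a topology \<Rightarrow> 'b topology \<Rightarrow> 'b \<Rightarrow> ('a \<Rightarrow> 'b) \<Rightarrow> ('a \<times> (real \<Rightarrow> 'b)) topology" where
  "homotopy_fibre X Y y0 f =
     subtopology (prod_topology X (path_space Y)) {(x, \<gamma>). \<gamma> 0 = y0 \<and> \<gamma> 1 = f x}"

definition fibre_basepoint :: "'a \<Rightarrow> 'b \<Rightarrow> 'a \<times> (real \<Rightarrow> 'b)" where
  "fibre_basepoint x0 y0 = (x0, restrict (\<lambda>_. y0) {0..1})"

text \<open>The homotopy cofibre of a based map \<open>f : (A, a0) \<rightarrow> (B, b0)\<close> is the reduced mapping cone,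
  i.e. the quotient of the disjoint union of \<open>B\<close> and \<open>A \<times> [0,1]\<close> by \<open>(a, 0) \<sim> f a\<close>,
  \<open>(a, 1) \<sim> b0\<close> and \<open>(a0, t) \<sim> b0\<close>. Its points are represented by \<open>Inl b\<close> with \<open>b\<close> in \<open>B\<close>
  and \<open>Inr (a, t)\<close> with \<open>a \<noteq> a0\<close> and \<open>0 < t < 1\<close>; \<open>cone_point\<close> sends \<open>(a, t)\<close> to the
  representative of its class.\<close>

definition cone_point ::
  "'a \<Rightarrow> 'b \<Rightarrow> ('a \<Rightarrow> 'b) \<Rightarrow> 'a \<times> real \<Rightarrow> 'b + 'a \<times> real" where
  "cone_point a0 b0 f z =
     (if fst z = a0 \<or> snd z = 1 then Inl b0
      else if snd z = 0 then Inl (f (fst z)) else Inr z)"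

definition homotopy_cofibre ::
  "'a topology \<Rightarrow> 'a \<Rightarrow> 'b topology \<Rightarrow> 'b \<Rightarrow> ('a \<Rightarrow> 'b) \<Rightarrow> ('b + 'a \<times> real) topology" where
  "homotopy_cofibre A a0 B b0 f =
     topology (\<lambda>U.
       U \<subseteq> Inl ` topspace B \<union> Inr ` ((topspace A - {a0}) \<times> {0<..<1}) \<and>
       openin B {b \<in> topspace B. Inl b \<in> U} \<and>
       openin (prod_topology A unit_interval)
         {z \<in> topspace (prod_topology A unit_interval). cone_point a0 b0 f z \<in> U})"

lemma openin_homotopy_cofibre:
  "openin (homotopy_cofibre A a0 B b0 f) U \<longleftrightarrow>
     U \<subseteq> Inl ` topspace B \<union> Inr ` ((topspace A - {a0}) \<times> {0<..<1}) \<and>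
     openin B {b \<in> topspace B. Inl b \<in> U} \<and>
     openin (prod_topology A unit_interval)
       {z \<in> topspace (prod_topology A unit_interval). cone_point a0 b0 f z \<in> U}"
proof -
  have Int: "{x \<in> W. g x \<in> U \<inter> V} = {x \<in> W. g x \<in> U} \<inter> {x \<in> W. g x \<in> V}"
    for g :: "'x \<Rightarrow> 'y" and W U V by auto
  have Un: "{x \<in> W. g x \<in> \<Union>\<K>} = \<Union>((\<lambda>U. {x \<in> W. g x \<in> U}) ` \<K>)"
    for g :: "'x \<Rightarrow> 'y" and W \<K> by auto
  have "istopology (\<lambda>U.
       U \<subseteq> Inl ` topspace B \<union> Inr ` ((topspace A - {a0}) \<times> {0<..<1}) \<and>
       openin B {b \<in> topspace B. Inl b \<in> U} \<and>
       openin (prod_topology A unit_interval)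
         {z \<in> topspace (prod_topology A unit_interval). cone_point a0 b0 f z \<in> U})"
    unfolding istopology_def Int Un
    by (intro conjI allI impI openin_Int openin_Union) blast+
  then show ?thesis
    unfolding homotopy_cofibre_def by (simp add: topology_inverse')
qed


section \<open>H-spaces\<close>

definition H_space :: "'a topology \<Rightarrow> 'a \<Rightarrow> ('a \<times> 'a \<Rightarrow> 'a) \<Rightarrow> bool" where
  "H_space X x0 \<mu> \<longleftrightarrow>
     based_map (prod_topology X X) (x0, x0) X x0 \<mu> \<and>
     based_homotopic X x0 X x0 (\<lambda>x. \<mu> (x, x0)) id \<and>
     based_homotopic X x0 X x0 (\<lambda>x. \<mu> (x0, x)) id"

definition homotopy_associative :: "'a topology \<Rightarrow> 'a \<Rightarrow> ('a \<times> 'a \<Rightarrow> 'a) \<Rightarrow> bool" where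
  "homotopy_associative X x0 \<mu> \<longleftrightarrow>
     based_homotopic (prod_topology X (prod_topology X X)) (x0, x0, x0) X x0
       (\<lambda>(x, y, z). \<mu> (\<mu> (x, y), z)) (\<lambda>(x, y, z). \<mu> (x, \<mu> (y, z)))"

definition homotopy_commutative :: "'a topology \<Rightarrow> 'a \<Rightarrow> ('a \<times> 'a \<Rightarrow> 'a) \<Rightarrow> bool" where
  "homotopy_commutative X x0 \<mu> \<longleftrightarrow>
     based_homotopic (prod_topology X X) (x0, x0) X x0 \<mu> (\<lambda>(x, y). \<mu> (y, x))"

definition H_map ::
  "'a topology \<Rightarrow> 'a \<Rightarrow> ('a \<times> 'a \<Rightarrow> 'a) \<Rightarrow>
   'b topology \<Rightarrow> 'b \<Rightarrow> ('b \<times> 'b \<Rightarrow> 'b) \<Rightarrow> ('a \<Rightarrow> 'b) \<Rightarrow> bool" where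
  "H_map X x0 \<mu> Y y0 \<nu> f \<longleftrightarrow>
     based_map X x0 Y y0 f \<and>
     based_homotopic (prod_topology X X) (x0, x0) Y y0
       (\<lambda>(x, y). f (\<mu> (x, y))) (\<lambda>(x, y). \<nu> (f x, f y))"

text \<open>The composite of the \<open>k\<close>-fold diagonal and the multiplication iterated from the left,
  \<open>x \<mapsto> ((x x) x) \<dots> x\<close>.\<close>

fun power_map :: "'a \<Rightarrow> ('a \<times> 'a \<Rightarrow> 'a) \<Rightarrow> nat \<Rightarrow> 'a \<Rightarrow> 'a" where
  "power_map x0 \<mu> 0 x = x0"
| "power_map x0 \<mu> (Suc 0) x = x"
| "power_map x0 \<mu> (Suc (Suc k)) x = \<mu> (power_map x0 \<mu> (Suc k) x, x)"

text \<open>Junk if no \<open>p ^ k\<close>-power map is null homotopic.\<close>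

definition H_exp :: "nat \<Rightarrow> 'a topology \<Rightarrow> 'a \<Rightarrow> ('a \<times> 'a \<Rightarrow> 'a) \<Rightarrow> nat" where
  "H_exp p X x0 \<mu> = p ^ (LEAST k. null_homotopic X x0 X x0 (power_map x0 \<mu> (p ^ k)))"

definition p_local_HAHC_space :: "nat \<Rightarrow> 'a topology \<Rightarrow> 'a \<Rightarrow> ('a \<times> 'a \<Rightarrow> 'a) \<Rightarrow> bool" where
  "p_local_HAHC_space p X x0 \<mu> \<longleftrightarrow>
     p_local_space p X x0 \<and> H_space X x0 \<mu> \<and>
     homotopy_associative X x0 \<mu> \<and> homotopy_commutative X x0 \<mu>"


section \<open>Universal spaces\<close>

text \<open>The target \<open>Y\<close> of the universal property ranges over the based spaces on the type of \<open>F\<close>.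
  Since \<open>F\<close> itself is among them, two structures on \<open>F\<close> with this property are
  equivalent by an H-map compatible with the maps from \<open>P\<close>; so if some structure on \<open>F\<close> is
  universal for all \<open>Y\<close>, this property is equivalent to universality for all \<open>Y\<close>.\<close>

definition universal_space ::
  "nat \<Rightarrow> 'c topology \<Rightarrow> 'c \<Rightarrow> 'a topology \<Rightarrow> 'a \<Rightarrow> ('a \<times> 'a \<Rightarrow> 'a) \<Rightarrow> ('c \<Rightarrow> 'a) \<Rightarrow> bool" where
  "universal_space p P p0 F f0 \<mu> i \<longleftrightarrow>
     p_local_HAHC_space p F f0 \<mu> \<and> based_map P p0 F f0 i \<and>
     (\<forall>(Y :: 'a topology) y0 \<nu> f.
        p_local_HAHC_space p Y y0 \<nu> \<longrightarrow> based_map P p0 Y y0 f \<longrightarrow>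
        (\<exists>g. H_map F f0 \<mu> Y y0 \<nu> g \<and> based_homotopic P p0 Y y0 (g \<circ> i) f \<and>
             (\<forall>g'. H_map F f0 \<mu> Y y0 \<nu> g' \<and> based_homotopic P p0 Y y0 (g' \<circ> i) f \<longrightarrow>
                   based_homotopic F f0 Y y0 g' g)))"

text \<open>Up to homotopy equivalence, \<open>i\<close> is the inclusion of the \<open>(m+1)\<close>-skeleton of a CW complex
  with one vertex (the basepoint), one \<open>m\<close>-cell, one \<open>(m+1)\<close>-cell, and all
  other cells of higher dimension.\<close>

definition bottom_two_cells ::
  "nat \<Rightarrow> 'c topology \<Rightarrow> 'c \<Rightarrow> 'a topology \<Rightarrow> 'a \<Rightarrow> ('c \<Rightarrow> 'a) \<Rightarrow> bool" where
  "bottom_two_cells m P p0 F f0 i \<longleftrightarrow>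
     (\<exists>(K :: 'a topology) C k0 c0 c1 c2 e h.
        cw_structure K C \<and>
        {c \<in> C. fst c \<le> Suc m} = {c0, c1, c2} \<and>
        fst c0 = 0 \<and> open_cell c0 = {k0} \<and> fst c1 = m \<and> fst c2 = Suc m \<and>
        based_map P p0 (skeleton K C (Suc m)) k0 e \<and>
        homotopy_equivalence P (skeleton K C (Suc m)) e \<and>
        based_map K k0 F f0 h \<and> homotopy_equivalence K F h \<and>
        based_homotopic P p0 F f0 i (h \<circ> e))"

end

theory Submission
  imports Defs "HOL-Analysis.Analysis"
begin

text \<open>Power maps of a homotopy associative, homotopy commutative H-space are H-maps. By uniqueness in the
  universal property the \<open>p\<^sup>r\<close>-power map of \<open>F\<close> is therefore trivial as soon as it is trivial on the bottom
  two cells. Up to homotopy these form a sphere \<open>S\<^sup>m\<close> with an \<open>(m+1)\<close>-cell attached by a map of some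
  degree \<open>d\<close>, which is odd: it divides \<open>p\<^sup>r\<close>, because \<open>p\<^sup>r\<close> annihilates the \<open>m\<close>-th homology of the mod
  \<open>p\<^sup>r\<close> Moore space. It remains to show that \<open>d\<close> annihilates the homotopy classes of maps from the mapping
  cone of a map of odd degree \<open>d\<close> to an H-space of this kind. Clearly \<open>d\<^sup>2\<close> does. The failure of
  \<open>U \<mapsto> U(j x)\<close> to be additive is measured by a map on a torus that is trivial on both coordinate circles;
  the flip of the torus inverts it, so its square is trivial. Hence \<open>2 d\<close> annihilates, and \<open>d\<close> does as
  \<open>gcd(2 d, d\<^sup>2) = d\<close>.

  Conversely let \<open>p\<^sup>l\<close> annihilate \<open>F\<close>, which contains \<open>\<Omega>S\<close>. The adjoint of a generator of the homology of
  \<open>S\<close> then shows that \<open>p\<^sup>l\<close> times this generator is divisible by \<open>p\<^sup>r\<close>, whence \<open>l \<ge> r\<close>.\<close>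

text \<open>No quotient such as a suspension, torus or Moore space is formed: a map out of it is a
  map on a product with the real line that satisfies periodicity conditions. Thus
  \<open>x \<mapsto> j x\<close> makes sense, and every deformation of coordinates is a formula.
  Classes of such maps multiply pointwise in the target and form only a monoid; an
  \<open>(N - 1)\<close>-st power replaces the inverse where the order divides \<open>N\<close>, the
  reversed loop does so elsewhere. The obstacle on the mapping cone is that its base has the finer
  period \<open>1/d\<close>, which the deformation of a diagonal loop into two successive loops does
  not respect. Hence the detour through a map that measures non-additivity, and through its square,
  which can be made trivial on the base. The Moore space is a cofibre of p-local spheres, whereas
  the cell argument needs a genuine sphere and disc. Only the exponent of one homology group is
  carried over to the CW model. There the attaching map is an arbitrary self-map of a sphere, and
  Hopf's degree theorem, proved by general position and suspension, brings it to the form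
  \<open>x \<mapsto> d x\<close>.\<close>

abbreviation IZ :: "'z topology \<Rightarrow> (real \<times> 'z) topology" where
 "IZ Z \<equiv> prod_topology unit_interval Z"

abbreviation rcont :: "'x topology \<Rightarrow> ('x \<Rightarrow> real) \<Rightarrow> bool" where
 "rcont X f \<equiv> continuous_map X euclideanreal f"

abbreviation cmap :: "'x topology \<Rightarrow> 'y topology \<Rightarrow> ('x \<Rightarrow> 'y) \<Rightarrow> bool" where
 "cmap \<equiv> continuous_map"

abbreviation htp :: "'x topology \<Rightarrow> 'y topology \<Rightarrow> ('x \<Rightarrow> 'y) \<Rightarrow> ('x \<Rightarrow> 'y) \<Rightarrow> bool" where
 "htp \<equiv> homotopic_with (\<lambda>_. True)"

abbreviation sph :: "nat \<Rightarrow> (nat \<Rightarrow> real) set" where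
 "sph n \<equiv> topspace (nsphere n)"

abbreviation rel_H :: "int \<Rightarrow> 'x topology \<Rightarrow> 'x set \<Rightarrow> 'x chain set monoid" where
 "rel_H \<equiv> relative_homology_group"

lemmas cm_pair = continuous_map_pairedI
lemmas cm_fst = continuous_map_fst
lemmas cm_snd = continuous_map_snd
lemmas cm_sub = continuous_map_from_subtopology
lemmas cm_full = continuous_map_into_fulltopology
lemmas cm_in_sub = continuous_map_in_subtopology
lemmas cm_funspace = continuous_map_funspace
lemmas closedin_pre = closedin_continuous_map_preimage
lemmas openin_pre = openin_continuous_map_preimage
lemmas htp_trans = homotopic_with_trans

section \<open>Homotopy classes of constrained maps\<close>

text \<open>A map out of a quotient of \<open>D\<close> is given by a map on \<open>D\<close> that sends a set \<open>B\<close> to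
 the basepoint and respects a set \<open>E\<close> of identifications.\<close>

definition adm :: "'d set \<Rightarrow> ('d \<times> 'd) set \<Rightarrow> 'f \<Rightarrow> ('d \<Rightarrow> 'f) \<Rightarrow> bool" where
 "adm B E z h \<longleftrightarrow> (\<forall>a \<in> B. h a = z) \<and> (\<forall>(a, b) \<in> E. h a = h b)"

definition cmaps :: "'d topology \<Rightarrow> 'd set \<Rightarrow> ('d \<times> 'd) set \<Rightarrow> 'f topology \<Rightarrow> 'f \<Rightarrow> ('d \<Rightarrow> 'f) set" where
 "cmaps D B E F z = {f. cmap D F f \<and> adm B E z f}"

abbreviation hmt :: "'d topology \<Rightarrow> 'd set \<Rightarrow> ('d \<times> 'd) set \<Rightarrow> 'f topology \<Rightarrow> 'f
  \<Rightarrow> ('d \<Rightarrow> 'f) \<Rightarrow> ('d \<Rightarrow> 'f) \<Rightarrow> bool" where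
 "hmt D B E F z \<equiv> homotopic_with (adm B E z) D F"

lemma admD: "adm B E z h \<Longrightarrow> a \<in> B \<Longrightarrow> h a = z"
 by (simp add: adm_def)

lemma admD2: "adm B E z h \<Longrightarrow> (a, b) \<in> E \<Longrightarrow> h a = h b"
 by (auto simp: adm_def)

lemma admI: "(\<And>a. a \<in> B \<Longrightarrow> h a = z) \<Longrightarrow> (\<And>a b. (a, b) \<in> E \<Longrightarrow> h a = h b) \<Longrightarrow> adm B E z h"
 by (auto simp: adm_def)

lemma adm_post: "adm B E z h \<Longrightarrow> u z = y \<Longrightarrow> adm B E y (\<lambda>x. u (h x))"
 by (rule admI) (metis admD, metis admD2)

lemma adm_pair: "adm B E z h \<Longrightarrow> adm B E y k \<Longrightarrow> adm B E (z, y) (\<lambda>x. (h x, k x))"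
 by (rule admI) (metis admD, metis admD2)

lemma cmapsI: "cmap D F f \<Longrightarrow> adm B E z f \<Longrightarrow> f \<in> cmaps D B E F z"
 by (simp add: cmaps_def)

lemma cmapsD:
 assumes "f \<in> cmaps D B E F z"
 shows "cmap D F f" "adm B E z f"
 using assms by (auto simp: cmaps_def)

lemma hmt_cmaps:
 assumes "hmt D B E F z f g"
 shows "f \<in> cmaps D B E F z" "g \<in> cmaps D B E F z"
 using assms homotopic_with_imp_continuous_maps homotopic_with_imp_property
 by (auto intro!: cmapsI) blast+

lemma hmt_refl: "f \<in> cmaps D B E F z \<Longrightarrow> hmt D B E F z f f"
 by (simp add: cmaps_def)

text \<open>Time runs over all of \<real> in the continuity premise, so that no subspace topology
  appears, but the constraints are only asked for in \<open>[0,1]\<close>.\<close>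

lemma hmtI:
 assumes "cmap (prod_topology euclideanreal D) F h"
  and "\<And>x. h (0, x) = f x" "\<And>x. h (1, x) = g x"
  and "\<And>t. t \<in> {0..1} \<Longrightarrow> adm B E z (\<lambda>x. h (t, x))"
 shows "hmt D B E F z f g"
proof -
 have "cmap (IZ D) F h"
  using assms(1) by (metis (no_types) cm_sub prod_topology_subtopology(1))
 then show ?thesis
  unfolding homotopic_with_def using assms(2-) by blast
qed

lemma hmt_post:
 assumes "homotopic_with (\<lambda>h. h x0 = y0) X Y u v" "f \<in> cmaps D B E X x0"
 shows "hmt D B E Y y0 (u \<circ> f) (v \<circ> f)"
proof (rule homotopic_with_compose_continuous_map_right[OF assms(1) cmapsD(1)[OF assms(2)]])
 fix j assume j: "j x0 = y0"
 show "adm B E y0 (j \<circ> f)"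
 proof (rule admI)
  show "(j \<circ> f) a = y0" if "a \<in> B" for a
   using admD[OF cmapsD(2)[OF assms(2)] that] j by simp
  show "(j \<circ> f) a = (j \<circ> f) b" if "(a, b) \<in> E" for a b
   using admD2[OF cmapsD(2)[OF assms(2)] that] by simp
 qed
qed

text \<open>A pair from \<open>E'\<close> may also collapse to one point or land in \<open>B\<close>
  as a whole; either way a constrained map cannot separate it.\<close>

lemma hmt_pre:
 assumes "hmt D B E F z f g" "cmap D' D \<theta>"
  and "\<And>a. a \<in> B' \<Longrightarrow> \<theta> a \<in> B"
  and "\<And>a b. (a, b) \<in> E' \<Longrightarrow> (\<theta> a, \<theta> b) \<in> E \<or> \<theta> a = \<theta> b \<or> {\<theta> a, \<theta> b} \<subseteq> B"
 shows "hmt D' B' E' F z (f \<circ> \<theta>) (g \<circ> \<theta>)"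
proof (rule homotopic_with_compose_continuous_map_right[OF assms(1,2)])
 fix j assume j: "adm B E z j"
 show "adm B' E' z (j \<circ> \<theta>)"
 proof (rule admI)
  show "(j \<circ> \<theta>) a = z" if "a \<in> B'" for a
   using admD[OF j assms(3)[OF that]] by simp
  show "(j \<circ> \<theta>) a = (j \<circ> \<theta>) b" if "(a, b) \<in> E'" for a b
   using assms(4)[OF that] admD[OF j, of "\<theta> a"] admD[OF j, of "\<theta> b"] admD2[OF j, of "\<theta> a" "\<theta> b"]
   by auto
 qed
qed

lemma hmt_mono:
 assumes "hmt D B E F z f g" "B' \<subseteq> B"
  and "\<And>a b. (a, b) \<in> E' \<Longrightarrow> (a, b) \<in> E \<or> {a, b} \<subseteq> B"
 shows "hmt D B' E' F z f g"
 using hmt_pre[OF assms(1) continuous_map_id, of B' E'] assms(2,3) by auto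

text \<open>The map \<open>f\<close> stays fixed and its argument is moved. The constraints are
  asked of the composite only, since a moving point may leave the constrained set while
  \<open>f\<close> still has the required value.\<close>

lemma hmt_pre_htpy:
 assumes "f \<in> cmaps D B E F z"
  and "cmap (prod_topology euclideanreal D') D h"
  and "\<And>t a. t \<in> {0..1} \<Longrightarrow> a \<in> B' \<Longrightarrow> f (h (t, a)) = z"
  and "\<And>t a b. t \<in> {0..1} \<Longrightarrow> (a, b) \<in> E' \<Longrightarrow> f (h (t, a)) = f (h (t, b))"
  and "\<And>x. f (h (0, x)) = u x" "\<And>x. f (h (1, x)) = v x"
 shows "hmt D' B' E' F z u v"
 by (rule hmtI[of _ _ "f \<circ> h"])
   (use assms in \<open>auto intro!: admI continuous_map_compose dest: cmapsD\<close>)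

lemma hmt_cong:
 assumes "hmt D B E F z f g" "\<And>x. f x = f' x" "\<And>x. g x = g' x"
 shows "hmt D B E F z f' g'"
proof -
 have "f = f'" "g = g'" using assms(2,3) by auto
 then show ?thesis using assms(1) by simp
qed

lemma hmt_pair:
 assumes "hmt D B E F z f f'" "hmt D B E G y g g'"
 shows "hmt D B E (prod_topology F G) (z, y) (\<lambda>x. (f x, g x)) (\<lambda>x. (f' x, g' x))"
proof -
 obtain h where h: "cmap (IZ D) F h"
  "\<forall>x. h (0, x) = f x" "\<forall>x. h (1, x) = f' x" "\<forall>t \<in> {0..1}. adm B E z (\<lambda>x. h (t, x))"
  using assms(1) unfolding homotopic_with_def by blast
 obtain k where k: "cmap (IZ D) G k"
  "\<forall>x. k (0, x) = g x" "\<forall>x. k (1, x) = g' x" "\<forall>t \<in> {0..1}. adm B E y (\<lambda>x. k (t, x))"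
  using assms(2) unfolding homotopic_with_def by blast
 show ?thesis
  unfolding homotopic_with_def
 proof (intro exI[of _ "\<lambda>x. (h x, k x)"] conjI allI ballI)
  show "adm B E (z, y) (\<lambda>x. (h (t, x), k (t, x)))" if "t \<in> {0..1}" for t
   by (rule adm_pair[OF h(4)[rule_format, OF that] k(4)[rule_format, OF that]])
 qed (use h k in \<open>auto intro: cm_pair\<close>)
qed

lemma cmaps_pair:
 "f \<in> cmaps D B E F z \<Longrightarrow> g \<in> cmaps D B E G y \<Longrightarrow> (\<lambda>x. (f x, g x)) \<in> cmaps D B E (prod_topology F G) (z, y)"
 by (rule hmt_cmaps(1)[OF hmt_pair[OF hmt_refl hmt_refl]])

lemma cmaps_const: "z \<in> topspace F \<Longrightarrow> (\<lambda>_. z) \<in> cmaps D B E F z"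
 by (auto intro!: cmapsI admI)

lemma cmaps_post:
 assumes "f \<in> cmaps D B E X x0" "cmap X Y u" "u x0 = y0"
 shows "u \<circ> f \<in> cmaps D B E Y y0"
 by (rule hmt_cmaps(1)[OF hmt_post[OF _ assms(1), of _ _ u u]]) (simp add: assms)

section \<open>The monoid of homotopy classes of maps into an H-space\<close>

definition pmul :: "('f \<times> 'f \<Rightarrow> 'f) \<Rightarrow> ('d \<Rightarrow> 'f) \<Rightarrow> ('d \<Rightarrow> 'f) \<Rightarrow> 'd \<Rightarrow> 'f" where
 "pmul \<mu> f g = (\<lambda>x. \<mu> (f x, g x))"

locale hspace =
 fixes F :: "'f topology" and z :: 'f and \<mu> :: "'f \<times> 'f \<Rightarrow> 'f"
 assumes H: "H_space F z \<mu>"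
begin

abbreviation pw :: "nat \<Rightarrow> ('d \<Rightarrow> 'f) \<Rightarrow> 'd \<Rightarrow> 'f" where
 "pw k f \<equiv> power_map z \<mu> k \<circ> f"

lemma z_in: "z \<in> topspace F"
 using H by (simp add: H_space_def based_map_def)

lemma mu_cont: "cmap (prod_topology F F) F \<mu>" and mu_zz: "\<mu> (z, z) = z"
 using H by (auto simp: H_space_def based_map_def)

lemma pmul_hmt:
 assumes "hmt D B E F z f f'" "hmt D B E F z g g'"
 shows "hmt D B E F z (pmul \<mu> f g) (pmul \<mu> f' g')"
proof -
 have "hmt D B E F z (\<mu> \<circ> (\<lambda>x. (f x, g x))) (\<mu> \<circ> (\<lambda>x. (f' x, g' x)))"
  by (rule homotopic_with_compose_continuous_map_left[OF hmt_pair[OF assms] mu_cont])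
    (unfold o_def, erule adm_post, rule mu_zz)
 then show ?thesis by (simp add: pmul_def o_def)
qed

lemma pmul_cmaps: "f \<in> cmaps D B E F z \<Longrightarrow> g \<in> cmaps D B E F z \<Longrightarrow> pmul \<mu> f g \<in> cmaps D B E F z"
 using hmt_cmaps(1)[OF pmul_hmt[OF hmt_refl hmt_refl]] .

lemma pmul_unit_right: "f \<in> cmaps D B E F z \<Longrightarrow> hmt D B E F z (pmul \<mu> f (\<lambda>_. z)) f"
 using hmt_post[of z z F F "\<lambda>x. \<mu> (x, z)" id f] H
 by (simp add: H_space_def based_homotopic_def pmul_def o_def)

lemma pmul_unit_left: "f \<in> cmaps D B E F z \<Longrightarrow> hmt D B E F z (pmul \<mu> (\<lambda>_. z) f) f"
 using hmt_post[of z z F F "\<lambda>x. \<mu> (z, x)" id f] H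
 by (simp add: H_space_def based_homotopic_def pmul_def o_def)

lemma power_map_Suc: "k > 0 \<Longrightarrow> power_map z \<mu> (Suc k) x = \<mu> (power_map z \<mu> k x, x)"
 by (cases k) auto

lemma power_map_z: "power_map z \<mu> k z = z"
proof (induction k)
 case (Suc k) then show ?case by (cases k) (auto simp: mu_zz)
qed auto

lemma power_map_cont: "cmap F F (power_map z \<mu> k)"
proof (induction k)
 case 0
 have "power_map z \<mu> 0 = (\<lambda>_. z)" by auto
 then show ?case by (simp add: z_in)
next
 case (Suc k)
 show ?case
 proof (cases "k = 0")
  case True
  then have "power_map z \<mu> (Suc k) = id" by auto
  then show ?thesis by simp
 next
  case False
  then have "power_map z \<mu> (Suc k) = \<mu> \<circ> (\<lambda>x. (power_map z \<mu> k x, x))"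
   by (auto simp: power_map_Suc)
  then show ?thesis
   using continuous_map_compose[OF cm_pair[OF Suc continuous_map_id[unfolded id_def]] mu_cont]
   by metis
 qed
qed

lemma pw_hmt: "hmt D B E F z f g \<Longrightarrow> hmt D B E F z (pw k f) (pw k g)"
 by (rule homotopic_with_compose_continuous_map_left[OF _ power_map_cont])
   (assumption, unfold o_def, erule adm_post, rule power_map_z)

lemma pw_cmaps: "f \<in> cmaps D B E F z \<Longrightarrow> pw k f \<in> cmaps D B E F z"
 using hmt_cmaps(1)[OF pw_hmt[OF hmt_refl]] .

text \<open>\<open>power_map\<close> starts with \<open>x\<close> itself at exponent 1 rather than
  with a product with the basepoint, so the equation is strict for \<open>k > 0\<close> and needs
  the unit homotopy at \<open>k = 0\<close>.\<close>

lemma pw_Suc: "f \<in> cmaps D B E F z \<Longrightarrow> hmt D B E F z (pw (Suc k) f) (pmul \<mu> (pw k f) f)"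
proof (cases "k = 0")
 case True
 assume f: "f \<in> cmaps D B E F z"
 have "pw (Suc k) f = f" "pw k f = (\<lambda>_. z)"
  using True by (auto simp: o_def)
 then show ?thesis
  using homotopic_with_symD[OF pmul_unit_left[OF f]] by simp
next
 case False
 assume f: "f \<in> cmaps D B E F z"
 have "pw (Suc k) f = pmul \<mu> (pw k f) f"
  using False by (auto simp: o_def pmul_def power_map_Suc)
 then show ?thesis
  using hmt_refl[OF pw_cmaps[OF f]] by metis
qed

definition hclass :: "'d topology \<Rightarrow> 'd set \<Rightarrow> ('d \<times> 'd) set \<Rightarrow> ('d \<Rightarrow> 'f) \<Rightarrow> ('d \<Rightarrow> 'f) set" where
 "hclass D B E f = {g. hmt D B E F z f g}"

text \<open>Representatives are picked by choice; \<open>hmonoid_mult\<close> shows that the product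
  does not depend on them. An H-space as defined here comes without homotopy inverses, so this is a
  monoid at best.\<close>

definition hmonoid :: "'d topology \<Rightarrow> 'd set \<Rightarrow> ('d \<times> 'd) set \<Rightarrow> ('d \<Rightarrow> 'f) set monoid" where
 "hmonoid D B E = \<lparr>carrier = hclass D B E ` cmaps D B E F z,
   monoid.mult = (\<lambda>X Y. hclass D B E (pmul \<mu> (SOME f. f \<in> X) (SOME g. g \<in> Y))),
   monoid.one = hclass D B E (\<lambda>_. z)\<rparr>"

lemma hclass_eqI: "hmt D B E F z f g \<Longrightarrow> hclass D B E f = hclass D B E g"
 unfolding hclass_def by (auto intro: htp_trans homotopic_with_symD)

lemma hclass_eqD: "f \<in> cmaps D B E F z \<Longrightarrow> hclass D B E g = hclass D B E f \<Longrightarrow> hmt D B E F z g f"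
 using hmt_refl by (fastforce simp: hclass_def)

lemma hclass_in: "f \<in> cmaps D B E F z \<Longrightarrow> hclass D B E f \<in> carrier (hmonoid D B E)"
 by (simp add: hmonoid_def)

lemma hmonoid_one: "\<one>\<^bsub>hmonoid D B E\<^esub> = hclass D B E (\<lambda>_. z)"
 by (simp add: hmonoid_def)

lemma hmonoid_mult:
 assumes f: "f \<in> cmaps D B E F z" and g: "g \<in> cmaps D B E F z"
 shows "hclass D B E f \<otimes>\<^bsub>hmonoid D B E\<^esub> hclass D B E g = hclass D B E (pmul \<mu> f g)"
proof -
 have f': "hmt D B E F z f (SOME f'. f' \<in> hclass D B E f)"
  using someI[of "\<lambda>f'. f' \<in> hclass D B E f" f] hmt_refl[OF f] by (simp add: hclass_def)
 have g': "hmt D B E F z g (SOME g'. g' \<in> hclass D B E g)"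
  using someI[of "\<lambda>g'. g' \<in> hclass D B E g" g] hmt_refl[OF g] by (simp add: hclass_def)
 show ?thesis
  using hclass_eqI[OF pmul_hmt[OF f' g']] by (simp add: hmonoid_def)
qed

end

locale ha_space = hspace +
 assumes assoc: "homotopy_associative F z \<mu>"
begin

lemma pmul_assoc:
 assumes "f \<in> cmaps D B E F z" "g \<in> cmaps D B E F z" "h \<in> cmaps D B E F z"
 shows "hmt D B E F z (pmul \<mu> (pmul \<mu> f g) h) (pmul \<mu> f (pmul \<mu> g h))"
 using hmt_post[OF assoc[unfolded homotopy_associative_def based_homotopic_def]
   cmaps_pair[OF assms(1) cmaps_pair[OF assms(2,3)]]]
 by (simp add: pmul_def o_def)

lemma monoid_hmonoid: "Group.monoid (hmonoid D B E)"
proof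
 fix x y w assume "x \<in> carrier (hmonoid D B E)" "y \<in> carrier (hmonoid D B E)" "w \<in> carrier (hmonoid D B E)"
 then obtain f g h where [simp]: "x = hclass D B E f" "y = hclass D B E g" "w = hclass D B E h"
  and m: "f \<in> cmaps D B E F z" "g \<in> cmaps D B E F z" "h \<in> cmaps D B E F z"
  by (auto simp: hmonoid_def)
 show "x \<otimes>\<^bsub>hmonoid D B E\<^esub> y \<in> carrier (hmonoid D B E)"
  using m by (simp add: hmonoid_mult hclass_in pmul_cmaps)
 show "x \<otimes>\<^bsub>hmonoid D B E\<^esub> y \<otimes>\<^bsub>hmonoid D B E\<^esub> w = x \<otimes>\<^bsub>hmonoid D B E\<^esub> (y \<otimes>\<^bsub>hmonoid D B E\<^esub> w)"
  using m by (simp add: hmonoid_mult pmul_cmaps hclass_eqI[OF pmul_assoc])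
next
 have c: "(\<lambda>_. z) \<in> cmaps D B E F z" by (rule cmaps_const[OF z_in])
 show "\<one>\<^bsub>hmonoid D B E\<^esub> \<in> carrier (hmonoid D B E)"
  using c by (simp add: hmonoid_one hclass_in)
 fix x assume "x \<in> carrier (hmonoid D B E)"
 then obtain f where [simp]: "x = hclass D B E f" and m: "f \<in> cmaps D B E F z"
  by (auto simp: hmonoid_def)
 show "\<one>\<^bsub>hmonoid D B E\<^esub> \<otimes>\<^bsub>hmonoid D B E\<^esub> x = x" "x \<otimes>\<^bsub>hmonoid D B E\<^esub> \<one>\<^bsub>hmonoid D B E\<^esub> = x"
  using m c by (simp_all add: hmonoid_one hmonoid_mult hclass_eqI[OF pmul_unit_left] hclass_eqI[OF pmul_unit_right])
qed

lemma hclass_pw: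
 assumes "f \<in> cmaps D B E F z"
 shows "hclass D B E (pw k f) = hclass D B E f [^]\<^bsub>hmonoid D B E\<^esub> k"
proof (induction k)
 case 0
 have "pw 0 f = (\<lambda>_. z)" by (auto simp: o_def)
 then show ?case by (simp add: hmonoid_one monoid.nat_pow_0[OF monoid_hmonoid])
next
 case (Suc k)
 have "hclass D B E (pw (Suc k) f) = hclass D B E (pw k f) \<otimes>\<^bsub>hmonoid D B E\<^esub> hclass D B E f"
  unfolding hmonoid_mult[OF pw_cmaps[OF assms] assms] by (rule hclass_eqI[OF pw_Suc[OF assms]])
 then show ?case
  unfolding Suc monoid.nat_pow_Suc[OF monoid_hmonoid] .
qed

end

locale hahc_space = ha_space +
 assumes comm: "homotopy_commutative F z \<mu>"
begin

lemma pmul_comm: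
 assumes "f \<in> cmaps D B E F z" "g \<in> cmaps D B E F z"
 shows "hmt D B E F z (pmul \<mu> f g) (pmul \<mu> g f)"
 using hmt_post[OF comm[unfolded homotopy_commutative_def based_homotopic_def] cmaps_pair[OF assms]]
 by (simp add: pmul_def o_def)

lemma comm_monoid_hmonoid: "comm_monoid (hmonoid D B E)"
proof (rule monoid.monoid_comm_monoidI[OF monoid_hmonoid])
 fix x y assume "x \<in> carrier (hmonoid D B E)" "y \<in> carrier (hmonoid D B E)"
 then obtain f g where [simp]: "x = hclass D B E f" "y = hclass D B E g"
  and m: "f \<in> cmaps D B E F z" "g \<in> cmaps D B E F z"
  by (auto simp: hmonoid_def)
 show "x \<otimes>\<^bsub>hmonoid D B E\<^esub> y = y \<otimes>\<^bsub>hmonoid D B E\<^esub> x"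
  using m hclass_eqI[OF pmul_comm[OF m]] by (simp add: hmonoid_mult)
qed

text \<open>The classes of the two projections of \<open>F \<times> F\<close> commute, so the power of their product is the
 product of their powers.\<close>

lemma H_map_power_map: "H_map F z \<mu> F z \<mu> (power_map z \<mu> k)"
proof -
 let ?D = "prod_topology F F" and ?B = "{(z, z)}"
 interpret M: comm_monoid "hmonoid ?D ?B {}" by (rule comm_monoid_hmonoid)
 have f: "fst \<in> cmaps ?D ?B {} F z" and s: "snd \<in> cmaps ?D ?B {} F z"
  by (auto intro!: cmapsI admI simp: cm_fst cm_snd)
 have "hclass ?D ?B {} (pw k (pmul \<mu> fst snd)) = hclass ?D ?B {} (pmul \<mu> (pw k fst) (pw k snd))"
  using M.pow_mult_distrib[OF M.m_comm, OF hclass_in[OF f] hclass_in[OF s] hclass_in[OF f] hclass_in[OF s], of k]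
  unfolding hmonoid_mult[OF f s] hclass_pw[OF f, symmetric] hclass_pw[OF s, symmetric]
   hclass_pw[OF pmul_cmaps[OF f s], symmetric] hmonoid_mult[OF pw_cmaps[OF f] pw_cmaps[OF s]] .
 then have "hmt ?D ?B {} F z (pw k (pmul \<mu> fst snd)) (pmul \<mu> (pw k fst) (pw k snd))"
  by (intro hclass_eqD pmul_cmaps pw_cmaps f s)
 then have "homotopic_with (\<lambda>h. h (z, z) = z) ?D F (pw k (pmul \<mu> fst snd)) (pmul \<mu> (pw k fst) (pw k snd))"
  by (rule homotopic_with_mono) (simp add: adm_def)
 then show ?thesis
  by (simp add: H_map_def based_map_def z_in power_map_cont power_map_z based_homotopic_def
    pmul_def o_def case_prod_beta')
qed

end

section \<open>The triangle lemma\<close>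

text \<open>The sawtooth of period 1 with slopes 1 and -1. The pair
  \<open>(x + zeta x, x - zeta x)\<close> is \<open>(2 x, 0)\<close> on \<open>[0,1/2]\<close> and
  \<open>(1, 2 x - 1)\<close> on \<open>[1/2,1]\<close>: adding and subtracting it turns the
  diagonal of a torus into one coordinate circle followed by the other.\<close>

definition zeta :: "real \<Rightarrow> real" where
 "zeta x = infdist x \<int>"

lemma zeta_eq:
 assumes "\<bar>x - of_int n\<bar> \<le> 1/2"
 shows "zeta x = \<bar>x - of_int n\<bar>"
proof (rule antisym)
 show "zeta x \<le> \<bar>x - of_int n\<bar>"
  unfolding zeta_def using infdist_le[of "of_int n" "\<int>" x] by (simp add: dist_real_def)
 have "\<bar>x - of_int n\<bar> \<le> dist x a" if "a \<in> \<int>" for a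
 proof -
  from that obtain m where a: "a = of_int m" by (rule Ints_cases)
  show ?thesis
  proof (cases "m = n")
   case False
   then have "\<bar>real_of_int n - of_int m\<bar> \<ge> 1" by linarith
   then show ?thesis using assms unfolding a dist_real_def by linarith
  qed (simp add: a dist_real_def)
 qed
 moreover have "(\<int>::real set) \<noteq> {}" using Ints_0 by blast
 ultimately show "\<bar>x - of_int n\<bar> \<le> zeta x"
  unfolding zeta_def infdist_notempty[OF \<open>\<int> \<noteq> {}\<close>] by (intro cINF_greatest)
qed

lemma nearest_int: obtains n where "\<bar>x - of_int n\<bar> \<le> 1/2" "zeta x = \<bar>x - of_int n\<bar>"
proof -
 have "\<bar>x - of_int (round x)\<bar> \<le> 1/2"
  using of_int_round_abs_le[of x] by (simp add: abs_minus_commute)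
 then show ?thesis using that zeta_eq by blast
qed

lemma zeta_add_int: "zeta (x + of_int n) = zeta x"
proof -
 obtain m where m: "\<bar>x - of_int m\<bar> \<le> 1/2" "zeta x = \<bar>x - of_int m\<bar>" by (rule nearest_int)
 then show ?thesis using zeta_eq[of "x + of_int n" "m + n"] by (simp add: algebra_simps)
qed

lemma zeta_Ints: "x \<in> \<int> \<Longrightarrow> zeta x = 0"
 by (simp add: zeta_def)

lemma continuous_zeta: "continuous_on S zeta"
 unfolding zeta_def by (intro continuous_intros)

lemma zeta_cases: "x + zeta x \<in> \<int> \<or> x - zeta x \<in> \<int>"
proof -
 obtain n where "zeta x = \<bar>x - of_int n\<bar>" by (rule nearest_int)
 then have "x + zeta x = of_int n \<or> x - zeta x = of_int n" by linarith
 then show ?thesis by (metis Ints_of_int)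
qed

text \<open>Constraints for loops: the loop coordinate is a real number of period 1, and its
  integral values go to the basepoint. \<open>TB\<close> and \<open>TE\<close> are the version for a
  torus; there only the lattice points, not the coordinate circles, go to the basepoint.\<close>

definition LB :: "'d set \<Rightarrow> (real \<times> 'd) set" where
 "LB B = {(x, d). x \<in> \<int> \<or> d \<in> B}"

definition LE :: "('d \<times> 'd) set \<Rightarrow> ((real \<times> 'd) \<times> (real \<times> 'd)) set" where
 "LE E = {((x, d), (y, d')). y - x \<in> \<int> \<and> d = d' \<or> x = y \<and> (d, d') \<in> E}"

definition TB :: "'d set \<Rightarrow> (real \<times> real \<times> 'd) set" where
 "TB B = {(x, y, d). x \<in> \<int> \<and> y \<in> \<int> \<or> d \<in> B}"

definition TE :: "('d \<times> 'd) set \<Rightarrow> ((real \<times> real \<times> 'd) \<times> (real \<times> real \<times> 'd)) set" where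
 "TE E = LE (LE E)"

abbreviation RD :: "'d topology \<Rightarrow> (real \<times> 'd) topology" where
 "RD D \<equiv> prod_topology euclideanreal D"

section \<open>Continuity rules for maps built from real coordinates, and homotopies with real
  time\<close>

lemma cont_o:
 assumes "cmap X euclidean f" "continuous_on UNIV g"
 shows "cmap X euclidean (\<lambda>x. g (f x))"
 using continuous_map_compose[OF assms(1), of euclidean g] assms(2) by (simp add: o_def)

lemma cont_o2:
 assumes "cmap X euclidean f" "cmap X euclidean g"
  and "continuous_on UNIV (\<lambda>p. h (fst p) (snd p))"
 shows "cmap X euclidean (\<lambda>x. h (f x) (g x))"
proof -
 have "cmap X euclidean (\<lambda>x. (f x, g x))"
  using cm_pair[OF assms(1,2)] by (simp flip: euclidean_product_topology)
 from cont_o[OF this assms(3)] show ?thesis by simp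
qed

lemma cont_arith:
 fixes f g :: "'a \<Rightarrow> real"
 assumes "rcont X f" "rcont X g"
 shows "rcont X (\<lambda>x. f x + g x)" "rcont X (\<lambda>x. f x - g x)"
  "rcont X (\<lambda>x. f x * g x)" "rcont X (\<lambda>x. min (f x) (g x))"
  "rcont X (\<lambda>x. max (f x) (g x))"
 by (intro cont_o2[OF assms] continuous_intros)+

lemma cont_unary:
 fixes f :: "'a \<Rightarrow> real"
 assumes "rcont X f"
 shows "rcont X (\<lambda>x. - f x)" "rcont X (\<lambda>x. f x / c)"
  "rcont X (\<lambda>x. \<bar>f x\<bar>)" "rcont X (\<lambda>x. zeta (f x))"
 unfolding divide_inverse
 by (intro cont_o[OF assms] continuous_zeta continuous_intros)+

lemma cont_id: "cmap X X (\<lambda>x. x)"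
 using continuous_map_id by (simp add: id_def)

lemma cont_const: "cmap X euclidean (\<lambda>_. c)"
 by simp

lemma cont_fst_snd:
 assumes "cmap Z (prod_topology X Y) f"
 shows "cmap Z X (\<lambda>x. fst (f x))" "cmap Z Y (\<lambda>x. snd (f x))"
 using assms by (simp_all add: continuous_map_pairwise o_def)

lemmas cont_intros = cm_pair cont_arith cont_unary
 cm_fst cm_snd cont_id cont_const
 cont_fst_snd

lemma cm_compose:
 assumes "cmap X Y g" "cmap Z X f"
 shows "cmap Z Y (\<lambda>x. g (f x))"
 using continuous_map_compose[OF assms(2,1)] by (simp add: o_def)

text \<open>Clamping the time to \<open>[0,1]\<close> extends the homotopy to all real times and
  keeps \<open>P\<close> at each of them, which spares later constructions the subspace
  topology.\<close>

lemma homotopic_withE: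
 assumes "homotopic_with P X Y f g"
 obtains h where "cmap (RD X) Y h"
  "\<And>x. h (0, x) = f x" "\<And>x. h (1, x) = g x" "\<And>t. P (\<lambda>x. h (t, x))"
proof -
 obtain h where h: "cmap (IZ X) Y h"
  "\<forall>x. h (0, x) = f x" "\<forall>x. h (1, x) = g x" "\<forall>t \<in> {0..1}. P (\<lambda>x. h (t, x))"
  using assms unfolding homotopic_with_def by blast
 let ?c = "\<lambda>t::real. max 0 (min 1 t)"
 have "cmap (RD X) unit_interval (\<lambda>p. ?c (fst p))"
  by (rule continuous_map_into_subtopology) (auto intro!: cont_intros)
 then have "cmap (RD X) (IZ X) (\<lambda>p. (?c (fst p), snd p))"
  by (intro cm_pair cm_snd)
 from continuous_map_compose[OF this h(1)] show ?thesis
  by (intro that[of "h \<circ> (\<lambda>p. (?c (fst p), snd p))"]) (use h in \<open>auto simp: o_def\<close>)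
qed

lemma homotopic_withI:
 assumes "cmap (RD X) Y h"
  "\<And>x. h (0, x) = f x" "\<And>x. h (1, x) = g x" "\<And>t. t \<in> {0..1} \<Longrightarrow> P (\<lambda>x. h (t, x))"
 shows "homotopic_with P X Y f g"
proof -
 have "cmap (IZ X) Y h"
  using assms(1) by (metis (no_types) cm_sub prod_topology_subtopology(1))
 then show ?thesis
  unfolding homotopic_with_def by (intro exI[of _ h]) (simp add: assms(2-))
qed

lemma continuous_map_glue:
 assumes "closedin X A" "closedin X B" "topspace X \<subseteq> A \<union> B"
  and "cmap (subtopology X A) Y f" "cmap (subtopology X B) Y g"
  and "\<And>x. x \<in> A \<inter> B \<Longrightarrow> f x = g x"
  and "\<And>x. x \<in> A \<Longrightarrow> h x = f x" "\<And>x. x \<in> B \<Longrightarrow> h x = g x"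
 shows "cmap X Y h"
proof (rule pasting_lemma_closed[where I = "{A, B}" and T = id and f = "\<lambda>S. if S = A then f else g"])
 show "closedin X (id S)" if "S \<in> {A, B}" for S
  using that assms(1,2) by auto
 show "cmap (subtopology X (id S)) Y (if S = A then f else g)" if "S \<in> {A, B}" for S
  using that assms(4,5) by auto
 show "(if S = A then f else g) x = (if T = A then f else g) x"
  if "S \<in> {A, B}" "T \<in> {A, B}" "x \<in> topspace X \<inter> id S \<inter> id T" for S T x
  using that assms(6)[of x] by (auto split: if_splits)
 show "\<exists>S. S \<in> {A, B} \<and> x \<in> id S \<and> h x = (if S = A then f else g) x" if "x \<in> topspace X" for x
 proof (cases "x \<in> A")
  case True
  then show ?thesis using assms(7)[of x] by auto
 next
  case False
  then show ?thesis using assms(3) that assms(8)[of x] by auto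
 qed
qed auto

lemma continuous_map_glue_le:
 assumes "rcont X u" "cmap X Y f" "cmap X Y g"
  and "\<And>x. x \<in> topspace X \<Longrightarrow> u x = 0 \<Longrightarrow> f x = g x"
 shows "cmap X Y (\<lambda>x. if u x \<le> 0 then f x else g x)"
 by (rule continuous_map_cases_le) (use assms in \<open>auto intro: cm_sub\<close>)

text \<open>\<open>zeta\<close> has period 1 and vanishes at the integers, so the straight line
  homotopy that adds a multiple of it to either argument respects the periods and keeps lattice
  points at lattice points.\<close>

lemma hmt_shear:
 fixes i j :: int and i' j' :: real
 assumes V: "V \<in> cmaps (RD (RD D)) (TB B) (TE E) F z"
 shows "hmt (RD D) (LB B) (LE E) F z (\<lambda>(x, d). V (of_int i * x, of_int j * x, d))
   (\<lambda>(x, d). V (of_int i * x + i' * zeta x, of_int j * x + j' * zeta x, d))"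
proof -
 have Vc: "cmap (RD (RD D)) F V" and Va: "adm (TB B) (TE E) z V"
  using V by (auto dest: cmapsD)
 have VB: "V (x, y, d) = z" if "x \<in> \<int> \<and> y \<in> \<int> \<or> d \<in> B" for x y d
  using admD[OF Va] that by (simp add: TB_def)
 have Vs: "V (x, y, d) = V (x', y', d)" if "x' - x \<in> \<int>" "y' - y \<in> \<int>" for x y d x' y'
 proof -
  have "V (x, y, d) = V (x', y, d)" "V (x', y, d) = V (x', y', d)"
   using that by (auto intro!: admD2[OF Va] simp: TE_def LE_def)
  then show ?thesis by simp
 qed
 have VE: "V (x, y, d) = V (x, y, d')" if "(d, d') \<in> E" for x y d d'
  using that by (auto intro!: admD2[OF Va] simp: TE_def LE_def)
 have zs: "zeta y = zeta x" if "y - x \<in> \<int>" for x y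
  using that zeta_add_int[of x] by (metis Ints_cases add_diff_cancel_left' add_diff_eq)
 show ?thesis
 proof (rule hmt_pre_htpy[OF V, where h = "\<lambda>(t, x, d).
   (of_int i * x + t * (i' * zeta x), of_int j * x + t * (j' * zeta x), d)"])
  show "cmap (RD (RD D)) (RD (RD D)) (\<lambda>(t, x, d).
   (of_int i * x + t * (i' * zeta x), of_int j * x + t * (j' * zeta x), d))"
   unfolding case_prod_beta' by (intro cont_intros; rule cont_id)
  fix t :: real assume "t \<in> {0..1}"
  let ?g = "\<lambda>(t, x, d). (of_int i * x + t * (i' * zeta x), of_int j * x + t * (j' * zeta x), d)"
  show "V (?g (t, a)) = z" if "a \<in> LB B" for a
   using that by (auto simp: LB_def intro!: VB simp: zeta_Ints)
  show "V (?g (t, a)) = V (?g (t, b))" if "(a, b) \<in> LE E" for a b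
   using that by (auto simp: LE_def zs intro!: Vs VE simp flip: right_diff_distrib)
 qed auto
qed

context hspace
begin

lemma R_htpy:
 obtains h where "cmap (RD F) F h" "\<And>x. h (0, x) = \<mu> (x, z)"
  "\<And>x. h (1, x) = x" "\<And>t. h (t, z) = z"
 using H unfolding H_space_def based_homotopic_def by (auto elim!: homotopic_withE simp: id_def)

lemma L_htpy:
 obtains h where "cmap (RD F) F h" "\<And>x. h (0, x) = \<mu> (z, x)"
  "\<And>x. h (1, x) = x" "\<And>t. h (t, z) = z"
 using H unfolding H_space_def based_homotopic_def by (auto elim!: homotopic_withE simp: id_def)

text \<open>The diagonal loop of a torus is deformed into the concatenation of the two coordinate
 loops. At each time one of the two factors of their product is at the basepoint.\<close>

lemma triangle:
 assumes V: "V \<in> cmaps (RD (RD D)) (TB B) (TE E) F z"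
 shows "hmt (RD D) (LB B) (LE E) F z (\<lambda>(x, d). V (x, x, d))
   (pmul \<mu> (\<lambda>(x, d). V (x, 0, d)) (\<lambda>(x, d). V (0, x, d)))"
proof -
 have Vc: "cmap (RD (RD D)) F V" and Va: "adm (TB B) (TE E) z V"
  using V by (auto dest: cmapsD)
 have VB: "V (x, y, d) = z" if "x \<in> \<int> \<and> y \<in> \<int> \<or> d \<in> B" for x y d
  using admD[OF Va] that by (simp add: TB_def)
 have Vs: "V (x, y, d) = V (x', y', d)" if "x' - x \<in> \<int>" "y' - y \<in> \<int>" for x y d x' y'
 proof -
  have "V (x, y, d) = V (x', y, d)" "V (x', y, d) = V (x', y', d)"
   using that by (auto intro!: admD2[OF Va] simp: TE_def LE_def)
  then show ?thesis by simp
 qed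
 have VE: "V (x, y, d) = V (x, y, d')" if "(d, d') \<in> E" for x y d d'
  using that by (auto intro!: admD2[OF Va] simp: TE_def LE_def)
 let ?u = "\<lambda>x. x + zeta x" and ?v = "\<lambda>x. x - zeta x"
 have zs: "zeta y = zeta x" if "y - x \<in> \<int>" for x y
  using that zeta_add_int[of x] by (metis Ints_cases add_diff_cancel_left' add_diff_eq)
 note s1 = hmt_shear[OF V]
 obtain R where R: "cmap (RD F) F R" "\<And>x. R (0, x) = \<mu> (x, z)"
  "\<And>x. R (1, x) = x" "\<And>t. R (t, z) = z" by (rule R_htpy) blast
 obtain L where L: "cmap (RD F) F L" "\<And>x. L (0, x) = \<mu> (z, x)"
  "\<And>x. L (1, x) = x" "\<And>t. L (t, z) = z" by (rule L_htpy) blast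
 have s4: "hmt (RD D) (LB B) (LE E) F z
   (pmul \<mu> (\<lambda>(x, d). V (?u x, 0, d)) (\<lambda>(x, d). V (0, ?v x, d))) (\<lambda>(x, d). V (?u x, ?v x, d))"
 proof (rule homotopic_withI)
  \<comment> \<open>At every \<open>x\<close> at least one of \<open>?u x\<close>,
    \<open>?v x\<close> is an integer, so at least one factor of the product is \<open>z\<close>,
    and the matching unit homotopy removes it. Where both are integers, both branches are constantly
    \<open>z\<close>.\<close>
  let ?h = "\<lambda>(t, x, d). if ?v x \<in> \<int> then R (t, V (?u x, 0, d)) else L (t, V (0, ?v x, d))"
  let ?T = "RD (RD D)"
  let ?C = "{p \<in> topspace ?T. ?v (fst (snd p)) \<in> \<int>}"
   and ?C' = "{p \<in> topspace ?T. ?u (fst (snd p)) \<in> \<int>}"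
  have clZ: "closedin euclideanreal \<int>" by (simp add: closed_Ints)
  have cl: "closedin ?T ?C" "closedin ?T ?C'"
   by (rule closedin_pre[OF _ clZ], intro cont_intros; rule cont_id)+
  have Vu: "cmap ?T F (\<lambda>p. R (fst p, V (?u (fst (snd p)), 0, snd (snd p))))"
   by (rule cm_compose[OF R(1)]) (intro cont_intros cm_compose[OF Vc]; rule cont_id)
  have Vv: "cmap ?T F (\<lambda>p. L (fst p, V (0, ?v (fst (snd p)), snd (snd p))))"
   by (rule cm_compose[OF L(1)]) (intro cont_intros cm_compose[OF Vc]; rule cont_id)
  have agree: "R (t, V (?u x, 0, d)) = L (t, V (0, ?v x, d))" if "?u x \<in> \<int>" "?v x \<in> \<int>" for t x d
   using that by (simp add: VB R(4) L(4))
  have h2: "?h (t, x, d) = L (t, V (0, ?v x, d))" if "?u x \<in> \<int>" for t x d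
   using agree[OF that] by simp
  show "cmap ?T F ?h"
   by (rule continuous_map_glue[OF cl _ cm_sub[OF Vu] cm_sub[OF Vv]])
     (use zeta_cases agree h2 in auto)
  show "?h (0, p) = pmul \<mu> (\<lambda>(x, d). V (?u x, 0, d)) (\<lambda>(x, d). V (0, ?v x, d)) p" for p
  proof (cases p)
   case (Pair x d)
   show ?thesis
   proof (cases "?v x \<in> \<int>")
    case True
    then have "V (0, ?v x, d) = z" by (intro VB) auto
    then show ?thesis using True by (simp add: Pair R pmul_def)
   next
    case False
    then have "V (?u x, 0, d) = z" using zeta_cases by (intro VB) auto
    then show ?thesis using False by (simp add: Pair L pmul_def)
   qed
  qed
  show "?h (1, p) = (\<lambda>(x, d). V (?u x, ?v x, d)) p" for p
  proof (cases p)
   case (Pair x d)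
   show ?thesis
   proof (cases "?v x \<in> \<int>")
    case True
    then show ?thesis by (auto simp: Pair R intro!: Vs)
   next
    case False
    then have "?u x \<in> \<int>" using zeta_cases by auto
    then show ?thesis using False by (auto simp: Pair L intro!: Vs)
   qed
  qed
  fix t :: real assume "t \<in> {0..1}"
  show "adm (LB B) (LE E) z (\<lambda>p. ?h (t, p))"
  proof (rule admI)
   show "?h (t, a) = z" if "a \<in> LB B" for a
    using that by (auto simp: LB_def VB R(4) L(4) zeta_Ints)
   fix a b assume "(a, b) \<in> LE E"
   then obtain x d y d' where ab: "a = (x, d)" "b = (y, d')"
    and c: "y - x \<in> \<int> \<and> d = d' \<or> x = y \<and> (d, d') \<in> E" by (auto simp: LE_def)
   from c show "?h (t, a) = ?h (t, b)"
   proof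
    assume c: "y - x \<in> \<int> \<and> d = d'"
    then have i: "?u y - ?u x \<in> \<int>" "?v y - ?v x \<in> \<int>" using zs[of y x] by auto
    then have "?v x \<in> \<int> \<longleftrightarrow> ?v y \<in> \<int>" 
      using Ints_add[OF i(2), of "?v x"] Ints_diff[OF _ i(2), of "?v y"] by auto
    moreover have "V (?u x, 0, d) = V (?u y, 0, d')" "V (0, ?v x, d) = V (0, ?v y, d')"
     using c i by (auto intro!: Vs)
    ultimately show ?thesis by (simp add: ab)
   next
    assume "x = y \<and> (d, d') \<in> E"
    then show ?thesis by (auto simp: ab VE[of d d'])
   qed
  qed
 qed
 have "hmt (RD D) (LB B) (LE E) F z (\<lambda>(x, d). V (x, x, d)) (\<lambda>(x, d). V (?u x, ?v x, d))"
  using s1[of 1 1 1 "-1"] by simp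
 moreover have "hmt (RD D) (LB B) (LE E) F z (\<lambda>(x, d). V (x, 0, d)) (\<lambda>(x, d). V (?u x, 0, d))"
  using s1[of 1 0 1 0] by simp
 moreover have "hmt (RD D) (LB B) (LE E) F z (\<lambda>(x, d). V (0, x, d)) (\<lambda>(x, d). V (0, ?v x, d))"
  using s1[of 0 1 0 "-1"] by simp
 ultimately show ?thesis
  
  by (rule htp_trans[OF _ htp_trans[OF homotopic_with_symD[OF s4] homotopic_with_symD[OF pmul_hmt]]])
qed

end

section \<open>Homotopy extension for maps on loops, tori and cones\<close>

lemma cmaps_preI:
 assumes "f \<in> cmaps D B E F z" "cmap D' D \<theta>"
  and "\<And>a. a \<in> B' \<Longrightarrow> f (\<theta> a) = z"
  and "\<And>a b. (a, b) \<in> E' \<Longrightarrow> f (\<theta> a) = f (\<theta> b)"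
 shows "(\<lambda>a. f (\<theta> a)) \<in> cmaps D' B' E' F z"
 by (intro cmapsI admI cm_compose[OF cmapsD(1)[OF assms(1)] assms(2)]) (fact assms)+

lemma hmt_preI:
 assumes "hmt D B E F z f g" "cmap D' D \<theta>"
  and "\<And>a. a \<in> B' \<Longrightarrow> \<theta> a \<in> B"
  and "\<And>a b. (a, b) \<in> E' \<Longrightarrow> (\<theta> a, \<theta> b) \<in> E \<or> {\<theta> a, \<theta> b} \<subseteq> B"
  and "\<And>a. f (\<theta> a) = f' a" "\<And>a. g (\<theta> a) = g' a"
 shows "hmt D' B' E' F z f' g'"
proof (rule hmt_cong[OF hmt_pre[OF assms(1,2), of B' E']])
 show "(\<theta> a, \<theta> b) \<in> E \<or> \<theta> a = \<theta> b \<or> {\<theta> a, \<theta> b} \<subseteq> B" if "(a, b) \<in> E'" for a b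
  using assms(4)[OF that] by blast
qed (simp_all add: assms(3,5,6))

text \<open>\<open>u\<close> is a collar coordinate. The homotopy \<open>g\<close>, which starts at
  \<open>f\<close> where \<open>u \<ge> 0\<close>, is run up to time \<open>min 1 (u q)\<close>: not
  at all at the edge of the collar, completely at depth 1.\<close>

lemma hmt_collar:
 assumes f: "f \<in> cmaps Q B E F z" and u: "rcont Q u"
  and g: "cmap (RD Q) F g" and g0: "\<And>q. u q \<ge> 0 \<Longrightarrow> g (0, q) = f q"
  and a: "\<And>t. t \<in> {0..1} \<Longrightarrow> adm B E z (\<lambda>q. if u q \<le> 0 then f q else g (t * min 1 (u q), q))"
 shows "hmt Q B E F z f (\<lambda>q. if u q \<le> 0 then f q else g (min 1 (u q), q))"
proof (rule hmtI)
 let ?h = "\<lambda>p. if u (snd p) \<le> 0 then f (snd p) else g (fst p * min 1 (u (snd p)), snd p)"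
 have us: "rcont (RD Q) (\<lambda>p. u (snd p))"
  by (rule cm_compose[OF u cm_snd])
 show "cmap (RD Q) F ?h"
 proof (rule continuous_map_glue_le[OF us])
  show "cmap (RD Q) F (\<lambda>p. f (snd p))"
   by (rule cm_compose[OF cmapsD(1)[OF f] cm_snd])
  show "cmap (RD Q) F (\<lambda>p. g (fst p * min 1 (u (snd p)), snd p))"
   by (rule cm_compose[OF g]) (intro cont_intros us)
 qed (simp add: g0)
 show "?h (0, x) = f x" "?h (1, x) = (if u x \<le> 0 then f x else g (min 1 (u x), x))" for x
  by (auto simp: g0)
 show "adm B E z (\<lambda>x. ?h (t, x))" if "t \<in> {0..1}" for t
  unfolding fst_conv snd_conv by (rule a[OF that])
qed

text \<open>On the base of the mapping cone of the degree \<open>k\<close> map, a map has the form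
  \<open>U(k x)\<close>; loops there are based at the multiples of \<open>1/k\<close> and have
  period \<open>1/k\<close>.\<close>

definition LBk :: "nat \<Rightarrow> 'd set \<Rightarrow> (real \<times> 'd) set" where
 "LBk k B = {(x, d). real k * x \<in> \<int> \<or> d \<in> B}"

definition LEk :: "nat \<Rightarrow> ((real \<times> 'd) \<times> (real \<times> 'd)) set" where
 "LEk k = {((x, d), (y, d')). real k * (y - x) \<in> \<int> \<and> d = d'}"

definition TBk :: "nat \<Rightarrow> 'd set \<Rightarrow> (real \<times> real \<times> 'd) set" where
 "TBk k B = {(x, y, d). real k * x \<in> \<int> \<and> real k * y \<in> \<int> \<or> d \<in> B}"

definition TEk :: "nat \<Rightarrow> ((real \<times> real \<times> 'd) \<times> (real \<times> real \<times> 'd)) set" where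
 "TEk k = {((x, y, d), (x', y', d')). real k * (x' - x) \<in> \<int> \<and> real k * (y' - y) \<in> \<int> \<and> d = d'}"

text \<open>The constraints on a map on a cone with cone coordinate \<open>s\<close>, where
 stronger identifications hold on the base \<open>s \<ge> 1\<close>.\<close>

definition CB :: "'a set \<Rightarrow> 'a set \<Rightarrow> (real \<times> 'a) set" where
 "CB B B' = {(s, a). s \<le> 0 \<or> a \<in> B \<or> s \<ge> 1 \<and> a \<in> B'}"

definition CE :: "('a \<times> 'a) set \<Rightarrow> ('a \<times> 'a) set \<Rightarrow> ((real \<times> 'a) \<times> (real \<times> 'a)) set" where
 "CE E E' = {((s, a), (s', b)). s = s' \<and> ((a, b) \<in> E \<or> s \<ge> 1 \<and> (a, b) \<in> E')}"

lemmas cs_defs = LB_def LE_def TB_def TE_def LBk_def LEk_def TBk_def TEk_def CB_def CE_def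

lemma Ints_mult_diff: "y - x \<in> \<int> \<Longrightarrow> c \<in> \<int> \<Longrightarrow> c * y - c * x \<in> (\<int>::real set)"
 by (metis Ints_mult right_diff_distrib)

lemma cm_to_pair_assoc:
 "cmap (RD (RD Z)) (RD (RD Z)) (\<lambda>(s, x, y). (x, s, y))"
 unfolding case_prod_beta' by (intro cont_intros; rule cont_id)

context hspace
begin

text \<open>Homotopy extension from the base of a cone: the null homotopy there respects the finer
  identifications, so it can be run on a collar of the base. Afterwards only the coarser
  identifications need recording, as the base goes to the basepoint.\<close>

lemma nullhtpy_on_base:
 assumes f: "f \<in> cmaps (RD A) (CB B B') (CE E E') F z"
  and n: "hmt A B' E' F z (\<lambda>a. f (1, a)) (\<lambda>_. z)" and "B \<subseteq> B'" "E \<subseteq> E'"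
 obtains g where "g \<in> cmaps (RD A) (CB B UNIV) (CE E {}) F z"
  "hmt (RD A) (CB B B') (CE E E') F z f g"
proof -
 have fB: "f (s, a) = z" if "s \<le> 0 \<or> a \<in> B \<or> s \<ge> 1 \<and> a \<in> B'" for s a
  using admD[OF cmapsD(2)[OF f], of "(s, a)"] that by (simp add: CB_def)
 have fE: "f (s, a) = f (s, b)" if "(a, b) \<in> E \<or> s \<ge> 1 \<and> (a, b) \<in> E'" for s a b
  using admD2[OF cmapsD(2)[OF f], of "(s, a)" "(s, b)"] that by (simp add: CE_def)
 obtain G where G: "cmap (RD A) F G" "\<And>a. G (0, a) = f (1, a)" "\<And>a. G (1, a) = z"
  "\<And>t. adm B' E' z (\<lambda>a. G (t, a))" using n by (rule homotopic_withE) blast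
 have GB: "G (t, a) = z" if "a \<in> B'" for t a using admD[OF G(4) that] .
 have GB': "G (t, a) = z" if "a \<in> B' \<or> t = 1" for t a using that GB G(3) by blast
 have GE: "G (t, a) = G (t, b)" if "(a, b) \<in> E'" for t a b using admD2[OF G(4) that] .
 \<comment> \<open>Performs the whole cone on \<open>s \<le> 1/2\<close> and leaves
   \<open>1/2 \<le> s\<close> as a collar on which the map is \<open>f (1, a)\<close>.\<close>
 let ?m = "\<lambda>s::real. min (2 * s) 1"
 let ?f = "\<lambda>(s, a). f (?m s, a)"
 have h1: "hmt (RD A) (CB B B') (CE E E') F z f ?f"
 proof (rule hmt_pre_htpy[OF f, where h = "\<lambda>(t, s, a). (s + t * (?m s - s), a)"])
  show "cmap (RD (RD A)) (RD A) (\<lambda>(t, s, a). (s + t * (?m s - s), a))"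
   unfolding case_prod_beta' by (intro cont_intros; rule cont_id)
  fix t :: real assume t: "t \<in> {0..1}"
  have n: "s + t * (?m s - s) \<le> 0" if "s \<le> 0" for s
  proof -
   have "s + t * (?m s - s) = (1 + t) * s" using that by (simp add: algebra_simps)
   then show ?thesis using t that by (simp add: mult_le_0_iff)
  qed
  have p: "s + t * (?m s - s) \<ge> 1" if "s \<ge> 1" for s
  proof -
   have "s + t * (?m s - s) = 1 + (1 - t) * (s - 1)" using that by (simp add: algebra_simps)
   then show ?thesis using t that by simp
  qed
  show "f (case (t, a) of (t, s, a) \<Rightarrow> (s + t * (?m s - s), a)) = z" if "a \<in> CB B B'" for a
  proof -
   obtain s x where q: "a = (s, x)" by force
   show ?thesis
    unfolding q prod.case by (rule fB) (use that n[of s] p[of s] in \<open>auto simp: q CB_def\<close>)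
  qed
  show "f (case (t, a) of (t, s, a) \<Rightarrow> (s + t * (?m s - s), a)) =
    f (case (t, b) of (t, s, a) \<Rightarrow> (s + t * (?m s - s), a))" if "(a, b) \<in> CE E E'" for a b
  proof -
   obtain s x y where q: "a = (s, x)" "b = (s, y)" using \<open>(a, b) \<in> CE E E'\<close> by (auto simp: CE_def)
   show ?thesis
    unfolding q prod.case by (rule fE) (use that p[of s] in \<open>auto simp: q CE_def\<close>)
  qed
 qed auto
 let ?u = "\<lambda>q::real \<times> 'b. 2 * fst q - 1"
 let ?g = "\<lambda>q. if ?u q \<le> 0 then ?f q else G (min 1 (?u q), snd q)"
 have mc: "cmap (RD (RD A)) F (\<lambda>p. G (fst p, snd (snd p)))"
  by (rule cm_compose[OF G(1)]) (intro cont_intros; rule cont_id)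
 have f1: "?f q = f (1, snd q)" if "?u q \<ge> 0" for q
  using that by (cases q) auto
 have h2: "hmt (RD A) (CB B B') (CE E E') F z ?f ?g"
 proof -
  have "hmt (RD A) (CB B B') (CE E E') F z ?f (\<lambda>q. if ?u q \<le> 0 then ?f q else
    (\<lambda>p. G (fst p, snd (snd p))) (min 1 (?u q), q))"
  proof (rule hmt_collar[OF hmt_cmaps(2)[OF h1] _ mc])
   show "rcont (RD A) ?u"
    by (intro cont_intros; rule cont_id)
   show "(\<lambda>p. G (fst p, snd (snd p))) (0, q) = ?f q" if "?u q \<ge> 0" for q
    using f1[OF that] by (simp add: G)
   fix t :: real
   show "adm (CB B B') (CE E E') z (\<lambda>q. if ?u q \<le> 0 then ?f q else
     (\<lambda>p. G (fst p, snd (snd p))) (t * min 1 (?u q), q))"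
   proof (rule admI)
    show "(if ?u q \<le> 0 then ?f q else (\<lambda>p. G (fst p, snd (snd p))) (t * min 1 (?u q), q)) = z"
     if "q \<in> CB B B'" for q
     using that \<open>B \<subseteq> B'\<close> by (auto simp: CB_def intro!: fB GB split: prod.splits)
    show "(if ?u q \<le> 0 then ?f q else (\<lambda>p. G (fst p, snd (snd p))) (t * min 1 (?u q), q)) =
     (if ?u q' \<le> 0 then ?f q' else (\<lambda>p. G (fst p, snd (snd p))) (t * min 1 (?u q'), q'))"
     if "(q, q') \<in> CE E E'" for q q'
     using that \<open>E \<subseteq> E'\<close> by (auto simp: CE_def intro!: fE GE split: prod.splits)
   qed
  qed
  then show ?thesis unfolding fst_conv snd_conv .
 qed
 show ?thesis
 proof (rule that[OF _ htp_trans[OF h1 h2]])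
  have "adm (CB B UNIV) (CE E {}) z ?g"
  proof (rule admI)
   show "?g q = z" if "q \<in> CB B UNIV" for q
    using that \<open>B \<subseteq> B'\<close> by (auto simp: CB_def intro!: fB GB')
   show "?g q = ?g q'" if "(q, q') \<in> CE E {}" for q q'
    using that \<open>E \<subseteq> E'\<close> by (auto simp: CE_def intro!: fE GE)
  qed
  then show "?g \<in> cmaps (RD A) (CB B UNIV) (CE E {}) F z"
   by (rule cmapsI[OF cmapsD(1)[OF hmt_cmaps(2)[OF h2]]])
 qed
qed

text \<open>The same extension at the fibres over the integers, with a collar on both sides of each.
  By periodicity in \<open>x\<close> one null homotopy at \<open>x = 0\<close> serves all of
  them.\<close>

lemma nullhtpy_on_fibre:
 assumes f: "f \<in> cmaps (RD D) {(x, d). x \<in> \<int> \<and> d \<in> B' \<or> d \<in> B} (LE E) F z"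
  and n: "hmt D B' E F z (\<lambda>d. f (0, d)) (\<lambda>_. z)" and "B \<subseteq> B'"
 obtains g where "g \<in> cmaps (RD D) (LB B) (LE E) F z"
  "hmt (RD D) {(x, d). x \<in> \<int> \<and> d \<in> B' \<or> d \<in> B} (LE E) F z f g"
proof -
 let ?B = "{(x, d). x \<in> \<int> \<and> d \<in> B' \<or> d \<in> B}"
 have fB: "f (x, d) = z" if "x \<in> \<int> \<and> d \<in> B' \<or> d \<in> B" for x d
  using admD[OF cmapsD(2)[OF f], of "(x, d)"] that by simp
 have fE: "f (x, a) = f (y, b)" if "y - x \<in> \<int> \<and> a = b \<or> x = y \<and> (a, b) \<in> E" for x y a b
  using admD2[OF cmapsD(2)[OF f], of "(x, a)" "(y, b)"] that by (simp add: LE_def)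
 obtain G where G: "cmap (RD D) F G" "\<And>a. G (0, a) = f (0, a)" "\<And>a. G (1, a) = z"
  "\<And>t. adm B' E z (\<lambda>a. G (t, a))" using n by (rule homotopic_withE) blast
 have GB: "G (t, a) = z" if "a \<in> B'" for t a using admD[OF G(4) that] .
 have GB': "G (t, a) = z" if "a \<in> B' \<or> t = 1" for t a using that GB G(3) by blast
 have GE: "G (t, a) = G (t, b)" if "(a, b) \<in> E" for t a b using admD2[OF G(4) that] .
 \<comment> \<open>\<open>x + ?c x\<close> is constantly \<open>m\<close> on
   \<open>[m - 1/4, m + 1/4]\<close> for each integer \<open>m\<close> and has slope 2 in between.
   The correction \<open>?c\<close> vanishes at the integers and has period 1.\<close>
 let ?c = "\<lambda>x. zeta (x - 1/4) - 1/4"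
 have zi: "zeta y = zeta x" if "y - x \<in> \<int>" for x y
  using that zeta_add_int[of x] by (metis Ints_cases add_diff_cancel_left' add_diff_eq)
 have ci: "?c y = ?c x" if "y - x \<in> \<int>" for x y
  using that by (auto intro!: zi)
 have cZ: "x + ?c x \<in> \<int>" if "zeta x \<le> 1/4" for x
 proof -
  obtain m where m: "\<bar>x - of_int m\<bar> \<le> 1/2" "zeta x = \<bar>x - of_int m\<bar>" by (rule nearest_int)
  have "zeta (x - 1/4) = of_int m + 1/4 - x"
   using m that zeta_eq[of "x - 1/4" m] by linarith
  then show ?thesis by simp
 qed
 have c0: "?c x = 0" if "x \<in> \<int>" for x
 proof -
  have "zeta (0 - 1/4) = 1/4" using zeta_eq[of "-1/4" 0] by simp
  then show ?thesis using ci[of x 0] that by simp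
 qed
 let ?f = "\<lambda>(x, d). f (x + ?c x, d)"
 have h1: "hmt (RD D) ?B (LE E) F z f ?f"
 proof (rule hmt_pre_htpy[OF f, where h = "\<lambda>(t, x, d). (x + t * ?c x, d)"])
  show "cmap (RD (RD D)) (RD D) (\<lambda>(t, x, d). (x + t * ?c x, d))"
   unfolding case_prod_beta' by (intro cont_intros; rule cont_id)
  fix t :: real assume t: "t \<in> {0..1}"
  show "f (case (t, a) of (t, x, d) \<Rightarrow> (x + t * ?c x, d)) = z" if "a \<in> ?B" for a
   using that by (auto simp: c0 intro!: fB)
  show "f (case (t, a) of (t, x, d) \<Rightarrow> (x + t * ?c x, d)) =
    f (case (t, b) of (t, x, d) \<Rightarrow> (x + t * ?c x, d))" if "(a, b) \<in> LE E" for a b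
   using that by (auto simp: LE_def ci intro!: fE)
 qed auto
 \<comment> \<open>Collar coordinate: positive exactly at distance less than 1/4 from the integers,
   and 1 at them.\<close>
 let ?u = "\<lambda>q. 1 - 4 * zeta (fst q)"
 let ?h = "\<lambda>t q. if ?u q \<le> 0 then ?f q else (\<lambda>p. G (fst p, snd (snd p))) (t * min 1 (?u q), q)"
 let ?g = "\<lambda>q. if ?u q \<le> 0 then ?f q else (\<lambda>p. G (fst p, snd (snd p))) (min 1 (?u q), q)"
 have mc: "cmap (RD (RD D)) F (\<lambda>p. G (fst p, snd (snd p)))"
  by (rule cm_compose[OF G(1)]) (intro cont_intros; rule cont_id)
 have aE: "?h t q = ?h t q'" if "(q, q') \<in> LE E" for t q q'
  using that by (auto simp: LE_def ci intro!: fE GE) (auto simp: zi)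
 have h2: "hmt (RD D) ?B (LE E) F z ?f ?g"
 proof (rule hmt_collar[OF hmt_cmaps(2)[OF h1] _ mc])
  show "rcont (RD D) ?u"
   by (intro cont_intros; rule cont_id)
  show "(\<lambda>p. G (fst p, snd (snd p))) (0, q) = ?f q" if "?u q \<ge> 0" for q
   using that cZ[of "fst q"] by (cases q) (auto simp: G intro!: fE)
  fix t :: real
  show "adm ?B (LE E) z (?h t)"
  proof (rule admI)
   show "?h t q = z" if "q \<in> ?B" for q
    using that \<open>B \<subseteq> B'\<close> by (auto simp: zeta_Ints intro!: fB GB)
  qed (rule aE)
 qed
 show ?thesis
 proof (rule that[OF _ htp_trans[OF h1 h2]])
  have "adm (LB B) (LE E) z ?g"
  proof (rule admI)
   show "?g q = z" if "q \<in> LB B" for q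
    using that \<open>B \<subseteq> B'\<close> by (auto simp: LB_def zeta_Ints intro!: fB GB')
   show "?g q = ?g q'" if "(q, q') \<in> LE E" for q q'
    using aE[OF that, of 1] unfolding mult_1 .
  qed
  then show "?g \<in> cmaps (RD D) (LB B) (LE E) F z"
   by (rule cmapsI[OF cmapsD(1)[OF hmt_cmaps(2)[OF h2]]])
 qed
qed

text \<open>For maps trivial on the base the cone coordinate is a mere parameter: the same
  identifications hold at every \<open>s\<close>, so it can be moved into the parameter space of
  \<open>triangle\<close>.\<close>

lemma triangle_s:
 assumes V: "V \<in> cmaps (RD (RD (RD D))) (CB (TB B) UNIV) (CE (TE {}) {}) F z"
 shows "hmt (RD (RD D)) (CB (LB B) UNIV) (CE (LE {}) {}) F z (\<lambda>(s, x, d). V (s, x, x, d))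
   (pmul \<mu> (\<lambda>(s, x, d). V (s, x, 0, d)) (\<lambda>(s, x, d). V (s, 0, x, d)))"
proof -
 let ?B = "{(s::real, d). s \<le> 0 \<or> s \<ge> 1 \<or> d \<in> B}"
 have VB: "V (s, x, y, d) = z" if "s \<le> 0 \<or> s \<ge> 1 \<or> x \<in> \<int> \<and> y \<in> \<int> \<or> d \<in> B" for s x y d
  using admD[OF cmapsD(2)[OF V], of "(s, x, y, d)"] that by (auto simp: cs_defs)
 have VE: "V (s, x, y, d) = V (s, x', y', d)"
  if "x' - x \<in> \<int> \<and> y' = y \<or> x' = x \<and> y' - y \<in> \<int>" for s x y d x' y'
  using admD2[OF cmapsD(2)[OF V], of "(s, x, y, d)" "(s, x', y', d)"] that by (auto simp: cs_defs)
 have "(\<lambda>(x, y, s, d). V (s, x, y, d)) \<in> cmaps (RD (RD (RD D))) (TB ?B) (TE {}) F z"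
  unfolding case_prod_beta'
  by (rule cmaps_preI[OF V], (intro cont_intros; rule cont_id)[1], auto simp: cs_defs intro!: VB VE)
 note t = triangle[OF this]
 show ?thesis
  by (rule hmt_preI[OF t cm_to_pair_assoc]) (auto simp: cs_defs pmul_def)
qed

end

section \<open>Multiples and inverses of loops, and the order of the cone of an odd degree
  map\<close>

context ha_space
begin

text \<open>Induction on \<open>j\<close> by the triangle lemma for
  \<open>V(a, b) = f(j a + b)\<close>, whose diagonal is \<open>f((j + 1) x)\<close>.\<close>

lemma multiple:
 assumes f: "f \<in> cmaps (RD D) (LB B) (LE E) F z"
 shows "hmt (RD D) (LB B) (LE E) F z (\<lambda>(x, d). f (real j * x, d)) (pw j f)"
proof (induction j)
 case 0
 have "f (0, d) = z" for d
  using admD[OF cmapsD(2)[OF f], of "(0, d)"] by (simp add: LB_def)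
 then have eq: "(\<lambda>(x, d). f (real 0 * x, d)) = pw 0 f" by auto
 show ?case unfolding eq by (rule hmt_refl[OF pw_cmaps[OF f]])
next
 case (Suc j)
 have fB: "f (x, d) = z" if "x \<in> \<int> \<or> d \<in> B" for x d
  using admD[OF cmapsD(2)[OF f], of "(x, d)"] that by (simp add: LB_def)
 have fE: "f (x, d) = f (x', d')" if "x' - x \<in> \<int> \<and> d = d' \<or> x = x' \<and> (d, d') \<in> E" for x x' d d'
  using admD2[OF cmapsD(2)[OF f], of "(x, d)" "(x', d')"] that by (auto simp: LE_def)
 have "(\<lambda>(a, b, d). f (real j * a + b, d)) \<in> cmaps (RD (RD D)) (TB B) (TE E) F z"
  unfolding case_prod_beta'
  by (rule cmaps_preI[OF f], (intro cont_intros; rule cont_id)[1], auto simp: cs_defs intro!: fB fE Ints_mult_diff)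
 note t = triangle[OF this]
 have "hmt (RD D) (LB B) (LE E) F z (\<lambda>(x, d). f (real (Suc j) * x, d))
   (pmul \<mu> (\<lambda>(x, d). f (real j * x, d)) f)"
  by (rule hmt_cong[OF t]) (auto simp: pmul_def algebra_simps)
 then show ?case
  by (rule htp_trans) (rule htp_trans[OF pmul_hmt[OF Suc hmt_refl[OF f]]
    homotopic_with_symD[OF pw_Suc[OF f]]])
qed

text \<open>For \<open>V(a, b) = f(a - b)\<close> the diagonal is constant, and the two axes are the
  loop and its reverse.\<close>

lemma inverse_loop:
 assumes f: "f \<in> cmaps (RD D) (LB B) (LE E) F z"
 shows "hmt (RD D) (LB B) (LE E) F z (pmul \<mu> f (\<lambda>(x, d). f (- x, d))) (\<lambda>_. z)"
proof -
 have fB: "f (x, d) = z" if "x \<in> \<int> \<or> d \<in> B" for x d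
  using admD[OF cmapsD(2)[OF f], of "(x, d)"] that by (simp add: LB_def)
 have fE: "f (x, d) = f (x', d')" if "x' - x \<in> \<int> \<and> d = d' \<or> x = x' \<and> (d, d') \<in> E" for x x' d d'
  using admD2[OF cmapsD(2)[OF f], of "(x, d)" "(x', d')"] that by (auto simp: LE_def)
 have i: "- a - - b \<in> \<int>" if "a - b \<in> \<int>" for a b :: real
  using Ints_minus[OF that] by simp
 have "(\<lambda>(a, b, d). f (a - b, d)) \<in> cmaps (RD (RD D)) (TB B) (TE E) F z"
  unfolding case_prod_beta'
  by (rule cmaps_preI[OF f], (intro cont_intros; rule cont_id)[1], auto simp: cs_defs intro!: fB fE dest: i)
 note t = triangle[OF this]
 show ?thesis
  by (rule homotopic_with_symD[OF hmt_cong[OF t]]) (auto simp: pmul_def fB)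
qed

lemma multiple_s:
 assumes f: "f \<in> cmaps (RD (RD D)) (CB (LB B) UNIV) (CE (LE {}) {}) F z"
 shows "hmt (RD (RD D)) (CB (LB B) UNIV) (CE (LE {}) {}) F z (\<lambda>(s, x, d). f (s, real j * x, d)) (pw j f)"
proof -
 let ?B = "{(s::real, d). s \<le> 0 \<or> s \<ge> 1 \<or> d \<in> B}"
 have fB: "f (s, x, d) = z" if "s \<le> 0 \<or> s \<ge> 1 \<or> x \<in> \<int> \<or> d \<in> B" for s x d
  using admD[OF cmapsD(2)[OF f], of "(s, x, d)"] that by (auto simp: cs_defs)
 have fE: "f (s, x, d) = f (s, x', d)" if "x' - x \<in> \<int>" for s x d x'
  using admD2[OF cmapsD(2)[OF f], of "(s, x, d)" "(s, x', d)"] that by (auto simp: cs_defs)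
 have "(\<lambda>(x, s, d). f (s, x, d)) \<in> cmaps (RD (RD D)) (LB ?B) (LE {}) F z"
  unfolding case_prod_beta'
  by (rule cmaps_preI[OF f], (intro cont_intros; rule cont_id)[1], auto simp: cs_defs intro!: fB fE)
 note t = multiple[OF this]
 show ?thesis
  by (rule hmt_preI[OF t cm_to_pair_assoc]) (auto simp: cs_defs)
qed

end

lemma cm_swap: "cmap (RD (RD Z)) (RD (RD Z)) (\<lambda>(x, y, d). (y, x, d))"
 by (rule cm_to_pair_assoc)

lemma Ints_mult_diff': "y - x \<in> \<int> \<Longrightarrow> c \<in> \<int> \<Longrightarrow> y * c - x * c \<in> (\<int>::real set)"
 by (metis Ints_mult left_diff_distrib)

text \<open>\<open>TE\<close> changes one torus coordinate at a time, so a pair that differs in both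
  is joined through the intermediate point \<open>m a b\<close>.\<close>

lemma hmt_preI2:
 assumes "hmt D B E F z f g" "cmap D' D \<theta>"
  and "\<And>a. a \<in> B' \<Longrightarrow> \<theta> a \<in> B"
  and "\<And>a b. (a, b) \<in> E' \<Longrightarrow> (\<theta> a, m a b) \<in> E \<and> (m a b, \<theta> b) \<in> E"
  and "\<And>a. f (\<theta> a) = f' a" "\<And>a. g (\<theta> a) = g' a"
 shows "hmt D' B' E' F z f' g'"
proof -
 have "hmt D' B' E' F z (f \<circ> \<theta>) (g \<circ> \<theta>)"
 proof (rule homotopic_with_compose_continuous_map_right[OF assms(1,2)])
  fix j assume j: "adm B E z j"
  show "adm B' E' z (j \<circ> \<theta>)"
  proof (rule admI)
   show "(j \<circ> \<theta>) a = z" if "a \<in> B'" for a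
    using admD[OF j assms(3)[OF that]] by simp
   show "(j \<circ> \<theta>) a = (j \<circ> \<theta>) b" if "(a, b) \<in> E'" for a b
    using assms(4)[OF that] admD2[OF j] by (metis o_apply)
  qed
 qed
 then show ?thesis
  by (rule hmt_cong) (simp_all add: assms(5,6))
qed

text \<open>Substitute for division: with \<open>c = b ^ (N - 1)\<close> and \<open>b ^ N\<close>
  trivial, the last factor is trivial, and a relation on \<open>a \<otimes> c\<close> becomes one
  between the squares of \<open>a\<close> and \<open>b\<close>.\<close>

lemma (in comm_monoid) mult_square_shuffle:
 assumes "a \<in> carrier G" "c \<in> carrier G" "b \<in> carrier G"
 shows "((a \<otimes> c) \<otimes> (a \<otimes> c)) \<otimes> (b \<otimes> b) = (a \<otimes> a) \<otimes> ((c \<otimes> b) \<otimes> (c \<otimes> b))"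
 using assms by (simp add: m_ac)

context hahc_space
begin

lemma hclass_wedge:
 assumes "f \<in> cmaps D B E F z" "g \<in> cmaps D B E F z" "h \<in> cmaps D B E F z"
 shows "hclass D B E (pmul \<mu> f (pw n (pmul \<mu> g h)))
  = hclass D B E f \<otimes>\<^bsub>hmonoid D B E\<^esub> (hclass D B E g \<otimes>\<^bsub>hmonoid D B E\<^esub> hclass D B E h) [^]\<^bsub>hmonoid D B E\<^esub> n"
 by (simp add: assms pmul_cmaps pw_cmaps hmonoid_mult flip: hclass_pw)

text \<open>If \<open>U\<close> has order \<open>N\<close>, then \<open>w(x, y) = U(x + y) (U(x) U(y)) ^ (N - 1)\<close> is trivial on both
 coordinate circles, so up to homotopy it is a map on the 2-sphere \<open>T\<^sup>2 / (S\<^sup>1 \<or> S\<^sup>1)\<close>.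
 The flip \<open>(x, y) \<mapsto> (-x, -y)\<close> is isotopic to the identity there, but takes \<open>w\<close> to its inverse.\<close>

lemma torus_square_null:
 fixes Z :: "'z topology"
 assumes U: "U \<in> cmaps (RD Z) (LB B) (LE {}) F z" and N: "N \<ge> 1"
  and UN: "hmt (RD Z) (LB B) (LE {}) F z (pw N U) (\<lambda>_. z)"
  and w: "w = pmul \<mu> (\<lambda>(x, y, d). U (x + y, d)) (pw (N - 1) (pmul \<mu> (\<lambda>(x, y, d). U (x, d)) (\<lambda>(x, y, d). U (y, d))))"
 shows "hmt (RD (RD Z)) (TB B) (TE {}) F z (pmul \<mu> w w) (\<lambda>_. z)"
proof -
 let ?D = "RD (RD Z)" and ?B = "TB B :: (real \<times> real \<times> 'z) set"
  and ?E = "TE {} :: ((real \<times> real \<times> 'z) \<times> real \<times> real \<times> 'z) set"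
 let ?M = "hmonoid ?D ?B ?E" and ?c = "hclass ?D ?B ?E"
 let ?C = "cmaps ?D ?B ?E F z"
 let ?B1 = "LB B :: (real \<times> 'z) set" and ?E1 = "LE {} :: ((real \<times> 'z) \<times> real \<times> 'z) set"
 let ?M1 = "hmonoid (RD Z) ?B1 ?E1" and ?c1 = "hclass (RD Z) ?B1 ?E1"
 interpret M: comm_monoid ?M by (rule comm_monoid_hmonoid)
 interpret M1: comm_monoid ?M1 by (rule comm_monoid_hmonoid)
 have UB: "U (x, d) = z" if "x \<in> \<int> \<or> d \<in> B" for x d
  using admD[OF cmapsD(2)[OF U], of "(x, d)"] that by (simp add: LB_def)
 have UE: "U (x, d) = U (x', d)" if "x' - x \<in> \<int>" for x x' d
  using admD2[OF cmapsD(2)[OF U], of "(x, d)" "(x', d)"] that by (auto simp: LE_def)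
 \<comment> \<open>\<open>U\<close> composed with an integral linear form on the torus.
   \<open>w\<close> and its flip are built from such maps, and \<open>inverse_loop\<close> inverts
   each of them.\<close>
 define P where "P a b = (\<lambda>(x, y, d). U (of_int a * x + of_int b * y, d))" for a b :: int
 have cl: "cmap ?D (RD Z) (\<lambda>(x, y, d). (of_int a * x + of_int b * y, d))" for a b :: int
  unfolding case_prod_beta' by (intro cont_intros; rule cont_id)
 have P: "P a b \<in> ?C" for a b
  unfolding P_def case_prod_beta'
  by (rule cmaps_preI[OF U], (intro cont_intros; rule cont_id)[1])
    (auto simp: cs_defs intro!: UB UE Ints_mult_diff)
 have wP: "w = pmul \<mu> (P 1 1) (pw (N - 1) (pmul \<mu> (P 1 0) (P 0 1)))"
  by (simp add: w P_def)
 have wC: "w \<in> ?C"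
  unfolding wP by (intro pmul_cmaps pw_cmaps P)
 have inv: "?c (P a b) \<otimes>\<^bsub>?M\<^esub> ?c (P (- a) (- b)) = \<one>\<^bsub>?M\<^esub>" for a b
 proof -
  have "hmt ?D ?B ?E F z (pmul \<mu> (P a b) (P (- a) (- b))) (\<lambda>_. z)"
   by (rule hmt_preI[OF inverse_loop[OF U] cl[of a b]])
     (auto simp: cs_defs pmul_def P_def algebra_simps Ints_mult_diff Ints_mult_diff' simp flip: right_diff_distrib)
  then show ?thesis by (simp add: hmonoid_mult P hmonoid_one hclass_eqI)
 qed
 define w' where "w' = (\<lambda>(x, y, d). w (- x, - y, d))"
 have w'P: "w' = pmul \<mu> (P (- 1) (- 1)) (pw (N - 1) (pmul \<mu> (P (- 1) 0) (P 0 (- 1))))"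
  unfolding w'_def wP by (auto simp: fun_eq_iff P_def pmul_def minus_diff_commute)
 have w'C: "w' \<in> ?C"
  unfolding w'P by (intro pmul_cmaps pw_cmaps P)
 have ww': "?c w \<otimes>\<^bsub>?M\<^esub> ?c w' = \<one>\<^bsub>?M\<^esub>"
 proof -
  let ?a = "?c (P 1 1)" and ?b = "?c (P 1 0)" and ?d = "?c (P 0 1)"
   and ?a' = "?c (P (- 1) (- 1))" and ?b' = "?c (P (- 1) 0)" and ?d' = "?c (P 0 (- 1))"
  have c: "?a \<in> carrier ?M" "?b \<in> carrier ?M" "?d \<in> carrier ?M"
   "?a' \<in> carrier ?M" "?b' \<in> carrier ?M" "?d' \<in> carrier ?M" by (intro hclass_in P)+
  have i: "?a \<otimes>\<^bsub>?M\<^esub> ?a' = \<one>\<^bsub>?M\<^esub>" "?b \<otimes>\<^bsub>?M\<^esub> ?b' = \<one>\<^bsub>?M\<^esub>" "?d \<otimes>\<^bsub>?M\<^esub> ?d' = \<one>\<^bsub>?M\<^esub>"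
   using inv[of 1 1] inv[of 1 0] inv[of 0 1] by simp_all
  have "?c w \<otimes>\<^bsub>?M\<^esub> ?c w' = (?a \<otimes>\<^bsub>?M\<^esub> (?b \<otimes>\<^bsub>?M\<^esub> ?d) [^]\<^bsub>?M\<^esub> (N - 1)) \<otimes>\<^bsub>?M\<^esub> (?a' \<otimes>\<^bsub>?M\<^esub> (?b' \<otimes>\<^bsub>?M\<^esub> ?d') [^]\<^bsub>?M\<^esub> (N - 1))"
   unfolding wP w'P by (simp add: hclass_wedge P)
  also have "\<dots> = (?a \<otimes>\<^bsub>?M\<^esub> ?a') \<otimes>\<^bsub>?M\<^esub> ((?b \<otimes>\<^bsub>?M\<^esub> ?d) [^]\<^bsub>?M\<^esub> (N - 1) \<otimes>\<^bsub>?M\<^esub> (?b' \<otimes>\<^bsub>?M\<^esub> ?d') [^]\<^bsub>?M\<^esub> (N - 1))"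
   using c by (simp add: M.m_ac)
  also have "\<dots> = (?a \<otimes>\<^bsub>?M\<^esub> ?a') \<otimes>\<^bsub>?M\<^esub> ((?b \<otimes>\<^bsub>?M\<^esub> ?d) \<otimes>\<^bsub>?M\<^esub> (?b' \<otimes>\<^bsub>?M\<^esub> ?d')) [^]\<^bsub>?M\<^esub> (N - 1)"
   using c by (simp add: M.pow_mult_distrib M.m_comm)
  also have "(?b \<otimes>\<^bsub>?M\<^esub> ?d) \<otimes>\<^bsub>?M\<^esub> (?b' \<otimes>\<^bsub>?M\<^esub> ?d') = (?b \<otimes>\<^bsub>?M\<^esub> ?b') \<otimes>\<^bsub>?M\<^esub> (?d \<otimes>\<^bsub>?M\<^esub> ?d')"
   using c by (simp add: M.m_ac)
  finally show ?thesis by (simp add: i)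
 qed
 have N1: "Suc (N - 1) = N" using N by simp
 \<comment> \<open>On either coordinate circle one factor of the inner product is constant, and
   \<open>w\<close> reduces to \<open>U U ^ (N - 1)\<close>, the \<open>N\<close>-th power of
   \<open>U\<close>.\<close>
 have edge: "?c1 (pmul \<mu> U (pw (N - 1) (pmul \<mu> (\<lambda>_. z) U))) = ?c1 (\<lambda>_. z)"
  "?c1 (pmul \<mu> U (pw (N - 1) (pmul \<mu> U (\<lambda>_. z)))) = ?c1 (\<lambda>_. z)"
 proof -
  have "?c1 U [^]\<^bsub>?M1\<^esub> Suc (N - 1) = \<one>\<^bsub>?M1\<^esub>"
   unfolding N1 using hclass_eqI[OF UN] by (simp add: hclass_pw[OF U] hmonoid_one)
  then have "?c1 U \<otimes>\<^bsub>?M1\<^esub> ?c1 U [^]\<^bsub>?M1\<^esub> (N - 1) = \<one>\<^bsub>?M1\<^esub>"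
   by (simp add: M1.m_comm hclass_in U)
  then show "?c1 (pmul \<mu> U (pw (N - 1) (pmul \<mu> (\<lambda>_. z) U))) = ?c1 (\<lambda>_. z)"
   "?c1 (pmul \<mu> U (pw (N - 1) (pmul \<mu> U (\<lambda>_. z)))) = ?c1 (\<lambda>_. z)"
   using U by (simp_all add: hclass_wedge U cmaps_const z_in hclass_in flip: hmonoid_one)
 qed
 have e1: "hmt (RD Z) ?B1 ?E1 F z (\<lambda>d. w (0, d)) (\<lambda>_. z)"
  by (rule hmt_cong[OF hclass_eqD[OF cmaps_const[OF z_in] edge(1)]]) (auto simp: w pmul_def UB)
 have e2: "hmt (RD Z) ?B1 ?E1 F z (\<lambda>(x, d). w (x, 0, d)) (\<lambda>_. z)"
  by (rule hmt_cong[OF hclass_eqD[OF cmaps_const[OF z_in] edge(2)]]) (auto simp: w pmul_def UB)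
 let ?BZ = "{d. snd d \<in> B} :: (real \<times> 'z) set"
 have TB1: "{(x, d). x \<in> \<int> \<and> d \<in> ?B1 \<or> d \<in> ?BZ} = ?B"
  by (auto simp: cs_defs)
 have f1: "w \<in> cmaps ?D {(x, d). x \<in> \<int> \<and> d \<in> ?B1 \<or> d \<in> ?BZ} (LE ?E1) F z"
  using wC unfolding TB1 TE_def .
 obtain v1 where v1: "v1 \<in> cmaps ?D (LB ?BZ) (LE ?E1) F z"
  "hmt ?D {(x, d). x \<in> \<int> \<and> d \<in> ?B1 \<or> d \<in> ?BZ} (LE ?E1) F z w v1"
  by (rule nullhtpy_on_fibre[OF f1 e1]) (auto simp: LB_def)
 have wv1: "hmt ?D ?B ?E F z w v1"
  using v1(2) unfolding TB1 TE_def .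
 have v1B: "v1 (x, y, d) = z" if "x \<in> \<int> \<or> d \<in> B" for x y d
  using admD[OF cmapsD(2)[OF v1(1)], of "(x, y, d)"] that by (simp add: LB_def)
 have v1E: "v1 (x, y, d) = v1 (x', y', d)" if "x' - x \<in> \<int> \<and> y' = y \<or> x' = x \<and> y' - y \<in> \<int>" for x x' y y' d
  using admD2[OF cmapsD(2)[OF v1(1)], of "(x, y, d)" "(x', y', d)"] that by (auto simp: LE_def)
 \<comment> \<open>The coordinates are exchanged to treat the other circle. With \<open>?B1\<close>
   in both places of \<open>nullhtpy_on_fibre\<close>, points with integral \<open>x\<close> stay at
   the basepoint throughout.\<close>
 let ?v1 = "\<lambda>(y, x, d). v1 (x, y, d)"
 have f2: "?v1 \<in> cmaps ?D {(x, d). x \<in> \<int> \<and> d \<in> ?B1 \<or> d \<in> ?B1} (LE ?E1) F z"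
  unfolding case_prod_beta'
  by (rule cmaps_preI[OF v1(1)], (intro cont_intros; rule cont_id)[1])
    (auto simp: cs_defs intro!: v1B v1E)
 have "hmt (RD Z) ?B1 ?E1 F z (\<lambda>(x, d). w (x, 0, d)) (\<lambda>d. ?v1 (0, d))"
 proof (rule hmt_preI[OF wv1])
  show "cmap (RD Z) ?D (\<lambda>(x, d). (x, 0, d))"
   unfolding case_prod_beta' by (intro cont_intros; rule cont_id)
 qed (auto simp: cs_defs)
 then have e3: "hmt (RD Z) ?B1 ?E1 F z (\<lambda>d. ?v1 (0, d)) (\<lambda>_. z)"
  by (rule htp_trans[OF homotopic_with_symD e2])
 obtain v2 where v2: "v2 \<in> cmaps ?D (LB ?B1) (LE ?E1) F z"
  "hmt ?D {(x, d). x \<in> \<int> \<and> d \<in> ?B1 \<or> d \<in> ?B1} (LE ?E1) F z ?v1 v2"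
  by (rule nullhtpy_on_fibre[OF f2 e3]) auto
 have v2B: "v2 (x, y, d) = z" if "x \<in> \<int> \<or> y \<in> \<int> \<or> d \<in> B" for x y d
  using admD[OF cmapsD(2)[OF v2(1)], of "(x, y, d)"] that by (simp add: LB_def)
 have v2E: "v2 (x, y, d) = v2 (x', y', d)" if "x' - x \<in> \<int> \<and> y' = y \<or> x' = x \<and> y' - y \<in> \<int>" for x x' y y' d
  using admD2[OF cmapsD(2)[OF v2(1)], of "(x, y, d)" "(x', y', d)"] that by (auto simp: LE_def)
 \<comment> \<open>The flip as two reflections. Each inverts the class by
   \<open>inverse_loop\<close>, which applies in either coordinate because \<open>v2\<close> is
   trivial on both circles. Hence \<open>?n2\<close> has the class of \<open>w\<close>, while it is
   homotopic to the flip \<open>w'\<close>.\<close>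
 let ?v = "\<lambda>(x, y, d). v2 (y, x, d)" and ?n1 = "\<lambda>(x, y, d). v2 (y, - x, d)"
  and ?n1' = "\<lambda>(y, x, d). v2 (y, - x, d)" and ?n2 = "\<lambda>(x, y, d). v2 (- y, - x, d)"
 have neg: "- b - - a \<in> \<int>" if "b - a \<in> \<int>" for a b :: real
  using Ints_minus[OF that] by simp
 have vC: "?v \<in> cmaps ?D (LB ?B1) (LE ?E1) F z"
  unfolding case_prod_beta'
  by (rule cmaps_preI[OF v2(1)], (intro cont_intros; rule cont_id)[1])
    (auto simp: cs_defs intro!: v2B v2E)
 have n1'C: "?n1' \<in> cmaps ?D (LB ?B1) (LE ?E1) F z"
  unfolding case_prod_beta'
  by (rule cmaps_preI[OF v2(1)], (intro cont_intros; rule cont_id)[1])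
    (auto simp: cs_defs intro!: v2B v2E dest: neg)
 have n1C: "?n1 \<in> ?C"
  unfolding case_prod_beta'
  by (rule cmaps_preI[OF v2(1)], (intro cont_intros; rule cont_id)[1])
    (auto simp: cs_defs intro!: v2B v2E dest: neg)
 have n2C: "?n2 \<in> ?C"
  unfolding case_prod_beta'
  by (rule cmaps_preI[OF v2(1)], (intro cont_intros; rule cont_id)[1])
    (auto simp: cs_defs intro!: v2B v2E dest: neg)
 have "hmt ?D ?B ?E F z v1 ?v"
  by (rule hmt_preI[OF v2(2) cm_swap]) (auto simp: cs_defs)
 then have wv: "hmt ?D ?B ?E F z w ?v"
  by (rule htp_trans[OF wv1])
 have vC': "?v \<in> ?C" by (rule hmt_cmaps(2)[OF wv])
 have "hmt ?D ?B ?E F z (pmul \<mu> ?v ?n1) (\<lambda>_. z)"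
  by (rule hmt_preI[OF inverse_loop[OF vC] cont_id]) (auto simp: cs_defs pmul_def)
 then have c1: "?c ?v \<otimes>\<^bsub>?M\<^esub> ?c ?n1 = \<one>\<^bsub>?M\<^esub>"
  by (simp add: hmonoid_mult[OF vC' n1C] hmonoid_one hclass_eqI)
 have "hmt ?D ?B ?E F z (pmul \<mu> ?n1 ?n2) (\<lambda>_. z)"
  by (rule hmt_preI[OF inverse_loop[OF n1'C] cm_swap]) (auto simp: cs_defs pmul_def)
 then have c2: "?c ?n1 \<otimes>\<^bsub>?M\<^esub> ?c ?n2 = \<one>\<^bsub>?M\<^esub>"
  by (simp add: hmonoid_mult[OF n1C n2C] hmonoid_one hclass_eqI)
 have "hmt ?D ?B ?E F z w' ?n2"
 proof (rule hmt_preI[OF wv])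
  show "cmap ?D ?D (\<lambda>(x, y, d). (- x, - y, d))"
   unfolding case_prod_beta' by (intro cont_intros; rule cont_id)
 qed (auto simp: cs_defs w'_def dest: neg)
 then have c3: "?c w' = ?c ?n2" by (rule hclass_eqI)
 have "?c ?n2 = (?c ?v \<otimes>\<^bsub>?M\<^esub> ?c ?n1) \<otimes>\<^bsub>?M\<^esub> ?c ?n2"
  unfolding c1 using hclass_in[OF n2C] by (rule M.l_one[symmetric])
 also have "\<dots> = ?c ?v \<otimes>\<^bsub>?M\<^esub> (?c ?n1 \<otimes>\<^bsub>?M\<^esub> ?c ?n2)"
  by (intro M.m_assoc hclass_in vC' n1C n2C)
 also have "\<dots> = ?c ?v"
  unfolding c2 using hclass_in[OF vC'] by (rule M.r_one)
 also have "\<dots> = ?c w"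
  by (rule hclass_eqI[OF wv, symmetric])
 finally have "?c w \<otimes>\<^bsub>?M\<^esub> ?c w = \<one>\<^bsub>?M\<^esub>"
  using ww' c3 by simp
 then show ?thesis
  by (intro hclass_eqD cmaps_const z_in) (simp add: hmonoid_mult wC hmonoid_one)
qed

text \<open>For \<open>D = \<real> \<times> \<real> \<times> Z\<close> with coordinates \<open>(s, x, d)\<close> the constraints below describe the based maps
 out of the mapping cone of the degree \<open>k\<close> map on the suspension of \<open>Z / B\<close>: its identity
 has order \<open>k\<close> if \<open>k\<close> is odd.\<close>

theorem odd_degree_cone_exponent:
 fixes Z :: "'z topology"
 assumes f: "f \<in> cmaps (RD (RD Z)) (CB (LB B) (LBk k B)) (CE (LE {}) (LEk k)) F z" and k: "odd k"
 shows "hmt (RD (RD Z)) (CB (LB B) (LBk k B)) (CE (LE {}) (LEk k)) F z (pw k f) (\<lambda>_. z)"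
proof -
 let ?D = "RD (RD Z)" and ?B = "CB (LB B) (LBk k B)" and ?E = "CE (LE {}) (LEk k)"
 let ?M = "hmonoid ?D ?B ?E" and ?c = "hclass ?D ?B ?E" and ?C = "cmaps ?D ?B ?E F z"
 let ?B1 = "LB B" and ?E1 = "LE {}"
 let ?M1 = "hmonoid (RD Z) ?B1 ?E1" and ?c1 = "hclass (RD Z) ?B1 ?E1"
 interpret M: comm_monoid ?M by (rule comm_monoid_hmonoid)
 interpret M1: comm_monoid ?M1 by (rule comm_monoid_hmonoid)
 have k0: "k > 0" using k by (rule odd_pos)
 have fB: "f (s, x, d) = z" if "s \<le> 0 \<or> x \<in> \<int> \<or> s \<ge> 1 \<and> real k * x \<in> \<int> \<or> d \<in> B" for s x d
  using admD[OF cmapsD(2)[OF f], of "(s, x, d)"] that by (auto simp: cs_defs)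
 have fE: "f (s, x, d) = f (s, x', d)" if "x' - x \<in> \<int> \<or> s \<ge> 1 \<and> real k * (x' - x) \<in> \<int>" for s x d x'
  using admD2[OF cmapsD(2)[OF f], of "(s, x, d)" "(s, x', d)"] that by (auto simp: cs_defs)
 \<comment> \<open>The base loop rescaled from period \<open>1/k\<close> to period 1, so that
   \<open>f(1, x, d) = U(k x, d)\<close>.\<close>
 define U where "U = (\<lambda>(x, d). f (1, x / real k, d))"
 have U: "U \<in> cmaps (RD Z) ?B1 ?E1 F z"
  unfolding U_def case_prod_beta'
  by (rule cmaps_preI[OF f], (intro cont_intros; rule cont_id)[1])
    (auto simp: cs_defs k0 right_diff_distrib intro!: fB fE)
 have UB: "U (x, d) = z" if "x \<in> \<int> \<or> d \<in> B" for x d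
  using admD[OF cmapsD(2)[OF U], of "(x, d)"] that by (simp add: LB_def)
 have Uk: "U (real k * x, d) = f (1, x, d)" for x d
  using k0 by (simp add: U_def)
 \<comment> \<open>Lowering the cone coordinate from 1 to 0 contracts the base loop through the
   cone; by \<open>multiple\<close> the \<open>k\<close>-th power of \<open>U\<close> is
   trivial.\<close>
 have Uk_null: "hmt (RD Z) ?B1 ?E1 F z (\<lambda>(x, d). U (real k * x, d)) (\<lambda>_. z)"
 proof (rule hmt_pre_htpy[OF f, where h = "\<lambda>(t, x, d). (1 - t, x, d)"])
  show "cmap (RD (RD Z)) ?D (\<lambda>(t, x, d). (1 - t, x, d))"
   unfolding case_prod_beta' by (intro cont_intros; rule cont_id)
 qed (auto simp: cs_defs Uk intro!: fB fE)
 have Upw: "hmt (RD Z) ?B1 ?E1 F z (pw k U) (\<lambda>_. z)"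
  by (rule htp_trans[OF homotopic_with_symD[OF multiple[OF U]] Uk_null])
 have cont_k: "cmap (RD Z) (RD Z) (\<lambda>(x, d). (real k * x, d))"
  unfolding case_prod_beta' by (intro cont_intros; rule cont_id)
 have fC: "pw k f \<in> ?C" by (rule pw_cmaps[OF f])
 have sub: "LB B \<subseteq> LBk k B" "LE {} \<subseteq> LEk k"
  by (auto simp: cs_defs)
 \<comment> \<open>Rescaled back to period \<open>1/k\<close>, the null homotopy of
   \<open>U ^ k\<close> is admissible on the base, so \<open>f ^ k\<close> deforms to a map
   \<open>g\<close> trivial on the base.\<close>
 have "hmt (RD Z) (LBk k B) (LEk k) F z (\<lambda>a. pw k f (1, a)) (\<lambda>_. z)"
  by (rule hmt_preI[OF Upw cont_k]) (auto simp: cs_defs Uk right_diff_distrib)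
 then obtain g where g: "g \<in> cmaps ?D (CB (LB B) UNIV) (CE (LE {}) {}) F z" "hmt ?D ?B ?E F z (pw k f) g"
  using nullhtpy_on_base[OF fC _ sub] by blast
 have gB: "g (s, x, d) = z" if "s \<le> 0 \<or> s \<ge> 1 \<or> x \<in> \<int> \<or> d \<in> B" for s x d
  using admD[OF cmapsD(2)[OF g(1)], of "(s, x, d)"] that by (auto simp: cs_defs)
 have gE: "g (s, x, d) = g (s, x', d)" if "x' - x \<in> \<int>" for s x d x'
  using admD2[OF cmapsD(2)[OF g(1)], of "(s, x, d)" "(s, x', d)"] that by (auto simp: cs_defs)
 have weaken: "hmt ?D ?B ?E F z u v" if "hmt ?D (CB (LB B) UNIV) (CE (LE {}) {}) F z u v" for u v
  by (rule hmt_mono[OF that]) (auto simp: cs_defs)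
 \<comment> \<open>\<open>g(s, k x, d)\<close> satisfies the base constraints at every level
   \<open>s\<close>, so the cone can be contracted. As \<open>g\<close> is trivial on the base,
   \<open>multiple_s\<close> identifies this map with \<open>g ^ k\<close>; hence the
   \<open>k * k\<close>-th power of \<open>f\<close> is trivial.\<close>
 have g_null: "hmt ?D ?B ?E F z (\<lambda>(s, x, d). g (s, real k * x, d)) (\<lambda>_. z)"
 proof (rule hmt_pre_htpy[OF g(1), where h = "\<lambda>(t, s, x, d). ((1 - t) * s, real k * x, d)"])
  show "cmap (RD ?D) ?D (\<lambda>(t, s, x, d). ((1 - t) * s, real k * x, d))"
   unfolding case_prod_beta' by (intro cont_intros; rule cont_id)
 qed (auto simp: cs_defs mult_le_0_iff intro!: gB gE simp flip: right_diff_distrib)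
 have "?c g [^]\<^bsub>?M\<^esub> k = \<one>\<^bsub>?M\<^esub>"
  using hclass_eqI[OF weaken[OF multiple_s[OF g(1), of k]]] hclass_eqI[OF g_null]
   hclass_pw[OF hmt_cmaps(2)[OF g(2)], of k] by (simp add: hmonoid_one)
 then have "(?c f [^]\<^bsub>?M\<^esub> k) [^]\<^bsub>?M\<^esub> k = \<one>\<^bsub>?M\<^esub>"
  using hclass_eqI[OF g(2)] by (simp add: hclass_pw[OF f])
 then have kk: "?c f [^]\<^bsub>?M\<^esub> (k * k) = \<one>\<^bsub>?M\<^esub>"
  by (simp add: M.nat_pow_pow hclass_in f)
 let ?N = "k * k"
 have N: "?N \<ge> 1" using k0 by simp
 have N1: "Suc (?N - 1) = ?N" using N by simp
 have fN: "hmt ?D ?B ?E F z (pw ?N f) (\<lambda>_. z)"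
  by (rule hclass_eqD[OF cmaps_const[OF z_in]]) (simp only: hclass_pw[OF f] kk hmonoid_one)
 have UN: "hmt (RD Z) ?B1 ?E1 F z (pw ?N U) (\<lambda>_. z)"
 proof (rule hclass_eqD[OF cmaps_const[OF z_in]])
  have "?c1 U [^]\<^bsub>?M1\<^esub> k = \<one>\<^bsub>?M1\<^esub>"
   using hclass_eqI[OF Upw] by (simp only: hclass_pw[OF U] hmonoid_one)
  then have "?c1 U [^]\<^bsub>?M1\<^esub> (k * k) = \<one>\<^bsub>?M1\<^esub>"
   by (simp add: hclass_in U flip: M1.nat_pow_pow)
  then show "?c1 (pw ?N U) = ?c1 (\<lambda>_. z)"
   by (simp only: hclass_pw[OF U] hmonoid_one)
 qed
 let ?DS = "RD (RD (RD Z))"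
 let ?BS = "CB (TB B) (TBk k B)" and ?ES = "CE (TE {}) (TEk k)"
 let ?S = "\<lambda>(s, x, y, d). f (s, x + y, d)" and ?X = "\<lambda>(s, x, y, d). f (s, x, d)" and ?Y = "\<lambda>(s, x, y, d). f (s, y, d)"
 have S: "?S \<in> cmaps ?DS ?BS ?ES F z" and X: "?X \<in> cmaps ?DS ?BS ?ES F z" and Y: "?Y \<in> cmaps ?DS ?BS ?ES F z"
  unfolding case_prod_beta'
  by (rule cmaps_preI[OF f], (intro cont_intros; rule cont_id)[1],
    auto simp: cs_defs distrib_left right_diff_distrib add_diff_add intro!: fB fE)+
 \<comment> \<open>The deviation of \<open>f\<close> from additivity, the \<open>(N - 1)\<close>-st
   power serving as inverse. On the base it is the \<open>w\<close> of
   \<open>torus_square_null\<close> evaluated at \<open>(k x, k y)\<close>, so its square deforms to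
   a map \<open>h\<close> trivial on the base.\<close>
 define W where "W = pmul \<mu> ?S (pw (?N - 1) (pmul \<mu> ?X ?Y))"
 have WC: "W \<in> cmaps ?DS ?BS ?ES F z"
  unfolding W_def by (intro pmul_cmaps pw_cmaps S X Y)
 let ?w = "pmul \<mu> (\<lambda>(x, y, d). U (x + y, d)) (pw (?N - 1) (pmul \<mu> (\<lambda>(x, y, d). U (x, d)) (\<lambda>(x, y, d). U (y, d))))"
 have ww: "hmt ?D (TB B) (TE {}) F z (pmul \<mu> ?w ?w) (\<lambda>_. z)"
  by (rule torus_square_null[OF U N UN refl])
 have cont_kk: "cmap ?D ?D (\<lambda>(x, y, d). (real k * x, real k * y, d))"
  unfolding case_prod_beta' by (intro cont_intros; rule cont_id)
 have W1: "hmt ?D (TBk k B) (TEk k) F z (\<lambda>a. pmul \<mu> W W (1, a)) (\<lambda>_. z)"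
  by (rule hmt_preI2[OF ww cont_kk, where m = "\<lambda>(x, y, d) (x', y', d'). (real k * x', real k * y, d)"])
    (auto simp: cs_defs pmul_def W_def Uk right_diff_distrib simp flip: distrib_left)
 have subT: "TB B \<subseteq> TBk k B" "TE {} \<subseteq> TEk k"
  by (auto simp: cs_defs)
 obtain h where h: "h \<in> cmaps ?DS (CB (TB B) UNIV) (CE (TE {}) {}) F z" "hmt ?DS ?BS ?ES F z (pmul \<mu> W W) h"
  using nullhtpy_on_base[OF pmul_cmaps[OF WC WC] W1 subT] by blast
 have hB: "h (s, x, y, d) = z" if "s \<le> 0 \<or> s \<ge> 1 \<or> x \<in> \<int> \<and> y \<in> \<int> \<or> d \<in> B" for s x y d
  using admD[OF cmapsD(2)[OF h(1)], of "(s, x, y, d)"] that by (auto simp: cs_defs)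
 have hE: "h (s, x, y, d) = h (s, x', y', d)" if "x' - x \<in> \<int> \<and> y' = y \<or> x' = x \<and> y' - y \<in> \<int>" for s x y d x' y'
  using admD2[OF cmapsD(2)[OF h(1)], of "(s, x, y, d)" "(s, x', y', d)"] that by (auto simp: cs_defs)
 let ?f = "\<lambda>j::nat. \<lambda>(s, x, d). f (s, real j * x, d)"
 have fj: "?f j \<in> ?C" for j
  unfolding case_prod_beta'
  by (rule cmaps_preI[OF f], (intro cont_intros; rule cont_id)[1])
    (auto simp: cs_defs mult.left_commute[of "real k"] intro!: fB fE simp flip: right_diff_distrib)
 have f1: "?f 1 = f" by auto
 have cont_j: "cmap ?D ?D (\<lambda>(s, x, d). (s, real j * x, d))" for j :: nat
  unfolding case_prod_beta' by (intro cont_intros; rule cont_id)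
 have fjN: "?c (?f j) [^]\<^bsub>?M\<^esub> ?N = \<one>\<^bsub>?M\<^esub>" for j
 proof -
  have "hmt ?D ?B ?E F z (pw ?N (?f j)) (\<lambda>_. z)"
   by (rule hmt_preI[OF fN cont_j[of j]])
     (auto simp: cs_defs mult.left_commute[of "real k"] simp flip: right_diff_distrib)
  then show ?thesis
   using hclass_eqI by (simp only: hmonoid_one flip: hclass_pw[OF fj]) blast
 qed
 let ?W = "\<lambda>(i::nat) (j::nat). \<lambda>(s, x, d). W (s, real i * x, real j * x, d)"
 have cont_ij: "cmap ?D ?DS (\<lambda>(s, x, d). (s, real i * x, real j * x, d))" for i j :: nat
  unfolding case_prod_beta' by (intro cont_intros; rule cont_id)
 have Wij: "?W i j = pmul \<mu> (?f (i + j)) (pw (?N - 1) (pmul \<mu> (?f i) (?f j)))" for i j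
  by (auto simp: W_def pmul_def distrib_right)
 have WijC: "?W i j \<in> ?C" for i j
  unfolding Wij by (intro pmul_cmaps pw_cmaps fj)
 have cW: "?c (?W i j) = ?c (?f (i + j)) \<otimes>\<^bsub>?M\<^esub> (?c (?f i) \<otimes>\<^bsub>?M\<^esub> ?c (?f j)) [^]\<^bsub>?M\<^esub> (?N - 1)" for i j
  unfolding Wij by (rule hclass_wedge[OF fj fj fj])
 let ?h = "\<lambda>(i::nat) (j::nat). \<lambda>(s, x, d). h (s, real i * x, real j * x, d)"
 have Wh: "hmt ?D ?B ?E F z (pmul \<mu> (?W i j) (?W i j)) (?h i j)" for i j
  by (rule hmt_preI2[OF h(2) cont_ij[of i j], where m = "\<lambda>(s, x, d) (s', x', d'). (s, real i * x', real j * x, d)"])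
    (auto simp: cs_defs mult.left_commute[of "real k"] pmul_def simp flip: right_diff_distrib)
 have Wh': "?c (?W i j) \<otimes>\<^bsub>?M\<^esub> ?c (?W i j) = ?c (?h i j)" for i j
  by (simp only: hmonoid_mult[OF WijC WijC] hclass_eqI[OF Wh])
 \<comment> \<open>The triangle deformation breaks the period \<open>1/k\<close> and cannot be
   applied to \<open>W\<close>. It applies to \<open>h\<close>, because the base of \<open>h\<close>
   goes to the basepoint and imposes no finer period.\<close>
 have hj: "?c (?h j 1) = ?c (?h j 0) \<otimes>\<^bsub>?M\<^esub> ?c (?h 0 1)" for j
 proof -
  have "(\<lambda>(s, a, b, d). h (s, real j * a, b, d)) \<in> cmaps ?DS (CB (TB B) UNIV) (CE (TE {}) {}) F z"
   unfolding case_prod_beta'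
   by (rule cmaps_preI[OF h(1)], (intro cont_intros; rule cont_id)[1])
     (auto simp: cs_defs intro!: hB hE simp flip: right_diff_distrib)
  from weaken[OF triangle_s[OF this]] have "hmt ?D ?B ?E F z (?h j 1) (pmul \<mu> (?h j 0) (?h 0 1))"
   by (rule hmt_cong) (auto simp: pmul_def)
  then show ?thesis
   by (simp only: hmonoid_mult[OF hmt_cmaps(2)[OF Wh] hmt_cmaps(2)[OF Wh]] hclass_eqI)
 qed
 have f0: "?c (?f 0) = \<one>\<^bsub>?M\<^esub>"
 proof -
  have "?f 0 = (\<lambda>_. z)" by (auto simp: fB)
  then show ?thesis by (simp only: hmonoid_one)
 qed
 have ci: "?c (?f j) \<in> carrier ?M" for j by (rule hclass_in[OF fj])
 have W0: "?c (?W j 0) = \<one>\<^bsub>?M\<^esub>" "?c (?W 0 j) = \<one>\<^bsub>?M\<^esub>" for j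
 proof -
  have "?c (?f j) \<otimes>\<^bsub>?M\<^esub> ?c (?f j) [^]\<^bsub>?M\<^esub> (?N - 1) = ?c (?f j) [^]\<^bsub>?M\<^esub> Suc (?N - 1)"
   by (simp add: M.m_comm ci)
  then have *: "?c (?f j) \<otimes>\<^bsub>?M\<^esub> ?c (?f j) [^]\<^bsub>?M\<^esub> (?N - 1) = \<one>\<^bsub>?M\<^esub>"
   unfolding N1 fjN .
  show "?c (?W j 0) = \<one>\<^bsub>?M\<^esub>" "?c (?W 0 j) = \<one>\<^bsub>?M\<^esub>"
   unfolding cW f0 add_0_left add_0_right M.r_one[OF ci] M.l_one[OF ci] by (rule *)+
 qed
 \<comment> \<open>\<open>W(j x, x)\<close> squares to the product of the squares of
   \<open>W(j x, 0)\<close> and \<open>W(0, x)\<close>, which are trivial; hence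
   \<open>f((j + 1) x)\<close> and \<open>f(j x) f(x)\<close> have equal squares.\<close>
 have sq: "?c (?f j) [^]\<^bsub>?M\<^esub> (2::nat) = ?c f [^]\<^bsub>?M\<^esub> (2 * j)" for j
 proof (induction j)
  case 0
  then show ?case by (simp only: f0 M.nat_pow_one mult_0_right M.nat_pow_0)
 next
  case (Suc j)
  let ?a = "?c (?f (Suc j))" and ?b = "?c (?f j) \<otimes>\<^bsub>?M\<^esub> ?c f"
  have cf: "?c f \<in> carrier ?M" using ci[of 1] unfolding f1 .
  have b: "?b \<in> carrier ?M" by (intro M.m_closed ci cf)
  have a: "?a \<in> carrier ?M" by (rule ci)
  have bN: "?b [^]\<^bsub>?M\<^esub> ?N = \<one>\<^bsub>?M\<^esub>"
   using fjN[of j] fjN[of 1] unfolding f1 by (simp add: M.pow_mult_distrib M.m_comm ci cf)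
  have "?c (?W j 1) \<otimes>\<^bsub>?M\<^esub> ?c (?W j 1) = (?c (?W j 0) \<otimes>\<^bsub>?M\<^esub> ?c (?W j 0)) \<otimes>\<^bsub>?M\<^esub> (?c (?W 0 1) \<otimes>\<^bsub>?M\<^esub> ?c (?W 0 1))"
   unfolding Wh' by (rule hj)
  also have "\<dots> = \<one>\<^bsub>?M\<^esub>"
   unfolding W0 by simp
  finally have "(?a \<otimes>\<^bsub>?M\<^esub> ?b [^]\<^bsub>?M\<^esub> (?N - 1)) \<otimes>\<^bsub>?M\<^esub> (?a \<otimes>\<^bsub>?M\<^esub> ?b [^]\<^bsub>?M\<^esub> (?N - 1)) = \<one>\<^bsub>?M\<^esub>"
   unfolding cW f1 Suc_eq_plus1 .
  then have "?b \<otimes>\<^bsub>?M\<^esub> ?b = ((?a \<otimes>\<^bsub>?M\<^esub> ?b [^]\<^bsub>?M\<^esub> (?N - 1)) \<otimes>\<^bsub>?M\<^esub> (?a \<otimes>\<^bsub>?M\<^esub> ?b [^]\<^bsub>?M\<^esub> (?N - 1))) \<otimes>\<^bsub>?M\<^esub> (?b \<otimes>\<^bsub>?M\<^esub> ?b)"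
   using b by simp
  also have "\<dots> = (?a \<otimes>\<^bsub>?M\<^esub> ?a) \<otimes>\<^bsub>?M\<^esub> ((?b [^]\<^bsub>?M\<^esub> (?N - 1) \<otimes>\<^bsub>?M\<^esub> ?b) \<otimes>\<^bsub>?M\<^esub> (?b [^]\<^bsub>?M\<^esub> (?N - 1) \<otimes>\<^bsub>?M\<^esub> ?b))"
   by (rule M.mult_square_shuffle[OF a M.nat_pow_closed[OF b] b])
  also have "?b [^]\<^bsub>?M\<^esub> (?N - 1) \<otimes>\<^bsub>?M\<^esub> ?b = ?b [^]\<^bsub>?M\<^esub> Suc (?N - 1)"
   by (rule M.nat_pow_Suc[symmetric])
  finally have "?a \<otimes>\<^bsub>?M\<^esub> ?a = ?b \<otimes>\<^bsub>?M\<^esub> ?b"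
   unfolding N1 bN using a by simp
  then have "?a [^]\<^bsub>?M\<^esub> (2::nat) = ?b [^]\<^bsub>?M\<^esub> (2::nat)"
   using a b by (simp add: numeral_2_eq_2)
  also have "\<dots> = ?c (?f j) [^]\<^bsub>?M\<^esub> (2::nat) \<otimes>\<^bsub>?M\<^esub> ?c f [^]\<^bsub>?M\<^esub> (2::nat)"
   by (intro M.pow_mult_distrib M.m_comm ci cf)
  also have "\<dots> = ?c f [^]\<^bsub>?M\<^esub> (2 * j + 2)"
   unfolding Suc by (rule M.nat_pow_mult[OF cf])
  finally show ?case by simp
 qed
 have cf: "?c f \<in> carrier ?M" by (rule hclass_in[OF f])
 have "?c (?f k) = \<one>\<^bsub>?M\<^esub>"
 proof -
  have "hmt ?D ?B ?E F z (?f k) (\<lambda>_. z)"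
  proof (rule hmt_pre_htpy[OF f, where h = "\<lambda>(t, s, x, d). ((1 - t) * s, real k * x, d)"])
   show "cmap (RD ?D) ?D (\<lambda>(t, s, x, d). ((1 - t) * s, real k * x, d))"
    unfolding case_prod_beta' by (intro cont_intros; rule cont_id)
  qed (auto simp: cs_defs mult_le_0_iff intro!: fB fE simp flip: right_diff_distrib)
  then show ?thesis by (simp only: hclass_eqI hmonoid_one)
 qed
 then have k2: "?c f [^]\<^bsub>?M\<^esub> (2 * k) = \<one>\<^bsub>?M\<^esub>"
  using sq[of k] by simp
 \<comment> \<open>With \<open>k = 2 m + 1\<close> the exponent \<open>k * k\<close> is
   \<open>k + 2 k m\<close>; the powers of \<open>f\<close> with exponents \<open>k * k\<close> and
   \<open>2 * k\<close> are both trivial.\<close>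
 obtain m where m: "k = 2 * m + 1" using k by (rule oddE)
 have "\<one>\<^bsub>?M\<^esub> = ?c f [^]\<^bsub>?M\<^esub> (k + 2 * k * m)"
  using kk m by (simp add: algebra_simps)
 also have "\<dots> = ?c f [^]\<^bsub>?M\<^esub> k \<otimes>\<^bsub>?M\<^esub> (?c f [^]\<^bsub>?M\<^esub> (2 * k)) [^]\<^bsub>?M\<^esub> m"
  by (simp only: M.nat_pow_mult[OF cf, symmetric] M.nat_pow_pow[OF cf])
 also have "\<dots> = ?c f [^]\<^bsub>?M\<^esub> k"
  unfolding k2 using cf by simp
 finally show ?thesis
  by (intro hclass_eqD cmaps_const z_in) (simp only: hclass_pw[OF f] hmonoid_one)
qed

end

section \<open>Homology of relative homeomorphisms\<close>

lemma hom_induced_one: "hom_induced p X S Y T f \<one>\<^bsub>rel_H p X S\<^esub> = \<one>\<^bsub>rel_H p Y T\<^esub>"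
 by (rule hom_one[OF hom_induced_hom]) auto

lemma hom_induced_mult:
 assumes "a \<in> carrier (rel_H p X S)" "b \<in> carrier (rel_H p X S)"
 shows "hom_induced p X S Y T f (a \<otimes>\<^bsub>rel_H p X S\<^esub> b)
   = hom_induced p X S Y T f a \<otimes>\<^bsub>rel_H p Y T\<^esub> hom_induced p X S Y T f b"
 using hom_induced_hom assms by (rule hom_mult)

lemma iso_surj:
 assumes "h \<in> iso G H" "y \<in> carrier H"
 shows "\<exists>x \<in> carrier G. h x = y"
proof -
 have "h ` carrier G = carrier H" using assms(1) by (simp add: iso_def bij_betw_def)
 then have "y \<in> h ` carrier G" using assms(2) by simp
 then show ?thesis by (elim imageE) auto
qed

text \<open>The map of pairs factors through \<open>(T, T)\<close>, whose relative homology is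
  trivial.\<close>

lemma hom_induced_into_subset:
 assumes f: "cmap X Y f" and S: "S \<subseteq> topspace X" "f \<in> topspace X \<rightarrow> T" "T \<subseteq> topspace Y"
 shows "hom_induced p X S Y T f c = \<one>\<^bsub>rel_H p Y T\<^esub>"
proof -
 let ?Z = "subtopology Y T"
 have f': "cmap X ?Z f" using f S(2) by (simp add: cm_in_sub)
 have Z: "topspace ?Z = T" using S(3) by auto
 have t: "trivial_group (rel_H p ?Z T)"
  using trivial_relative_homology_group_topspace[of p ?Z] unfolding Z .
 have "hom_induced p X S Y T (id \<circ> f) c = hom_induced p ?Z T Y T id (hom_induced p X S ?Z T f c)"
  using S by (intro hom_induced_compose'[symmetric] f') (auto simp: cm_sub)
 also have "hom_induced p X S ?Z T f c = \<one>\<^bsub>rel_H p ?Z T\<^esub>"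
  using t hom_induced_carrier[of p X S ?Z T f c] by (simp add: trivial_group_def)
 finally show ?thesis by (simp add: hom_induced_one)
qed

text \<open>\<open>E\<close> is a section of the relative homeomorphism \<open>D\<close> off \<open>A\<close>, and \<open>R\<close>, \<open>R'\<close> push the
 neighbourhoods \<open>N\<close>, \<open>N'\<close> into \<open>A\<close>, \<open>A'\<close>.\<close>

lemma relative_homology_onto:
 assumes D: "cmap X' X D" "D \<in> A' \<rightarrow> A" "D \<in> N' \<rightarrow> N"
  and A: "closedin X A" "openin X N" "A \<subseteq> N"
  and E: "cmap (subtopology X (topspace X - A)) X' E" "E \<in> N - A \<rightarrow> N'"
   "\<And>x. x \<in> topspace X - A \<Longrightarrow> D (E x) = x"
  and R: "homotopic_with (\<lambda>h. h \<in> A \<rightarrow> A) X X R id" "R \<in> N \<rightarrow> A"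
  and R': "cmap X' X' R'" "R' \<in> N' \<rightarrow> A'" "\<And>x. x \<in> topspace X' \<Longrightarrow> D (R' x) = R (D x)"
  and z: "z \<in> carrier (rel_H p X A)"
 shows "\<exists>y \<in> carrier (rel_H p X' A'). hom_induced p X' A' X A D y = z"
proof -
 have Asub: "A \<subseteq> topspace X" and Nsub: "N \<subseteq> topspace X"
  using A closedin_subset openin_subset by blast+
 have Rc: "cmap X X R"
  using R(1) homotopic_with_imp_continuous_maps by blast
 let ?Y = "subtopology X (topspace X - A)"
 have cl: "X closure_of A \<subseteq> X interior_of N"
  using A by (simp add: closure_of_closedin interior_of_openin)
 have iso: "hom_induced p ?Y (N - A) (subtopology X (topspace X)) N id
   \<in> iso (rel_H p ?Y (N - A)) (rel_H p (subtopology X (topspace X)) N)"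
  by (rule homology_excision_axiom[OF cl Nsub])
 define z' where "z' = hom_induced p X A X N id z"
 have "z' \<in> carrier (rel_H p X N)"
  unfolding z'_def by (rule hom_induced_carrier)
 then obtain y where y: "y \<in> carrier (rel_H p ?Y (N - A))"
  "hom_induced p ?Y (N - A) X N id y = z'"
  using iso_surj[OF iso] unfolding subtopology_topspace by blast
 \<comment> \<open>The lift: after excision of \<open>A\<close> the class is carried up by the
   section \<open>E\<close> and pushed into \<open>A'\<close> by \<open>R'\<close>. Downstairs this
   becomes \<open>R\<close>, which is homotopic to the identity.\<close>
 define w where "w = hom_induced p X' N' X' A' R' (hom_induced p ?Y (N - A) X' N' E y)"
 have "hom_induced p X' A' X A D w = hom_induced p X' N' X A (D \<circ> R') (hom_induced p ?Y (N - A) X' N' E y)"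
  unfolding w_def by (rule hom_induced_compose'[OF R'(1,2) D(1,2)])
 also have "hom_induced p X' N' X A (D \<circ> R') = hom_induced p X' N' X A (R \<circ> D)"
  by (rule hom_induced_eq) (simp add: R'(3))
 also have "\<dots> (hom_induced p ?Y (N - A) X' N' E y) = hom_induced p ?Y (N - A) X A (R \<circ> D \<circ> E) y"
  using D R(2) by (intro hom_induced_compose' E(1,2) continuous_map_compose[OF D(1) Rc]) auto
 also have "hom_induced p ?Y (N - A) X A (R \<circ> D \<circ> E) = hom_induced p ?Y (N - A) X A (R \<circ> id)"
  by (rule hom_induced_eq) (auto simp: E(3))
 also have "\<dots> y = hom_induced p X N X A R z'"
  unfolding y(2)[symmetric] by (rule hom_induced_compose'[symmetric])
   (use R(2) in \<open>auto intro: Rc cm_sub\<close>)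
 also have "\<dots> = hom_induced p X A X A (R \<circ> id) z"
  unfolding z'_def by (rule hom_induced_compose') (use A(3) R(2) Rc in auto)
 also have "\<dots> = hom_induced p X A X A id z"
  using homology_homotopy_axiom[OF R(1), of p] by simp
 also have "\<dots> = z" by (rule hom_induced_id[OF z])
 finally show ?thesis
  unfolding w_def using hom_induced_carrier by blast
qed

text \<open>A map from a compact to a Hausdorff space is closed, so \<open>X\<close> carries the
  quotient topology of \<open>A\<close> and \<open>X'\<close>. With \<open>A\<close> empty this says
  that \<open>D\<close> is a quotient map.\<close>

lemma continuous_map_on_pushout:
 assumes X': "compact_space X'" and X: "Hausdorff_space X" and D: "cmap X' X D"
  and A: "closedin X A" "topspace X \<subseteq> A \<union> D ` topspace X'"
  and g: "cmap (subtopology X A) Y g" "cmap X' Y (\<lambda>x. g (D x))"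
 shows "cmap X Y g"
 unfolding continuous_map_closedin
proof (intro conjI allI impI)
 have gA: "g x \<in> topspace Y" if "x \<in> A" for x
  using g(1) that closedin_subset[OF A(1)] by (auto simp: continuous_map_def Pi_iff)
 have gD: "g (D x) \<in> topspace Y" if "x \<in> topspace X'" for x
  using g(2) that by (auto simp: continuous_map_def Pi_iff)
 show "g \<in> topspace X \<rightarrow> topspace Y"
  using A(2) gA gD by blast
 fix C assume C: "closedin Y C"
 have cm: "closed_map X' X D"
  by (rule continuous_imp_closed_map[OF D X' X])
 have "closedin X' {x \<in> topspace X'. g (D x) \<in> C}"
  by (rule closedin_pre[OF g(2) C])
 then have 1: "closedin X (D ` {x \<in> topspace X'. g (D x) \<in> C})"
  using cm unfolding closed_map_def by blast
 have "closedin (subtopology X A) {x \<in> topspace (subtopology X A). g x \<in> C}"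
  by (rule closedin_pre[OF g(1) C])
 then have 2: "closedin X {x \<in> topspace (subtopology X A). g x \<in> C}"
  by (rule closedin_trans_full[OF _ A(1)])
 have "D x \<in> topspace X" if "x \<in> topspace X'" for x
  using D that by (auto simp: continuous_map_def)
 then have "{x \<in> topspace X. g x \<in> C} = D ` {x \<in> topspace X'. g (D x) \<in> C} \<union> {x \<in> topspace (subtopology X A). g x \<in> C}"
  using A(2) by auto
 then show "closedin X {x \<in> topspace X. g x \<in> C}"
  using closedin_Un[OF 1 2] by simp
qed

text \<open>\<open>H\<close> pushes a neighbourhood of \<open>A'\<close> into \<open>A'\<close>. It
  may move points of \<open>A'\<close> as long as \<open>D\<close> does not notice, which suffices
  for \<open>H\<close> to descend to a deformation of \<open>X\<close>.\<close>

lemma relative_homology_onto_cell: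
 assumes X': "compact_space X'" and X: "Hausdorff_space X" and D: "cmap X' X D" "D \<in> A' \<rightarrow> A"
  and A: "closedin X A" "topspace X \<subseteq> A \<union> D ` topspace X'" and A': "closedin X' A'"
  and inj: "inj_on D (topspace X' - A')" and disj: "\<And>x. x \<in> topspace X' - A' \<Longrightarrow> D x \<notin> A"
  and N': "openin X' N'" "A' \<subseteq> N'"
  and H: "cmap (IZ X') X' H"
   "\<And>x. x \<in> topspace X' \<Longrightarrow> H (0, x) = x" "\<And>x. x \<in> N' \<Longrightarrow> H (1, x) \<in> A'"
   "\<And>t x. t \<in> {0..1} \<Longrightarrow> x \<in> A' \<Longrightarrow> H (t, x) \<in> topspace X' \<and> D (H (t, x)) = D x"
  and z: "z \<in> carrier (rel_H p X A)"
 shows "\<exists>y \<in> carrier (rel_H p X' A'). hom_induced p X' A' X A D y = z"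
proof -
 let ?C = "topspace X' - A'"
 have A's: "A' \<subseteq> topspace X'" and N's: "N' \<subseteq> topspace X'" and As: "A \<subseteq> topspace X"
  using A' N' A closedin_subset openin_subset by blast+
 have DX: "D x \<in> topspace X" if "x \<in> topspace X'" for x
  using D(1) that by (auto simp: continuous_map_def)
 \<comment> \<open>The inverse of \<open>D\<close> over the complement of \<open>A\<close>; it is
   continuous there because \<open>D\<close> is closed.\<close>
 define E where "E = inv_into ?C D"
 have E: "E x \<in> ?C" "D (E x) = x" if "x \<in> topspace X - A" for x
 proof -
  have "x \<in> D ` ?C" using that A(2) D(2) by auto
  then show "E x \<in> ?C" "D (E x) = x"
   unfolding E_def by (rule inv_into_into, rule f_inv_into_f)
 qed
 have ED: "E (D x) = x" if "x \<in> ?C" for x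
  unfolding E_def using inj that by (rule inv_into_f_f)
 have cm: "closed_map X' X D"
  by (rule continuous_imp_closed_map[OF D(1) X' X])
 let ?Y = "subtopology X (topspace X - A)"
 have Ec: "cmap ?Y X' E"
  unfolding continuous_map_closedin
 proof (intro conjI allI impI)
  show "E \<in> topspace ?Y \<rightarrow> topspace X'" using E by auto
  fix K assume K: "closedin X' K"
  then have "closedin X (D ` K)" using cm unfolding closed_map_def by blast
  moreover have "{x \<in> topspace ?Y. E x \<in> K} = (topspace X - A) \<inter> D ` K"
   using E ED D(2) closedin_subset[OF K] by (auto simp: image_iff) (metis DiffI PiE ED subsetD)+
  ultimately show "closedin ?Y {x \<in> topspace ?Y. E x \<in> K}"
   by (metis closedin_subtopology_Int_closed)
 qed
 define h where "h = (\<lambda>p. if snd p \<in> A then snd p else D (H (fst p, E (snd p))))"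
 have hD: "h (t, D x) = D (H (t, x))" if "x \<in> topspace X'" "t \<in> {0..1}" for t x
 proof (cases "x \<in> A'")
  case True
  then show ?thesis using D(2) H(4)[OF that(2) True] by (auto simp: h_def Pi_iff)
 next
  case False
  then show ?thesis using that disj[of x] ED[of x] by (simp add: h_def)
 qed
 let ?I = "unit_interval"
 have hc: "cmap (prod_topology ?I X) X h"
 proof (rule continuous_map_on_pushout)
  show "compact_space (prod_topology ?I X')"
   by (simp add: compact_space_prod_topology X' compact_space_subtopology)
  show "Hausdorff_space (prod_topology ?I X)"
   by (simp add: Hausdorff_space_prod_topology X Hausdorff_space_subtopology)
  show "cmap (prod_topology ?I X') (prod_topology ?I X) (\<lambda>p. (fst p, D (snd p)))"
   by (intro cm_pair cm_fst cm_compose[OF D(1)] cm_snd)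
  show "closedin (prod_topology ?I X) ({0..1} \<times> A)"
   using A(1) by (simp add: closedin_prod_Times_iff)
  show "topspace (prod_topology ?I X) \<subseteq> {0..1} \<times> A \<union> (\<lambda>p. (fst p, D (snd p))) ` topspace (prod_topology ?I X')"
  proof
   fix p assume "p \<in> topspace (prod_topology ?I X)"
   then obtain t x where p: "p = (t, x)" "t \<in> {0..1}" "x \<in> topspace X" by auto
   from p(3) A(2) show "p \<in> {0..1} \<times> A \<union> (\<lambda>p. (fst p, D (snd p))) ` topspace (prod_topology ?I X')"
   proof (cases "x \<in> A")
    case False
    then obtain y where "y \<in> topspace X'" "x = D y" using A(2) p(3) by auto
    then show ?thesis using p by (intro UnI2 image_eqI[of _ _ "(t, y)"]) auto
   qed (use p in auto)
  qed
  show "cmap (subtopology (prod_topology ?I X) ({0..1} \<times> A)) X h"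
   by (rule continuous_map_eq[OF cm_sub[OF cm_snd]])
     (auto simp: h_def)
  show "cmap (prod_topology ?I X') X (\<lambda>p. h (fst p, D (snd p)))"
   by (rule continuous_map_eq[OF continuous_map_compose[OF H(1) D(1)]]) (auto simp: hD)
 qed
 define R where "R x = h (1, x)" for x
 have Rid: "homotopic_with (\<lambda>h. h \<in> A \<rightarrow> A) X X id R"
 proof (subst homotopic_with)
  show "\<exists>h. cmap (prod_topology ?I X) X h \<and> (\<forall>x \<in> topspace X. h (0, x) = id x) \<and>
    (\<forall>x \<in> topspace X. h (1, x) = R x) \<and> (\<forall>t \<in> {0..1}. (\<lambda>x. h (t, x)) \<in> A \<rightarrow> A)"
   using hc E H(2) by (intro exI[of _ h]) (auto simp: R_def h_def)
 qed (use As in \<open>auto simp: Pi_iff subset_iff\<close>)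
 let ?N = "topspace X - D ` (topspace X' - N')"
 have cN: "closedin X (D ` (topspace X' - N'))"
  using cm N'(1) unfolding closed_map_def by (simp add: closedin_diff)
 have R1: "D (H (1, x)) = R (D x)" if "x \<in> topspace X'" for x
  using hD[OF that, of 1] by (simp add: R_def)
 show ?thesis
 proof (rule relative_homology_onto[OF D _ A(1) _ _ Ec])
  show "D \<in> N' \<rightarrow> ?N"
  proof
   fix x assume x: "x \<in> N'"
   have "D x \<noteq> D y" if "y \<in> topspace X' - N'" for y
   proof (cases "x \<in> A'")
    case True
    then have "D x \<in> A" using D(2) by auto
    moreover have "D y \<notin> A" using that N'(2) by (intro disj) auto
    ultimately show ?thesis by auto
   next
    case False
    then show ?thesis using that x inj N'(2) N's by (auto simp: inj_on_def)
   qed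
   then show "D x \<in> ?N" using DX x N's by auto
  qed
  show "openin X ?N" using cN by blast
  show "A \<subseteq> ?N"
   using As disj N'(2) by blast
  show "E \<in> ?N - A \<rightarrow> N'"
   using E by (auto simp: image_iff) (metis DiffI)
  show "homotopic_with (\<lambda>h. h \<in> A \<rightarrow> A) X X R id"
   by (rule homotopic_with_symD[OF Rid])
  show "R \<in> ?N \<rightarrow> A"
  proof
   fix x assume x: "x \<in> ?N"
   show "R x \<in> A"
   proof (cases "x \<in> A")
    case True
    then show ?thesis by (simp add: R_def h_def)
   next
    case False
    then have e: "E x \<in> ?C" "D (E x) = x" using E x by auto
    then have "E x \<in> N'" using x by (metis DiffD1 DiffD2 DiffI image_eqI)
    then show ?thesis
     using H(3) D(2) R1[of "E x"] e by (auto simp: Pi_iff) (metis)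
   qed
  qed
  show "cmap X' X' (\<lambda>x. H (1, x))"
   by (rule cm_compose[OF H(1)]) (simp add: cm_pair)
 qed (use E R1 H(3) z in auto)
qed

section \<open>Additivity of the Hurewicz map\<close>

text \<open>A map on \<open>[0,1] \<times> Z\<close> that sends \<open>{0,1} \<times> Z \<union> [0,1] \<times> B\<close> to the basepoint acts on the homology of
 this pair. Concatenation in the coordinate \<open>[0,1]\<close> becomes addition.\<close>

definition dIZ :: "'z topology \<Rightarrow> 'z set \<Rightarrow> (real \<times> 'z) set" where
 "dIZ Z B = {0, 1} \<times> topspace Z \<union> {0..1} \<times> (topspace Z \<inter> B)"

definition hur :: "int \<Rightarrow> 'z topology \<Rightarrow> 'z set \<Rightarrow> 'a topology \<Rightarrow> 'a \<Rightarrow> (real \<times> 'z \<Rightarrow> 'a)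
  \<Rightarrow> (real \<times> 'z) chain set \<Rightarrow> 'a chain set" where
 "hur p Z B X x0 f = hom_induced p (IZ Z) (dIZ Z B) X {x0} f"

definition dIZ2 :: "'z topology \<Rightarrow> 'z set \<Rightarrow> (real \<times> 'z) set" where
 "dIZ2 Z B = dIZ Z B \<union> {1/2} \<times> topspace Z"

lemma Pi_pairI: "(\<And>t y. (t, y) \<in> S \<Longrightarrow> f t y \<in> T) \<Longrightarrow> (\<lambda>(t, y). f t y) \<in> S \<rightarrow> T"
 by auto

text \<open>The difference \<open>e\<close> of the two sides vanishes once the lower half is added
  to the subspace, and also once the upper half is. By the latter it comes from the upper half,
  where the retraction \<open>?r2\<close> is homotopic to the identity; but \<open>?r2\<close>
  factors through the pair with the lower half added, so \<open>e\<close> vanishes.\<close>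

lemma IZ_split:
 assumes c: "c \<in> carrier (rel_H p (IZ Z) (dIZ Z B))"
 defines "G \<equiv> rel_H p (IZ Z) (dIZ2 Z B)"
 shows "hom_induced p (IZ Z) (dIZ Z B) (IZ Z) (dIZ2 Z B) id c
  = hom_induced p (IZ Z) (dIZ Z B) (IZ Z) (dIZ2 Z B) (\<lambda>(t, y). (min t (1/2), y)) c
   \<otimes>\<^bsub>G\<^esub> hom_induced p (IZ Z) (dIZ Z B) (IZ Z) (dIZ2 Z B) (\<lambda>(t, y). (max t (1/2), y)) c"
proof -
 let ?Q = "IZ Z" and ?A = "dIZ2 Z B"
 let ?r1 = "\<lambda>(t::real, y). (min t (1/2), y)" and ?r2 = "\<lambda>(t::real, y). (max t (1/2), y)"
 let ?B1 = "?A \<union> {0..1/2} \<times> topspace Z" and ?B2 = "?A \<union> {1/2..1} \<times> topspace Z"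
 interpret G: comm_group G unfolding G_def by simp
 have subs: "dIZ Z B \<subseteq> ?A" "?A \<subseteq> topspace ?Q" "dIZ Z B \<subseteq> topspace ?Q" "?B1 \<subseteq> topspace ?Q" "?B2 \<subseteq> topspace ?Q"
  by (auto simp: dIZ2_def dIZ_def)
 have move: "cmap (IZ ?Q) ?Q (\<lambda>(s, t, y). (t + s * (g t - t), y))"
  if "continuous_on UNIV g" "\<And>t. t \<in> {0..1} \<Longrightarrow> g t \<in> {0..1}" for g :: "real \<Rightarrow> real"
 proof -
  have f: "rcont (IZ ?Q) fst"
   using cm_fst cm_full by blast
  have t: "rcont (IZ ?Q) (\<lambda>p. fst (snd p))"
   using cont_fst_snd(1)[OF cm_snd] cm_full by blast
  have "rcont (IZ ?Q) (\<lambda>p. fst (snd p) + fst p * (g (fst (snd p)) - fst (snd p)))"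
   by (intro cont_arith f t cont_o[OF t that(1)])
  moreover have "t + s * (g t - t) \<in> {0..1}" if "t \<in> {0..1}" "s \<in> {0..1}" for s t
  proof -
   have "t + s * (g t - t) = (1 - s) * t + s * g t" by (simp add: algebra_simps)
   moreover have "(1 - s) * t + s * g t \<le> (1 - s) * 1 + s * 1"
    using that \<open>\<And>t. t \<in> {0..1} \<Longrightarrow> g t \<in> {0..1}\<close>[OF that(1)] by (intro add_mono mult_left_mono) auto
   ultimately show ?thesis
    using that \<open>\<And>t. t \<in> {0..1} \<Longrightarrow> g t \<in> {0..1}\<close>[OF that(1)] by auto
  qed
  ultimately have "cmap (IZ ?Q) unit_interval (\<lambda>p. fst (snd p) + fst p * (g (fst (snd p)) - fst (snd p)))"
   by (intro continuous_map_into_subtopology) auto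
  then show ?thesis
   unfolding case_prod_beta' by (intro cm_pair cont_fst_snd(2)[OF cm_snd])
 qed
 have mn: "continuous_on UNIV (\<lambda>t::real. min t (1/2))" "continuous_on UNIV (\<lambda>t::real. max t (1/2))"
  by (intro continuous_intros)+
 have h1: "homotopic_with P ?Q ?Q id ?r1"
  if "\<And>s. s \<in> {0..1} \<Longrightarrow> P (\<lambda>(t, y). (t + s * (min t (1/2) - t), y))" for P
  unfolding homotopic_with_def
  by (intro exI[of _ "\<lambda>(s, t, y). (t + s * (min t (1/2) - t), y)"] conjI move mn) (use that in auto)
 have h2: "homotopic_with P ?Q ?Q id ?r2"
  if "\<And>s. s \<in> {0..1} \<Longrightarrow> P (\<lambda>(t, y). (t + s * (max t (1/2) - t), y))" for P
  unfolding homotopic_with_def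
  by (intro exI[of _ "\<lambda>(s, t, y). (t + s * (max t (1/2) - t), y)"] conjI move mn) (use that in auto)
 have rc: "cmap ?Q ?Q ?r1" "cmap ?Q ?Q ?r2"
  using homotopic_with_imp_continuous_maps[OF h1[of "\<lambda>_. True"]]
   homotopic_with_imp_continuous_maps[OF h2[of "\<lambda>_. True"]] by auto
 have rA: "?r1 \<in> ?A \<rightarrow> ?A" "?r2 \<in> ?A \<rightarrow> ?A"
  by (auto simp: dIZ2_def dIZ_def min_def max_def split: if_splits)
 have mid1: "t + s * (min t (1/2) - t) \<in> {1/2..1}" if "t \<in> {1/2..1}" "s \<in> {0..1}" for s t :: real
 proof -
  have "t + s * (min t (1/2) - t) = 1/2 + (1 - s) * (t - 1/2)" using that by (simp add: min_absorb2 field_simps)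
  moreover have "(1 - s) * (t - 1/2) \<le> 1 * (1/2)" using that by (intro mult_mono) auto
  ultimately show ?thesis using that by auto
 qed
 have mid2: "t + s * (max t (1/2) - t) \<in> {0..1/2}" if "t \<in> {0..1/2}" "s \<in> {0..1}" for s t :: real
 proof -
  have "t + s * (max t (1/2) - t) = 1/2 - (1 - s) * (1/2 - t)" using that by (simp add: max_absorb2 field_simps)
  moreover have "(1 - s) * (1/2 - t) \<le> 1 * (1/2)" using that by (intro mult_mono) auto
  ultimately show ?thesis using that by auto
 qed
 let ?H = "\<lambda>S. hom_induced p ?Q (dIZ Z B) ?Q S"
 define a b d where "a = ?H ?A id c" and "b = ?H ?A ?r1 c" and "d = ?H ?A ?r2 c"
 have abd: "a \<in> carrier G" "b \<in> carrier G" "d \<in> carrier G"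
  unfolding a_def b_def d_def G_def by (rule hom_induced_carrier)+
 let ?j = "\<lambda>S. hom_induced p ?Q ?A ?Q S id"
 have j: "?j S (?H ?A f c) = ?H S f c" if "?A \<subseteq> S" "cmap ?Q ?Q f" "f \<in> dIZ Z B \<rightarrow> ?A" for S f
 proof -
  have "id \<in> ?A \<rightarrow> S" using that(1) by (auto simp: subset_iff)
  then show ?thesis
   using hom_induced_compose'[OF that(2,3) continuous_map_id, of S p c] by simp
 qed
 have rd: "?r1 \<in> dIZ Z B \<rightarrow> ?A" "?r2 \<in> dIZ Z B \<rightarrow> ?A" "id \<in> dIZ Z B \<rightarrow> ?A"
  by (auto simp: dIZ2_def dIZ_def min_def max_def split: if_splits)
 have "?H ?B2 id = ?H ?B2 ?r1"
 proof (rule homology_homotopy_axiom[OF h1])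
  fix s :: real assume s: "s \<in> {0..1}"
  show "(\<lambda>(t, y). (t + s * (min t (1/2) - t), y)) \<in> dIZ Z B \<rightarrow> ?B2"
  proof (rule Pi_pairI)
   fix t y assume ty: "(t, y) \<in> dIZ Z B"
   then have y: "y \<in> topspace Z" and t: "t \<in> {0..1}" by (auto simp: dIZ_def)
   show "(t + s * (min t (1/2) - t), y) \<in> ?B2"
   proof (cases "t \<ge> 1/2")
    case True
    then show ?thesis using mid1[of t s] s t y by auto
   next
    case False
    then show ?thesis using ty subs(1) by (auto simp: min_def)
   qed
  qed
 qed
 moreover have "?H ?B2 ?r2 c = \<one>\<^bsub>rel_H p ?Q ?B2\<^esub>"
  by (rule hom_induced_into_subset[OF rc(2) subs(3) _ subs(5)]) (auto simp: max_def)
 ultimately have e2: "?j ?B2 a = ?j ?B2 b" "?j ?B2 d = \<one>\<^bsub>rel_H p ?Q ?B2\<^esub>"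
  unfolding a_def b_def d_def by (simp_all add: j rc rd)
 have "?H ?B1 id = ?H ?B1 ?r2"
 proof (rule homology_homotopy_axiom[OF h2])
  fix s :: real assume s: "s \<in> {0..1}"
  show "(\<lambda>(t, y). (t + s * (max t (1/2) - t), y)) \<in> dIZ Z B \<rightarrow> ?B1"
  proof (rule Pi_pairI)
   fix t y assume ty: "(t, y) \<in> dIZ Z B"
   then have y: "y \<in> topspace Z" and t: "t \<in> {0..1}" by (auto simp: dIZ_def)
   show "(t + s * (max t (1/2) - t), y) \<in> ?B1"
   proof (cases "t \<le> 1/2")
    case True
    then show ?thesis using mid2[of t s] s t y by auto
   next
    case False
    then show ?thesis using ty subs(1) by (auto simp: max_def)
   qed
  qed
 qed
 moreover have "?H ?B1 ?r1 c = \<one>\<^bsub>rel_H p ?Q ?B1\<^esub>"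
  by (rule hom_induced_into_subset[OF rc(1) subs(3) _ subs(4)]) (auto simp: min_def)
 ultimately have e1: "?j ?B1 a = ?j ?B1 d" "?j ?B1 b = \<one>\<^bsub>rel_H p ?Q ?B1\<^esub>"
  unfolding a_def b_def d_def by (simp_all add: j rc rd)
 define e where "e = a \<otimes>\<^bsub>G\<^esub> inv\<^bsub>G\<^esub> (b \<otimes>\<^bsub>G\<^esub> d)"
 have eG: "e \<in> carrier G" unfolding e_def using abd by simp
 have jh: "?j S \<in> hom G (rel_H p ?Q S)" for S
  unfolding G_def by (rule hom_induced_hom)
 have je: "?j S e = \<one>\<^bsub>rel_H p ?Q S\<^esub>" if "?j S a = ?j S b \<otimes>\<^bsub>rel_H p ?Q S\<^esub> ?j S d" for S
 proof -
  interpret h: group_hom G "rel_H p ?Q S" "?j S"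
   by (simp add: group_hom_def group_hom_axioms_def jh)
  show ?thesis unfolding e_def using abd that by simp
 qed
 have jc: "?j S x \<in> carrier (rel_H p ?Q S)" for S x by (rule hom_induced_carrier)
 have je1: "?j ?B1 e = \<one>\<^bsub>rel_H p ?Q ?B1\<^esub>"
  by (rule je) (simp add: e1(2), simp add: e1 jc group.is_monoid monoid.l_one)
 have je2: "?j ?B2 e = \<one>\<^bsub>rel_H p ?Q ?B2\<^esub>"
  by (rule je) (simp add: e2(2), simp add: e2 jc group.is_monoid monoid.r_one)
 let ?S = "subtopology ?Q ?B2"
 have tS: "topspace ?S = ?B2" using subs(5) by auto
 have "e \<in> kernel G (rel_H p ?Q ?B2) (?j ?B2)"
  using eG je2 by (simp add: kernel_def)
 also have "\<dots> = hom_induced p ?S ?A ?Q ?A id ` carrier (rel_H p ?S ?A)"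
  using homology_exactness_triple_3[of ?A ?B2 p ?Q] by (simp add: G_def)
 finally obtain e' where e': "e' \<in> carrier (rel_H p ?S ?A)" "e = hom_induced p ?S ?A ?Q ?A id e'"
  by blast
 \<comment> \<open>The slice at 0 belongs to \<open>?B2\<close> and would be dragged across the
   lower half by the homotopy to \<open>?r2\<close>; excision removes it first.\<close>
 let ?U = "{q \<in> ?B2. fst q < 1/4}"
 let ?W = "subtopology ?S (?B2 - ?U)"
 have fS: "rcont ?S fst"
  using cm_sub[OF cm_fst, of "unit_interval"] cm_full by blast
 have "?S closure_of ?U \<subseteq> {q \<in> topspace ?S. fst q \<in> {..1/4}}"
 proof (rule closure_of_minimal)
  show "closedin ?S {q \<in> topspace ?S. fst q \<in> {..1/4}}"
   by (rule closedin_pre[OF fS]) simp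
 qed (unfold tS, auto)
 also have "\<dots> \<subseteq> {q \<in> topspace ?S. fst q \<in> {..<1/2}}" by auto
 also have "\<dots> \<subseteq> ?S interior_of ?A"
 proof (rule interior_of_maximal)
  show "openin ?S {q \<in> topspace ?S. fst q \<in> {..<1/2}}"
   by (rule openin_pre[OF fS]) simp
 qed (unfold tS, auto)
 finally have cl: "?S closure_of ?U \<subseteq> ?S interior_of ?A" .
 have iso: "hom_induced p ?W (?A - ?U) (subtopology ?S ?B2) ?A id
   \<in> iso (rel_H p ?W (?A - ?U)) (rel_H p (subtopology ?S ?B2) ?A)"
  by (rule homology_excision_axiom[OF cl]) auto
 have SS: "subtopology ?S ?B2 = ?S" by (simp add: subtopology_subtopology)
 obtain f where f: "f \<in> carrier (rel_H p ?W (?A - ?U))"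
  "hom_induced p ?W (?A - ?U) ?S ?A id f = e'"
  using iso_surj[OF iso[unfolded SS] e'(1)] by blast
 have Wc: "cmap ?W ?S id" "cmap ?W ?Q id" "cmap ?S ?Q id"
  by (auto simp: cm_sub)
 have ef: "e = hom_induced p ?W (?A - ?U) ?Q ?A id f"
  unfolding e'(2) f(2)[symmetric]
  using hom_induced_compose'[OF Wc(1) _ Wc(3), of "?A - ?U" ?A ?A p f] by auto
 have W: "?W = subtopology ?Q (?B2 - ?U)"
  by (simp add: subtopology_subtopology Int_absorb1)
 have "homotopic_with (\<lambda>h. h \<in> (?A - ?U) \<rightarrow> ?A) ?W ?Q id ?r2"
  unfolding W
 proof (rule homotopic_from_subtopology, rule h2)
  fix s :: real assume s: "s \<in> {0..1}"
  show "(\<lambda>(t, y). (t + s * (max t (1/2) - t), y)) \<in> ?A - ?U \<rightarrow> ?A"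
  proof (rule Pi_pairI)
   fix t y assume "(t, y) \<in> ?A - ?U"
   then have ty: "(t, y) \<in> ?A" and U: "(t, y) \<notin> ?U" by auto
   then have y: "y \<in> topspace Z" and t: "t \<in> {0..1}" by (auto simp: dIZ2_def dIZ_def)
   show "(t + s * (max t (1/2) - t), y) \<in> ?A"
   proof (cases "t < 1/2")
    case True
    have "t \<noteq> 0" using U ty by auto
    then have "y \<in> B" using ty True t by (auto simp: dIZ2_def dIZ_def)
    then show ?thesis using mid2[of t s] s t y True by (auto simp: dIZ2_def dIZ_def)
   next
    case False
    then have "max t (1/2) = t" by simp
    then show ?thesis using ty by simp
   qed
  qed
 qed
 then have "hom_induced p ?W (?A - ?U) ?Q ?A id = hom_induced p ?W (?A - ?U) ?Q ?A ?r2"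
  by (rule homology_homotopy_axiom)
 then have "e = hom_induced p ?W (?A - ?U) ?Q ?A (?r2 \<circ> id) f"
  using ef by simp
 also have "\<dots> = hom_induced p ?Q ?A ?Q ?A ?r2 e"
  unfolding ef by (rule hom_induced_compose'[symmetric]) (use Wc rc rA in auto)
 also have "\<dots> = hom_induced p ?Q ?A ?Q ?A (?r2 \<circ> id) e" by simp
 also have "\<dots> = hom_induced p ?Q ?B1 ?Q ?A ?r2 (?j ?B1 e)"
  by (rule hom_induced_compose'[symmetric])
    (use rc in \<open>auto simp: dIZ2_def dIZ_def min_def max_def split: if_splits\<close>)
 finally have "e = \<one>\<^bsub>G\<^esub>"
  unfolding je1 by (simp add: hom_induced_one G_def)
 then have "a = b \<otimes>\<^bsub>G\<^esub> d"
  unfolding e_def using abd by (simp add: G.inv_solve_right')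
 then show ?thesis unfolding a_def b_def d_def .
qed

lemma hur_homotopy:
 assumes "hmt (RD Z) (LB B) (LE {}) X x0 f g"
 shows "hur p Z B X x0 f = hur p Z B X x0 g"
 unfolding hur_def
proof (rule homology_homotopy_axiom, unfold prod_topology_subtopology(1),
  rule homotopic_from_subtopology, rule homotopic_with_mono[OF assms])
 fix h assume h: "adm (LB B) (LE {}) x0 h"
 have "dIZ Z B \<subseteq> LB B" by (auto simp: dIZ_def LB_def)
 then show "h \<in> dIZ Z B \<rightarrow> {x0}"
  using admD[OF h] by auto
qed

lemma hur_cong:
 assumes "\<And>t y. t \<in> {0..1} \<Longrightarrow> y \<in> topspace Z \<Longrightarrow> f (t, y) = g (t, y)"
 shows "hur p Z B X x0 f = hur p Z B X x0 g"
 unfolding hur_def by (rule hom_induced_eq) (use assms in auto)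

lemma hur_split:
 assumes f: "cmap (IZ Z) X f" "f \<in> dIZ2 Z B \<rightarrow> {x0}"
  and c: "c \<in> carrier (rel_H p (IZ Z) (dIZ Z B))"
 shows "hur p Z B X x0 f c = hur p Z B X x0 (\<lambda>(t, y). f (min t (1/2), y)) c
   \<otimes>\<^bsub>rel_H p X {x0}\<^esub> hur p Z B X x0 (\<lambda>(t, y). f (max t (1/2), y)) c"
proof -
 let ?h = "hom_induced p (IZ Z) (dIZ2 Z B) X {x0} f"
 have r: "cmap (IZ Z) (IZ Z) (\<lambda>(t, y). (m t (1/2), y))" if "m = min \<or> m = max" for m :: "real \<Rightarrow> real \<Rightarrow> real"
 proof -
  have "rcont (IZ Z) (\<lambda>q. m (fst q) (1/2))"
   using that cm_full[OF cm_fst]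
   by (auto intro!: cont_arith)
  then have "cmap (IZ Z) unit_interval (\<lambda>q. m (fst q) (1/2))"
   using that by (intro continuous_map_into_subtopology) (auto simp: min_def max_def)
  then show ?thesis unfolding case_prod_beta' by (intro cm_pair cm_snd)
 qed
 have d: "(\<lambda>(t, y). (min t (1/2), y)) \<in> dIZ Z B \<rightarrow> dIZ2 Z B" "(\<lambda>(t, y). (max t (1/2), y)) \<in> dIZ Z B \<rightarrow> dIZ2 Z B"
  "id \<in> dIZ Z B \<rightarrow> dIZ2 Z B"
  by (auto simp: dIZ2_def dIZ_def min_def max_def split: if_splits)
 have "?h (hom_induced p (IZ Z) (dIZ Z B) (IZ Z) (dIZ2 Z B) g c) = hur p Z B X x0 (f \<circ> g) c"
  if "cmap (IZ Z) (IZ Z) g" "g \<in> dIZ Z B \<rightarrow> dIZ2 Z B" for g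
  unfolding hur_def by (rule hom_induced_compose'[OF that f])
 note this[OF r[of min] d(1)] this[OF r[of max] d(2)] this[OF continuous_map_id d(3)]
 then show ?thesis
  using arg_cong[OF IZ_split[OF c], of ?h]
  by (simp add: hom_induced_mult hom_induced_carrier o_def case_prod_beta')
qed

text \<open>The counterpart of \<open>triangle\<close> with addition in homology instead of a
  product in \<open>X\<close>: after the shear the diagonal loop is at the basepoint at time
  \<open>1/2\<close>, and its halves are the two sheared axes.\<close>

lemma hur_triangle:
 assumes V: "V \<in> cmaps (RD (RD Z)) (TB B) (TE {}) X x0"
  and c: "c \<in> carrier (rel_H p (IZ Z) (dIZ Z B))"
 shows "hur p Z B X x0 (\<lambda>(x, d). V (x, x, d)) c = hur p Z B X x0 (\<lambda>(x, d). V (x, 0, d)) c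
   \<otimes>\<^bsub>rel_H p X {x0}\<^esub> hur p Z B X x0 (\<lambda>(x, d). V (0, x, d)) c"
proof -
 let ?f = "\<lambda>(x, d). V (x + zeta x, x - zeta x, d)"
 have VB: "V (x, y, d) = x0" if "x \<in> \<int> \<and> y \<in> \<int> \<or> d \<in> B" for x y d
  using admD[OF cmapsD(2)[OF V], of "(x, y, d)"] that by (simp add: TB_def)
 have Vs: "V (x, y, d) = V (x', y, d)" "V (y, x, d) = V (y, x', d)" if "x' - x \<in> \<int>" for x y d x'
  using admD2[OF cmapsD(2)[OF V], of "(x, y, d)" "(x', y, d)"]
   admD2[OF cmapsD(2)[OF V], of "(y, x, d)" "(y, x', d)"] that by (auto simp: TE_def LE_def)
 have z: "zeta t = t" if "0 \<le> t" "t \<le> 1/2" for t using zeta_eq[of t 0] that by simp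
 have zh: "zeta (1/2) = 1/2" by (rule z) auto
 have z': "zeta t = 1 - t" if "1/2 \<le> t" "t \<le> 1" for t using zeta_eq[of t 1] that by simp
 have h: "hmt (RD Z) (LB B) (LE {}) X x0 (\<lambda>(x, d). V (x, x, d)) ?f"
  using hmt_shear[OF V, of 1 1 1 "-1"] by simp
 have fc: "cmap (IZ Z) X ?f"
  unfolding prod_topology_subtopology(1)
  by (rule cm_sub[OF cmapsD(1)[OF hmt_cmaps(2)[OF h]]])
 have fB: "?f \<in> dIZ2 Z B \<rightarrow> {x0}"
  by (auto simp: dIZ2_def dIZ_def zeta_Ints z intro!: VB)
 have "hur p Z B X x0 (\<lambda>(x, d). V (x, x, d)) c = hur p Z B X x0 ?f c"
  using hur_homotopy[OF h] by simp
 also note hur_split[OF fc fB c]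
 also have "hur p Z B X x0 (\<lambda>(t, y). ?f (min t (1/2), y)) = hur p Z B X x0 (\<lambda>(x, d). V (x + zeta x, 0, d))"
 proof (rule hur_cong)
  fix t y assume t: "t \<in> {0..1::real}"
  show "(\<lambda>(t, y). ?f (min t (1/2), y)) (t, y) = (\<lambda>(x, d). V (x + zeta x, 0, d)) (t, y)"
  proof (cases "t \<le> 1/2")
   case False
   have "V (1, 0, y) = V (t + zeta t, 0, y)" using z'[of t] t False by simp
   then show ?thesis using False by (simp add: zh)
  qed (use z t in \<open>simp add: min_absorb1\<close>)
 qed
 also have "\<dots> = hur p Z B X x0 (\<lambda>(x, d). V (x, 0, d))"
  using hur_homotopy[OF hmt_shear[OF V, of 1 0 1 0], of p] by simp
 also have "hur p Z B X x0 (\<lambda>(t, y). ?f (max t (1/2), y)) = hur p Z B X x0 (\<lambda>(x, d). V (0, x - zeta x, d))"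
 proof (rule hur_cong)
  fix t y assume t: "t \<in> {0..1::real}"
  show "(\<lambda>(t, y). ?f (max t (1/2), y)) (t, y) = (\<lambda>(x, d). V (0, x - zeta x, d)) (t, y)"
  proof (cases "t \<le> 1/2")
   case True
   have "V (1, 0, y) = V (0, 0, y)" by (rule Vs) simp
   then show ?thesis using True z[of t] t by (simp add: max_absorb2 zh)
  next
   case False
   have "V (1, 2 * t - 1, y) = V (0, 2 * t - 1, y)" by (rule Vs) simp
   then show ?thesis using False z'[of t] t by (simp add: max_absorb1)
  qed
 qed
 also have "\<dots> = hur p Z B X x0 (\<lambda>(x, d). V (0, x, d))"
  using hur_homotopy[OF hmt_shear[OF V, of 0 1 0 "-1"], of p] by simp
 finally show ?thesis .
qed

lemma hur_const:
 assumes "x0 \<in> topspace X" "c \<in> carrier (rel_H p (IZ Z) (dIZ Z B))"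
 shows "hur p Z B X x0 (\<lambda>_. x0) c = \<one>\<^bsub>rel_H p X {x0}\<^esub>"
 unfolding hur_def by (rule hom_induced_into_subset) (use assms in \<open>auto simp: dIZ_def\<close>)

text \<open>The triangle for \<open>V(a, b) = f(k a + b)\<close> gives additivity in
  \<open>k\<close>; induction in both directions covers negative \<open>k\<close>.\<close>

lemma hur_multiple:
 assumes f: "f \<in> cmaps (RD Z) (LB B) (LE {}) X x0" and x0: "x0 \<in> topspace X"
  and c: "c \<in> carrier (rel_H p (IZ Z) (dIZ Z B))"
 shows "hur p Z B X x0 (\<lambda>(x, d). f (of_int k * x, d)) c
  = hur p Z B X x0 f c [^]\<^bsub>rel_H p X {x0}\<^esub> (k::int)"
proof -
 let ?G = "rel_H p X {x0}"
 interpret G: comm_group ?G by simp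
 let ?h = "\<lambda>k::int. hur p Z B X x0 (\<lambda>(x, d). f (of_int k * x, d)) c"
 have hG: "?h k \<in> carrier ?G" for k unfolding hur_def by (rule hom_induced_carrier)
 have fB: "f (x, d) = x0" if "x \<in> \<int> \<or> d \<in> B" for x d
  using admD[OF cmapsD(2)[OF f], of "(x, d)"] that by (simp add: LB_def)
 have fE: "f (x, d) = f (x', d)" if "x' - x \<in> \<int>" for x x' d
  using admD2[OF cmapsD(2)[OF f], of "(x, d)" "(x', d)"] that by (auto simp: LE_def)
 have f1: "(\<lambda>(x, d). f (of_int 1 * x, d)) = f" by auto
 have add: "?h (k + 1) = ?h k \<otimes>\<^bsub>?G\<^esub> ?h 1" for k
 proof -
  have "(\<lambda>(a, b, d). f (of_int k * a + b, d)) \<in> cmaps (RD (RD Z)) (TB B) (TE {}) X x0"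
   unfolding case_prod_beta'
   by (rule cmaps_preI[OF f], (intro cont_intros; rule cont_id)[1])
     (auto simp: cs_defs intro!: fB fE Ints_mult_diff)
  from hur_triangle[OF this c] show ?thesis by (simp add: distrib_right)
 qed
 have h0: "?h 0 = \<one>\<^bsub>?G\<^esub>"
 proof -
  have "(\<lambda>(x, d). f (of_int 0 * x, d)) = (\<lambda>_. x0)" by (auto simp: fB)
  then show ?thesis using hur_const[OF x0 c] by simp
 qed
 have "?h k = ?h 1 [^]\<^bsub>?G\<^esub> k"
 proof (induction k rule: int_induct[of _ 0])
  case base
  then show ?case using h0 by simp
 next
  case (step1 i)
  then show ?case by (simp only: add G.int_pow_mult[OF hG] G.int_pow_1[OF hG])
 next
  case (step2 i)
  have "?h (i - 1) \<otimes>\<^bsub>?G\<^esub> ?h 1 = ?h 1 [^]\<^bsub>?G\<^esub> (i - 1) \<otimes>\<^bsub>?G\<^esub> ?h 1"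
   using add[of "i - 1"] step2 G.int_pow_mult[OF hG[of 1], of "i - 1" 1] G.int_pow_1[OF hG[of 1]] by simp
  then show ?case using hG by (simp only: G.right_cancel G.int_pow_closed)
 qed
 then show ?thesis unfolding f1 .
qed

section \<open>Spheres as iterated reduced suspensions\<close>

abbreviation e1 :: "nat \<Rightarrow> real" where
 "e1 \<equiv> \<lambda>i. if i = 0 then 1 else 0"

lemma topspace_nsphere: "x \<in> sph n \<longleftrightarrow> (\<Sum>i\<le>n. (x i)\<^sup>2) = 1 \<and> (\<forall>i>n. x i = 0)"
 by (auto simp: nsphere)

lemma continuous_map_nsphere:
 "cmap X (nsphere n) f \<longleftrightarrow>
   (\<forall>i. rcont X (\<lambda>x. f x i)) \<and> f \<in> topspace X \<rightarrow> sph n"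
 by (auto simp: nsphere cm_in_sub continuous_map_componentwise_UNIV Pi_iff)

lemma continuous_map_nsphere_coord:
 "cmap X (nsphere n) f \<Longrightarrow> rcont X (\<lambda>x. f x i)"
 by (simp add: continuous_map_nsphere)

lemma compact_space_cube_closed:
 assumes "closed S" "\<And>x i. x \<in> S \<Longrightarrow> \<bar>x i\<bar> \<le> (1::real)"
 shows "compact_space (subtopology (powertop_real UNIV) (S :: (nat \<Rightarrow> real) set))"
proof -
 have "compactin (powertop_real UNIV) (\<Pi>\<^sub>E i\<in>(UNIV::nat set). {-1..1})"
  by (simp add: compactin_PiE)
 moreover have "closedin (powertop_real UNIV) S"
  using assms(1) by (simp add: euclidean_product_topology)
 moreover have "S \<subseteq> (\<Pi>\<^sub>E i\<in>UNIV. {-1..1})"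
  using assms(2) by (auto simp: PiE_UNIV_domain abs_le_iff)
 ultimately have "compactin (powertop_real UNIV) S"
  using closed_compactin by blast
 then show ?thesis by (simp add: compact_space_subtopology)
qed

lemma sum_squares_coord_le: "i \<in> A \<Longrightarrow> finite A \<Longrightarrow> (x i)\<^sup>2 \<le> (\<Sum>i\<in>A. (x i)\<^sup>2 :: real)"
 by (rule member_le_sum) auto

lemma compact_space_nsphere: "compact_space (nsphere n)"
 unfolding nsphere
proof (rule compact_space_cube_closed)
 show "closed {x::nat \<Rightarrow> real. (\<Sum>i\<le>n. (x i)\<^sup>2) = 1 \<and> (\<forall>i>n. x i = 0)}"
  by (intro closed_Collect_conj closed_Collect_all closed_Collect_imp closed_Collect_eq
    continuous_intros open_Collect_const) auto
 fix x :: "nat \<Rightarrow> real" and i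
 assume x: "x \<in> {x. (\<Sum>i\<le>n. (x i)\<^sup>2) = 1 \<and> (\<forall>i>n. x i = 0)}"
 show "\<bar>x i\<bar> \<le> 1"
 proof (cases "i \<le> n")
  case True
  then have "(x i)\<^sup>2 \<le> 1" using sum_squares_coord_le[of i "{..n}" x] x by auto
  then show ?thesis by (simp add: abs_square_le_1)
 qed (use x in auto)
qed

lemma Hausdorff_space_nsphere: "Hausdorff_space (nsphere n)"
 unfolding nsphere_def by (rule Hausdorff_space_subtopology[OF Hausdorff_Euclidean_space])

text \<open>For \<open>z\<close> on the unit sphere of \<open>\<real>\<^sup>n\<^sup>+\<^sup>1\<close>, the loop \<open>Sig n z\<close> runs through the circle on the unit sphere
 of \<open>\<real>\<^sup>n\<^sup>+\<^sup>2\<close> that has the segment from the basepoint to \<open>z\<close> as a diameter and is orthogonal to \<open>\<real>\<^sup>n\<^sup>+\<^sup>1\<close>.\<close>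

definition Sig :: "nat \<Rightarrow> (nat \<Rightarrow> real) \<Rightarrow> real \<Rightarrow> nat \<Rightarrow> real" where
 "Sig n z u = (\<lambda>i. if i \<le> n then (e1 i + z i) / 2 + cos (2 * pi * u) * ((e1 i - z i) / 2)
   else if i = Suc n then sin (2 * pi * u) * sqrt ((1 - z 0) / 2) else 0)"

lemma sum_e1: "(\<Sum>i\<le>n. e1 i * z i) = z 0" "(\<Sum>i\<le>n. z i * e1 i) = z 0" "(\<Sum>i\<le>n. (e1 i)\<^sup>2) = 1"
 by (induction n) (auto simp: if_distrib)

lemma sum_square_e1_diff:
 assumes "(\<Sum>i\<le>n. (z i)\<^sup>2) = 1"
 shows "(\<Sum>i\<le>n. (z i - e1 i)\<^sup>2) = 2 * (1 - z 0)"
proof -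
 have "(\<Sum>i\<le>n. (z i - e1 i)\<^sup>2) = (\<Sum>i\<le>n. (z i)\<^sup>2) + (\<Sum>i\<le>n. (e1 i)\<^sup>2) - 2 * (\<Sum>i\<le>n. z i * e1 i)"
  by (simp add: power2_diff sum.distrib sum_subtractf sum_distrib_left mult.assoc)
 then show ?thesis unfolding assms sum_e1 by simp
qed

lemma nsphere_0_le: assumes "z \<in> sph n" shows "z 0 \<le> 1" "z 0 \<ge> -1"
proof -
 have "(z 0)\<^sup>2 \<le> 1" using sum_squares_coord_le[of 0 "{..n}" z] assms by (auto simp: topspace_nsphere)
 then have "\<bar>z 0\<bar> \<le> 1" by (simp add: abs_square_le_1)
 then show "z 0 \<le> 1" "z 0 \<ge> -1" by auto
qed

lemma nsphere_eq_e1: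
 assumes "z \<in> sph n" "z 0 = 1"
 shows "z = e1"
proof
 fix i
 have "(\<Sum>i\<le>n. (z i - e1 i)\<^sup>2) = 0"
  using sum_square_e1_diff[where n=n and z=z] assms by (simp add: topspace_nsphere)
 then have *: "\<forall>i\<le>n. z i - e1 i = 0"
  by (simp add: sum_nonneg_eq_0_iff)
 show "z i = e1 i"
 proof (cases "i \<le> n")
  case True
  then show ?thesis using * by (metis eq_iff_diff_eq_0)
 next
  case False
  then show ?thesis using assms(1) by (simp add: topspace_nsphere)
 qed
qed

lemma Sig_nsphere:
 assumes z: "z \<in> sph n"
 shows "Sig n z u \<in> sph (Suc n)"
proof -
 let ?c = "cos (2 * pi * u)" and ?s = "sin (2 * pi * u)"
 have z1: "(\<Sum>i\<le>n. (z i)\<^sup>2) = 1" using z by (simp add: topspace_nsphere)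
 have "(\<Sum>i\<le>n. (Sig n z u i)\<^sup>2) = (\<Sum>i\<le>n. (e1 i * ((1 + ?c) / 2) + z i * ((1 - ?c) / 2))\<^sup>2)"
  by (rule sum.cong) (auto simp: Sig_def field_simps)
 also have "\<dots> = ((1 + ?c) / 2)\<^sup>2 * (\<Sum>i\<le>n. (e1 i)\<^sup>2) + ((1 - ?c) / 2)\<^sup>2 * (\<Sum>i\<le>n. (z i)\<^sup>2)
   + 2 * ((1 + ?c) / 2) * ((1 - ?c) / 2) * (\<Sum>i\<le>n. e1 i * z i)"
  unfolding power2_sum power_mult_distrib sum.distrib sum_distrib_left
  by (intro arg_cong2[of _ _ _ _ "(+)"] sum.cong) (auto simp: algebra_simps)
 also have "\<dots> = (1 + ?c\<^sup>2) / 2 + (1 - ?c\<^sup>2) / 2 * z 0"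
  unfolding z1 sum_e1 by (simp add: power2_eq_square field_simps)
 finally have 1: "(\<Sum>i\<le>n. (Sig n z u i)\<^sup>2) = (1 + ?c\<^sup>2) / 2 + (1 - ?c\<^sup>2) / 2 * z 0" .
 have "(sqrt ((1 - z 0) / 2))\<^sup>2 = (1 - z 0) / 2"
  using nsphere_0_le[OF z] by simp
 then have 2: "(Sig n z u (Suc n))\<^sup>2 = (1 - ?c\<^sup>2) * ((1 - z 0) / 2)"
  by (simp add: Sig_def power_mult_distrib sin_squared_eq)
 have "(\<Sum>i\<le>Suc n. (Sig n z u i)\<^sup>2) = 1"
  unfolding sum.atMost_Suc 1 2 by (simp add: field_simps)
 then show ?thesis by (simp add: topspace_nsphere Sig_def)
qed

lemma continuous_map_Sig:
 assumes z: "cmap X (nsphere n) z" and u: "rcont X u"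
 shows "cmap X (nsphere (Suc n)) (\<lambda>x. Sig n (z x) (u x))"
proof -
 have zi: "rcont X (\<lambda>x. z x i)" for i
  by (rule continuous_map_nsphere_coord[OF z])
 have "rcont X (\<lambda>x. Sig n (z x) (u x) i)" for i
 proof -
  have c: "rcont X (\<lambda>x. cos (2 * pi * u x))" "rcont X (\<lambda>x. sin (2 * pi * u x))"
   by (rule cont_o[OF u], intro continuous_intros)+
  show ?thesis
   unfolding Sig_def
   by (cases "i \<le> n"; cases "i = Suc n")
     (auto intro!: cont_arith cont_unary(2) continuous_map_sqrt c zi)
 qed
 moreover have "(\<lambda>x. Sig n (z x) (u x)) \<in> topspace X \<rightarrow> sph (Suc n)"
  using z Sig_nsphere by (auto simp: continuous_map_def)
 ultimately show ?thesis by (simp add: continuous_map_nsphere)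
qed

lemma Sig_e1: "Sig n e1 u = e1"
 by (auto simp: Sig_def)

lemma Sig_Ints:
 assumes "u \<in> \<int>" shows "Sig n z u = e1"
proof -
 obtain k where "u = of_int k" using assms by (rule Ints_cases)
 then have "cos (2 * pi * u) = 1" "sin (2 * pi * u) = 0"
  using cos_int_2pin[of k] sin_int_2pin[of k] by (simp_all add: mult.assoc)
 then show ?thesis by (auto simp: Sig_def fun_eq_iff add_divide_distrib diff_divide_distrib)
qed

lemma Sig_shift: "v - u \<in> \<int> \<Longrightarrow> Sig n z v = Sig n z u"
proof -
 assume "v - u \<in> \<int>"
 then obtain k where "v - u = of_int k" by (rule Ints_cases)
 then have v: "2 * pi * v = 2 * pi * u + 2 * pi * of_int k" by (simp add: algebra_simps)
 have "cos (2 * pi * v) = cos (2 * pi * u)" "sin (2 * pi * v) = sin (2 * pi * u)"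
  unfolding v cos_add sin_add using cos_int_2pin[of k] sin_int_2pin[of k] by simp_all
 then show ?thesis by (simp add: Sig_def cong: if_cong)
qed

lemma cos_less_1: assumes "0 < u" "u < 1" shows "cos (2 * pi * u) < 1"
proof -
 have "cos (2 * pi * u) \<noteq> 1"
 proof
  assume "cos (2 * pi * u) = 1"
  then obtain k :: int where "2 * pi * u = of_int k * 2 * pi" by (auto simp: cos_one_2pi_int)
  then have "u = of_int k" by simp
  then show False using assms by simp
 qed
 then show ?thesis using cos_le_one[of "2 * pi * u"] by linarith
qed

lemma Sig_ne_e1:
 assumes "z \<in> sph n" "z \<noteq> e1" "0 < u" "u < 1"
 shows "Sig n z u \<noteq> e1"
proof
 assume a: "Sig n z u = e1"
 have "z 0 < 1" using nsphere_0_le[OF assms(1)] nsphere_eq_e1[OF assms(1)] assms(2) by fastforce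
 then have "(1 - z 0) * (1 - cos (2 * pi * u)) > 0" using cos_less_1[OF assms(3,4)] by simp
 moreover have "Sig n z u 0 = 1" by (simp add: a)
 ultimately show False by (simp add: Sig_def field_simps)
qed

text \<open>Put \<open>a = (1 - cos (2 pi u)) / 2\<close>. In the first coordinates the point minus
  \<open>e1\<close> is \<open>a\<close> times \<open>z - e1\<close>. Coordinate 0 yields
  \<open>a * (1 - z 0)\<close> and the squared length yields \<open>a * a * (1 - z 0)\<close>, hence
  \<open>a\<close> and then \<open>z\<close>; together with the last coordinate this fixes
  \<open>u\<close>.\<close>

lemma Sig_inj:
 assumes z: "z \<in> sph n" "z \<noteq> e1" and u: "0 < u" "u < 1"
  and z': "z' \<in> sph n" "z' \<noteq> e1" and u': "0 < u'" "u' < 1"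
  and eq: "Sig n z u = Sig n z' u'"
 shows "z = z' \<and> u = u'"
proof -
 define a where "a = (1 - cos (2 * pi * u)) / 2"
 define b where "b = (1 - cos (2 * pi * u')) / 2"
 have ab: "a > 0" "b > 0" using cos_less_1 u u' by (auto simp: a_def b_def)
 have zl: "z 0 < 1" "z' 0 < 1"
  using nsphere_0_le[OF z(1)] nsphere_eq_e1[OF z(1)] z(2) nsphere_0_le[OF z'(1)] nsphere_eq_e1[OF z'(1)] z'(2) by fastforce+
 have c: "a * (z i - e1 i) = b * (z' i - e1 i)" if "i \<le> n" for i
 proof -
  have "Sig n z u i = Sig n z' u' i" by (simp add: eq)
  moreover have "Sig n z u i - e1 i = a * (z i - e1 i)" "Sig n z' u' i - e1 i = b * (z' i - e1 i)"
   using that by (simp_all add: Sig_def a_def b_def field_simps)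
  ultimately show ?thesis by simp
 qed
 have 0: "a * (1 - z 0) = b * (1 - z' 0)" using c[of 0] by (simp add: algebra_simps)
 have "(\<Sum>i\<le>n. (a * (z i - e1 i))\<^sup>2) = (\<Sum>i\<le>n. (b * (z' i - e1 i))\<^sup>2)"
  by (rule sum.cong) (use c in auto)
 then have "a\<^sup>2 * (2 * (1 - z 0)) = b\<^sup>2 * (2 * (1 - z' 0))"
  using sum_square_e1_diff[where n=n and z=z] sum_square_e1_diff[where n=n and z=z'] z(1) z'(1)
  by (simp add: topspace_nsphere power_mult_distrib flip: sum_distrib_left)
 then have "2 * (a * (a * (1 - z 0))) = 2 * (b * (b * (1 - z' 0)))"
  by (simp only: power2_eq_square mult_ac)
 then have "a * (a * (1 - z 0)) = b * (a * (1 - z 0))"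
  using 0 by simp
 then have "a = b" using ab zl by simp
 then have zz: "z i = z' i" if "i \<le> n" for i using c[OF that] ab by simp
 have "z = z'"
 proof
  fix i show "z i = z' i"
   using zz[of i] z(1) z'(1) by (cases "i \<le> n") (auto simp: topspace_nsphere)
 qed
 moreover have "u = u'"
 proof -
  have cc: "cos (2 * pi * u) = cos (2 * pi * u')" using \<open>a = b\<close> by (simp add: a_def b_def)
  have "Sig n z u (Suc n) = Sig n z' u' (Suc n)" by (simp add: eq)
  then have "sin (2 * pi * u) = sin (2 * pi * u')"
   using zl \<open>z = z'\<close> by (simp add: Sig_def)
  with cc obtain k :: int where "2 * pi * u = 2 * pi * u' + 2 * pi * of_int k"
   using sin_cos_eq_iff[of "2 * pi * u" "2 * pi * u'"] by (auto simp: mult_ac)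
  then have "2 * pi * u = 2 * pi * (u' + of_int k)" by (simp add: algebra_simps)
  then have "u = u' + of_int k" by simp
  then have "k = 0" using u u' by linarith
  then show ?thesis using \<open>u = u' + of_int k\<close> by simp
 qed
 ultimately show ?thesis by simp
qed

lemma Sig_surj:
 assumes p: "p \<in> sph (Suc n)"
 obtains z u where "z \<in> sph n" "0 \<le> u" "u \<le> 1" "Sig n z u = p"
proof (cases "p 0 = 1")
 case True
 then have "p = e1" by (rule nsphere_eq_e1[OF p])
 then show ?thesis using that[of e1 0] in_topspace_nsphere[of n] by (simp add: Sig_e1)
next
 case False
 then have p0: "p 0 < 1" using nsphere_0_le[OF p] by simp
 define h where "h = p (Suc n)"
 \<comment> \<open>This is \<open>(1 - cos (2 pi u)) / 2\<close> for the solution: then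
   \<open>p i - e1 i = a (z i - e1 i)\<close> for \<open>i \<le> n\<close>, and comparing squared
   lengths gives the value.\<close>
 define a where "a = 1 - h\<^sup>2 / (2 * (1 - p 0))"
 have ps: "(\<Sum>i\<le>n. (p i)\<^sup>2) = 1 - h\<^sup>2" using p by (simp add: topspace_nsphere h_def)
 have "(\<Sum>i\<le>n. (p i - e1 i)\<^sup>2) = (\<Sum>i\<le>n. (p i)\<^sup>2) + (\<Sum>i\<le>n. (e1 i)\<^sup>2) - 2 * (\<Sum>i\<le>n. p i * e1 i)"
  by (simp add: power2_diff sum.distrib sum_subtractf sum_distrib_left mult.assoc)
 moreover have "2 * (1 - p 0) * a = 2 * (1 - p 0) - h\<^sup>2"
  using p0 by (simp add: a_def right_diff_distrib)
 ultimately have pe: "(\<Sum>i\<le>n. (p i - e1 i)\<^sup>2) = 2 * (1 - p 0) * a"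
  unfolding ps sum_e1 by simp
 have "(p 0 - e1 0)\<^sup>2 \<le> (\<Sum>i\<le>n. (p i - e1 i)\<^sup>2)"
  by (rule member_le_sum) auto
 then have "0 < 2 * (1 - p 0) * a"
  using p0 unfolding pe by (smt (verit) zero_less_power2 if_True)
 then have a: "a > 0" using p0 by (simp add: zero_less_mult_iff)
 have a1: "a \<le> 1" using p0 by (simp add: a_def)
 have hh: "h\<^sup>2 = 2 * (1 - p 0) * (1 - a)" using p0 by (simp add: a_def)
 define z where "z = (\<lambda>i. if i \<le> n then e1 i + (p i - e1 i) / a else 0)"
 have z0: "1 - z 0 = (1 - p 0) / a" by (simp add: z_def minus_divide_left)
 have "(\<Sum>i\<le>n. (z i)\<^sup>2) = (\<Sum>i\<le>n. (e1 i)\<^sup>2) + 2 / a * ((\<Sum>i\<le>n. p i * e1 i) - (\<Sum>i\<le>n. (e1 i)\<^sup>2)) + (\<Sum>i\<le>n. (p i - e1 i)\<^sup>2) / a\<^sup>2"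
  unfolding z_def sum_subtractf[symmetric] sum_distrib_left sum_divide_distrib sum.distrib[symmetric]
  by (rule sum.cong) (auto simp: power2_eq_square algebra_simps add_divide_distrib diff_divide_distrib)
 also have "\<dots> = 1"
  unfolding pe sum_e1 using a by (simp add: power2_eq_square field_simps)
 finally have z: "z \<in> sph n"
  by (simp add: topspace_nsphere z_def)
 define c where "c = 1 - 2 * a"
 define s where "s = h / sqrt ((1 - z 0) / 2)"
 have pos: "(1 - z 0) / 2 > 0" using z0 a p0 by simp
 have "s\<^sup>2 = h\<^sup>2 / ((1 - z 0) / 2)"
  using pos by (simp add: s_def power_divide)
 also have "\<dots> = 4 * a * (1 - a)"
  unfolding z0 hh using p0 a by (simp add: field_simps)
 finally have "c\<^sup>2 + s\<^sup>2 = 1"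
  by (simp add: c_def power2_eq_square algebra_simps)
 then obtain t where t: "0 \<le> t" "t \<le> 2 * pi" "c = cos t" "s = sin t"
  using sincos_total_2pi_le by metis
 have "Sig n z (t / (2 * pi)) = p"
 proof
  fix i
  have t': "2 * pi * (t / (2 * pi)) = t" by simp
  consider "i \<le> n" | "i = Suc n" | "i > Suc n" by linarith
  then show "Sig n z (t / (2 * pi)) i = p i"
  proof cases
   case 1
   then show ?thesis using a unfolding Sig_def t' t(3)[symmetric]
    by (simp add: c_def z_def field_simps)
  next
   case 2
   then show ?thesis using pos unfolding Sig_def t' t(4)[symmetric] by (simp add: s_def h_def)
  next
   case 3
   then show ?thesis using p by (simp add: Sig_def topspace_nsphere)
  qed
 qed
 then show ?thesis
  using that[OF z, of "t / (2 * pi)"] t(1,2) by simp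
qed

section \<open>Cube coordinates on spheres\<close>

definition clamp01 :: "real \<Rightarrow> real" where
 "clamp01 u = max 0 (min 1 u)"

text \<open>The sphere as an iterated reduced suspension of the 0-sphere, which consists of
  \<open>e1\<close> and its antipode. The first coordinate stays unclamped and periodic so that
  integers can multiply it; the others are clamped to \<open>[0,1]\<close>.\<close>

fun lam :: "nat \<Rightarrow> real \<times> (nat \<Rightarrow> real) \<Rightarrow> nat \<Rightarrow> real" where
 "lam 0 p = Sig 0 (\<lambda>i. - e1 i) (fst p)"
| "lam (Suc k) p = Sig (Suc k) (lam k p) (clamp01 (snd p k))"

definition Zc :: "nat \<Rightarrow> (nat \<Rightarrow> real) topology" where
 "Zc k = subtopology (powertop_real UNIV) {y. \<forall>i. y i \<in> (if i < k then {0..1} else {0})}"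

definition Bc :: "nat \<Rightarrow> (nat \<Rightarrow> real) set" where
 "Bc k = {y. \<exists>i<k. y i \<le> 0 \<or> y i \<ge> 1}"

lemma clamp01_simps: "u \<le> 0 \<Longrightarrow> clamp01 u = 0" "u \<ge> 1 \<Longrightarrow> clamp01 u = 1" "0 \<le> u \<Longrightarrow> u \<le> 1 \<Longrightarrow> clamp01 u = u"
 by (auto simp: clamp01_def)

lemma continuous_map_Zc_coord: "rcont (Zc k) (\<lambda>y. y i)"
 unfolding Zc_def by (rule cm_sub, rule continuous_map_product_projection[OF UNIV_I])

lemma neg_e1_nsphere: "(\<lambda>i. - e1 i) \<in> sph n"
 using sum_e1(3)[of n] by (simp add: topspace_nsphere)

lemma lam_cont: "cmap (RD (Zc k')) (nsphere (Suc k)) (lam k)"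
proof (induction k)
 case 0
 show ?case
  using continuous_map_Sig[of "RD (Zc k')" 0 "\<lambda>_. (\<lambda>i. - e1 i)" fst] neg_e1_nsphere[of 0]
  by (simp add: cm_fst)
next
 case (Suc k)
 have "rcont (RD (Zc k')) (\<lambda>p. clamp01 (snd p k))"
  unfolding clamp01_def
  by (intro cont_arith cont_const cm_compose[OF continuous_map_Zc_coord[of k']] cm_snd)
 from continuous_map_Sig[OF Suc this] show ?case by simp
qed

lemma lam_nsphere: "lam k p \<in> sph (Suc k)"
 by (induction k) (auto intro!: Sig_nsphere neg_e1_nsphere)

lemma lam_e1: "fst p \<in> \<int> \<or> snd p \<in> Bc k \<Longrightarrow> lam k p = e1"
proof (induction k)
 case 0
 then show ?case by (simp add: Sig_Ints Bc_def)
next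
 case (Suc k)
 show ?case
 proof (cases "snd p k \<le> 0 \<or> snd p k \<ge> 1")
  case True
  then have "clamp01 (snd p k) \<in> \<int>" by (auto simp: clamp01_simps)
  then show ?thesis by (simp add: Sig_Ints)
 next
  case False
  then have "fst p \<in> \<int> \<or> snd p \<in> Bc k" using Suc.prems by (auto simp: Bc_def less_Suc_eq)
  then show ?thesis by (simp add: Suc.IH Sig_e1)
 qed
qed

lemma lam_shift: "x' - x \<in> \<int> \<Longrightarrow> lam k (x', y) = lam k (x, y)"
 by (induction k) (auto simp: Sig_shift[of x' x])

lemma lam_cmaps: "lam k \<in> cmaps (RD (Zc k)) (LB (Bc k)) (LE {}) (nsphere (Suc k)) e1"
proof (rule cmapsI[OF lam_cont], rule admI)
 show "lam k a = e1" if "a \<in> LB (Bc k)" for a using that by (intro lam_e1) (auto simp: LB_def)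
 show "lam k a = lam k b" if "(a, b) \<in> LE {}" for a b
  using that by (auto simp: LE_def lam_shift)
qed

lemma lam_ne_e1:
 assumes "0 < x" "x < 1" "\<And>i. i < k \<Longrightarrow> 0 < y i \<and> y i < 1"
 shows "lam k (x, y) \<noteq> e1"
 using assms
proof (induction k)
 case 0
 have "(\<lambda>i. - e1 i) \<noteq> e1" by (auto simp: fun_eq_iff)
 then show ?case using Sig_ne_e1[OF neg_e1_nsphere[of 0]] 0 by simp
next
 case (Suc k)
 moreover have "clamp01 (y k) = y k" using Suc.prems(3)[of k] by (simp add: clamp01_def)
 ultimately show ?case using Sig_ne_e1[OF lam_nsphere, of k "(x, y)" "y k"] by simp
qed

lemma lam_inj:
 assumes "0 < x" "x < 1" "\<And>i. i < k \<Longrightarrow> 0 < y i \<and> y i < 1"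
  and "0 < x'" "x' < 1" "\<And>i. i < k \<Longrightarrow> 0 < y' i \<and> y' i < 1"
  and "lam k (x, y) = lam k (x', y')"
 shows "x = x' \<and> (\<forall>i<k. y i = y' i)"
 using assms
proof (induction k)
 case 0
 have "(\<lambda>i. - e1 i) \<noteq> e1" by (auto simp: fun_eq_iff)
 then show ?case using Sig_inj[OF neg_e1_nsphere[of 0] _ _ _ neg_e1_nsphere[of 0]] 0 by simp
next
 case (Suc k)
 have "lam k (x, y) \<noteq> e1"
  by (rule lam_ne_e1) (use Suc.prems in auto)
 moreover have "lam k (x', y') \<noteq> e1"
  by (rule lam_ne_e1) (use Suc.prems in auto)
 moreover have "clamp01 (y k) = y k" "clamp01 (y' k) = y' k"
  using Suc.prems(3)[of k] Suc.prems(6)[of k] by (simp_all add: clamp01_def)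
 ultimately have *: "lam k (x, y) = lam k (x', y') \<and> y k = y' k"
  using Suc.prems by (intro Sig_inj[OF lam_nsphere _ _ _ lam_nsphere]) auto
 have "x = x' \<and> (\<forall>i<k. y i = y' i)"
  by (rule Suc.IH) (use Suc.prems(1-6) * in auto)
 then show ?case using * by (auto simp: less_Suc_eq)
qed

lemma topspace_Zc: "topspace (Zc k) = {y. \<forall>i. y i \<in> (if i < k then {0..1} else {0})}"
 by (simp add: Zc_def)

lemma lam_surj:
 assumes "p \<in> sph (Suc k)"
 shows "\<exists>x y. x \<in> {0..1} \<and> y \<in> topspace (Zc k) \<and> lam k (x, y) = p"
 using assms
proof (induction k arbitrary: p)
 case 0
 obtain z u where zu: "z \<in> sph 0" "0 \<le> u" "u \<le> 1" "Sig 0 z u = p"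
  using 0 by (rule Sig_surj)
 have y: "(\<lambda>_. 0) \<in> topspace (Zc 0)" by (simp add: topspace_Zc)
 have "z = e1 \<or> z = (\<lambda>i. - e1 i)"
  using zu(1) by (auto simp: topspace_nsphere fun_eq_iff power2_eq_1_iff)
 then show ?case
 proof
  assume "z = e1"
  then have "lam 0 (0, \<lambda>_. 0) = p" using zu by (simp add: Sig_e1 Sig_Ints)
  then show ?thesis using y by (intro exI[of _ 0] exI[of _ "\<lambda>_. 0"]) simp
 next
  assume "z = (\<lambda>i. - e1 i)"
  then have "lam 0 (u, \<lambda>_. 0) = p" using zu by simp
  then show ?thesis using y zu by (intro exI[of _ u] exI[of _ "\<lambda>_. 0"]) simp
 qed
next
 case (Suc k)
 obtain z u where zu: "z \<in> sph (Suc k)" "0 \<le> u" "u \<le> 1" "Sig (Suc k) z u = p"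
  using Suc.prems by (rule Sig_surj)
 obtain x y where xy: "x \<in> {0..1}" "y \<in> topspace (Zc k)" "lam k (x, y) = z"
  using Suc.IH[OF zu(1)] by blast
 have cong: "lam j (x, y(k := u)) = lam j (x, y)" if "j \<le> k" for j
  using that by (induction j) auto
 have "lam (Suc k) (x, y(k := u)) = p"
  using cong[of k] xy(3) zu by (simp add: clamp01_simps)
 moreover have "y(k := u) \<in> topspace (Zc (Suc k))"
  using xy(2) zu by (auto simp: topspace_Zc less_Suc_eq split: if_splits)
 ultimately show ?case using xy(1) by blast
qed

lemma compact_space_Zc: "compact_space (Zc k)"
 unfolding Zc_def
proof (rule compact_space_cube_closed)
 have "closed {y::nat \<Rightarrow> real. y i \<in> (if i < k then {0..1} else {0})}" for i
  by (cases "i < k") (auto intro!: closed_Collect_conj closed_Collect_le closed_Collect_eq continuous_intros)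
 then show "closed {y::nat \<Rightarrow> real. \<forall>i. y i \<in> (if i < k then {0..1} else {0})}"
  by (intro closed_Collect_all)
qed (auto split: if_splits, (metis abs_of_nonneg abs_zero atLeastAtMost_iff singletonD zero_le_one)+)

text \<open>\<open>lam k\<close> is a relative homeomorphism from the \<open>(k + 1)\<close>-cube
  and its boundary to the sphere and its basepoint.\<close>

lemma lam_onto_homology:
 assumes z: "z \<in> carrier (rel_H p (nsphere (Suc k)) {e1})"
 obtains c where "c \<in> carrier (rel_H p (IZ (Zc k)) (dIZ (Zc k) (Bc k)))"
  "hur p (Zc k) (Bc k) (nsphere (Suc k)) e1 (lam k) c = z"
proof -
 let ?B = "dIZ (Zc k) (Bc k)" and ?X = "IZ (Zc k)"
 \<comment> \<open>Linear homotopy from the identity to \<open>clamp01 (2 x - 1/2)\<close>, which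
   keeps both ends fixed and sends everything outside \<open>[1/4,3/4]\<close> to an end.\<close>
 define \<sigma> where "\<sigma> = (\<lambda>t x::real. (1 - t) * x + t * clamp01 (2 * x - 1/2))"
 have \<sigma>01: "\<sigma> t x \<in> {0..1}" if "t \<in> {0..1}" "x \<in> {0..1}" for t x
 proof -
  have c: "clamp01 (2 * x - 1/2) \<in> {0..1}" by (auto simp: clamp01_def)
  have "(1 - t) * x \<le> (1 - t) * 1" "t * clamp01 (2 * x - 1/2) \<le> t * 1"
   by (rule mult_left_mono; use that c in auto)+
  then have "\<sigma> t x \<le> 1" unfolding \<sigma>_def by simp
  moreover have "\<sigma> t x \<ge> 0" unfolding \<sigma>_def using that c by simp
  ultimately show ?thesis by simp
 qed
 have \<sigma>b: "\<sigma> t x = x" if "x = 0 \<or> x = 1" for t x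
  using that by (auto simp: \<sigma>_def clamp01_def)
 have \<sigma>1: "\<sigma> 1 x \<in> {0, 1}" if "x < 1/4 \<or> x > 3/4" for x
  using that by (auto simp: \<sigma>_def clamp01_def)
 have \<sigma>c: "rcont Y (\<lambda>p. \<sigma> (f p) (g p))"
  if "rcont Y f" "rcont Y g" for Y and f g :: "'c \<Rightarrow> real"
  unfolding \<sigma>_def clamp01_def by (intro cont_arith cont_const that)
 let ?H = "\<lambda>(t, x, y). (\<sigma> t x, \<lambda>i. if i < k then \<sigma> t (y i) else 0)"
 let ?T = "IZ ?X"
 have ct: "rcont ?T fst" "rcont ?T (\<lambda>p. fst (snd p))"
  using cm_full[OF cm_fst]
   cm_full[OF cont_fst_snd(1)[OF cm_snd]] by auto
 have cy: "rcont ?T (\<lambda>p. snd (snd p) i)" for i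
  by (rule cm_compose[OF continuous_map_Zc_coord cont_fst_snd(2)[OF cm_snd]])
 have Hc: "cmap ?T ?X ?H"
  unfolding case_prod_beta'
 proof (rule cm_pair)
  show "cmap ?T unit_interval (\<lambda>p. \<sigma> (fst p) (fst (snd p)))"
   by (intro continuous_map_into_subtopology \<sigma>c ct) (use \<sigma>01 in auto)
  have "rcont ?T (\<lambda>p. if i < k then \<sigma> (fst p) (snd (snd p) i) else 0)" for i
   by (cases "i < k") (auto intro!: \<sigma>c ct cy)
  then have "cmap ?T (powertop_real UNIV) (\<lambda>p i. if i < k then \<sigma> (fst p) (snd (snd p) i) else 0)"
   by (simp add: continuous_map_componentwise_UNIV)
  then show "cmap ?T (Zc k) (\<lambda>p i. if i < k then \<sigma> (fst p) (snd (snd p) i) else 0)"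
   unfolding Zc_def by (intro continuous_map_into_subtopology) (use \<sigma>01 in \<open>auto simp: topspace_Zc split: if_splits\<close>)
 qed
 let ?in = "\<lambda>x::real. 0 < x \<and> x < 1"
 have in_iff: "(x, y) \<in> topspace ?X - ?B \<longleftrightarrow> ?in x \<and> y \<in> topspace (Zc k) \<and> (\<forall>i<k. ?in (y i))" for x y
 proof -
  have "?in x \<longleftrightarrow> x \<in> {0..1} \<and> x \<noteq> 0 \<and> x \<noteq> 1" by auto
  moreover have "(\<forall>i<k. ?in (y i)) \<longleftrightarrow> y \<notin> Bc k" by (auto simp: Bc_def not_le)
  ultimately show ?thesis by (auto simp: dIZ_def)
 qed
 have Xc: "rcont ?X fst" "rcont ?X (\<lambda>q. snd q i)" for i
  by (rule cm_full[OF cm_fst],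
    rule cm_compose[OF continuous_map_Zc_coord cm_snd])
 have HX: "?H (t, a) \<in> topspace ?X" if "t \<in> {0..1}" "a \<in> topspace ?X" for t a
  by (rule funcset_mem[OF cm_funspace[OF Hc]]) (use that in auto)
 have HB: "?H (t, a) \<in> ?B" if t: "t \<in> {0..1}" and a: "a \<in> ?B" for t a
 proof -
  obtain x y where e: "a = (x, y)" by (cases a)
  have X: "?H (t, a) \<in> topspace ?X" by (rule HX[OF t]) (use a in \<open>auto simp: dIZ_def\<close>)
  have y: "y \<in> topspace (Zc k)" using a by (auto simp: e dIZ_def)
  have yi: "y i = 0 \<or> y i = 1" if "i < k" "y i \<le> 0 \<or> y i \<ge> 1" for i
  proof -
   have "y i \<in> {0..1}" using y that(1) by (auto simp: topspace_Zc split: if_splits)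
   then show ?thesis using that(2) by auto
  qed
  from a consider "x = 0 \<or> x = 1" | i where "i < k" "y i \<le> 0 \<or> y i \<ge> 1"
   by (auto simp: e dIZ_def Bc_def)
  then show ?thesis
  proof cases
   case 1
   then show ?thesis using X by (auto simp: e dIZ_def \<sigma>b)
  next
   case 2
   then have "\<sigma> t (y i) \<le> 0 \<or> \<sigma> t (y i) \<ge> 1" using yi[OF 2] \<sigma>b[of "y i" t] by auto
   then show ?thesis using X 2(1) by (auto simp: e dIZ_def Bc_def)
  qed
 qed
 have "\<exists>c \<in> carrier (rel_H p ?X ?B).
   hom_induced p ?X ?B (nsphere (Suc k)) {e1} (lam k) c = z"
 \<comment> \<open>The neighbourhood of the boundary consists of the points with some coordinate
   outside \<open>[1/4,3/4]\<close>. Index \<open>k\<close> stands for the periodic coordinate, the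
   smaller ones for the rest of the cube.\<close>
 proof (rule relative_homology_onto_cell[where N' = "{q \<in> topspace ?X. \<exists>i\<le>k. (if i = k then fst q else snd q i) \<notin> {1/4..3/4}}" and H = ?H])
  show "compact_space ?X"
   by (simp add: compact_space_prod_topology compact_space_Zc compact_space_subtopology)
  show "Hausdorff_space (nsphere (Suc k))" by (rule Hausdorff_space_nsphere)
  show "cmap ?X (nsphere (Suc k)) (lam k)"
   unfolding prod_topology_subtopology(1) by (rule cm_sub[OF lam_cont])
  show "lam k \<in> ?B \<rightarrow> {e1}"
   by (auto simp: dIZ_def intro!: lam_e1)
  show "closedin (nsphere (Suc k)) {e1}"
   by (simp add: closedin_Hausdorff_singleton[OF Hausdorff_space_nsphere] in_topspace_nsphere)
  show "sph (Suc k) \<subseteq> {e1} \<union> lam k ` topspace ?X"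
  proof
   fix p assume "p \<in> sph (Suc k)"
   then obtain x y where "x \<in> {0..1}" "y \<in> topspace (Zc k)" "lam k (x, y) = p"
    using lam_surj by blast
   then show "p \<in> {e1} \<union> lam k ` topspace ?X" by (intro UnI2 image_eqI[of _ _ "(x, y)"]) auto
  qed
  show "closedin ?X ?B"
  proof -
   have "closedin ?X {q \<in> topspace ?X. fst q \<in> {0, 1}}"
    by (rule closedin_pre[OF Xc(1)]) simp
   moreover have "closedin ?X {q \<in> topspace ?X. snd q i \<in> {..0} \<union> {1..}}" for i
    by (rule closedin_pre[OF Xc(2)]) (simp add: closed_Un)
   then have "closedin ?X (\<Union>i\<in>{..<k}. {q \<in> topspace ?X. snd q i \<in> {..0} \<union> {1..}})"
    by (intro closedin_Union) auto
   ultimately have "closedin ?X ({q \<in> topspace ?X. fst q \<in> {0, 1}} \<union> (\<Union>i\<in>{..<k}. {q \<in> topspace ?X. snd q i \<in> {..0} \<union> {1..}}))"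
    by (rule closedin_Un)
   moreover have "?B = {q \<in> topspace ?X. fst q \<in> {0, 1}} \<union> (\<Union>i\<in>{..<k}. {q \<in> topspace ?X. snd q i \<in> {..0} \<union> {1..}})"
    by (auto simp: dIZ_def Bc_def)
   ultimately show ?thesis by simp
  qed
  show "inj_on (lam k) (topspace ?X - ?B)"
  proof (rule inj_onI)
   fix a b assume ab: "a \<in> topspace ?X - ?B" "b \<in> topspace ?X - ?B" "lam k a = lam k b"
   obtain x y x' y' where e: "a = (x, y)" "b = (x', y')" by (cases a; cases b)
   have a': "?in x" "y \<in> topspace (Zc k)" "\<forall>i<k. ?in (y i)" using ab(1) unfolding e in_iff by auto
   have b': "?in x'" "y' \<in> topspace (Zc k)" "\<forall>i<k. ?in (y' i)" using ab(2) unfolding e in_iff by auto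
   have i: "x = x' \<and> (\<forall>i<k. y i = y' i)"
    by (rule lam_inj) (use a' b' ab(3) e in auto)
   have "y i = y' i" for i
   proof (cases "i < k")
    case False
    then show ?thesis using a'(2) b'(2) unfolding topspace_Zc by (metis (mono_tags, lifting) mem_Collect_eq singletonD)
   qed (use i in auto)
   then show "a = b" using i e by auto
  qed
  show "lam k a \<notin> {e1}" if a: "a \<in> topspace ?X - ?B" for a
  proof -
   obtain x y where e: "a = (x, y)" by (cases a)
   show ?thesis using a lam_ne_e1[of x k y] unfolding e in_iff by auto
  qed
  show "openin ?X {q \<in> topspace ?X. \<exists>i\<le>k. (if i = k then fst q else snd q i) \<notin> {1/4..3/4}}"
  proof -
   have "openin ?X {q \<in> topspace ?X. (if i = k then fst q else snd q i) \<in> - {1/4..3/4}}" for i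
   proof (rule openin_pre)
    show "rcont ?X (\<lambda>q. if i = k then fst q else snd q i)"
     using Xc by (cases "i = k") auto
   qed (simp add: open_Compl)
   then have "openin ?X (\<Union>i\<le>k. {q \<in> topspace ?X. (if i = k then fst q else snd q i) \<in> - {1/4..3/4}})"
    by (intro openin_Union) auto
   moreover have "(\<Union>i\<le>k. {q \<in> topspace ?X. (if i = k then fst q else snd q i) \<in> - {1/4..3/4}})
     = {q \<in> topspace ?X. \<exists>i\<le>k. (if i = k then fst q else snd q i) \<notin> {1/4..3/4}}"
    by blast
   ultimately show ?thesis by metis
  qed
  show "?B \<subseteq> {q \<in> topspace ?X. \<exists>i\<le>k. (if i = k then fst q else snd q i) \<notin> {1/4..3/4}}"
  proof
   fix a assume a: "a \<in> ?B"
   obtain x y where e: "a = (x, y)" by (cases a)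
   from a consider "x = 0 \<or> x = 1" | i where "i < k" "y i \<le> 0 \<or> y i \<ge> 1"
    by (auto simp: e dIZ_def Bc_def)
   then have "\<exists>i\<le>k. (if i = k then x else y i) \<notin> {1/4..3/4}"
   proof cases
    case 1
    then show ?thesis by (intro exI[of _ k]) auto
   next
    case (2 i)
    then show ?thesis by (intro exI[of _ i]) auto
   qed
   moreover have "a \<in> topspace ?X" using a by (auto simp: dIZ_def)
   ultimately show "a \<in> {q \<in> topspace ?X. \<exists>i\<le>k. (if i = k then fst q else snd q i) \<notin> {1/4..3/4}}"
    unfolding e mem_Collect_eq fst_conv snd_conv by blast
  qed
  show "cmap ?T ?X ?H" by (rule Hc)
  show "?H (0, a) = a" if a: "a \<in> topspace ?X" for a
  proof -
   obtain x y where e: "a = (x, y)" by (cases a)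
   have "(if i < k then y i else 0) = y i" for i
    using a by (auto simp: e topspace_Zc split: if_splits)
   moreover have "\<sigma> 0 x = x" for x by (simp add: \<sigma>_def)
   ultimately show ?thesis by (simp add: e cong: if_cong)
  qed
  show "?H (1, a) \<in> ?B" if a: "a \<in> {q \<in> topspace ?X. \<exists>i\<le>k. (if i = k then fst q else snd q i) \<notin> {1/4..3/4}}" for a
  proof -
   obtain x y where e: "a = (x, y)" by (cases a)
   obtain i where i: "i \<le> k" "(if i = k then x else y i) \<notin> {1/4..3/4}"
    using a unfolding e mem_Collect_eq fst_conv snd_conv by blast
   have X: "?H (1, a) \<in> topspace ?X" by (rule HX) (use a in auto)
   show ?thesis
   proof (cases "i = k")
    case True
    then have "\<sigma> 1 x \<in> {0, 1}" using i by (intro \<sigma>1) auto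
    then show ?thesis using X by (auto simp: e dIZ_def)
   next
    case False
    then have "\<sigma> 1 (y i) \<in> {0, 1}" using i by (intro \<sigma>1) auto
    then show ?thesis using X False i(1) by (auto simp: e dIZ_def Bc_def intro!: exI[of _ i])
   qed
  qed
  show "?H (t, a) \<in> topspace ?X \<and> lam k (?H (t, a)) = lam k a" if "t \<in> {0..1}" "a \<in> ?B" for t a
  proof -
   have le: "lam k b = e1" if "b \<in> ?B" for b
    using that by (intro lam_e1) (auto simp: dIZ_def)
   have "?B \<subseteq> topspace ?X" by (auto simp: dIZ_def)
   then have "?H (t, a) \<in> topspace ?X" by (rule subsetD) (rule HB[OF that])
   then show ?thesis unfolding le[OF HB[OF that]] le[OF that(2)] by simp
  qed
  show "z \<in> carrier (rel_H p (nsphere (Suc k)) {e1})" by (rule z)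
 qed
 then show ?thesis using that unfolding hur_def by blast
qed

section \<open>Maps between spheres\<close>

text \<open>Radial projection to the unit sphere of the first \<open>m + 1\<close> coordinates.
  Where these vanish, division by 0 gives the value 0.\<close>

definition nz :: "nat \<Rightarrow> (nat \<Rightarrow> real) \<Rightarrow> nat \<Rightarrow> real" where
 "nz m v = (\<lambda>i. if i \<le> m then v i / sqrt (\<Sum>j\<le>m. (v j)\<^sup>2) else 0)"

lemma sum_squares_pos: "i \<le> (m::nat) \<Longrightarrow> v i \<noteq> 0 \<Longrightarrow> (\<Sum>j\<le>m. (v j)\<^sup>2 :: real) > 0"
 by (rule sum_pos2[of _ i]) auto

lemma nz_nsphere:
 assumes "i \<le> m" "v i \<noteq> 0"
 shows "nz m v \<in> sph m"
proof -
 have "(\<Sum>j\<le>m. (nz m v j)\<^sup>2) = (\<Sum>j\<le>m. (v j)\<^sup>2) / (\<Sum>j\<le>m. (v j)\<^sup>2)"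
  unfolding sum_divide_distrib by (rule sum.cong) (auto simp: nz_def power_divide sum_nonneg)
 then show ?thesis
  using sum_squares_pos[of i m v, OF assms] by (simp add: topspace_nsphere) (simp add: nz_def)
qed

lemma nz_id: "p \<in> sph m \<Longrightarrow> nz m p = p"
 by (auto simp: nz_def topspace_nsphere)

lemma continuous_map_sum_squares:
 fixes m :: nat
 assumes "\<And>i. i \<le> m \<Longrightarrow> rcont X (\<lambda>x. v x i)"
 shows "rcont X (\<lambda>x. \<Sum>j\<le>m. (v x j)\<^sup>2)"
 unfolding power2_eq_square by (intro continuous_map_sum cont_arith assms) auto

lemma continuous_map_real_quotient:
 fixes f g :: "'a \<Rightarrow> real"
 assumes "rcont X f" "rcont X g" "\<And>x. x \<in> topspace X \<Longrightarrow> g x \<noteq> 0"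
 shows "rcont X (\<lambda>x. f x / g x)"
 using assms by (rule continuous_map_real_divide)

lemma continuous_map_nz:
 assumes "\<And>i. i \<le> m \<Longrightarrow> rcont X (\<lambda>x. v x i)"
  and "\<And>x. x \<in> topspace X \<Longrightarrow> \<exists>i\<le>m. v x i \<noteq> 0"
 shows "cmap X (nsphere m) (\<lambda>x. nz m (v x))"
 unfolding continuous_map_nsphere
proof (intro conjI allI)
 have "sqrt (\<Sum>j\<le>m. (v x j)\<^sup>2) \<noteq> 0" if "x \<in> topspace X" for x
  using assms(2)[OF that] sum_squares_pos[of _ m "v x"] by force
 then show "rcont X (\<lambda>x. nz m (v x) i)" for i
  unfolding nz_def using assms(1)
  by (cases "i \<le> m") (auto intro!: continuous_map_real_quotient continuous_map_sqrt continuous_map_sum_squares)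
 show "(\<lambda>x. nz m (v x)) \<in> topspace X \<rightarrow> sph m"
  using nz_nsphere assms(2) by blast
qed

lemma cont_fst_I: "rcont (IZ X) fst"
 using cm_full[OF cm_fst] .

lemma sphere_homotopy:
 assumes "\<And>i. i \<le> m \<Longrightarrow> rcont (IZ X) (\<lambda>q. v q i)"
  and "\<And>t x. t \<in> {0..1} \<Longrightarrow> x \<in> topspace X \<Longrightarrow> \<exists>i\<le>m. v (t, x) i \<noteq> 0"
  and "\<And>x. x \<in> topspace X \<Longrightarrow> nz m (v (0, x)) = f x" "\<And>x. x \<in> topspace X \<Longrightarrow> nz m (v (1, x)) = g x"
 shows "htp X (nsphere m) f g"
proof (subst homotopic_with)
 show "\<exists>h. cmap (IZ X) (nsphere m) h \<and>
   (\<forall>x \<in> topspace X. h (0, x) = f x) \<and> (\<forall>x \<in> topspace X. h (1, x) = g x) \<and> (\<forall>t \<in> {0..1}. True)"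
  by (rule exI[of _ "\<lambda>q. nz m (v q)"]) (use assms in \<open>auto intro!: continuous_map_nz\<close>)
qed auto

text \<open>The straight line between two unit vectors meets the origin only at its midpoint, and
  only if they are antipodes.\<close>

lemma homotopic_nonantipodal:
 assumes f: "cmap X (nsphere m) f" and g: "cmap X (nsphere m) g"
  and n: "\<And>x. x \<in> topspace X \<Longrightarrow> \<exists>i\<le>m. g x i \<noteq> - f x i"
 shows "htp X (nsphere m) f g"
proof (rule sphere_homotopy)
 let ?v = "\<lambda>q i. (1 - fst q) * f (snd q) i + fst q * g (snd q) i"
 have c: "rcont (IZ X) (\<lambda>q. f (snd q) i)"
  "rcont (IZ X) (\<lambda>q. g (snd q) i)" for i
  by (rule cm_compose[OF continuous_map_nsphere_coord[OF f] cm_snd],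
    rule cm_compose[OF continuous_map_nsphere_coord[OF g] cm_snd])
 show "rcont (IZ X) (\<lambda>q. ?v q i)" for i
  by (intro cont_arith c cont_fst_I cont_const)
 have S: "f x \<in> sph m" "g x \<in> sph m" if "x \<in> topspace X" for x
  using f g that by (auto dest: cm_funspace)
 show "\<exists>i\<le>m. ?v (t, x) i \<noteq> 0" if t: "t \<in> {0..1}" and x: "x \<in> topspace X" for t x
 proof (rule ccontr)
  assume "\<not> ?thesis"
  then have e: "(1 - t) * f x i = - (t * g x i)" if "i \<le> m" for i using that by fastforce
  have "(\<Sum>i\<le>m. ((1 - t) * f x i)\<^sup>2) = (\<Sum>i\<le>m. (t * g x i)\<^sup>2)"
   by (rule sum.cong) (simp_all add: e)
  then have "(1 - t)\<^sup>2 = t\<^sup>2"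
   using S[OF x] by (simp add: power_mult_distrib topspace_nsphere flip: sum_distrib_left)
  then have "1 - 2 * t = 0" by (simp add: power2_eq_square algebra_simps)
  then have "t = 1/2" by simp
  then have "g x i = - f x i" if "i \<le> m" for i using e[OF that] unfolding \<open>t = 1/2\<close> by simp
  then show False using n[OF x] by blast
 qed
qed (use nz_id f g in \<open>auto dest: cm_funspace\<close>)

text \<open>At a zero of \<open>a\<close> the bound on \<open>\<phi>\<close> forces the product to
  0, so continuity of \<open>\<phi>\<close> matters only elsewhere. This handles the poles of a
  sphere, where the direction of the meridian is undefined.\<close>

lemma continuous_map_bounded_times:
 fixes a \<phi> :: "'a \<Rightarrow> real"
 assumes a: "rcont X a" and b: "\<And>x. x \<in> topspace X \<Longrightarrow> a x \<noteq> 0 \<Longrightarrow> \<bar>\<phi> x\<bar> \<le> 1"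
  and \<phi>: "rcont (subtopology X {x. a x \<noteq> 0}) \<phi>"
 shows "rcont X (\<lambda>x. a x * \<phi> x)"
 unfolding continuous_map
proof (intro conjI allI impI)
 fix V :: "real set" assume V: "openin euclideanreal V"
 let ?A = "{x \<in> topspace X. a x \<in> - {0}}"
 have A: "openin X ?A" by (rule openin_pre[OF a]) (simp add: open_Compl)
 have sA: "subtopology X {x. a x \<noteq> 0} = subtopology X ?A"
 proof -
  have "?A = topspace X \<inter> {x. a x \<noteq> 0}" by auto
  then show ?thesis by (metis subtopology_restrict)
 qed
 have c: "rcont (subtopology X ?A) (\<lambda>x. a x * \<phi> x)"
  by (rule cont_arith(3)[OF cm_sub[OF a] \<phi>[unfolded sA]])
 have 1: "openin X {x \<in> topspace (subtopology X ?A). a x * \<phi> x \<in> V}"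
  by (rule openin_trans_full[OF openin_pre[OF c V] A])
 show "openin X {x \<in> topspace X. a x * \<phi> x \<in> V}"
 proof (cases "0 \<in> V")
  case False
  then have "{x \<in> topspace X. a x * \<phi> x \<in> V} = {x \<in> topspace (subtopology X ?A). a x * \<phi> x \<in> V}"
   by auto
  then show ?thesis using 1 by simp
 next
  case True
  then obtain e where e: "e > 0" "ball 0 e \<subseteq> V" using V by (auto simp: open_contains_ball)
  have 2: "openin X {x \<in> topspace X. a x \<in> ball 0 e}"
   by (rule openin_pre[OF a]) simp
  have "a x * \<phi> x \<in> V" if "x \<in> topspace X" "a x \<in> ball 0 e" for x
  proof (cases "a x = 0")
   case False
   have "\<bar>a x * \<phi> x\<bar> \<le> \<bar>a x\<bar> * 1"
    unfolding abs_mult using b[OF that(1) False] by (intro mult_left_mono) auto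
   then have "a x * \<phi> x \<in> ball 0 e" using that(2) by (simp add: dist_real_def)
   then show ?thesis using e by auto
  qed (use True in auto)
  then have "{x \<in> topspace X. a x * \<phi> x \<in> V}
    = {x \<in> topspace (subtopology X ?A). a x * \<phi> x \<in> V} \<union> {x \<in> topspace X. a x \<in> ball 0 e}"
   using e(1) by auto
  then show ?thesis using openin_Un[OF 1 2] by simp
 qed
qed auto

section \<open>Suspension of self-maps of spheres\<close>

definition hw :: "nat \<Rightarrow> (nat \<Rightarrow> real) \<Rightarrow> real" where
 "hw m p = sqrt (\<Sum>i\<le>m. (p i)\<^sup>2)"

text \<open>The unreduced suspension along meridians, in contrast to the reduced one given by
  \<open>Sig\<close>.\<close>

definition susp :: "nat \<Rightarrow> ((nat \<Rightarrow> real) \<Rightarrow> nat \<Rightarrow> real) \<Rightarrow> (nat \<Rightarrow> real) \<Rightarrow> nat \<Rightarrow> real" where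
 "susp m g p = (\<lambda>i. if i \<le> m then hw m p * g (nz m p) i else if i = Suc m then p (Suc m) else 0)"

lemma hw_nonneg: "hw m p \<ge> 0"
 by (simp add: hw_def sum_nonneg)

lemma hw_square: "(hw m p)\<^sup>2 = (\<Sum>i\<le>m. (p i)\<^sup>2)"
 by (simp add: hw_def sum_nonneg)

lemma hw_zero: "hw m p = 0 \<longleftrightarrow> (\<forall>i\<le>m. p i = 0)"
 by (auto simp: hw_def sum_nonneg_eq_0_iff)

lemma hw_nz: "i \<le> m \<Longrightarrow> hw m p * nz m p i = p i"
 using hw_zero[of m p] by (cases "hw m p = 0") (auto simp: nz_def hw_def)

lemma hw_nsphere: "p \<in> sph (Suc m) \<Longrightarrow> (hw m p)\<^sup>2 + (p (Suc m))\<^sup>2 = 1"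
 by (simp add: hw_square topspace_nsphere)

lemma nz_in: "hw m p \<noteq> 0 \<Longrightarrow> nz m p \<in> sph m"
 using nz_nsphere hw_zero by metis

lemma continuous_map_hw: "rcont (nsphere n) (hw m)"
 unfolding hw_def
 by (intro continuous_map_sqrt continuous_map_sum_squares continuous_map_nsphere_projection)

lemma nsphere_coord_le1: assumes "p \<in> sph m" shows "\<bar>p i\<bar> \<le> 1"
proof (cases "i \<le> m")
 case True
 then have "(p i)\<^sup>2 \<le> 1" using sum_squares_coord_le[of i "{..m}" p] assms by (auto simp: topspace_nsphere)
 then show ?thesis by (simp add: abs_square_le_1)
qed (use assms in \<open>auto simp: topspace_nsphere\<close>)

lemma continuous_map_nz_sub:
 "cmap (subtopology (prod_topology T (nsphere (Suc m))) {q. hw m (snd q) \<noteq> 0}) (nsphere m) (\<lambda>q. nz m (snd q))"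
proof (rule continuous_map_nz)
 show "rcont (subtopology (prod_topology T (nsphere (Suc m))) {q. hw m (snd q) \<noteq> 0}) (\<lambda>q. snd q i)" for i
  by (intro cm_sub cm_compose[OF continuous_map_nsphere_projection[of "Suc m"]] cm_snd)
qed (auto simp: hw_zero)

lemma susp_nsphere:
 assumes "hw m p \<noteq> 0 \<Longrightarrow> g (nz m p) \<in> sph m" "p \<in> sph (Suc m)"
 shows "susp m g p \<in> sph (Suc m)"
proof -
 have "(\<Sum>i\<le>m. (susp m g p i)\<^sup>2) = (hw m p)\<^sup>2 * (\<Sum>i\<le>m. (g (nz m p) i)\<^sup>2)"
  unfolding sum_distrib_left by (rule sum.cong) (auto simp: susp_def power_mult_distrib)
 also have "\<dots> = (hw m p)\<^sup>2"
  using assms(1) by (cases "hw m p = 0") (auto simp: topspace_nsphere)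
 finally have "(\<Sum>i\<le>Suc m. (susp m g p i)\<^sup>2) = 1"
  using hw_nsphere[OF assms(2)] by (simp add: susp_def)
 then show ?thesis by (simp add: topspace_nsphere) (simp add: susp_def)
qed

lemma continuous_map_susp:
 assumes H: "cmap (prod_topology T (nsphere m)) (nsphere m) H"
 shows "cmap (prod_topology T (nsphere (Suc m))) (nsphere (Suc m)) (\<lambda>q. susp m (\<lambda>z. H (fst q, z)) (snd q))"
 unfolding continuous_map_nsphere
proof (intro conjI allI)
 let ?T = "prod_topology T (nsphere (Suc m))"
 let ?S = "subtopology ?T {q. hw m (snd q) \<noteq> 0}"
 have S: "cmap ?S (prod_topology T (nsphere m)) (\<lambda>q. (fst q, nz m (snd q)))"
  by (intro cm_pair continuous_map_nz_sub cm_sub[OF cm_fst])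
 have HS: "H (t, z) \<in> sph m" if "t \<in> topspace T" "z \<in> sph m" for t z
  using funcset_mem[OF cm_funspace[OF H], of "(t, z)"] that by simp
 have hwc: "rcont ?T (\<lambda>q. hw m (snd q))"
  by (rule cm_compose[OF continuous_map_hw cm_snd])
 have "rcont ?T (\<lambda>q. hw m (snd q) * H (fst q, nz m (snd q)) i)" for i
 proof (rule continuous_map_bounded_times[OF hwc])
  show "\<bar>H (fst q, nz m (snd q)) i\<bar> \<le> 1" if "q \<in> topspace ?T" "hw m (snd q) \<noteq> 0" for q
   using that by (intro nsphere_coord_le1[of _ m] HS nz_in) auto
  show "rcont ?S (\<lambda>q. H (fst q, nz m (snd q)) i)"
   by (rule continuous_map_nsphere_coord[OF cm_compose[OF H S]])
 qed
 then show "rcont ?T (\<lambda>q. susp m (\<lambda>z. H (fst q, z)) (snd q) i)" for i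
  unfolding susp_def
  by (cases "i \<le> m"; cases "i = Suc m")
    (auto intro!: cm_compose[OF continuous_map_nsphere_projection[of "Suc m"]] cm_snd)
 show "(\<lambda>q. susp m (\<lambda>z. H (fst q, z)) (snd q)) \<in> topspace ?T \<rightarrow> sph (Suc m)"
  using HS nz_in by (auto intro!: susp_nsphere)
qed

lemma continuous_map_susp1:
 assumes "cmap (nsphere m) (nsphere m) g"
 shows "cmap (nsphere (Suc m)) (nsphere (Suc m)) (susp m g)"
proof -
 have "cmap (IZ (nsphere (Suc m))) (nsphere (Suc m)) (\<lambda>q. susp m g (snd q))"
  using continuous_map_susp[OF cm_compose[OF assms cm_snd]] unfolding snd_conv .
 then have "cmap (nsphere (Suc m)) (nsphere (Suc m)) (\<lambda>p. susp m g (snd (0::real, p)))"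
  by (rule cm_compose) (intro cm_pair cont_id, simp)
 then show ?thesis by simp
qed

lemma susp_homotopic:
 assumes "htp (nsphere m) (nsphere m) f g"
 shows "htp (nsphere (Suc m)) (nsphere (Suc m)) (susp m f) (susp m g)"
proof -
 obtain H where H: "cmap (IZ (nsphere m)) (nsphere m) H"
  "\<forall>x. H (0, x) = f x" "\<forall>x. H (1, x) = g x"
  using assms unfolding homotopic_with_def by blast
 show ?thesis
  unfolding homotopic_with_def
  by (rule exI[of _ "\<lambda>q. susp m (\<lambda>z. H (fst q, z)) (snd q)"])
    (use continuous_map_susp[OF H(1)] H(2,3) in simp)
qed

text \<open>A self-map that misses the north pole on the lower and the south pole on the upper hemisphere
 is deformed into a suspension: add the height of the argument to the value, then
 slide the argument along its meridian to the equator.\<close>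

lemma homotopic_susp:
 assumes f: "cmap (nsphere (Suc m)) (nsphere (Suc m)) f"
  and N: "\<And>p. p \<in> sph (Suc m) \<Longrightarrow> \<forall>i\<le>m. f p i = 0 \<Longrightarrow> p (Suc m) * f p (Suc m) > 0"
 obtains g where "cmap (nsphere m) (nsphere m) g"
  "htp (nsphere (Suc m)) (nsphere (Suc m)) f (susp m g)"
proof -
 let ?S = "nsphere (Suc m)" and ?T = "IZ (nsphere (Suc m))"
 let ?M = "Suc m"
 have fS: "f p \<in> topspace ?S" if "p \<in> topspace ?S" for p
  using that f by (auto dest: cm_funspace)
 have fc: "rcont X (\<lambda>q. f (u q) i)" if "cmap X ?S u" for X :: "'x topology" and u i
  by (rule cm_compose[OF continuous_map_nsphere_coord[OF f] that])
 have hwc: "rcont ?T (\<lambda>q. hw m (snd q))"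
  by (rule cm_compose[OF continuous_map_hw cm_snd])
 have pc: "rcont ?T (\<lambda>q. snd q i)" for i
  by (rule cm_compose[OF continuous_map_nsphere_projection[of "Suc m"] cm_snd])
 let ?n = "\<lambda>i. if i = ?M then 1 else 0 :: real"
 have h0: "p ?M \<noteq> 0" if "p \<in> topspace ?S" "hw m p = 0" for p
  using hw_nsphere[OF that(1)] that(2) by auto
 \<comment> \<open>Slides a point along its meridian, from itself at time 0 to the equator at time
   1; the height keeps its sign before that.\<close>
 define eq where "eq = (\<lambda>t p. nz ?M (\<lambda>i. if i = ?M then (1 - t) * p i else p i))"
 have eqS: "eq t p \<in> topspace ?S" "sgn (eq t p ?M) = sgn ((1 - t) * p ?M)" if "hw m p \<noteq> 0" for t p
 proof -
  obtain j where j: "j \<le> m" "p j \<noteq> 0" using \<open>hw m p \<noteq> 0\<close> hw_zero by auto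
  then show "eq t p \<in> topspace ?S" unfolding eq_def by (intro nz_nsphere[of j]) auto
  have "(\<Sum>i\<le>?M. (if i = ?M then (1 - t) * p i else p i)\<^sup>2) > 0"
   using j by (intro sum_squares_pos[of j]) auto
  then show "sgn (eq t p ?M) = sgn ((1 - t) * p ?M)"
   unfolding eq_def nz_def by (simp add: sgn_divide sgn_mult)
 qed
 have eqc: "cmap (subtopology ?T {q. hw m (snd q) \<noteq> 0}) ?S (\<lambda>q. eq (fst q) (snd q))"
  unfolding eq_def
 proof (rule continuous_map_nz)
  show "cmap (subtopology ?T {q. hw m (snd q) \<noteq> 0}) euclideanreal
    (\<lambda>q. if i = ?M then (1 - fst q) * snd q i else snd q i)" for i
   by (cases "i = ?M") (auto intro!: cm_sub cont_arith cont_fst_I pc)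
  show "\<exists>i\<le>?M. (if i = ?M then (1 - fst q) * snd q i else snd q i) \<noteq> 0"
   if "q \<in> topspace (subtopology ?T {q. hw m (snd q) \<noteq> 0})" for q
  proof -
   have "hw m (snd q) \<noteq> 0" using that by simp
   then obtain j where "j \<le> m" "snd q j \<noteq> 0" using hw_zero by auto
   then show ?thesis by (intro exI[of _ j]) auto
  qed
 qed
 text \<open>The next fact excludes zeros: a value \<open>a f(q) + b n\<close> with \<open>a > 0\<close> can only vanish if
  \<open>f(q)\<close> is a pole, and then \<open>b\<close> has the sign of that pole.\<close>
 have nonzero: "\<exists>i\<le>?M. a * f q i + b * ?n i \<noteq> 0"
  if "q \<in> topspace ?S" "a > 0" "b * q ?M \<ge> 0" "q ?M = 0 \<Longrightarrow> b = 0" for a b q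
 proof (cases "\<forall>i\<le>m. f q i = 0")
  case True
  then have p: "q ?M * f q ?M > 0" using N that(1) by blast
  then have "b * f q ?M \<ge> 0" using that(3)
   by (smt (verit) mult_nonneg_nonpos mult_nonpos_nonneg zero_less_mult_iff zero_le_mult_iff)
  moreover have "f q ?M \<noteq> 0" using p by auto
  ultimately have "(a * f q ?M + b) * f q ?M > 0"
   using that(2) by (simp add: distrib_right add_pos_nonneg mult.assoc) (metis add_pos_nonneg mult_pos_pos not_real_square_gt_zero)
  then show ?thesis by (intro exI[of _ ?M]) auto
 next
  case False
  then obtain j where "j \<le> m" "f q j \<noteq> 0" by auto
  then show ?thesis using that(2) by (intro exI[of _ j]) auto
 qed
 have pole: "\<exists>i\<le>?M. (a::real) * c i + p ?M * ?n i \<noteq> 0" if "p \<in> topspace ?S" "hw m p = 0" "a = 0" for a c p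
  using h0[OF that(1,2)] that(3) by (intro exI[of _ ?M]) auto
 have s1: "htp ?S ?S f (\<lambda>p. nz ?M (\<lambda>i. hw m p * f p i + p ?M * ?n i))"
 proof (rule sphere_homotopy[where v = "\<lambda>q i. (1 - fst q + fst q * hw m (snd q)) * f (snd q) i + fst q * snd q ?M * ?n i"])
  show "rcont ?T (\<lambda>q. (1 - fst q + fst q * hw m (snd q)) * f (snd q) i + fst q * snd q ?M * ?n i)" for i
   by (intro cont_arith cont_fst_I fc cm_snd hwc pc cont_const)
  fix t p assume t: "t \<in> {0..1::real}" and p: "p \<in> topspace ?S"
  show "\<exists>i\<le>?M. (1 - fst (t, p) + fst (t, p) * hw m (snd (t, p))) * f (snd (t, p)) i + fst (t, p) * snd (t, p) ?M * ?n i \<noteq> 0"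
  proof (cases "1 - t + t * hw m p > 0")
   case True
   have "t * p ?M * p ?M \<ge> 0" using t by (simp add: mult.assoc)
   from nonzero[OF p True this] show ?thesis unfolding fst_conv snd_conv by simp
  next
   case False
   have "t * hw m p \<ge> 0" using t hw_nonneg[of m p] by simp
   then have "t = 1" using False t by auto
   then have "hw m p = 0" using False hw_nonneg[of m p] by auto
   then show ?thesis using pole[OF p, of 0 "f p"] \<open>t = 1\<close> by simp
  qed
 qed (simp_all add: nz_id fS)
 have hc: "rcont ?T (\<lambda>q. hw m (snd q) * f (eq (fst q) (snd q)) i)" for i
 proof (rule continuous_map_bounded_times[OF hwc])
  show "\<bar>f (eq (fst q) (snd q)) i\<bar> \<le> 1" if "q \<in> topspace ?T" "hw m (snd q) \<noteq> 0" for q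
   using that by (intro nsphere_coord_le1[of _ ?M] fS eqS)
  show "rcont (subtopology ?T {q. hw m (snd q) \<noteq> 0}) (\<lambda>q. f (eq (fst q) (snd q)) i)"
   by (rule fc[OF eqc])
 qed
 \<comment> \<open>If the value at the slid point is a pole, it has the sign of the height of the
   slid point, hence of \<open>p\<close>. The added height then points the same way and cannot
   cancel it.\<close>
 have s2: "htp ?S ?S (\<lambda>p. nz ?M (\<lambda>i. hw m p * f p i + p ?M * ?n i))
   (\<lambda>p. nz ?M (\<lambda>i. hw m p * f (eq 1 p) i + p ?M * ?n i))"
 proof (rule sphere_homotopy[where v = "\<lambda>q i. hw m (snd q) * f (eq (fst q) (snd q)) i + snd q ?M * ?n i"])
  show "rcont ?T (\<lambda>q. hw m (snd q) * f (eq (fst q) (snd q)) i + snd q ?M * ?n i)" for i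
   by (intro cont_arith hc pc cont_const)
  fix t p assume t: "t \<in> {0..1::real}" and p: "p \<in> topspace ?S"
  show "\<exists>i\<le>?M. hw m (snd (t, p)) * f (eq (fst (t, p)) (snd (t, p))) i + snd (t, p) ?M * ?n i \<noteq> 0"
  proof (cases "hw m p = 0")
   case True
   then show ?thesis using pole[OF p, of 0 "f p"] by simp
  next
   case False
   show ?thesis
   proof (cases "\<forall>i\<le>m. f (eq t p) i = 0")
    case True
    then have "eq t p ?M * f (eq t p) ?M > 0" using N eqS(1)[OF False] by blast
    then have "sgn (eq t p ?M) = sgn (f (eq t p) ?M)" "f (eq t p) ?M \<noteq> 0"
     by (auto simp: sgn_if zero_less_mult_iff)
    then have s: "sgn ((1 - t) * p ?M) = sgn (f (eq t p) ?M)" using eqS(2)[OF False, of t] by simp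
    then have "1 - t > 0" using t \<open>f (eq t p) ?M \<noteq> 0\<close> by (cases "t = 1") (auto simp: sgn_0_0)
    then have s': "sgn (p ?M) = sgn (f (eq t p) ?M)" using s by (simp add: sgn_mult)
    have "hw m p > 0" using False hw_nonneg[of m p] by simp
    then have "hw m p * f (eq t p) ?M + p ?M \<noteq> 0"
     using s' \<open>f (eq t p) ?M \<noteq> 0\<close>
     by (smt (verit) mult_pos_pos mult_pos_neg sgn_less sgn_greater)
    then show ?thesis by (intro exI[of _ ?M]) simp
   next
    case F: False
    then obtain j where "j \<le> m" "f (eq t p) j \<noteq> 0" by auto
    then show ?thesis using False by (intro exI[of _ j]) auto
   qed
  qed
 next
  fix p assume p: "p \<in> topspace ?S"
  have "(\<lambda>i. if i = ?M then (1 - 0) * p i else p i) = p" by auto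
  then have "eq 0 p = p" using nz_id[OF p] unfolding eq_def by simp
  then show "nz ?M (\<lambda>i. hw m (snd (0::real, p)) * f (eq (fst (0::real, p)) (snd (0, p))) i + snd (0::real, p) ?M * ?n i)
    = nz ?M (\<lambda>i. hw m p * f p i + p ?M * ?n i)" by simp
 qed simp
 have zS: "z \<in> topspace ?S" "z ?M = 0" if "z \<in> sph m" for z
  using that by (auto simp: topspace_nsphere)
 have fz: "\<exists>i\<le>m. f z i \<noteq> 0" if "z \<in> sph m" for z
  using N[OF zS(1)[OF that]] zS(2)[OF that] by auto
 \<comment> \<open>On the equator \<open>f\<close> avoids both poles by \<open>N\<close>, so its
   horizontal part can be normalised.\<close>
 define g where "g = (\<lambda>z. nz m (f z))"
 have gc: "cmap (nsphere m) (nsphere m) g"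
  unfolding g_def
 proof (rule continuous_map_nz)
  have "cmap (nsphere m) ?S (\<lambda>z. z)"
   using zS by (auto simp: continuous_map_nsphere continuous_map_nsphere_projection)
  then show "rcont (nsphere m) (\<lambda>z. f z i)" for i by (rule fc)
 qed (use fz in auto)
 have gS: "g z \<in> sph m" if "z \<in> sph m" for z
  using that gc by (auto dest: cm_funspace)
 have eq1: "eq 1 p = nz m p" if "p \<in> topspace ?S" for p
 proof -
  have "(\<Sum>j\<le>?M. (if j = ?M then (1 - 1) * p j else p j)\<^sup>2) = (\<Sum>j\<le>m. (p j)\<^sup>2)"
   by simp
  then show ?thesis unfolding eq_def nz_def by (auto simp: fun_eq_iff)
 qed
 have nzc: "cmap (subtopology ?T {q. hw m (snd q) \<noteq> 0}) ?S (\<lambda>q. nz m (snd q))"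
  using cm_compose[OF _ continuous_map_nz_sub, of m ?S "\<lambda>z. z" unit_interval] zS
  by (auto simp: continuous_map_nsphere continuous_map_nsphere_projection)
 have gc': "rcont ?T (\<lambda>q. hw m (snd q) * g (nz m (snd q)) i)" for i
 proof (rule continuous_map_bounded_times[OF hwc])
  show "\<bar>g (nz m (snd q)) i\<bar> \<le> 1" if "q \<in> topspace ?T" "hw m (snd q) \<noteq> 0" for q
   using that by (intro nsphere_coord_le1[of _ m] gS nz_in)
  show "rcont (subtopology ?T {q. hw m (snd q) \<noteq> 0}) (\<lambda>q. g (nz m (snd q)) i)"
   by (rule continuous_map_nsphere_coord[OF cm_compose[OF gc continuous_map_nz_sub]])
 qed
 have fc': "rcont ?T (\<lambda>q. hw m (snd q) * f (nz m (snd q)) i)" for i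
 proof (rule continuous_map_bounded_times[OF hwc])
  show "\<bar>f (nz m (snd q)) i\<bar> \<le> 1" if "q \<in> topspace ?T" "hw m (snd q) \<noteq> 0" for q
   using that by (intro nsphere_coord_le1[of _ ?M] fS zS nz_in)
  show "rcont (subtopology ?T {q. hw m (snd q) \<noteq> 0}) (\<lambda>q. f (nz m (snd q)) i)"
   by (rule fc[OF nzc])
 qed
 have s3: "htp ?S ?S (\<lambda>p. nz ?M (\<lambda>i. hw m p * f (eq 1 p) i + p ?M * ?n i)) (susp m g)"
 proof (rule sphere_homotopy[where v = "\<lambda>q i. (1 - fst q) * (hw m (snd q) * f (nz m (snd q)) i)
    + fst q * (hw m (snd q) * g (nz m (snd q)) i) + snd q ?M * ?n i"])
  show "rcont ?T (\<lambda>q. (1 - fst q) * (hw m (snd q) * f (nz m (snd q)) i)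
    + fst q * (hw m (snd q) * g (nz m (snd q)) i) + snd q ?M * ?n i)" for i
   by (intro cont_arith fc' gc' pc cont_const cont_fst_I)
  fix t p assume t: "t \<in> {0..1::real}" and p: "p \<in> topspace ?S"
  show "\<exists>i\<le>?M. (1 - fst (t, p)) * (hw m (snd (t, p)) * f (nz m (snd (t, p))) i)
    + fst (t, p) * (hw m (snd (t, p)) * g (nz m (snd (t, p))) i) + snd (t, p) ?M * ?n i \<noteq> 0"
  proof (cases "hw m p = 0")
   case True
   then show ?thesis using pole[OF p, of 0 "f p"] by simp
  next
   case False
   then have z: "nz m p \<in> sph m" by (rule nz_in)
   obtain j where j: "j \<le> m" "f (nz m p) j \<noteq> 0" using fz[OF z] by auto
   define c where "c = sqrt (\<Sum>i\<le>m. (f (nz m p) i)\<^sup>2)"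
   have c: "c > 0" unfolding c_def using sum_squares_pos[of j m "f (nz m p)"] j by simp
   have "g (nz m p) j = f (nz m p) j / c"
    using j(1) unfolding g_def nz_def[of m "f (nz m p)"] c_def by simp
   then have "(1 - t) * (hw m p * f (nz m p) j) + t * (hw m p * g (nz m p) j)
     = hw m p * f (nz m p) j * ((1 - t) + t / c)"
    by (simp add: algebra_simps)
   moreover have "(1 - t) + t / c > 0"
    using t c by (cases "t = 0") (auto intro: add_nonneg_pos)
   ultimately show ?thesis using j False by (intro exI[of _ j]) auto
  qed
 next
  fix p assume p: "p \<in> topspace ?S"
  show "nz ?M (\<lambda>i. (1 - fst (0::real, p)) * (hw m (snd (0::real, p)) * f (nz m (snd (0::real, p))) i)
    + fst (0::real, p) * (hw m (snd (0::real, p)) * g (nz m (snd (0::real, p))) i) + snd (0::real, p) ?M * ?n i)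
   = nz ?M (\<lambda>i. hw m p * f (eq 1 p) i + p ?M * ?n i)" by (simp add: eq1[OF p])
  have "susp m g p \<in> topspace ?S" using gS nz_in p by (intro susp_nsphere) auto
  then have "nz ?M (susp m g p) = susp m g p" by (rule nz_id)
  moreover have "nz ?M (\<lambda>i. hw m p * g (nz m p) i + p ?M * ?n i) = nz ?M (susp m g p)"
  proof -
   have "hw m p * g (nz m p) i + p ?M * ?n i = susp m g p i" if "i \<le> ?M" for i
    using that by (cases "i = ?M") (auto simp: susp_def g_def nz_def)
   then show ?thesis unfolding nz_def by (auto simp: fun_eq_iff intro!: arg_cong[of _ _ "\<lambda>x. _ / sqrt x"] sum.cong)
  qed
  ultimately show "nz ?M (\<lambda>i. (1 - fst (1::real, p)) * (hw m (snd (1::real, p)) * f (nz m (snd (1::real, p))) i)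
    + fst (1::real, p) * (hw m (snd (1::real, p)) * g (nz m (snd (1::real, p))) i) + snd (1::real, p) ?M * ?n i) = susp m g p"
   by simp
 qed
 show ?thesis
  using that[OF gc] htp_trans[OF htp_trans[OF s1 s2] s3] by blast
qed

section \<open>General position\<close>

text \<open>Counting: if every point of the target cube were hit, preimages of the points of a grid
  of mesh \<open>1/Q\<close> would lie in different cells of mesh \<open>1/N\<close> of the
  \<open>d\<close>-cube, of which there are too few.\<close>

lemma lipschitz_misses_point:
 fixes G :: "(nat \<Rightarrow> real) \<Rightarrow> nat \<Rightarrow> real"
 assumes d: "d < D" and lip: "\<And>x y i. x \<in> UNIV \<rightarrow> {0..1} \<Longrightarrow> y \<in> UNIV \<rightarrow> {0..1} \<Longrightarrow> i < D \<Longrightarrow>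
   \<bar>G x i - G y i\<bar> \<le> L * (\<Sum>j<d. \<bar>x j - y j\<bar>)"
 obtains v where "v \<in> UNIV \<rightarrow> {0..1}" "\<And>x. x \<in> UNIV \<rightarrow> {0..1} \<Longrightarrow> \<exists>i<D. G x i \<noteq> v i"
proof (rule ccontr)
 assume neg: "\<not> thesis"
 have hit: "\<exists>x \<in> UNIV \<rightarrow> {0..1}. \<forall>i<D. G x i = v i" if "v \<in> UNIV \<rightarrow> {0..1}" for v
  using neg that by (metis \<open>\<And>v. v \<in> UNIV \<rightarrow> {0..1} \<Longrightarrow> (\<And>x. x \<in> UNIV \<rightarrow> {0..1} \<Longrightarrow> \<exists>i<D. G x i \<noteq> v i) \<Longrightarrow> thesis\<close>)
 define c where "c = nat \<lceil>\<bar>L\<bar> * real d\<rceil> + 1"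
 \<comment> \<open>With \<open>c > |L| d\<close> and cells of mesh \<open>1/(c Q)\<close> the
   Lipschitz bound separates grid points. This costs a factor \<open>c ^ d\<close> in the number of
   cells; as \<open>Q = c ^ d\<close>, one additional direction of the grid outweighs it.\<close>
 define Q where "Q = c ^ d"
 define N where "N = c * Q"
 have c: "real c > \<bar>L\<bar> * real d" "c \<ge> 1" unfolding c_def by linarith+
 have Q: "Q \<ge> 1" using c(2) by (simp add: Q_def)
 have N: "N \<ge> 1" using c(2) Q by (simp add: N_def)
 let ?T = "{..<D} \<rightarrow>\<^sub>E {..Q}" and ?C = "{..<d} \<rightarrow>\<^sub>E {..N}"
 define v where "v = (\<lambda>a i. if i < D then real (a i) / real Q else 0)"
 have vI: "v a \<in> UNIV \<rightarrow> {0..1}" if "a \<in> ?T" for a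
 proof
  fix i show "v a i \<in> {0..1}"
  proof (cases "i < D")
   case True
   then have "a i \<le> Q" using that by auto
   then show ?thesis using True Q by (simp add: v_def divide_le_eq)
  qed (simp add: v_def)
 qed
 define x where "x = (\<lambda>a. SOME x. x \<in> UNIV \<rightarrow> {0..1} \<and> (\<forall>i<D. G x i = v a i))"
 have x: "x a \<in> UNIV \<rightarrow> {0..1}" "\<And>i. i < D \<Longrightarrow> G (x a) i = v a i" if "a \<in> ?T" for a
  using someI_ex[of "\<lambda>x. x \<in> UNIV \<rightarrow> {0..1} \<and> (\<forall>i<D. G x i = v a i)"] hit[OF vI[OF that]]
  unfolding x_def by blast+
 define cell where "cell = (\<lambda>a. restrict (\<lambda>j. nat \<lfloor>real N * x a j\<rfloor>) {..<d})"
 have "inj_on cell ?T"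
 proof (rule inj_onI)
  fix a b assume a: "a \<in> ?T" and b: "b \<in> ?T" and e: "cell a = cell b"
  have near: "\<bar>x a j - x b j\<bar> \<le> 1 / real N" if "j < d" for j
  proof -
   have "cell a j = cell b j" by (simp add: e)
   then have "nat \<lfloor>real N * x a j\<rfloor> = nat \<lfloor>real N * x b j\<rfloor>" using that by (simp add: cell_def)
   moreover have "x a j \<ge> 0" "x b j \<ge> 0" using x(1)[OF a] x(1)[OF b] by (auto simp: Pi_iff)
   then have "\<lfloor>real N * x a j\<rfloor> \<ge> 0" "\<lfloor>real N * x b j\<rfloor> \<ge> 0" by simp_all
   ultimately have "\<lfloor>real N * x a j\<rfloor> = \<lfloor>real N * x b j\<rfloor>"
    using eq_nat_nat_iff by blast
   then have "\<bar>real N * x a j - real N * x b j\<bar> \<le> 1" by linarith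
   then have "real N * \<bar>x a j - x b j\<bar> \<le> 1"
    by (metis abs_mult abs_of_nat right_diff_distrib)
   then show ?thesis using N by (simp add: field_simps)
  qed
  have "(\<Sum>j<d. \<bar>x a j - x b j\<bar>) \<le> real d * (1 / real N)"
   using sum_bounded_above[of "{..<d}" "\<lambda>j. \<bar>x a j - x b j\<bar>" "1 / real N"] near by simp
  moreover have "(\<Sum>j<d. \<bar>x a j - x b j\<bar>) \<ge> 0" by (rule sum_nonneg) auto
  ultimately have "L * (\<Sum>j<d. \<bar>x a j - x b j\<bar>) \<le> \<bar>L\<bar> * (real d * (1 / real N))"
   by (intro mult_mono) auto
  also have "\<dots> < 1 / real Q"
   using c Q N by (simp add: N_def field_simps)
  finally have lt: "L * (\<Sum>j<d. \<bar>x a j - x b j\<bar>) < 1 / real Q" .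
  have "a i = b i" if "i < D" for i
  proof -
   have "\<bar>real (a i) / real Q - real (b i) / real Q\<bar> < 1 / real Q"
    using lip[OF x(1)[OF a] x(1)[OF b] that] lt that by (simp add: x(2)[OF a] x(2)[OF b] v_def)
   then have "\<bar>real (a i) - real (b i)\<bar> / real Q < 1 / real Q"
    by (simp flip: diff_divide_distrib)
   then have "\<bar>real (a i) - real (b i)\<bar> < 1" using Q by (simp add: divide_less_cancel)
   then show ?thesis by linarith
  qed
  then show "a = b" using a b by (intro PiE_ext) auto
 qed
 moreover have "cell ` ?T \<subseteq> ?C"
 proof (intro subsetI, elim imageE)
  fix u a assume "u = cell a" and a: "a \<in> ?T"
  moreover have "nat \<lfloor>real N * x a j\<rfloor> \<le> N" for j
  proof -
   have "x a j \<le> 1" using x(1)[OF a] by (auto simp: Pi_iff)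
   then have "real N * x a j \<le> real N" by (simp add: mult_left_le)
   then show ?thesis by linarith
  qed
  ultimately show "u \<in> ?C" by (auto simp: cell_def)
 qed
 ultimately have "card ?T \<le> card ?C"
  by (intro card_inj_on_le finite_PiE) auto
 then have "Suc Q ^ D \<le> Suc N ^ d"
  by (simp add: card_PiE)
 also have "\<dots> \<le> (c * Suc Q) ^ d"
  using c(2) by (intro power_mono) (auto simp: N_def)
 also have "\<dots> = Q * Suc Q ^ d" by (simp only: power_mult_distrib Q_def)
 also have "\<dots> < Suc Q * Suc Q ^ d" by simp
 also have "\<dots> = Suc Q ^ Suc d" by simp
 also have "\<dots> \<le> Suc Q ^ D"
  using d by (intro power_increasing) auto
 finally show False by simp
qed

text \<open>Spherical coordinates, with the circle parametrised by \<open>[0,1]\<close>.\<close>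

fun ang :: "nat \<Rightarrow> (nat \<Rightarrow> real) \<Rightarrow> nat \<Rightarrow> real" where
 "ang 0 y = e1"
| "ang (Suc m) y = (\<lambda>i. if i \<le> m then cos (2 * pi * y m) * ang m y i
   else if i = Suc m then sin (2 * pi * y m) else 0)"

lemma ang_nsphere: "ang m y \<in> sph m"
proof (induction m)
 case 0
 then show ?case using in_topspace_nsphere[of 0] by simp
next
 case (Suc m)
 have "(\<Sum>i\<le>m. (ang (Suc m) y i)\<^sup>2) = (cos (2 * pi * y m))\<^sup>2 * (\<Sum>i\<le>m. (ang m y i)\<^sup>2)"
  unfolding sum_distrib_left by (rule sum.cong) (auto simp: power_mult_distrib)
 then show ?case using Suc by (auto simp: topspace_nsphere)
qed

lemma ang_cong: "(\<And>i. i < m \<Longrightarrow> y i = y' i) \<Longrightarrow> ang m y = ang m y'"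
 by (induction m) auto

lemma sincos_unit:
 assumes "c\<^sup>2 + s\<^sup>2 = (1::real)"
 obtains u where "0 \<le> u" "u \<le> 1" "c = cos (2 * pi * u)" "s = sin (2 * pi * u)"
proof -
 obtain t where t: "0 \<le> t" "t \<le> 2 * pi" "c = cos t" "s = sin t"
  using sincos_total_2pi_le[OF assms] by metis
 then show ?thesis by (intro that[of "t / (2 * pi)"]) auto
qed

text \<open>The horizontal norm and the height form a point of the unit circle, whose angle is the
  new coordinate.\<close>

lemma ang_extend:
 assumes p: "p \<in> sph (Suc m)" and z: "\<And>i. i \<le> m \<Longrightarrow> p i = hw m p * ang m y i"
 obtains u where "0 \<le> u" "u \<le> 1" "ang (Suc m) (y(m := u)) = p"
proof -
 obtain u where u: "0 \<le> u" "u \<le> 1" "hw m p = cos (2 * pi * u)" "p (Suc m) = sin (2 * pi * u)"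
  using sincos_unit[OF hw_nsphere[OF p]] by blast
 have "ang m (y(m := u)) = ang m y" by (rule ang_cong) auto
 then have "ang (Suc m) (y(m := u)) = p"
  using z u p by (auto simp: fun_eq_iff topspace_nsphere)
 then show ?thesis using that u by blast
qed

lemma ang_surj:
 assumes "p \<in> sph (Suc m)"
 shows "\<exists>y \<in> UNIV \<rightarrow> {0..1}. ang (Suc m) y = p"
 using assms
proof (induction m arbitrary: p)
 case 0
 have "(p 0)\<^sup>2 + (p 1)\<^sup>2 = 1" using 0 by (simp add: topspace_nsphere)
 then obtain u where u: "0 \<le> u" "u \<le> 1" "p 0 = cos (2 * pi * u)" "p 1 = sin (2 * pi * u)"
  by (rule sincos_unit)
 have "ang (Suc 0) (\<lambda>_. u) = p"
  using u 0 by (auto simp: fun_eq_iff topspace_nsphere)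
 then show ?case using u by (intro bexI[of _ "\<lambda>_. u"]) auto
next
 case (Suc m)
 have "\<exists>z \<in> sph (Suc m). \<forall>i\<le>Suc m. p i = hw (Suc m) p * z i"
 proof (cases "hw (Suc m) p = 0")
  case True
  then show ?thesis using in_topspace_nsphere[of "Suc m"] hw_zero[of "Suc m" p] by auto
 next
  case False
  then show ?thesis using hw_nz nz_in by metis
 qed
 then obtain y where y: "y \<in> UNIV \<rightarrow> {0..1}" "\<And>i. i \<le> Suc m \<Longrightarrow> p i = hw (Suc m) p * ang (Suc m) y i"
  using Suc.IH by metis
 obtain u where "0 \<le> u" "u \<le> 1" "ang (Suc (Suc m)) (y(Suc m := u)) = p"
  using ang_extend[OF Suc.prems y(2)] by blast
 moreover from this y(1) have "y(Suc m := u) \<in> UNIV \<rightarrow> {0..1}" by (auto simp: Pi_iff)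
 ultimately show ?case by blast
qed

section \<open>Lipschitz functions on spheres\<close>

lemma abs_cos_diff_le: "\<bar>cos a - cos b\<bar> \<le> \<bar>a - b\<bar>" "\<bar>sin a - sin b\<bar> \<le> \<bar>a - (b::real)\<bar>"
proof -
 have "norm (cos a - cos b) \<le> 1 * norm (a - b)"
  by (rule field_differentiable_bound[of UNIV cos "\<lambda>x. - sin x"])
    (auto intro!: derivative_eq_intros)
 then show "\<bar>cos a - cos b\<bar> \<le> \<bar>a - b\<bar>" by simp
 have "norm (sin a - sin b) \<le> 1 * norm (a - b)"
  by (rule field_differentiable_bound[of UNIV sin cos])
    (auto intro!: derivative_eq_intros)
 then show "\<bar>sin a - sin b\<bar> \<le> \<bar>a - b\<bar>" by simp
qed

lemma ang_lipschitz: "\<bar>ang m y i - ang m y' i\<bar> \<le> 2 * pi * (\<Sum>j<m. \<bar>y j - y' j\<bar>)"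
proof (induction m)
 case (Suc m)
 have 1: "\<bar>2 * pi * y m - 2 * pi * y' m\<bar> = 2 * pi * \<bar>y m - y' m\<bar>"
  by (simp add: abs_mult flip: right_diff_distrib)
 have s: "\<bar>sin (2 * pi * y m) - sin (2 * pi * y' m)\<bar> \<le> 2 * pi * \<bar>y m - y' m\<bar>"
  "\<bar>cos (2 * pi * y m) - cos (2 * pi * y' m)\<bar> \<le> 2 * pi * \<bar>y m - y' m\<bar>"
  using abs_cos_diff_le[of "2 * pi * y m" "2 * pi * y' m"] unfolding 1 by auto
 have "(\<Sum>j<m. \<bar>y j - y' j\<bar>) \<ge> 0" by (rule sum_nonneg) auto
 then have nn: "2 * pi * (\<Sum>j<m. \<bar>y j - y' j\<bar>) \<ge> 0" by simp
 consider "i \<le> m" | "i = Suc m" | "i > Suc m" by linarith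
 then show ?case
 proof cases
  case 1
  have "ang (Suc m) y i - ang (Suc m) y' i = (cos (2 * pi * y m) - cos (2 * pi * y' m)) * ang m y i
    + cos (2 * pi * y' m) * (ang m y i - ang m y' i)"
   using 1 by (simp add: algebra_simps)
  also have "\<bar>\<dots>\<bar> \<le> \<bar>cos (2 * pi * y m) - cos (2 * pi * y' m)\<bar> * \<bar>ang m y i\<bar>
    + \<bar>cos (2 * pi * y' m)\<bar> * \<bar>ang m y i - ang m y' i\<bar>"
   by (metis abs_mult abs_triangle_ineq)
  also have "\<dots> \<le> (2 * pi * \<bar>y m - y' m\<bar>) * 1 + 1 * (2 * pi * (\<Sum>j<m. \<bar>y j - y' j\<bar>))"
   using s(2) Suc nsphere_coord_le1[OF ang_nsphere] by (intro add_mono mult_mono) auto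
  finally show ?thesis by (simp add: algebra_simps)
 next
  case 2
  then have "\<bar>ang (Suc m) y i - ang (Suc m) y' i\<bar> = \<bar>sin (2 * pi * y m) - sin (2 * pi * y' m)\<bar>" by simp
  moreover have "2 * pi * (\<Sum>j<Suc m. \<bar>y j - y' j\<bar>) = 2 * pi * (\<Sum>j<m. \<bar>y j - y' j\<bar>) + 2 * pi * \<bar>y m - y' m\<bar>"
   by (simp add: distrib_left)
  ultimately show ?thesis using s(1) nn by linarith
 next
  case 3
  then show ?thesis using nn by (simp add: distrib_left)
 qed
qed simp

text \<open>A bound is included so that products stay in the class; one constant serves as bound and
  as Lipschitz constant.\<close>

definition lipsch :: "nat \<Rightarrow> (nat \<Rightarrow> real) set \<Rightarrow> ((nat \<Rightarrow> real) \<Rightarrow> real) \<Rightarrow> real \<Rightarrow> bool" where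
 "lipsch n S f L \<longleftrightarrow> L \<ge> 0 \<and> (\<forall>x \<in> S. \<bar>f x\<bar> \<le> L) \<and> (\<forall>x \<in> S. \<forall>y \<in> S. \<bar>f x - f y\<bar> \<le> L * (\<Sum>i<n. \<bar>x i - y i\<bar>))"

lemma lipsch_mono:
 assumes "lipsch n S f L" "L \<le> L'"
 shows "lipsch n S f L'"
proof -
 have "L * (\<Sum>i<n. \<bar>x i - y i\<bar>) \<le> L' * (\<Sum>i<n. \<bar>x i - y i\<bar>)" for x y :: "nat \<Rightarrow> real"
  using assms(2) by (intro mult_right_mono sum_nonneg) auto
 then show ?thesis using assms unfolding lipsch_def by (meson order_trans)
qed

lemma lipsch_add:
 assumes "lipsch n S f L" "lipsch n S g L'"
 shows "lipsch n S (\<lambda>x. f x + g x) (L + L')"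
 unfolding lipsch_def
proof (intro conjI ballI)
 show "L + L' \<ge> 0" using assms by (simp add: lipsch_def)
 show "\<bar>f x + g x\<bar> \<le> L + L'" if "x \<in> S" for x
  using assms that unfolding lipsch_def by (meson abs_triangle_ineq add_mono order_trans)
 fix x y assume "x \<in> S" "y \<in> S"
 then have "\<bar>f x - f y\<bar> \<le> L * (\<Sum>i<n. \<bar>x i - y i\<bar>)" "\<bar>g x - g y\<bar> \<le> L' * (\<Sum>i<n. \<bar>x i - y i\<bar>)"
  using assms by (auto simp: lipsch_def)
 then show "\<bar>f x + g x - (f y + g y)\<bar> \<le> (L + L') * (\<Sum>i<n. \<bar>x i - y i\<bar>)"
  unfolding distrib_right by linarith
qed

lemma lipsch_mult:
 assumes f: "lipsch n S f L" and g: "lipsch n S g L'"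
 shows "lipsch n S (\<lambda>x. f x * g x) (2 * L * L')"
 unfolding lipsch_def
proof (intro conjI ballI)
 have L: "L \<ge> 0" "L' \<ge> 0" using assms by (auto simp: lipsch_def)
 then show "2 * L * L' \<ge> 0" by simp
 have b: "\<bar>f x\<bar> \<le> L" "\<bar>g x\<bar> \<le> L'" if "x \<in> S" for x using f g that by (auto simp: lipsch_def)
 show "\<bar>f x * g x\<bar> \<le> 2 * L * L'" if "x \<in> S" for x
 proof -
  have "\<bar>f x * g x\<bar> \<le> L * L'" unfolding abs_mult using b[OF that] L by (intro mult_mono) auto
  moreover have "L * L' \<ge> 0" using L by simp
  ultimately show ?thesis by simp
 qed
 fix x y assume x: "x \<in> S" and y: "y \<in> S"
 let ?d = "\<Sum>i<n. \<bar>x i - y i\<bar>"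
 have d: "\<bar>f x - f y\<bar> \<le> L * ?d" "\<bar>g x - g y\<bar> \<le> L' * ?d"
  using f g x y by (auto simp: lipsch_def)
 have "f x * g x - f y * g y = f x * (g x - g y) + (f x - f y) * g y" by (simp add: algebra_simps)
 also have "\<bar>\<dots>\<bar> \<le> \<bar>f x\<bar> * \<bar>g x - g y\<bar> + \<bar>f x - f y\<bar> * \<bar>g y\<bar>"
  by (metis abs_mult abs_triangle_ineq)
 also have "\<dots> \<le> L * (L' * ?d) + (L * ?d) * L'"
  using b[OF x] b[OF y] d L by (intro add_mono mult_mono) auto
 finally show "\<bar>f x * g x - f y * g y\<bar> \<le> 2 * L * L' * ?d" by (simp add: algebra_simps)
qed

text \<open>The cutoff at \<open>e\<close> keeps the inverse Lipschitz on all of \<open>S\<close>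
  and changes nothing where \<open>f\<close> is at least \<open>e\<close>.\<close>

lemma lipsch_inverse_max:
 assumes f: "lipsch n S f L" and e: "e > 0"
 shows "lipsch n S (\<lambda>x. 1 / max (f x) e) (1 / e + L / e\<^sup>2)"
 unfolding lipsch_def
proof (intro conjI ballI)
 have L: "L \<ge> 0" using f by (simp add: lipsch_def)
 then show "1 / e + L / e\<^sup>2 \<ge> 0" using e by simp
 have le: "1 / max (f x) e \<le> 1 / e" "1 / max (f x) e \<ge> 0" for x
  using e by (auto simp: field_simps max_def)
 show "\<bar>1 / max (f x) e\<bar> \<le> 1 / e + L / e\<^sup>2" if "x \<in> S" for x
 proof -
  have "L / e\<^sup>2 \<ge> 0" using L by simp
  then show ?thesis using le[of x] by simp
 qed
 fix x y assume x: "x \<in> S" and y: "y \<in> S"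
 let ?d = "\<Sum>i<n. \<bar>x i - y i\<bar>"
 have dn: "?d \<ge> 0" by (rule sum_nonneg) auto
 have d: "\<bar>f x - f y\<bar> \<le> L * ?d" using f x y by (auto simp: lipsch_def)
 have p: "max (f x) e > 0" "max (f y) e > 0" using e by auto
 have "1 / max (f x) e - 1 / max (f y) e = (max (f y) e - max (f x) e) * (1 / max (f x) e) * (1 / max (f y) e)"
  using p by (simp add: field_simps)
 also have "\<bar>\<dots>\<bar> = \<bar>max (f y) e - max (f x) e\<bar> * (1 / max (f x) e) * (1 / max (f y) e)"
  using p by (simp add: abs_mult)
 also have "\<dots> \<le> (L * ?d) * (1 / e) * (1 / e)"
  using d le L dn e by (intro mult_mono) (auto simp: max_def)
 also have "\<dots> = (L / e\<^sup>2) * ?d" by (simp add: power2_eq_square)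
 also have "\<dots> \<le> (1 / e + L / e\<^sup>2) * ?d"
  using e dn by (intro mult_right_mono) auto
 finally show "\<bar>1 / max (f x) e - 1 / max (f y) e\<bar> \<le> (1 / e + L / e\<^sup>2) * ?d" .
qed

text \<open>Stone-Weierstrass for the algebra of continuous Lipschitz functions, which contains the
  coordinates.\<close>

lemma lipschitz_approximation:
 assumes f: "rcont (nsphere n) f" and e: "e > 0"
 obtains g L where "lipsch (Suc n) (sph n) g L" "rcont (nsphere n) g"
  "\<And>x. x \<in> sph n \<Longrightarrow> \<bar>f x - g x\<bar> < e"
proof -
 let ?S = "sph n"
 have S: "nsphere n = top_of_set ?S"
 proof -
  have "?S = {x. (\<Sum>i\<le>n. (x i)\<^sup>2) = 1 \<and> (\<forall>i>n. x i = 0)}" by (auto simp: topspace_nsphere)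
  then show ?thesis unfolding nsphere by (simp add: euclidean_product_topology)
 qed
 have cont: "rcont (nsphere n) h \<longleftrightarrow> continuous_on ?S h" for h :: "(nat \<Rightarrow> real) \<Rightarrow> real"
  by (subst S) (simp add: continuous_map_iff_continuous)
 let ?R = "{h. continuous_on ?S h \<and> (\<exists>L. lipsch (Suc n) ?S h L)}"
 interpret function_ring_on ?R ?S
 proof
  show "compact ?S"
   using compact_space_nsphere[of n] by (subst (asm) S) (simp add: compact_space_def compactin_subtopology)
  show "\<exists>f\<in>?R. f x \<noteq> f y" if xy: "x \<in> ?S" "y \<in> ?S" "x \<noteq> y" for x y
  proof -
   obtain j where j: "x j \<noteq> y j" using xy(3) by auto
   then have jn: "j < Suc n" using xy(1,2) by (auto simp: topspace_nsphere not_less) (metis Suc_le_eq not_less)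
   have "\<bar>u j - w j\<bar> \<le> 1 * (\<Sum>i<Suc n. \<bar>u i - w i\<bar>)" for u w :: "nat \<Rightarrow> real"
    using member_le_sum[of j "{..<Suc n}" "\<lambda>i. \<bar>u i - w i\<bar>"] jn by auto
   then have "lipsch (Suc n) ?S (\<lambda>x. x j) 1"
    using nsphere_coord_le1 by (auto simp: lipsch_def)
   moreover have "continuous_on ?S (\<lambda>x. x j)"
    using cont continuous_map_nsphere_projection by blast
   ultimately have "(\<lambda>x. x j) \<in> ?R" by auto
   then show ?thesis using j by (intro bexI[of _ "\<lambda>x. x j"])
  qed
  show "(\<lambda>_. c) \<in> ?R" for c
  proof -
   have "lipsch (Suc n) ?S (\<lambda>_. c) \<bar>c\<bar>"
    by (auto simp: lipsch_def intro!: mult_nonneg_nonneg sum_nonneg)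
   then show ?thesis by auto
  qed
 qed (auto intro: continuous_intros lipsch_add lipsch_mult)
 have "continuous_on ?S f" using f cont by simp
 from Stone_Weierstrass_basic[OF this e] obtain g where g: "g \<in> ?R" "\<forall>x \<in> ?S. \<bar>f x - g x\<bar> < e" ..
 from g(1) obtain L where "continuous_on ?S g" "lipsch (Suc n) ?S g L" by auto
 then show ?thesis using that[of g L] g(2) cont by simp
qed

text \<open>The half circle from pole to pole in the direction \<open>z\<close>; both poles lie on
  every meridian.\<close>

definition meridian :: "nat \<Rightarrow> (nat \<Rightarrow> real) \<Rightarrow> (nat \<Rightarrow> real) set" where
 "meridian m z = {p \<in> sph (Suc m). \<forall>i\<le>m. p i = hw m p * z i}"

lemma meridian_nz:
 assumes "p \<in> sph (Suc m)"
 shows "\<exists>z \<in> sph m. p \<in> meridian m z"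
proof (cases "hw m p = 0")
 case True
 then show ?thesis
  using in_topspace_nsphere[of m] hw_zero[of m p] assms by (auto simp: meridian_def)
next
 case False
 then show ?thesis using assms nz_in[of m p] hw_nz by (auto simp: meridian_def intro!: bexI[of _ "nz m p"])
qed

text \<open>Pairs of points on a common meridian form an \<open>(m+2)\<close>-dimensional family; a Lipschitz map takes it
 to a null set of the \<open>2(m+1)\<close>-dimensional space of pairs of directions.\<close>

lemma generic_directions:
 assumes m: "m \<ge> 1" and g: "\<And>i. i \<le> Suc m \<Longrightarrow> lipsch (Suc (Suc m)) (sph (Suc m)) (\<lambda>p. g p i) L"
  and \<delta>: "\<delta> > 0"
 obtains \<alpha> \<beta> where "\<And>i. \<alpha> i \<in> {0..1}" "\<And>i. \<beta> i \<in> {0..1}"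
  "\<And>z p p'. z \<in> sph m \<Longrightarrow> p \<in> meridian m z \<Longrightarrow> p' \<in> meridian m z \<Longrightarrow>
    \<not> (g p (Suc m) \<ge> \<delta> \<and> (\<forall>i\<le>m. g p i = \<alpha> i * g p (Suc m)) \<and>
     - g p' (Suc m) \<ge> \<delta> \<and> (\<forall>i\<le>m. g p' i = \<beta> i * - g p' (Suc m)))"
proof -
 let ?S = "sph (Suc m)" and ?M = "Suc m"
 \<comment> \<open>Two points on a common meridian can share their first \<open>m\<close> angles;
   \<open>y m\<close> is the last angle of the first point and \<open>y (m + 1)\<close> that of the
   second. The function \<open>u\<close> below is the slope of the value, with a cutoff at
   \<open>\<delta>\<close>.\<close>
 let ?P = "\<lambda>y. ang ?M y" and ?P' = "\<lambda>y. ang ?M (y(m := y ?M))"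
 define u where "u = (\<lambda>(s::real) p i. g p i * (1 / max (s * g p ?M) \<delta>))"
 have L0: "L \<ge> 0" using g[of 0] by (simp add: lipsch_def)
 have neg: "lipsch (Suc ?M) ?S (\<lambda>p. s * g p ?M) L" if "s = 1 \<or> s = -1" for s
 proof -
  have "\<bar>s * a - s * b\<bar> = \<bar>a - b\<bar>" "\<bar>s * a\<bar> = \<bar>a\<bar>" for a b using that by auto
  then show ?thesis using g[of ?M] unfolding lipsch_def by simp
 qed
 define L' where "L' = 2 * L * (1 / \<delta> + L / \<delta>\<^sup>2)"
 have ul: "lipsch (Suc ?M) ?S (\<lambda>p. u s p i) L'" if "i \<le> m" "s = 1 \<or> s = -1" for s i
  unfolding u_def L'_def using that g[of i] by (intro lipsch_mult lipsch_inverse_max neg \<delta>) auto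
 have L'0: "L' \<ge> 0" using ul[of 0 1] by (simp add: lipsch_def)
 define K where "K = L' * (real (Suc ?M) * (2 * pi))"
 have angl: "(\<Sum>i<Suc ?M. \<bar>ang ?M x i - ang ?M y i\<bar>) \<le> real (Suc ?M) * (2 * pi * (\<Sum>j<?M. \<bar>x j - y j\<bar>))" for x y
 proof -
  have "(\<Sum>i<Suc ?M. \<bar>ang ?M x i - ang ?M y i\<bar>) \<le> of_nat (card {..<Suc ?M}) * (2 * pi * (\<Sum>j<?M. \<bar>x j - y j\<bar>))"
   by (rule sum_bounded_above) (rule ang_lipschitz)
  then show ?thesis by (simp only: card_lessThan)
 qed
 have ulip: "\<bar>u s (ang ?M x) i - u s (ang ?M y) i\<bar> \<le> K * (\<Sum>j<?M. \<bar>x j - y j\<bar>)" if "i \<le> m" "s = 1 \<or> s = -1" for s x y i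
 proof -
  have "\<bar>u s (ang ?M x) i - u s (ang ?M y) i\<bar> \<le> L' * (\<Sum>i<Suc ?M. \<bar>ang ?M x i - ang ?M y i\<bar>)"
   using ul[OF that] ang_nsphere unfolding lipsch_def by blast
  also have "\<dots> \<le> L' * (real (Suc ?M) * (2 * pi * (\<Sum>j<?M. \<bar>x j - y j\<bar>)))"
   using angl L'0 by (rule mult_left_mono)
  finally show ?thesis by (simp only: K_def mult.assoc)
 qed
 have K0: "K \<ge> 0" using L'0 by (simp add: K_def)
 have sums: "(\<Sum>j<?M. \<bar>x j - y j\<bar>) \<le> (\<Sum>j<Suc ?M. \<bar>x j - y j\<bar>)"
  "(\<Sum>j<?M. \<bar>(x(m := x ?M)) j - (y(m := y ?M)) j\<bar>) \<le> (\<Sum>j<Suc ?M. \<bar>x j - y j\<bar>)" for x y :: "nat \<Rightarrow> real"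
 proof -
  have "(\<Sum>j<m. \<bar>(x(m := x ?M)) j - (y(m := y ?M)) j\<bar>) = (\<Sum>j<m. \<bar>x j - y j\<bar>)"
   by (rule sum.cong) auto
  then show "(\<Sum>j<?M. \<bar>(x(m := x ?M)) j - (y(m := y ?M)) j\<bar>) \<le> (\<Sum>j<Suc ?M. \<bar>x j - y j\<bar>)"
   by simp
 qed simp
 define G where "G = (\<lambda>y i. if i \<le> m then u 1 (?P y) i else u (-1) (?P' y) (i - ?M))"
 have "\<bar>G x i - G y i\<bar> \<le> K * (\<Sum>j<Suc ?M. \<bar>x j - y j\<bar>)" if "i < 2 * ?M" for x y i
 proof (cases "i \<le> m")
  case True
  have "\<bar>G x i - G y i\<bar> \<le> K * (\<Sum>j<?M. \<bar>x j - y j\<bar>)"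
   using ulip[OF True, of 1 x y] True by (simp add: G_def)
  also have "\<dots> \<le> K * (\<Sum>j<Suc ?M. \<bar>x j - y j\<bar>)"
   using sums(1) K0 by (rule mult_left_mono)
  finally show ?thesis .
 next
  case False
  have "\<bar>G x i - G y i\<bar> \<le> K * (\<Sum>j<?M. \<bar>(x(m := x ?M)) j - (y(m := y ?M)) j\<bar>)"
   using ulip[of "i - ?M" "-1" "x(m := x ?M)" "y(m := y ?M)"] False that by (simp only: G_def if_False) auto
  also have "\<dots> \<le> K * (\<Sum>j<Suc ?M. \<bar>x j - y j\<bar>)"
   using sums(2) K0 by (rule mult_left_mono)
  finally show ?thesis .
 qed
 \<comment> \<open>The inequality \<open>m + 2 < 2 m + 2\<close> fails for \<open>m = 0\<close>;
   self-maps of the circle are treated by lifting.\<close>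
 moreover have "Suc ?M < 2 * ?M" using m by simp
 ultimately obtain v where v: "v \<in> UNIV \<rightarrow> {0..1}" "\<And>x. x \<in> UNIV \<rightarrow> {0..1} \<Longrightarrow> \<exists>i<2 * ?M. G x i \<noteq> v i"
  using lipschitz_misses_point[of "Suc ?M" "2 * ?M" G K] by blast
 show ?thesis
 proof (rule that[of v "\<lambda>i. v (?M + i)"])
  fix z p p' assume z: "z \<in> sph m" and p: "p \<in> meridian m z" and p': "p' \<in> meridian m z"
  obtain y where y: "y \<in> UNIV \<rightarrow> {0..1}" "ang m y = z"
  proof -
   obtain k where "m = Suc k" using m by (cases m) auto
   then show ?thesis using ang_surj[of z k] z that by blast
  qed
  obtain a where a: "0 \<le> a" "a \<le> 1" "ang ?M (y(m := a)) = p"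
   using ang_extend[of p m y] p y(2) unfolding meridian_def by blast
  obtain b where b: "0 \<le> b" "b \<le> 1" "ang ?M (y(m := b)) = p'"
   using ang_extend[of p' m y] p' y(2) unfolding meridian_def by blast
  define w where "w = y(m := a, ?M := b)"
  have w: "w \<in> UNIV \<rightarrow> {0..1}" using y a b by (auto simp: w_def Pi_iff)
  have 1: "?P w = p" unfolding a(3)[symmetric] w_def by (rule ang_cong) auto
  have 2: "?P' w = p'" unfolding b(3)[symmetric] w_def by (rule ang_cong) auto
  show "\<not> (g p ?M \<ge> \<delta> \<and> (\<forall>i\<le>m. g p i = v i * g p ?M) \<and>
     - g p' ?M \<ge> \<delta> \<and> (\<forall>i\<le>m. g p' i = v (?M + i) * - g p' ?M))"
  proof
   assume h: "g p ?M \<ge> \<delta> \<and> (\<forall>i\<le>m. g p i = v i * g p ?M) \<and>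
     - g p' ?M \<ge> \<delta> \<and> (\<forall>i\<le>m. g p' i = v (?M + i) * - g p' ?M)"
   have "G w i = v i" if "i < 2 * ?M" for i
   proof (cases "i \<le> m")
    case True
    have "g p i = v i * g p ?M" "max (1 * g p ?M) \<delta> = g p ?M" "g p ?M \<noteq> 0" using h \<delta> True by auto
    then show ?thesis using True unfolding G_def 1 u_def by simp
   next
    case False
    then have i: "i - ?M \<le> m" "?M + (i - ?M) = i" using that by auto
    have "g p' (i - ?M) = v i * - g p' ?M" using h i by metis
    moreover have "max (-1 * g p' ?M) \<delta> = - g p' ?M" "- g p' ?M \<noteq> 0" using h \<delta> by auto
    ultimately show ?thesis using False unfolding G_def 2 u_def by simp
   qed
   then show False using v(2)[OF w] by blast
  qed
 qed (use v(1) in \<open>auto simp: Pi_iff\<close>)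
qed

text \<open>Two generic directions, one upward and one downward, have preimages that meet no common
  meridian. Sliding along meridians by \<open>\<Theta>\<close> brings the preimage of the upward one
  into the upper and that of the downward one into the lower hemisphere; a shear
  \<open>\<Psi>\<close> of the target turns the two directions into the poles.\<close>

lemma homotopic_hemispherical:
 assumes m: "m \<ge> 1" and f: "cmap (nsphere (Suc m)) (nsphere (Suc m)) f"
 obtains h where "cmap (nsphere (Suc m)) (nsphere (Suc m)) h"
  "htp (nsphere (Suc m)) (nsphere (Suc m)) f h"
  "\<And>p. p \<in> sph (Suc m) \<Longrightarrow> \<forall>i\<le>m. h p i = 0 \<Longrightarrow> p (Suc m) * h p (Suc m) > 0"
proof -
 let ?X = "nsphere (Suc m)" and ?M = "Suc m" and ?S = "sph (Suc m)"
 let ?T = "IZ (nsphere (Suc m))"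
 have fS: "f p \<in> ?S" if "p \<in> ?S" for p using f that by (auto dest: cm_funspace)
 have fi: "rcont ?X (\<lambda>p. f p i)" for i by (rule continuous_map_nsphere_coord[OF f])
 \<comment> \<open>The \<open>m + 2\<close> coordinate errors then cost at most 1/2 in the scalar
   product with the unit vector \<open>f p\<close>, so the segment from \<open>f p\<close> to
   \<open>g p\<close> avoids the origin.\<close>
 define \<epsilon> where "\<epsilon> = 1 / (2 * real (Suc ?M))"
 have \<epsilon>: "\<epsilon> > 0" by (simp add: \<epsilon>_def)
 have "\<exists>G. \<forall>i. (\<exists>L. lipsch (Suc ?M) ?S (G i) L) \<and> rcont ?X (G i)
    \<and> (\<forall>x \<in> ?S. \<bar>f x i - G i x\<bar> < \<epsilon>)"
  by (rule choice) (use lipschitz_approximation[OF fi \<epsilon>] in metis)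
 then obtain G where G: "\<And>i. \<exists>L. lipsch (Suc ?M) ?S (G i) L" "\<And>i. rcont ?X (G i)"
   "\<And>i x. x \<in> ?S \<Longrightarrow> \<bar>f x i - G i x\<bar> < \<epsilon>" by blast
 obtain L where L: "\<And>i. lipsch (Suc ?M) ?S (G i) (L i)" using G(1) by metis
 define g where "g = (\<lambda>p i. G i p)"
 have gl: "lipsch (Suc ?M) ?S (\<lambda>p. g p i) (Max (L ` {..?M}))" if "i \<le> ?M" for i
  using lipsch_mono[OF L[of i]] that by (simp add: g_def)
 have gc: "rcont ?X (\<lambda>p. g p i)" for i using G(2) by (simp add: g_def)
 have fg: "(\<Sum>i\<le>?M. f p i * ((1 - t) * f p i + t * g p i)) \<ge> 1/2" if p: "p \<in> ?S" and t: "t \<in> {0..1}" for p t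
 proof -
  have b: "f p i * ((1 - t) * f p i + t * g p i) \<ge> (f p i)\<^sup>2 - \<epsilon>" for i
  proof -
   have "\<bar>t * (f p i * (f p i - g p i))\<bar> \<le> 1 * (1 * \<epsilon>)"
    unfolding abs_mult using t nsphere_coord_le1[OF fS[OF p], of i] G(3)[OF p, of i]
    by (intro mult_mono) (auto simp: g_def)
   moreover have "f p i * ((1 - t) * f p i + t * g p i) = (f p i)\<^sup>2 - t * (f p i * (f p i - g p i))"
    by (simp add: power2_eq_square algebra_simps)
   ultimately show ?thesis by linarith
  qed
  have "(\<Sum>i\<le>?M. (f p i)\<^sup>2 - \<epsilon>) = 1/2"
  proof -
   have "(\<Sum>i\<le>?M. (f p i)\<^sup>2) = 1" using fS[OF p] by (simp only: topspace_nsphere mem_Collect_eq)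
   moreover have "(\<Sum>i\<le>?M. \<epsilon>) = 1/2" by (simp del: sum.atMost_Suc add: \<epsilon>_def field_simps)
   ultimately show ?thesis unfolding sum_subtractf by simp
  qed
  then show ?thesis using sum_mono[of "{..?M}" "\<lambda>i. (f p i)\<^sup>2 - \<epsilon>" "\<lambda>i. f p i * ((1 - t) * f p i + t * g p i)"] b by simp
 qed
 have gnz: "\<exists>i\<le>?M. (1 - t) * f p i + t * g p i \<noteq> 0" if "p \<in> ?S" "t \<in> {0..1}" for p t
 proof (rule ccontr)
  assume "\<not> ?thesis"
  then have "(\<Sum>i\<le>?M. f p i * ((1 - t) * f p i + t * g p i)) = 0" by (intro sum.neutral) auto
  then show False using fg[OF that] by simp
 qed
 define f1 where "f1 = (\<lambda>p. nz ?M (g p))"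
 have h1: "htp ?X ?X f f1"
 proof (rule sphere_homotopy[where v = "\<lambda>q i. (1 - fst q) * f (snd q) i + fst q * g (snd q) i"])
  show "rcont ?T (\<lambda>q. (1 - fst q) * f (snd q) i + fst q * g (snd q) i)" for i
   by (intro cont_arith cont_fst_I cont_const
     cm_compose[OF fi cm_snd] cm_compose[OF gc cm_snd])
 qed (use gnz in \<open>auto simp: nz_id fS f1_def\<close>)
 have f1c: "cmap ?X ?X f1" using homotopic_with_imp_continuous_maps[OF h1] by blast
 \<comment> \<open>If \<open>g p\<close> is a positive multiple of a vector with last entry 1 or -1
   and other entries in \<open>[0,1]\<close>, its last entry is the largest in absolute value. As
   the scalar product with \<open>f p\<close> is at least 1/2, that entry has absolute value at
   least \<open>\<delta>\<close>.\<close>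
 define \<delta> where "\<delta> = 1 / (2 * real (Suc ?M))"
 have \<delta>: "\<delta> > 0" by (simp add: \<delta>_def)
 have big: "s * g p ?M \<ge> \<delta>"
  if "p \<in> ?S" "s = 1 \<or> s = -1" "s * g p ?M > 0" "\<And>i. i \<le> m \<Longrightarrow> g p i = \<gamma> i * (s * g p ?M)" "\<And>i. \<gamma> i \<in> {0..1}" for p s \<gamma>
 proof -
  have b: "f p i * g p i \<le> s * g p ?M" if "i \<le> ?M" for i
  proof -
   have "\<bar>g p i\<bar> \<le> s * g p ?M"
   proof (cases "i = ?M")
    case True
    then show ?thesis using \<open>s = 1 \<or> s = -1\<close> \<open>s * g p ?M > 0\<close> by auto
   next
    case False
    then have "\<bar>g p i\<bar> = \<gamma> i * (s * g p ?M)" using that \<open>\<And>i. i \<le> m \<Longrightarrow> _ i\<close> \<open>\<And>i. \<gamma> i \<in> {0..1}\<close>[of i] \<open>s * g p ?M > 0\<close>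
     by (simp only: abs_mult[of "\<gamma> i"]) auto
    then show ?thesis using \<open>\<And>i. \<gamma> i \<in> {0..1}\<close>[of i] \<open>s * g p ?M > 0\<close> by (simp add: mult_left_le_one_le)
   qed
   moreover have "\<bar>f p i * g p i\<bar> \<le> 1 * \<bar>g p i\<bar>"
    unfolding abs_mult using nsphere_coord_le1[OF fS[OF \<open>p \<in> ?S\<close>]] by (intro mult_right_mono) auto
   ultimately show ?thesis by linarith
  qed
  have "1/2 \<le> (\<Sum>i\<le>?M. f p i * g p i)" using fg[OF \<open>p \<in> ?S\<close>, of 1] by simp
  also have "\<dots> \<le> real (Suc ?M) * (s * g p ?M)"
   using sum_bounded_above[of "{..?M}" "\<lambda>i. f p i * g p i" "s * g p ?M"] b by simp
  finally show ?thesis by (simp add: \<delta>_def field_simps)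
 qed
 \<comment> \<open>The preimage under \<open>g\<close> of the direction with horizontal part
   \<open>\<gamma>\<close> and height \<open>s\<close>. By \<open>big\<close> the bound
   \<open>\<delta>\<close> excludes nothing when \<open>\<gamma>\<close> has entries in
   \<open>[0,1]\<close>, and it makes the set closed.\<close>
 define A where "A = (\<lambda>s \<gamma>. {p \<in> ?S. s * g p ?M \<ge> \<delta> \<and> (\<forall>i\<le>m. g p i = \<gamma> i * (s * g p ?M))})"
 define pole :: "real \<Rightarrow> nat \<Rightarrow> real" where "pole = (\<lambda>s i. if i = ?M then s else 0)"
 have AS: "A s \<gamma> \<subseteq> ?S" for s \<gamma> by (auto simp: A_def)
 have pm: "pole s \<in> meridian m z" if "s = 1 \<or> s = -1" for s z
  using that hw_zero[of m "pole s"] by (auto simp: meridian_def topspace_nsphere pole_def)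
 \<comment> \<open>The poles do not move under a slide along meridians, so the opposite pole must
   not lie in the preimage to be moved. Preimages of different directions are disjoint, so one of
   two directions will do when the other preimage is empty. If both are nonempty, a pole in one of
   them would share a meridian with a point of the other.\<close>
 have rechoose: "\<exists>\<gamma>. (\<forall>i. \<gamma> i \<in> {0..1}) \<and> pole (- s) \<notin> A s \<gamma>" for s
 proof (cases "pole (- s) \<in> A s (\<lambda>_. 0)")
  case True
  then have "s * g (pole (- s)) ?M \<ge> \<delta>" "g (pole (- s)) 0 = 0" by (auto simp: A_def)
  then have "pole (- s) \<notin> A s (\<lambda>_. 1)" using \<delta> by (auto simp: A_def)
  then show ?thesis by (intro exI[of _ "\<lambda>_. 1"]) auto
 qed (intro exI[of _ "\<lambda>_. 0"], auto)
 have "\<exists>\<alpha> \<beta>. (\<forall>i. \<alpha> i \<in> {0..1}) \<and> (\<forall>i. \<beta> i \<in> {0..1}) \<and> pole (-1) \<notin> A 1 \<alpha> \<and> pole 1 \<notin> A (-1) \<beta> \<and>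
   (\<forall>z \<in> sph m. A 1 \<alpha> \<inter> meridian m z = {} \<or> A (-1) \<beta> \<inter> meridian m z = {})"
 proof -
  obtain \<alpha> \<beta> where ab: "\<And>i. \<alpha> i \<in> {0..1}" "\<And>i. \<beta> i \<in> {0..1}"
   "\<And>z p p'. z \<in> sph m \<Longrightarrow> p \<in> meridian m z \<Longrightarrow> p' \<in> meridian m z \<Longrightarrow>
    \<not> (g p ?M \<ge> \<delta> \<and> (\<forall>i\<le>m. g p i = \<alpha> i * g p ?M) \<and>
     - g p' ?M \<ge> \<delta> \<and> (\<forall>i\<le>m. g p' i = \<beta> i * - g p' ?M))"
  proof (rule generic_directions[of m g, OF m _ \<delta>])
   show "lipsch (Suc ?M) ?S (\<lambda>p. g p i) (Max (L ` {..?M}))" if "i \<le> ?M" for i by (rule gl[OF that])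
  next
   fix \<alpha> \<beta>
   assume 1: "\<And>i. \<alpha> i \<in> {0..1}" "\<And>i. \<beta> i \<in> {0..1}"
    "\<And>z p p'. z \<in> sph m \<Longrightarrow> p \<in> meridian m z \<Longrightarrow> p' \<in> meridian m z \<Longrightarrow>
    \<not> (g p ?M \<ge> \<delta> \<and> (\<forall>i\<le>m. g p i = \<alpha> i * g p ?M) \<and>
     - g p' ?M \<ge> \<delta> \<and> (\<forall>i\<le>m. g p' i = \<beta> i * - g p' ?M))"
   show thesis by (rule that[OF 1])
  qed
  have disj: "A 1 \<alpha> \<inter> meridian m z = {} \<or> A (-1) \<beta> \<inter> meridian m z = {}" if "z \<in> sph m" for z
  proof (rule ccontr)
   assume "\<not> ?thesis"
   then obtain p p' where p: "p \<in> A 1 \<alpha>" "p \<in> meridian m z" "p' \<in> A (-1) \<beta>" "p' \<in> meridian m z" by blast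
   then show False using ab(3)[OF that p(2,4)] unfolding A_def by simp
  qed
  consider "A 1 \<alpha> = {}" | "A (-1) \<beta> = {}" | p p' where "p \<in> A 1 \<alpha>" "p' \<in> A (-1) \<beta>" by blast
  then show ?thesis
  proof cases
   case 1
   then show ?thesis using rechoose[of "-1"] ab(1) by auto
  next
   case 2
   then show ?thesis using rechoose[of 1] ab(2) by auto
  next
   case 3
   then obtain z z' where "z \<in> sph m" "p \<in> meridian m z" "z' \<in> sph m" "p' \<in> meridian m z'"
    using meridian_nz AS by (meson subsetD)
   then have "pole 1 \<notin> A (-1) \<beta>" "pole (-1) \<notin> A 1 \<alpha>" using disj pm 3 by blast+
   then show ?thesis using ab(1,2) disj by blast
  qed
 qed
 then obtain \<alpha> \<beta> where ab: "\<And>i. \<alpha> i \<in> {0..1}" "\<And>i. \<beta> i \<in> {0..1}" and np: "pole (-1) \<notin> A 1 \<alpha>" "pole 1 \<notin> A (-1) \<beta>"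
  and disj: "\<And>z. z \<in> sph m \<Longrightarrow> A 1 \<alpha> \<inter> meridian m z = {} \<or> A (-1) \<beta> \<inter> meridian m z = {}" by blast
 define \<gamma> where "\<gamma> = (\<lambda>s::real. if s = 1 then \<alpha> else \<beta>)"
 have \<gamma>: "\<gamma> s i \<in> {0..1}" "\<gamma> 1 = \<alpha>" "\<gamma> (-1) = \<beta>" for s i using ab by (simp_all add: \<gamma>_def)
 let ?A = "\<lambda>s. A s (\<gamma> s)"
 have clA: "closedin ?X (?A s)" for s
 proof -
  have gs: "rcont ?X (\<lambda>p. s * g p ?M)" by (intro cont_arith cont_const gc)
  have "closedin ?X {p \<in> ?S. g p i - \<gamma> s i * (s * g p ?M) \<in> {0}}" for i
   by (rule closedin_pre[where Y = euclideanreal])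
     (intro cont_arith cont_const gs gc, simp)
  then have "closedin ?X (\<Inter>i\<in>{..m}. {p \<in> ?S. g p i - \<gamma> s i * (s * g p ?M) \<in> {0}})"
   by (intro closedin_INT) auto
  moreover have "closedin ?X {p \<in> ?S. s * g p ?M \<in> {\<delta>..}}" by (rule closedin_pre[OF gs]) simp
  ultimately have "closedin ?X ((\<Inter>i\<in>{..m}. {p \<in> ?S. g p i - \<gamma> s i * (s * g p ?M) \<in> {0}}) \<inter> {p \<in> ?S. s * g p ?M \<in> {\<delta>..}})"
   by (rule closedin_Int)
  moreover have "?A s = (\<Inter>i\<in>{..m}. {p \<in> ?S. g p i - \<gamma> s i * (s * g p ?M) \<in> {0}}) \<inter> {p \<in> ?S. s * g p ?M \<in> {\<delta>..}}"
   unfolding A_def by auto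
  ultimately show ?thesis by simp
 qed
 have hc: "rcont ?X (hw m)" by (rule continuous_map_hw)
 \<comment> \<open>Where the height has the wrong sign, the horizontal norm is bounded below by
   compactness, as the wrong pole is excluded; \<open>K\<close> is twice the inverse of that
   bound.\<close>
 have Kex: "\<exists>K>0. \<forall>p \<in> C. s * p ?M + K * hw m p > 0"
  if C: "closedin ?X C" and s: "s = 1 \<or> s = -1" and np: "pole (- s) \<notin> C" for C s
 proof -
  let ?C = "{p \<in> C. s * p ?M \<le> 0}"
  have CS: "C \<subseteq> ?S" using C closedin_subset by blast
  have hpos: "hw m p > 0" if "p \<in> ?C" for p
  proof (rule ccontr)
   assume "\<not> hw m p > 0"
   then have h0: "hw m p = 0" using hw_nonneg[of m p] by simp
   have pS: "p \<in> ?S" using that CS by auto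
   then have "(p ?M)\<^sup>2 = 1" using hw_nsphere[OF pS] h0 by simp
   then have "p ?M = - s" using s that by (auto simp: power2_eq_1_iff)
   then have "p = pole (- s)"
    using h0 pS hw_zero[of m p] by (auto simp: fun_eq_iff topspace_nsphere pole_def) (metis le_SucE not_less)
   then show False using np that by auto
  qed
  have "closedin ?X {p \<in> ?S. s * p ?M \<in> {..0}}"
   by (rule closedin_pre[where Y = euclideanreal])
     (auto intro!: cont_arith continuous_map_nsphere_projection)
  then have "closedin ?X (C \<inter> {p \<in> ?S. s * p ?M \<in> {..0}})" by (rule closedin_Int[OF C])
  moreover have "C \<inter> {p \<in> ?S. s * p ?M \<in> {..0}} = ?C" using CS by auto
  ultimately have "compactin ?X ?C"
   using compact_space_nsphere closedin_compact_space by metis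
  then have comp: "compact (hw m ` ?C)"
   using image_compactin[OF _ hc] by simp
  obtain \<eta> where \<eta>: "\<eta> > 0" "\<And>p. p \<in> ?C \<Longrightarrow> hw m p \<ge> \<eta>"
  proof (cases "?C = {}")
   case True
   then show ?thesis using that[of 1] by auto
  next
   case False
   then obtain y where "y \<in> hw m ` ?C" "\<forall>t \<in> hw m ` ?C. y \<le> t"
    using compact_attains_inf[OF comp] by blast
   then show ?thesis using that[of y] hpos by auto
  qed
  have "s * p ?M + 2 / \<eta> * hw m p > 0" if p: "p \<in> C" for p
  proof (cases "s * p ?M \<le> 0")
   case True
   then have "hw m p \<ge> \<eta>" using \<eta>(2) p by auto
   then have "2 / \<eta> * hw m p \<ge> 2" using \<eta>(1) by (simp add: field_simps)
   moreover have "\<bar>s * p ?M\<bar> \<le> 1" using s nsphere_coord_le1[of p ?M ?M] p CS by auto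
   ultimately show ?thesis by linarith
  next
   case False
   then show ?thesis using \<eta>(1) hw_nonneg[of m p] by (simp add: add_pos_nonneg)
  qed
  then show ?thesis using \<eta>(1) by (intro exI[of _ "2 / \<eta>"]) auto
 qed
 obtain K1 where K1: "K1 > 0" "\<And>p. p \<in> ?A 1 \<Longrightarrow> 1 * p ?M + K1 * hw m p > 0"
  using Kex[OF clA, of 1 1] np unfolding \<gamma> by auto
 obtain K2 where K2: "K2 > 0" "\<And>p. p \<in> ?A (-1) \<Longrightarrow> -1 * p ?M + K2 * hw m p > 0"
  using Kex[OF clA, of "-1" "-1"] np unfolding \<gamma> minus_minus by auto
 define K where "K = max K1 K2"
 have K: "K > 0" using K1 by (simp add: K_def)
 have KA: "s * p ?M + K * hw m p > 0" if "p \<in> ?A s" "s = 1 \<or> s = -1" for p s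
 proof -
  have "K1 * hw m p \<le> K * hw m p" "K2 * hw m p \<le> K * hw m p"
   using hw_nonneg[of m p] by (auto intro!: mult_right_mono simp: K_def)
  then show ?thesis using that K1(2)[of p] K2(2)[of p] by auto
 qed
 \<comment> \<open>The part of the preimage that a shift of heights by at most \<open>K hw\<close>
   can reach from the wrong hemisphere. Its meridian directions form closed sets, disjoint for the
   two signs, so Urysohn's lemma gives a function \<open>c\<close> that is -1 on those for
   \<open>s = 1\<close> and 1 on those for \<open>s = -1\<close>.\<close>
 let ?C = "\<lambda>s. {p \<in> ?A s. s * p ?M \<le> K * hw m p}"
 have hC: "hw m p \<noteq> 0" if "p \<in> ?C s" "s = 1 \<or> s = -1" for p s using KA[of p s] that by auto
 have cl': "closedin (nsphere m) (nz m ` ?C s)" "\<And>p. p \<in> ?C s \<Longrightarrow> nz m p \<in> sph m \<and> p \<in> meridian m (nz m p)"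
  if s: "s = 1 \<or> s = -1" for s
 proof -
  have "closedin ?X {p \<in> ?S. s * p ?M - K * hw m p \<in> {..0}}"
   by (rule closedin_pre[where Y = euclideanreal])
     (auto intro!: cont_arith continuous_map_nsphere_projection hc)
  then have "closedin ?X (?A s \<inter> {p \<in> ?S. s * p ?M - K * hw m p \<in> {..0}})" by (rule closedin_Int[OF clA])
  moreover have "?A s \<inter> {p \<in> ?S. s * p ?M - K * hw m p \<in> {..0}} = ?C s" using AS by auto
  ultimately have "compactin ?X (?C s)"
   using compact_space_nsphere closedin_compact_space by metis
  then have "compactin (subtopology ?X (?C s)) (?C s)" by (simp add: compactin_subtopology)
  moreover have "cmap (subtopology ?X (?C s)) (nsphere m) (nz m)"
  proof (rule continuous_map_nz[where v = "\<lambda>p. p"])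
   show "\<exists>i\<le>m. p i \<noteq> 0" if "p \<in> topspace (subtopology ?X (?C s))" for p
    using hC[OF _ s, of p] hw_zero[of m p] that by auto
  qed (intro cm_sub continuous_map_nsphere_projection)
  ultimately have "compactin (nsphere m) (nz m ` ?C s)" by (rule image_compactin)
  then show "closedin (nsphere m) (nz m ` ?C s)"
   by (rule compactin_imp_closedin[OF Hausdorff_space_nsphere])
  show "nz m p \<in> sph m \<and> p \<in> meridian m (nz m p)" if p: "p \<in> ?C s" for p
   using nz_in[OF hC[OF p s]] hw_nz p subsetD[OF AS, of p s "\<gamma> s"] by (auto simp: meridian_def)
 qed
 have dj: "disjnt (nz m ` ?C 1) (nz m ` ?C (-1))"
  unfolding disjnt_def
 proof (rule ccontr)
  assume "nz m ` ?C 1 \<inter> nz m ` ?C (-1) \<noteq> {}"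
  then obtain p p' where "p \<in> ?C 1" "p' \<in> ?C (-1)" "nz m p = nz m p'" by blast
  then show False using cl'(2)[of 1 p] cl'(2)[of "-1" p'] disj[of "nz m p"] \<gamma> by auto
 qed
 have nsp: "normal_space (nsphere m)"
  using compact_Hausdorff_or_regular_imp_normal_space compact_space_nsphere Hausdorff_space_nsphere by blast
 obtain c where c: "cmap (nsphere m) (top_of_set {-1..1}) c" "c ` nz m ` ?C 1 \<subseteq> {-1}" "c ` nz m ` ?C (-1) \<subseteq> {1::real}"
  using Urysohn_lemma[OF nsp cl'(1) cl'(1) dj, of "-1" 1] by auto
 have c1: "\<bar>c z\<bar> \<le> 1" if "z \<in> sph m" for z
  using c(1) that by (auto dest: cm_funspace simp: abs_le_iff) (smt (verit) PiE atLeastAtMost_iff cm_funspace topspace_euclidean_subtopology)+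
 have cc: "rcont (nsphere m) c" using c(1) cm_full by blast
 let ?ch = "\<lambda>p. hw m p * c (nz m p)"
 have chc: "rcont ?T (\<lambda>q. ?ch (snd q))"
 proof (rule continuous_map_bounded_times)
  show "rcont ?T (\<lambda>q. hw m (snd q))" by (rule cm_compose[OF hc cm_snd])
  show "\<bar>c (nz m (snd q))\<bar> \<le> 1" if "hw m (snd q) \<noteq> 0" for q using that by (intro c1 nz_in)
  show "rcont (subtopology ?T {x. hw m (snd x) \<noteq> 0}) (\<lambda>q. c (nz m (snd q)))"
   by (rule cm_compose[OF cc continuous_map_nz_sub])
 qed
 define \<theta> where "\<theta> = (\<lambda>t p i. if i = ?M then p i + t * (K * ?ch p) else p i)"
 define \<Theta> where "\<Theta> = (\<lambda>p. nz ?M (\<theta> 1 p))"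
 have pc: "rcont ?T (\<lambda>q. snd q i)" for i
  by (rule cm_compose[OF continuous_map_nsphere_projection[of ?M] cm_snd])
 have \<theta>nz: "\<exists>i\<le>?M. \<theta> t p i \<noteq> 0" if "p \<in> ?S" for t p
 proof (cases "hw m p = 0")
  case True
  then have "p ?M \<noteq> 0" using hw_nsphere[OF that] by auto
  then show ?thesis using True by (intro exI[of _ ?M]) (simp add: \<theta>_def)
 next
  case False
  then obtain j where "j \<le> m" "p j \<noteq> 0" using hw_zero by auto
  then show ?thesis by (intro exI[of _ j]) (simp add: \<theta>_def)
 qed
 have h2: "htp ?X ?X id \<Theta>"
 proof (rule sphere_homotopy[where v = "\<lambda>q. \<theta> (fst q) (snd q)"])
  show "rcont ?T (\<lambda>q. \<theta> (fst q) (snd q) i)" for i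
   unfolding \<theta>_def by (cases "i = ?M")
    (auto intro!: cont_arith pc chc cont_fst_I)
  show "nz ?M (\<theta> (fst (0::real, p)) (snd (0::real, p))) = id p" if "p \<in> ?S" for p
  proof -
   have "\<theta> 0 p = p" by (auto simp: \<theta>_def)
   then show ?thesis using nz_id[OF that] by simp
  qed
 qed (use \<theta>nz in \<open>auto simp: \<Theta>_def\<close>)
 have \<Theta>S: "\<Theta> p \<in> ?S" if "p \<in> ?S" for p
  using homotopic_with_imp_continuous_maps[OF h2] that by (auto dest: cm_funspace)
 have \<Theta>: "\<exists>\<rho>>0. (\<forall>i\<le>m. \<Theta> p i = p i / \<rho>) \<and> \<Theta> p ?M = (p ?M + K * ?ch p) / \<rho> \<and> hw m (\<Theta> p) = hw m p / \<rho> \<and> (hw m p \<noteq> 0 \<longrightarrow> nz m (\<Theta> p) = nz m p)"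
  if pS: "p \<in> ?S" for p
 proof -
  define \<rho> where "\<rho> = sqrt (\<Sum>j\<le>?M. (\<theta> 1 p j)\<^sup>2)"
  obtain j where "j \<le> ?M" "\<theta> 1 p j \<noteq> 0" using \<theta>nz[OF pS] by blast
  then have \<rho>: "\<rho> > 0" unfolding \<rho>_def using sum_squares_pos[of j ?M "\<theta> 1 p"] by simp
  have nzi: "\<Theta> p i = \<theta> 1 p i / \<rho>" if "i \<le> ?M" for i
   using that by (simp only: \<Theta>_def nz_def \<rho>_def if_True)
  have 1: "\<Theta> p i = p i / \<rho>" if "i \<le> m" for i using that nzi[of i] by (simp add: \<theta>_def)
  have 2: "\<Theta> p ?M = (p ?M + K * ?ch p) / \<rho>" using nzi[of ?M] by (simp add: \<theta>_def)
  have "(\<Sum>i\<le>m. (\<Theta> p i)\<^sup>2) = (\<Sum>i\<le>m. (p i)\<^sup>2) / \<rho>\<^sup>2"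
   unfolding sum_divide_distrib by (rule sum.cong) (auto simp: 1 power_divide)
  then have 3: "hw m (\<Theta> p) = hw m p / \<rho>" using \<rho> by (simp add: hw_def real_sqrt_divide)
  have "nz m (\<Theta> p) = nz m p" if "hw m p \<noteq> 0"
  proof -
   have "nz m u = (\<lambda>i. if i \<le> m then u i / hw m u else 0)" for u by (simp only: nz_def hw_def)
   then show ?thesis using \<rho> 1 3 by (auto simp: fun_eq_iff)
  qed
  then show ?thesis using \<rho> 1 2 3 by blast
 qed
 \<comment> \<open>If \<open>\<Theta> p\<close> lies in the preimage although \<open>p\<close> is on
   the wrong side, then \<open>\<Theta> p\<close> lies in \<open>?C s\<close>, and \<open>c\<close>
   is \<open>- s\<close> on this meridian. So the shift was a full one away from the pole
   \<open>s\<close>, which contradicts \<open>KA\<close>.\<close>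
 have miss: "s * p ?M > 0" if p: "p \<in> ?S" and a: "\<Theta> p \<in> ?A s" and s: "s = 1 \<or> s = -1" for p s
 proof (rule ccontr)
  assume n: "\<not> s * p ?M > 0"
  obtain \<rho> where \<rho>: "\<rho> > 0" "\<Theta> p ?M = (p ?M + K * ?ch p) / \<rho>" "hw m (\<Theta> p) = hw m p / \<rho>" "hw m p \<noteq> 0 \<Longrightarrow> nz m (\<Theta> p) = nz m p"
   using \<Theta>[OF p] by blast
  have pos: "s * (p ?M + K * ?ch p) + K * hw m p > 0"
   using KA[OF a s] \<rho>(1) unfolding \<rho>(2,3) by (simp add: zero_less_divide_iff flip: add_divide_distrib)
  have h0: "hw m p \<noteq> 0" using pos n by auto
  have "hw m p * (s * c (nz m p)) \<le> hw m p * 1"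
   using c1[OF nz_in[OF h0]] hw_nonneg[of m p] s by (intro mult_left_mono) auto
  then have "K * (hw m p * (s * c (nz m p))) \<le> K * hw m p" using K by simp
  moreover have "s * (p ?M + K * ?ch p) = s * p ?M + K * (hw m p * (s * c (nz m p)))" by (simp add: algebra_simps)
  ultimately have "s * (p ?M + K * ?ch p) \<le> K * hw m p" using n by linarith
  then have "s * (p ?M + K * ?ch p) / \<rho> \<le> K * hw m p / \<rho>" using \<rho>(1) by (simp add: divide_le_cancel)
  then have "\<Theta> p \<in> ?C s" using a unfolding mem_Collect_eq \<rho>(2,3) by simp
  then have "c (nz m (\<Theta> p)) \<in> c ` nz m ` ?C s" by (intro imageI)
  moreover have "c ` nz m ` ?C s \<subseteq> {- s}" using s c(2,3) by (elim disjE) (simp_all only: minus_minus)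
  ultimately have "c (nz m (\<Theta> p)) = - s" by blast
  then have "c (nz m p) = - s" by (simp only: \<rho>(4)[OF h0])
  then show False using pos n s by auto
 qed
 \<comment> \<open>At time 1 a shear of the upper half takes the direction
   \<open>(\<alpha>, 1)\<close> to the north pole, and one of the lower half takes
   \<open>(\<beta>, -1)\<close> to the south pole.\<close>
 define \<psi> where "\<psi> = (\<lambda>t v i. if i \<le> m then v i - t * (max (v ?M) 0 * \<alpha> i + max (- v ?M) 0 * \<beta> i) else v i)"
 define \<Psi> where "\<Psi> = (\<lambda>v. nz ?M (\<psi> 1 v))"
 have \<psi>nz: "\<exists>i\<le>?M. \<psi> t v i \<noteq> 0" if "v \<in> ?S" for t v
 proof (cases "v ?M = 0")
  case False
  then show ?thesis by (intro exI[of _ ?M]) (simp add: \<psi>_def)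
 next
  case True
  then have "hw m v \<noteq> 0" using hw_nsphere[OF that] by auto
  then obtain j where "j \<le> m" "v j \<noteq> 0" using hw_zero by auto
  then show ?thesis using True by (intro exI[of _ j]) (simp add: \<psi>_def)
 qed
 have h3: "htp ?X ?X id \<Psi>"
 proof (rule sphere_homotopy[where v = "\<lambda>q. \<psi> (fst q) (snd q)"])
  show "rcont ?T (\<lambda>q. \<psi> (fst q) (snd q) i)" for i
   unfolding \<psi>_def by (cases "i \<le> m")
    (auto intro!: cont_arith cont_unary(1) pc cont_fst_I)
  show "nz ?M (\<psi> (fst (0::real, p)) (snd (0::real, p))) = id p" if "p \<in> ?S" for p
  proof -
   have "\<psi> 0 p = p" by (auto simp: \<psi>_def)
   then show ?thesis using nz_id[OF that] by simp
  qed
 qed (use \<psi>nz in \<open>auto simp: \<Psi>_def\<close>)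
 let ?h = "\<Psi> \<circ> (f1 \<circ> \<Theta>)"
 have H: "htp ?X ?X (id \<circ> (f \<circ> id)) ?h"
  by (rule homotopic_compose[OF homotopic_compose[OF h2 h1] h3])
 show ?thesis
 proof (rule that[of ?h])
  show "cmap ?X ?X ?h" using homotopic_with_imp_continuous_maps[OF H] by blast
  show "htp ?X ?X f ?h" using H by simp
  fix p assume p: "p \<in> ?S" and z: "\<forall>i\<le>m. ?h p i = 0"
  let ?q = "\<Theta> p"
  define v where "v = f1 ?q"
  have q: "?q \<in> ?S" by (rule \<Theta>S[OF p])
  have v: "v \<in> ?S" unfolding v_def using f1c q by (auto dest: cm_funspace)
  define \<tau> where "\<tau> = sqrt (\<Sum>j\<le>?M. (\<psi> 1 v j)\<^sup>2)"
  obtain j where "j \<le> ?M" "\<psi> 1 v j \<noteq> 0" using \<psi>nz[OF v] by blast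
  then have \<tau>: "\<tau> > 0" unfolding \<tau>_def using sum_squares_pos[of j ?M "\<psi> 1 v"] by simp
  have hv: "?h p i = \<psi> 1 v i / \<tau>" if "i \<le> ?M" for i
   using that by (simp only: \<Psi>_def nz_def \<tau>_def v_def if_True o_apply)
  have vi: "v i = max (v ?M) 0 * \<alpha> i + max (- v ?M) 0 * \<beta> i" if "i \<le> m" for i
  proof -
   have "\<psi> 1 v i / \<tau> = 0" using z hv[of i] that by simp
   then show ?thesis using \<tau> that by (simp add: \<psi>_def)
  qed
  have hM: "?h p ?M = v ?M / \<tau>" using hv[of ?M] by (simp add: \<psi>_def)
  define \<sigma> where "\<sigma> = sqrt (\<Sum>j\<le>?M. (g ?q j)\<^sup>2)"
  obtain j where "j \<le> ?M" "g ?q j \<noteq> 0" using gnz[OF q, of 1] by auto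
  then have \<sigma>: "\<sigma> > 0" unfolding \<sigma>_def using sum_squares_pos[of j ?M "g ?q"] by simp
  have vg: "g ?q i = \<sigma> * v i" if "i \<le> ?M" for i
  proof -
   have "v i = g ?q i / \<sigma>" using that by (simp only: v_def f1_def nz_def \<sigma>_def if_True)
   then show ?thesis using \<sigma> by simp
  qed
  have "v ?M \<noteq> 0"
  proof
   assume "v ?M = 0"
   then have "hw m v = 0" using vi by (simp add: hw_zero)
   then show False using hw_nsphere[OF v] \<open>v ?M = 0\<close> by simp
  qed
  then obtain s :: real where s: "s = 1 \<or> s = -1" "s * v ?M > 0"
   by (metis linorder_neqE_linordered_idom mult_1 mult_minus1 neg_0_less_iff_less)
  have e: "g ?q i = \<gamma> s i * (s * g ?q ?M)" if "i \<le> m" for i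
   using vg[of i] vg[of ?M] vi[OF that] that s \<gamma> by (auto simp: max_def)
  have "s * g ?q ?M \<ge> \<delta>"
   by (rule big[OF q s(1) _ e \<gamma>(1)]) (use vg[of ?M] \<sigma> s in \<open>auto simp: mult_pos_neg\<close>)
  then have "?q \<in> ?A s" using q e by (auto simp: A_def)
  then have "s * p ?M > 0" by (rule miss[OF p _ s(1)])
  then show "p ?M * ?h p ?M > 0" using s \<tau> unfolding hM by (auto simp: mult_neg_neg divide_neg_pos)
 qed
qed

section \<open>Hopf's degree theorem\<close>

lemma lam_cong: "(\<And>i. i < k \<Longrightarrow> y i = y' i) \<Longrightarrow> lam k (x, y) = lam k (x, y')"
 by (induction k) auto

lemma lam_eqD:
 assumes eq: "lam k (x, y) = lam k (x', y')"
 shows "(x \<in> \<int> \<or> y \<in> Bc k) \<and> (x' \<in> \<int> \<or> y' \<in> Bc k) \<or> x' - x \<in> \<int> \<and> (\<forall>i<k. y i = y' i)"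
proof -
 have fr: "0 < frac x" "frac x < 1" "\<And>i. i < k \<Longrightarrow> 0 < y i \<and> y i < 1" "lam k (frac x, y) = lam k (x, y)"
  if "\<not> (x \<in> \<int> \<or> y \<in> Bc k)" for x y
 proof -
  show "0 < frac x" "frac x < 1" using that frac_lt_1 by (auto simp: frac_gt_0_iff)
  show "0 < y i \<and> y i < 1" if "i < k" for i using \<open>\<not> _\<close> that by (auto simp: Bc_def not_le)
  show "lam k (frac x, y) = lam k (x, y)" by (rule lam_shift) (simp add: frac_def)
 qed
 have ne: "lam k (x, y) \<noteq> e1" if "\<not> (x \<in> \<int> \<or> y \<in> Bc k)" for x y
 proof -
  have "lam k (frac x, y) \<noteq> e1" by (rule lam_ne_e1) (use fr(1-3)[OF that] in auto)
  then show ?thesis using fr(4)[OF that] by simp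
 qed
 have e: "lam k (x, y) = e1" if "x \<in> \<int> \<or> y \<in> Bc k" for x y using lam_e1[of "(x, y)" k] that by simp
 show ?thesis
 proof (cases "x \<in> \<int> \<or> y \<in> Bc k")
  case True
  then show ?thesis using ne[of x' y'] e[OF True] eq by auto
 next
  case False
  then have n': "\<not> (x' \<in> \<int> \<or> y' \<in> Bc k)" using ne[OF False] e[of x' y'] eq by auto
  have "frac x = frac x' \<and> (\<forall>i<k. y i = y' i)"
   by (rule lam_inj[OF fr(1-3)[OF False] fr(1-3)[OF n']]) (simp_all add: eq fr(4)[OF False] fr(4)[OF n'])
  moreover have "x' - x \<in> \<int>" if "frac x = frac x'"
  proof -
   have "x' - x = of_int (\<lfloor>x'\<rfloor> - \<lfloor>x\<rfloor>)" using that by (simp add: frac_def)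
   then show ?thesis by (simp only: Ints_of_int)
  qed
  ultimately show ?thesis by blast
 qed
qed

text \<open>A section chosen without continuity. What is defined through it is continuous if the
  given map on the cube is constant on the fibres of \<open>lam\<close>, since \<open>lam\<close> is
  a quotient map.\<close>

definition lsec :: "nat \<Rightarrow> (nat \<Rightarrow> real) \<Rightarrow> real \<times> (nat \<Rightarrow> real)" where
 "lsec k p = (SOME q. q \<in> topspace (IZ (Zc k)) \<and> lam k q = p)"

lemma lsec:
 assumes "p \<in> sph (Suc k)"
 shows "lsec k p \<in> topspace (IZ (Zc k))" "lam k (lsec k p) = p"
proof -
 obtain x y where "x \<in> {0..1}" "y \<in> topspace (Zc k)" "lam k (x, y) = p" using lam_surj[OF assms] by blast
 then have "\<exists>q. q \<in> topspace (IZ (Zc k)) \<and> lam k q = p" by (intro exI[of _ "(x, y)"]) simp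
 from someI_ex[OF this] show "lsec k p \<in> topspace (IZ (Zc k))" "lam k (lsec k p) = p" by (auto simp: lsec_def)
qed

lemma compact_space_IZ: "compact_space (IZ (Zc k))"
 by (simp add: compact_space_prod_topology compact_space_Zc compact_space_subtopology)

lemma lam_cont_IZ: "cmap (IZ (Zc k)) (nsphere (Suc k)) (lam k)"
proof -
 have "cmap (IZ (Zc k)) (RD (Zc k)) (\<lambda>q. (fst q, snd q))"
  by (intro cm_pair cm_snd cont_fst_I)
 then show ?thesis using cm_compose[OF lam_cont] by fastforce
qed

text \<open>The product of \<open>lam\<close> with a compact Hausdorff space is again a closed
  surjection, hence a quotient map.\<close>

lemma lam_descend:
 assumes T: "compact_space T" "Hausdorff_space T"
  and \<phi>: "cmap (prod_topology T (IZ (Zc k))) Y \<phi>"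
  and eq: "\<And>t q q'. t \<in> topspace T \<Longrightarrow> q \<in> topspace (IZ (Zc k)) \<Longrightarrow> q' \<in> topspace (IZ (Zc k)) \<Longrightarrow>
   lam k q = lam k q' \<Longrightarrow> \<phi> (t, q) = \<phi> (t, q')"
 shows "cmap (prod_topology T (nsphere (Suc k))) Y (\<lambda>(t, p). \<phi> (t, lsec k p))"
proof -
 let ?I = "IZ (Zc k)" and ?D = "\<lambda>(t, q). (t, lam k q)"
 show ?thesis
 proof (rule continuous_map_on_pushout[where A = "{}" and D = ?D])
  show "compact_space (prod_topology T ?I)"
   using T by (simp add: compact_space_prod_topology compact_space_Zc compact_space_subtopology)
  show "Hausdorff_space (prod_topology T (nsphere (Suc k)))"
   using T by (simp add: Hausdorff_space_prod_topology Hausdorff_space_nsphere)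
  show "cmap (prod_topology T ?I) (prod_topology T (nsphere (Suc k))) ?D"
   unfolding split_beta by (intro cm_pair cm_fst cm_compose[OF lam_cont_IZ cm_snd])
  show "topspace (prod_topology T (nsphere (Suc k))) \<subseteq> {} \<union> ?D ` topspace (prod_topology T ?I)"
  proof (rule subsetI)
   fix w assume w: "w \<in> topspace (prod_topology T (nsphere (Suc k)))"
   obtain t p where [simp]: "w = (t, p)" by (cases w)
   have tp: "t \<in> topspace T" "p \<in> sph (Suc k)" using w by auto
   then have "w = ?D (t, lsec k p)" "(t, lsec k p) \<in> topspace (prod_topology T ?I)"
    using lsec[OF tp(2)] unfolding topspace_prod_topology[of T ?I] by auto
   then show "w \<in> {} \<union> ?D ` topspace (prod_topology T ?I)" by blast
  qed
  show "cmap (prod_topology T ?I) Y (\<lambda>x. (\<lambda>(t, p). \<phi> (t, lsec k p)) (?D x))"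
  proof (rule continuous_map_eq[OF \<phi>])
   fix x assume "x \<in> topspace (prod_topology T ?I)"
   then obtain t q where x: "x = (t, q)" "t \<in> topspace T" "q \<in> topspace ?I"
    unfolding topspace_prod_topology[of T ?I] by blast
   show "\<phi> x = (\<lambda>(t, p). \<phi> (t, lsec k p)) (?D x)"
    unfolding x(1) prod.case using lsec[OF lam_nsphere[of k q]] x(2,3) by (intro eq) auto
  qed
 qed (simp_all add: continuous_map_def)
qed

lemma homotopic_descend:
 assumes \<phi>: "cmap (IZ (IZ (Zc k))) Y \<phi>"
  and eq: "\<And>t q q'. t \<in> {0..1} \<Longrightarrow> q \<in> topspace (IZ (Zc k)) \<Longrightarrow> q' \<in> topspace (IZ (Zc k)) \<Longrightarrow>
   lam k q = lam k q' \<Longrightarrow> \<phi> (t, q) = \<phi> (t, q')"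
  and 0: "\<And>q. q \<in> topspace (IZ (Zc k)) \<Longrightarrow> \<phi> (0, q) = f (lam k q)"
  and 1: "\<And>q. q \<in> topspace (IZ (Zc k)) \<Longrightarrow> \<phi> (1, q) = g (lam k q)"
 shows "htp (nsphere (Suc k)) Y f g"
proof -
 have "cmap (IZ (nsphere (Suc k))) Y (\<lambda>(t, p). \<phi> (t, lsec k p))"
  by (rule lam_descend[OF _ _ \<phi>]) (auto simp: compact_space_subtopology Hausdorff_space_subtopology intro: eq)
 moreover have "\<phi> (0, lsec k p) = f p" "\<phi> (1, lsec k p) = g p" if "p \<in> sph (Suc k)" for p
  using lsec[OF that] 0 1 by auto
 ultimately show ?thesis
  by (subst homotopic_with) auto
qed

text \<open>The standard map of degree \<open>d\<close>; \<open>lmul_lam\<close> removes the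
  dependence on the chosen section.\<close>

definition lmul :: "nat \<Rightarrow> int \<Rightarrow> (nat \<Rightarrow> real) \<Rightarrow> nat \<Rightarrow> real" where
 "lmul k d p = lam k (of_int d * fst (lsec k p), snd (lsec k p))"

lemma lmul_lam: "lmul k d (lam k (x, y)) = lam k (of_int d * x, y)"
proof -
 obtain x' y' where q: "lsec k (lam k (x, y)) = (x', y')" by (cases "lsec k (lam k (x, y))")
 have e: "lam k (x', y') = lam k (x, y)" using lsec(2)[OF lam_nsphere, of k "(x, y)"] q by simp
 have "lam k (of_int d * x', y') = lam k (of_int d * x, y)"
  using lam_eqD[OF e]
 proof
  assume "(x' \<in> \<int> \<or> y' \<in> Bc k) \<and> (x \<in> \<int> \<or> y \<in> Bc k)"
  then show ?thesis using lam_e1[of "(of_int d * x', y')" k] lam_e1[of "(of_int d * x, y)" k] by auto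
 next
  assume h: "x - x' \<in> \<int> \<and> (\<forall>i<k. y' i = y i)"
  have "lam k (of_int d * x', y') = lam k (of_int d * x', y)" using h by (intro lam_cong) auto
  also have "\<dots> = lam k (of_int d * x, y)"
  proof (rule lam_shift[symmetric])
   have "of_int d * (x - x') \<in> \<int>" using h by simp
   then show "of_int d * x - of_int d * x' \<in> \<int>" by (simp only: right_diff_distrib)
  qed
  finally show ?thesis .
 qed
 then show ?thesis by (simp add: lmul_def q)
qed

lemma lmul_e1: "lmul k d e1 = e1"
 using lmul_lam[of k d 0 "\<lambda>_. 0"] lam_e1[of "(0, \<lambda>_. 0)" k] by simp

lemma continuous_map_lmul: "cmap (nsphere (Suc k)) (nsphere (Suc k)) (lmul k d)"
proof (rule continuous_map_on_pushout[OF compact_space_IZ Hausdorff_space_nsphere lam_cont_IZ, where A = "{}"])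
 show "sph (Suc k) \<subseteq> {} \<union> lam k ` topspace (IZ (Zc k))"
  using lsec by (metis image_eqI subsetI sup_bot_left)
 have "cmap (IZ (Zc k)) (RD (Zc k)) (\<lambda>q. (of_int d * fst q, snd q))"
  by (intro cm_pair cont_arith cont_const cm_snd cont_fst_I)
 then have "cmap (IZ (Zc k)) (nsphere (Suc k)) (\<lambda>q. lam k (of_int d * fst q, snd q))"
  by (rule cm_compose[OF lam_cont])
 then show "cmap (IZ (Zc k)) (nsphere (Suc k)) (\<lambda>q. lmul k d (lam k q))"
  by (rule continuous_map_eq) (auto simp: lmul_lam)
qed (simp_all add: continuous_map_def)

lemma lam_0: "lam 0 (x, y) = (\<lambda>i. if i = 0 then cos (2 * pi * x) else if i = 1 then sin (2 * pi * x) else 0)"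
 by (auto simp: Sig_def fun_eq_iff)

text \<open>Read on the line, the map has a continuous logarithm. Its angle grows by
  \<open>2 pi d\<close> over a period and is deformed linearly to \<open>2 pi d x\<close>; the total
  growth stays the same at all times, so the deformation descends to the circle.\<close>

lemma hopf_circle:
 assumes f: "cmap (nsphere (Suc 0)) (nsphere (Suc 0)) f"
 shows "\<exists>d. htp (nsphere (Suc 0)) (nsphere (Suc 0)) f (lmul 0 d)"
proof -
 let ?l = "\<lambda>x. f (lam 0 (x, \<lambda>_. 0))"
 have lS: "?l x \<in> sph (Suc 0)" for x
  using f lam_nsphere[of 0 "(x, \<lambda>_. 0)"] by (auto dest: cm_funspace)
 have "cmap euclideanreal (RD (Zc 0)) (\<lambda>x. (x, \<lambda>_. 0))"
  by (intro cm_pair cont_id) (simp add: topspace_Zc)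
 then have "cmap euclideanreal (nsphere (Suc 0)) ?l"
  by (intro cm_compose[OF f] cm_compose[OF lam_cont])
 then have lc: "continuous_on UNIV (\<lambda>x. ?l x i)" for i
  using continuous_map_nsphere_coord by (fastforce simp: continuous_map_iff_continuous2)
 define c where "c = (\<lambda>x. Complex (?l x 0) (?l x 1))"
 have l1: "(?l x 0)\<^sup>2 + (?l x 1)\<^sup>2 = 1" for x using lS[of x] by (simp add: topspace_nsphere)
 then have c1: "norm (c x) = 1" for x by (simp add: c_def cmod_def)
 have "continuous_on UNIV c" unfolding c_def Complex_eq by (intro continuous_intros lc)
 moreover have "contractible (UNIV::real set)" by (simp add: convex_imp_contractible)
 moreover have "c x \<noteq> 0" for x using c1[of x] by auto
 ultimately obtain g where g: "continuous_on UNIV g" "\<And>x. c x = exp (g x)"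
  using continuous_logarithm_on_contractible[of UNIV c] by (metis UNIV_I)
 define h where "h = (\<lambda>x. Im (g x))"
 have hc: "continuous_on UNIV h" unfolding h_def by (intro continuous_intros g)
 have ch: "c x = cis (h x)" for x
 proof -
  have "exp (Re (g x)) = 1" using c1[of x] by (simp add: g(2))
  then show ?thesis unfolding g(2) h_def by (simp add: exp_eq_polar)
 qed
 have lh: "?l x = lam 0 (h x / (2 * pi), y)" for x y
 proof -
  have "?l x 0 = cos (h x)" "?l x 1 = sin (h x)" using ch[of x] by (auto simp: c_def complex_eq_iff)
  moreover have "?l x i = 0" if "i > 1" for i using lS[of x] that by (simp add: topspace_nsphere)
  ultimately show ?thesis unfolding lam_0 by (auto simp: fun_eq_iff)
 qed
 have "lam 0 (0, \<lambda>_. 0) = lam 0 (1, \<lambda>_. 0)" by (rule lam_shift) simp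
 then have "c 0 = c 1" by (simp only: c_def)
 then have "cos (h 1) = cos (h 0) \<and> sin (h 1) = sin (h 0)" by (auto simp: ch complex_eq_iff)
 then obtain d where d: "h 1 = h 0 + 2 * pi * of_int d"
  using sin_cos_eq_iff[of "h 1" "h 0"] by auto
 define a where "a = (\<lambda>t x. ((1 - t) * h x + t * (2 * pi * (of_int d * x))) / (2 * pi))"
 have a01: "a t 1 - a t 0 = of_int d" for t
  by (simp add: a_def d field_simps)
 have a: "lam 0 (a t x, y) = lam 0 (a t x', y')"
  if "lam 0 (x, y) = lam 0 (x', y')" "x \<in> {0..1}" "x' \<in> {0..1}" for t x y x' y'
 proof -
  have "x = x' \<or> x \<in> {0, 1} \<and> x' \<in> {0, 1}"
  proof -
   have Z: "x \<in> {0, 1}" if "x \<in> \<int>" "x \<in> {0..1}" for x :: real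
    using that by (auto elim!: Ints_cases)
   have D: "x' - x \<in> {-1, 0, 1}" if "x' - x \<in> \<int>"
    using that \<open>x \<in> {0..1}\<close> \<open>x' \<in> {0..1}\<close>
   proof (cases rule: Ints_cases)
    case (of_int n)
    then have "-1 \<le> n" "n \<le> 1" using \<open>x \<in> {0..1}\<close> \<open>x' \<in> {0..1}\<close> by auto
    then have "n \<in> {-1, 0, 1}" by auto
    then show ?thesis using of_int by auto
   qed
   show ?thesis using lam_eqD[OF that(1)]
   proof
    assume "(x \<in> \<int> \<or> y \<in> Bc 0) \<and> (x' \<in> \<int> \<or> y' \<in> Bc 0)"
    then show ?thesis using Z that(2,3) by (auto simp: Bc_def)
   next
    assume "x' - x \<in> \<int> \<and> (\<forall>i<0. y i = y' i)"
    then have "x' - x \<in> {-1, 0, 1}" using D by blast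
    then show ?thesis using that(2,3) by auto
   qed
  qed
  moreover have "a t 1 - a t 0 \<in> \<int>" unfolding a01 by (rule Ints_of_int)
  moreover from this have "a t 0 - a t 1 \<in> \<int>" using Ints_minus[of "a t 1 - a t 0"] by (simp only: minus_diff_eq)
  ultimately have "a t x' - a t x \<in> \<int>" by auto
  then show ?thesis using lam_shift[of "a t x'" "a t x" 0] by (simp add: lam_0)
 qed
 have "htp (nsphere (Suc 0)) (nsphere (Suc 0)) f (lmul 0 d)"
 proof (rule homotopic_descend[where \<phi> = "\<lambda>(t, x, y). lam 0 (a t x, y)"])
  let ?T = "IZ (IZ (Zc 0))"
  have t: "rcont ?T fst" "rcont ?T (\<lambda>q. fst (snd q))"
   by (rule cont_fst_I, rule cm_compose[OF cont_fst_I cm_snd])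
  have "rcont ?T (\<lambda>q. h (fst (snd q)))"
   by (rule cont_o[OF t(2) hc])
  then have "cmap ?T (RD (Zc 0)) (\<lambda>q. (a (fst q) (fst (snd q)), snd (snd q)))"
   unfolding a_def using t
   by (intro cm_pair cont_arith cont_unary(2) cont_const
     cont_fst_snd(2)[OF cm_snd]) auto
  then show "cmap ?T (nsphere (Suc 0)) (\<lambda>(t, x, y). lam 0 (a t x, y))"
   unfolding split_beta by (rule cm_compose[OF lam_cont])
 next
  fix t :: real and q q' assume t: "t \<in> {0..1}" "q \<in> topspace (IZ (Zc 0))" "q' \<in> topspace (IZ (Zc 0))" "lam 0 q = lam 0 q'"
  obtain x y x' y' where [simp]: "q = (x, y)" "q' = (x', y')" by (cases q, cases q')
  show "(case (t, q) of (t, x, y) \<Rightarrow> lam 0 (a t x, y)) = (case (t, q') of (t, x, y) \<Rightarrow> lam 0 (a t x, y))"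
   unfolding \<open>q = _\<close> \<open>q' = _\<close> prod.case by (rule a) (use t in auto)
 next
  fix q assume q: "q \<in> topspace (IZ (Zc 0))"
  obtain x y where [simp]: "q = (x, y)" by (cases q)
  have "lam 0 (x, y) = lam 0 (x, \<lambda>_. 0)" by (simp add: lam_0)
  then show "(case (0::real, q) of (t, x, y) \<Rightarrow> lam 0 (a t x, y)) = f (lam 0 q)"
   using lh[of x y] by (simp add: a_def del: lam.simps)
  show "(case (1::real, q) of (t, x, y) \<Rightarrow> lam 0 (a t x, y)) = lmul 0 d (lam 0 q)"
   by (simp add: a_def lmul_lam del: lam.simps)
 qed
 then show ?thesis by blast
qed

text \<open>The last coordinates of the two values never have opposite signs, so antipodal values
  force them to vanish. This leaves the basepoint, which both maps fix, and the equator, on which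
  both are \<open>lmul k d\<close>.\<close>

lemma susp_lmul: "htp (nsphere (Suc (Suc k))) (nsphere (Suc (Suc k))) (susp (Suc k) (lmul k d)) (lmul (Suc k) d)"
proof (rule homotopic_nonantipodal[OF continuous_map_susp1[OF continuous_map_lmul] continuous_map_lmul])
 let ?m = "Suc k"
 fix p assume "p \<in> sph (Suc ?m)"
 then obtain x y where "x \<in> {0..1}" "y \<in> topspace (Zc (Suc k))" and p: "lam (Suc k) (x, y) = p" using lam_surj by blast
 define z u where "z = lam k (x, y)" and "u = clamp01 (y k)"
 have z: "z \<in> sph ?m" unfolding z_def by (rule lam_nsphere)
 let ?g = "lmul k d z"
 have g: "?g \<in> sph ?m" unfolding lmul_def by (rule lam_nsphere)
 have pS: "p = Sig ?m z u" unfolding p[symmetric] z_def u_def by simp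
 have q: "lmul (Suc k) d p = Sig ?m ?g u"
  unfolding p[symmetric] lmul_lam z_def u_def by simp
 show "\<exists>i\<le>Suc ?m. lmul (Suc k) d p i \<noteq> - susp ?m (lmul k d) p i"
 proof (rule ccontr)
  assume "\<not> ?thesis"
  then have a: "lmul (Suc k) d p i = - susp ?m (lmul k d) p i" if "i \<le> Suc ?m" for i using that by blast
  have e: False if "p = e1"
  proof -
   have "hw ?m e1 = 1" unfolding hw_def by (simp only: sum_e1) simp
   moreover have "nz ?m e1 = e1" by (rule nz_id) (simp only: topspace_nsphere sum_e1, simp)
   ultimately have "susp ?m (lmul k d) p 0 = 1" using that by (simp add: susp_def lmul_e1)
   then show False using a[of 0] that by (simp add: lmul_e1)
  qed
  let ?a = "sqrt ((1 - z 0) / 2)" and ?b = "sqrt ((1 - ?g 0) / 2)"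
  have "sin (2 * pi * u) * ?b = - (sin (2 * pi * u) * ?a)"
   using a[of "Suc ?m"] unfolding q by (simp add: susp_def pS) (simp add: Sig_def)
  then have "sin (2 * pi * u) * (?a + ?b) = 0" by (simp add: algebra_simps)
  moreover have "?a \<ge> 0" "?b \<ge> 0" using nsphere_0_le(1)[OF z] nsphere_0_le(1)[OF g] by auto
  ultimately consider "?a = 0" | "sin (2 * pi * u) = 0" by (auto simp: add_nonneg_eq_0_iff)
  then show False
  proof cases
   case 1
   then have "z = e1" using nsphere_eq_e1[OF z] by simp
   then show False using e pS by (simp add: Sig_e1)
  next
   case 2
   then have "cos (2 * pi * u) = 1 \<or> cos (2 * pi * u) = -1"
    using sin_cos_squared_add[of "2 * pi * u"] unfolding 2 by (simp only: power2_eq_1_iff zero_power2 add_0)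
   then show False
   proof
    assume "cos (2 * pi * u) = 1"
    then have "p = e1" unfolding pS Sig_def 2 by (simp only: mult_1 mult_zero_left) (auto simp: fun_eq_iff field_simps)
    then show False by (rule e)
   next
    assume c: "cos (2 * pi * u) = -1"
    have S: "Sig ?m v u i = v i" if "i \<le> ?m" for v i
     using that unfolding Sig_def c by (simp add: field_simps)
    have pz: "p i = z i" if "i \<le> ?m" for i unfolding pS by (rule S[OF that])
    have "(\<Sum>i\<le>?m. (p i)\<^sup>2) = (\<Sum>i\<le>?m. (z i)\<^sup>2)" using pz by (intro sum.cong) auto
    also have "\<dots> = 1" using z by (simp only: topspace_nsphere)
    finally have h: "hw ?m p = 1" by (simp only: hw_def real_sqrt_one)
    have "nz ?m p i = z i" for i
     using hw_nz[of i ?m p] pz[of i] z h by (cases "i \<le> ?m") (auto simp: nz_def topspace_nsphere)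
    then have "nz ?m p = z" by blast
    then have "susp ?m (lmul k d) p i = ?g i" if "i \<le> ?m" for i using that h by (simp add: susp_def)
    then have "?g i = 0" if "i \<le> ?m" for i using a[of i] S[of i ?g] that unfolding q by simp
    then have "(\<Sum>i\<le>?m. (?g i)\<^sup>2) = 0" by (intro sum.neutral) auto
    moreover have "(\<Sum>i\<le>?m. (?g i)\<^sup>2) = 1" using g by (simp only: topspace_nsphere)
    ultimately show False by simp
   qed
  qed
 qed
qed

text \<open>Every self-map of the next sphere deforms to a suspension, and the suspension of a
  standard map is homotopic to a standard map, so the circle decides.\<close>

theorem hopf:
 assumes "cmap (nsphere (Suc k)) (nsphere (Suc k)) f"
 shows "\<exists>d. htp (nsphere (Suc k)) (nsphere (Suc k)) f (lmul k d)"
 using assms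
proof (induction k arbitrary: f)
 case 0
 then show ?case by (rule hopf_circle)
next
 case (Suc k)
 let ?S = "nsphere (Suc (Suc k))"
 obtain h where h: "cmap ?S ?S h" "htp ?S ?S f h"
  "\<And>p. p \<in> topspace ?S \<Longrightarrow> \<forall>i\<le>Suc k. h p i = 0 \<Longrightarrow> p (Suc (Suc k)) * h p (Suc (Suc k)) > 0"
  by (rule homotopic_hemispherical[OF _ Suc.prems]) auto
 obtain g where g: "cmap (nsphere (Suc k)) (nsphere (Suc k)) g" "htp ?S ?S h (susp (Suc k) g)"
  by (rule homotopic_susp[OF h(1,3)]) auto
 obtain d where d: "htp (nsphere (Suc k)) (nsphere (Suc k)) g (lmul k d)"
  using Suc.IH[OF g(1)] by blast
 have "htp ?S ?S f (lmul (Suc k) d)"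
  by (rule htp_trans[OF h(2) htp_trans[OF g(2) htp_trans[OF susp_homotopic[OF d] susp_lmul]]])
 then show ?case by blast
qed

section \<open>Homotopy cofibres\<close>

locale cofibre =
 fixes A :: "'a topology" and a0 :: 'a and B :: "'b topology" and b0 :: 'b and f :: "'a \<Rightarrow> 'b"
 assumes f: "based_map A a0 B b0 f"
begin

abbreviation Cf :: "('b + 'a \<times> real) topology" where "Cf \<equiv> homotopy_cofibre A a0 B b0 f"

abbreviation cp :: "'a \<times> real \<Rightarrow> 'b + 'a \<times> real" where "cp \<equiv> cone_point a0 b0 f"

lemma f_in: "a \<in> topspace A \<Longrightarrow> f a \<in> topspace B" and b0: "b0 \<in> topspace B" and a0: "a0 \<in> topspace A" and f_a0: "f a0 = b0"
 using f by (auto simp: based_map_def dest: cm_funspace)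

lemma cp_in:
 "a \<in> topspace A \<Longrightarrow> s \<in> {0..1} \<Longrightarrow> cp (a, s) \<in> Inl ` topspace B \<union> Inr ` ((topspace A - {a0}) \<times> {0<..<1})"
 using f_in b0 by (auto simp: cone_point_def)

lemma cp_in':
 "z \<in> topspace (prod_topology A unit_interval) \<Longrightarrow> cp z \<in> Inl ` topspace B \<union> Inr ` ((topspace A - {a0}) \<times> {0<..<1})"
 using cp_in[of "fst z" "snd z"] by (auto simp: mem_Times_iff)

lemma topspace_Cf: "topspace Cf = Inl ` topspace B \<union> Inr ` ((topspace A - {a0}) \<times> {0<..<1})" (is "_ = ?S")
proof
 show "topspace Cf \<subseteq> ?S" by (rule conjunct1[OF iffD1[OF openin_homotopy_cofibre openin_topspace]])
 have "openin Cf ?S"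
 proof (subst openin_homotopy_cofibre, intro conjI order_refl)
  have "{b \<in> topspace B. Inl b \<in> ?S} = topspace B" by auto
  then show "openin B {b \<in> topspace B. Inl b \<in> ?S}" by simp
  have "{z \<in> topspace (prod_topology A unit_interval). cp z \<in> ?S} = topspace (prod_topology A unit_interval)"
   using cp_in' by blast
  then show "openin (prod_topology A unit_interval) {z \<in> topspace (prod_topology A unit_interval). cp z \<in> ?S}"
   by (simp only: openin_topspace)
 qed
 then show "?S \<subseteq> topspace Cf" by (rule openin_subset)
qed

lemma continuous_map_Inl: "cmap B Cf Inl"
 unfolding continuous_map_def by (auto simp: topspace_Cf openin_homotopy_cofibre)

lemma continuous_map_cp: "cmap (prod_topology A unit_interval) Cf cp"
 unfolding continuous_map_def
proof (intro conjI allI impI)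
 show "cp \<in> topspace (prod_topology A unit_interval) \<rightarrow> topspace Cf"
  using cp_in' unfolding topspace_Cf by blast
qed (simp add: openin_homotopy_cofibre)

lemma cp_Cf: "z \<in> topspace (prod_topology A unit_interval) \<Longrightarrow> cp z \<in> topspace Cf"
 using cp_in' unfolding topspace_Cf by blast

lemma closedin_Cf:
 assumes "C \<subseteq> topspace Cf" "closedin B {b \<in> topspace B. Inl b \<in> C}"
  "closedin (prod_topology A unit_interval) {z \<in> topspace (prod_topology A unit_interval). cp z \<in> C}"
 shows "closedin Cf C"
 unfolding closedin_def
proof (intro conjI assms(1), subst openin_homotopy_cofibre, intro conjI)
 show "topspace Cf - C \<subseteq> Inl ` topspace B \<union> Inr ` ((topspace A - {a0}) \<times> {0<..<1})" by (auto simp: topspace_Cf)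
 have "{b \<in> topspace B. Inl b \<in> topspace Cf - C} = topspace B - {b \<in> topspace B. Inl b \<in> C}"
  by (auto simp: topspace_Cf)
 then show "openin B {b \<in> topspace B. Inl b \<in> topspace Cf - C}" using assms(2) by (simp add: closedin_def)
 have "{z \<in> topspace (prod_topology A unit_interval). cp z \<in> topspace Cf - C}
  = topspace (prod_topology A unit_interval) - {z \<in> topspace (prod_topology A unit_interval). cp z \<in> C}"
  using cp_Cf by blast
 then show "openin (prod_topology A unit_interval) {z \<in> topspace (prod_topology A unit_interval). cp z \<in> topspace Cf - C}"
  using assms(3) by (simp add: closedin_def)
qed

text \<open>\<open>Cf\<close> is a quotient of a space built from the product, so that the product of the quotient
 map with an interval is again a quotient map.\<close>

lemma continuous_map_homotopy_from_Cf:
 assumes \<beta>: "cmap (IZ B) Y \<beta>"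
  and \<phi>: "cmap (IZ (prod_topology A unit_interval)) Y \<phi>"
  and h: "\<And>t b. t \<in> {0..1} \<Longrightarrow> b \<in> topspace B \<Longrightarrow> h (t, Inl b) = \<beta> (t, b)"
   "\<And>t a s. t \<in> {0..1} \<Longrightarrow> a \<in> topspace A \<Longrightarrow> s \<in> {0..1} \<Longrightarrow> h (t, cp (a, s)) = \<phi> (t, a, s)"
 shows "cmap (IZ Cf) Y h"
proof -
 let ?AI = "prod_topology A unit_interval"
 \<comment> \<open>The disjoint union of \<open>B\<close> and \<open>A \<times> [0,1]\<close>,
   encoded as a product with a two-point discrete space so that product rules apply. Each summand is
   thickened by the other space, which is nonempty thanks to the basepoints.\<close>
 let ?W = "prod_topology (discrete_topology UNIV :: bool topology) (prod_topology B ?AI)"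
 let ?q = "\<lambda>(c, b, z). if c then Inl b else cp z"
 have hom: "topspace ?W = UNIV \<times> topspace B \<times> topspace ?AI" by simp
 have part: "openin ?W {w \<in> topspace ?W. Q w} \<longleftrightarrow> openin (prod_topology B ?AI) {x \<in> topspace (prod_topology B ?AI). Q (True, x)}
   \<and> openin (prod_topology B ?AI) {x \<in> topspace (prod_topology B ?AI). Q (False, x)}" (is "?l \<longleftrightarrow> ?r") for Q
 proof
  assume l: ?l
  have "openin (prod_topology B ?AI) {x \<in> topspace (prod_topology B ?AI). (c, x) \<in> {w \<in> topspace ?W. Q w}}" for c
   by (rule openin_pre[OF _ l]) (intro cm_pair cont_id, simp)
  then have "openin (prod_topology B ?AI) {x \<in> topspace (prod_topology B ?AI). Q (c, x)}" for c by simp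
  then show ?r by blast
 next
  assume r: ?r
  have "openin ?W ({True} \<times> {x \<in> topspace (prod_topology B ?AI). Q (True, x)} \<union> {False} \<times> {x \<in> topspace (prod_topology B ?AI). Q (False, x)})"
   using r by (intro openin_Un) (auto simp: openin_prod_Times_iff)
  moreover have "({True} \<times> {x \<in> topspace (prod_topology B ?AI). Q (True, x)} \<union> {False} \<times> {x \<in> topspace (prod_topology B ?AI). Q (False, x)})
    = {w \<in> topspace ?W. Q w}"
  proof (rule Set.set_eqI)
   fix w :: "bool \<times> 'b \<times> 'a \<times> real"
   obtain c x where [simp]: "w = (c, x)" by (cases w)
   show "w \<in> {True} \<times> {x \<in> topspace (prod_topology B ?AI). Q (True, x)} \<union> {False} \<times> {x \<in> topspace (prod_topology B ?AI). Q (False, x)}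
     \<longleftrightarrow> w \<in> {w \<in> topspace ?W. Q w}"
    by (cases c) simp_all
  qed
  ultimately show ?l by simp
 qed
 have ne: "topspace B \<noteq> {}" "topspace ?AI \<noteq> {}" using b0 a0 by auto
 have "quotient_map ?W Cf ?q"
  unfolding quotient_map_def
 proof (intro conjI allI impI)
  show "?q ` topspace ?W = topspace Cf"
  proof
   show "?q ` topspace ?W \<subseteq> topspace Cf"
   proof (rule image_subsetI)
    fix w assume w: "w \<in> topspace ?W"
    obtain c b z where [simp]: "w = (c, b, z)" by (cases w)
    have "b \<in> topspace B" "z \<in> topspace ?AI" using w unfolding hom by auto
    then show "?q w \<in> topspace Cf" using cp_Cf[of z] by (simp add: topspace_Cf)
   qed
   show "topspace Cf \<subseteq> ?q ` topspace ?W"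
   proof
    fix y assume "y \<in> topspace Cf"
    then have "(\<exists>b \<in> topspace B. y = Inl b) \<or> (\<exists>a s. a \<in> topspace A \<and> a \<noteq> a0 \<and> 0 < s \<and> s < 1 \<and> y = Inr (a, s))"
     unfolding topspace_Cf by fastforce
    then consider b where "b \<in> topspace B" "y = Inl b"
     | a s where "a \<in> topspace A" "a \<noteq> a0" "0 < s" "s < 1" "y = Inr (a, s)"
     by blast
    then show "y \<in> ?q ` topspace ?W"
    proof cases
     case 1
     then show ?thesis using a0 by (intro image_eqI[of _ _ "(True, b, a0, 0)"]) simp_all
    next
     case 2
     then show ?thesis using b0 by (intro image_eqI[of _ _ "(False, b0, a, s)"]) (simp_all add: cone_point_def)
    qed
   qed
  qed
  fix U assume U: "U \<subseteq> topspace Cf"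
  have 1: "{x \<in> topspace (prod_topology B ?AI). ?q (True, x) \<in> U} = {b \<in> topspace B. Inl b \<in> U} \<times> topspace ?AI"
   and 2: "{x \<in> topspace (prod_topology B ?AI). ?q (False, x) \<in> U} = topspace B \<times> {z \<in> topspace ?AI. cp z \<in> U}"
   by auto
  show "openin ?W {x \<in> topspace ?W. ?q x \<in> U} = openin Cf U"
  proof -
   have t: "openin (prod_topology B ?AI) (V \<times> topspace ?AI) \<longleftrightarrow> openin B V"
    "openin (prod_topology B ?AI) (topspace B \<times> V') \<longleftrightarrow> openin ?AI V'" for V V'
    unfolding openin_prod_Times_iff using ne openin_empty[of B] openin_empty[of ?AI] openin_topspace[of B] openin_topspace[of ?AI]
    by (metis)+
   show ?thesis unfolding part 1 2 t openin_homotopy_cofibre using U unfolding topspace_Cf by (simp only: simp_thms)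
  qed
 qed
 then have Q: "quotient_map (IZ ?W) (IZ Cf) (\<lambda>(t, w). (t, ?q w))"
  by (intro quotient_map_prod_right compact_imp_locally_compact_space disjI1)
   (simp_all add: compact_space_subtopology Hausdorff_space_subtopology)
 have "cmap (IZ ?W) Y (h \<circ> (\<lambda>(t, w). (t, ?q w)))"
 proof (rule continuous_map_glue[where A = "{x. fst (snd x)} \<inter> topspace (IZ ?W)" and B = "{x. \<not> fst (snd x)} \<inter> topspace (IZ ?W)"
    and f = "\<lambda>(t, c, b, z). \<beta> (t, b)" and g = "\<lambda>(t, c, b, z). \<phi> (t, z)"])
  have c: "cmap (IZ ?W) (discrete_topology UNIV) (\<lambda>x. fst (snd x))"
   by (rule cm_compose[OF cm_fst cm_snd])
  show "closedin (IZ ?W) ({x. fst (snd x)} \<inter> topspace (IZ ?W))"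
   using closedin_pre[OF c, of "{True}"] by (simp add: Int_def conj_commute)
  show "closedin (IZ ?W) ({x. \<not> fst (snd x)} \<inter> topspace (IZ ?W))"
   using closedin_pre[OF c, of "{False}"] by (simp add: Int_def conj_commute)
  have "cmap (IZ ?W) Y (\<lambda>x. \<beta> (fst x, fst (snd (snd x))))"
   by (intro cm_compose[OF \<beta>] cm_pair cm_fst cont_fst_snd(1)[where Y = ?AI]
     cont_fst_snd(2)[where X = "discrete_topology UNIV"] cm_snd)
  then show "cmap (subtopology (IZ ?W) ({x. fst (snd x)} \<inter> topspace (IZ ?W))) Y (\<lambda>(t, c, b, z). \<beta> (t, b))"
   unfolding split_beta by (rule cm_sub)
  have "cmap (IZ ?W) Y (\<lambda>x. \<phi> (fst x, snd (snd (snd x))))"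
   by (intro cm_compose[OF \<phi>] cm_pair cm_fst cont_fst_snd(2)[where X = B]
     cont_fst_snd(2)[where X = "discrete_topology UNIV"] cm_snd)
  then show "cmap (subtopology (IZ ?W) ({x. \<not> fst (snd x)} \<inter> topspace (IZ ?W))) Y (\<lambda>(t, c, b, z). \<phi> (t, z))"
   unfolding split_beta by (rule cm_sub)
 qed (auto simp: h)
 then show ?thesis using continuous_compose_quotient_map[OF Q] by blast
qed

lemma continuous_map_from_Cf:
 assumes "cmap B Y \<beta>" "cmap (prod_topology A unit_interval) Y \<phi>"
  and "\<And>z. z \<in> topspace (prod_topology A unit_interval) \<Longrightarrow> case_sum \<beta> \<phi> (cp z) = \<phi> z"
 shows "cmap Cf Y (case_sum \<beta> \<phi>)"
proof -
 have "cmap (IZ Cf) Y (\<lambda>q. case_sum \<beta> \<phi> (snd q))"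
  by (rule continuous_map_homotopy_from_Cf[OF cm_compose[OF assms(1) cm_snd] cm_compose[OF assms(2) cm_snd]])
   (simp_all add: assms(3))
 then have "cmap Cf Y (\<lambda>x. case_sum \<beta> \<phi> (snd (0 :: real, x)))"
  by (rule cm_compose) (intro cm_pair cont_id, simp)
 then show ?thesis by simp
qed

end

section \<open>Retraction of a neighbourhood onto the base of a cofibre, and homology of
  cofibres\<close>

context cofibre
begin

lemma Cf_cases:
 assumes "x \<in> topspace Cf"
 obtains b where "x = Inl b" "b \<in> topspace B"
  | a s where "x = Inr (a, s)" "cp (a, s) = Inr (a, s)" "a \<in> topspace A" "a \<noteq> a0" "0 < s" "s < 1"
proof -
 have "(\<exists>b. x = Inl b \<and> b \<in> topspace B) \<or> (\<exists>a s. x = Inr (a, s) \<and> a \<in> topspace A \<and> a \<noteq> a0 \<and> 0 < s \<and> s < 1)"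
  using assms unfolding topspace_Cf by fastforce
 then show ?thesis using that by (fastforce simp: cone_point_def)
qed

end

locale ndr_cofibre = cofibre +
 fixes u :: "'a \<Rightarrow> real" and k :: "real \<times> 'a \<Rightarrow> 'a"
 assumes u: "cmap A unit_interval u" "{x \<in> topspace A. u x = 0} = {a0}"
  and k: "cmap (IZ A) A k" "\<And>x. x \<in> topspace A \<Longrightarrow> k (0, x) = x"
   "\<And>t. t \<in> {0..1} \<Longrightarrow> k (t, a0) = a0" "\<And>x. x \<in> topspace A \<Longrightarrow> u x < 1 \<Longrightarrow> k (1, x) = a0"
begin

text \<open>At time 1 the outer thirds of the cone coordinate are pushed to the ends, and the NDR
  homotopy moves points near \<open>a0\<close> to \<open>a0\<close> on the upper two thirds. Its
  time \<open>min 1 (3 s)\<close> is 0 at \<open>s = 0\<close>, where the gluing along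
  \<open>f\<close> has to be respected.\<close>

definition resc :: "real \<Rightarrow> 'a \<times> real \<Rightarrow> 'b + 'a \<times> real" where
 "resc t = (\<lambda>(a, s). cp (k (t * min 1 (3 * s), a), (1 - t) * s + t * clamp01 (3 * s - 1)))"

definition Resc :: "real \<Rightarrow> 'b + 'a \<times> real \<Rightarrow> 'b + 'a \<times> real" where
 "Resc t = case_sum Inl (resc t)"

definition NB :: "('b + 'a \<times> real) set" where
 "NB = {x \<in> topspace Cf. case_sum (\<lambda>_. True) (\<lambda>(a, s). s < 1/3 \<or> s > 2/3 \<or> u a < 1) x}"

lemma u_a0: "u a0 = 0" using u(2) by auto

lemma Resc_cp:
 assumes "a \<in> topspace A" "s \<in> {0..1}" "t \<in> {0..1}"
 shows "Resc t (cp (a, s)) = resc t (a, s)"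
proof -
 have m: "t * min 1 (3 * s) \<in> {0..1}" using assms by (auto simp: mult_le_one)
 have e: "cp (x, 1) = Inl b0" "cp (a0, y) = Inl b0" for x y by (simp_all add: cone_point_def)
 consider "a = a0" | "s = 1" | "a \<noteq> a0" "s = 0" | "a \<noteq> a0" "s \<noteq> 0" "s \<noteq> 1" by blast
 then show ?thesis
 proof cases
  case 1
  then show ?thesis using k(3)[OF m] by (simp add: Resc_def resc_def e)
 next
  case 2
  then show ?thesis by (simp add: Resc_def resc_def e clamp01_simps)
 next
  case 3
  then show ?thesis using k(2)[OF assms(1)] by (simp add: Resc_def resc_def clamp01_simps cone_point_def)
 next
  case 4
  then show ?thesis by (simp add: Resc_def cone_point_def)
 qed
qed

lemma continuous_map_unit:
 assumes "rcont X g" "\<And>x. x \<in> topspace X \<Longrightarrow> g x \<in> {0..1}"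
 shows "cmap X unit_interval g"
 using assms by (auto simp: cm_in_sub)

lemma continuous_map_Resc: "cmap (IZ Cf) Cf (\<lambda>(t, x). Resc t x)"
proof (rule continuous_map_homotopy_from_Cf[where \<beta> = "\<lambda>(t, b). Inl b" and \<phi> = "\<lambda>(t, z). resc t z"])
 show "cmap (IZ B) Cf (\<lambda>(t, b). Inl b)"
  unfolding split_beta by (rule cm_compose[OF continuous_map_Inl cm_snd])
 let ?T = "IZ (prod_topology A unit_interval)"
 have c: "rcont ?T fst" "rcont ?T (\<lambda>q. snd (snd q))"
  by (rule cont_fst_I, rule cm_full, rule cont_fst_snd(2)[OF cm_snd])
 have m: "q \<in> topspace ?T \<Longrightarrow> fst q \<in> {0..1} \<and> snd (snd q) \<in> {0..1}" for q by auto
 have cl: "clamp01 x \<in> {0..1}" for x by (auto simp: clamp01_def)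
 have "cmap ?T unit_interval (\<lambda>q. fst q * min 1 (3 * snd (snd q)))"
 proof (rule continuous_map_unit)
  show "fst q * min 1 (3 * snd (snd q)) \<in> {0..1}" if "q \<in> topspace ?T" for q
   using m[OF that] by (auto simp: mult_le_one)
 qed (intro cont_arith c cont_const)
 moreover have "cmap ?T A (\<lambda>q. fst (snd q))"
  by (rule cont_fst_snd(1)[OF cm_snd])
 ultimately have 1: "cmap ?T A (\<lambda>q. k (fst q * min 1 (3 * snd (snd q)), fst (snd q)))"
  by (intro cm_compose[OF k(1)] cm_pair)
 have 2: "cmap ?T unit_interval (\<lambda>q. (1 - fst q) * snd (snd q) + fst q * clamp01 (3 * snd (snd q) - 1))"
 proof (rule continuous_map_unit)
  show "(1 - fst q) * snd (snd q) + fst q * clamp01 (3 * snd (snd q) - 1) \<in> {0..1}" if "q \<in> topspace ?T" for q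
  proof -
   have "convex {0..1::real}" by simp
   from convexD[OF this, of "snd (snd q)" "clamp01 (3 * snd (snd q) - 1)" "1 - fst q" "fst q"]
   show ?thesis using m[OF that] cl[of "3 * snd (snd q) - 1"] by simp
  qed
 qed (unfold clamp01_def, intro cont_arith c cont_const)
 show "cmap ?T Cf (\<lambda>(t, z). resc t z)"
  unfolding resc_def split_beta by (intro cm_compose[OF continuous_map_cp] cm_pair 1 2)
qed (simp_all add: Resc_cp, simp add: Resc_def)

lemma Resc_0: "x \<in> topspace Cf \<Longrightarrow> Resc 0 x = x"
 by (erule Cf_cases) (simp_all add: Resc_def resc_def k(2))

lemma Resc_homotopic: "homotopic_with (\<lambda>h. h \<in> Inl ` topspace B \<rightarrow> Inl ` topspace B) Cf Cf (Resc 1) id"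
proof (rule homotopic_with_symD)
 show "homotopic_with (\<lambda>h. h \<in> Inl ` topspace B \<rightarrow> Inl ` topspace B) Cf Cf id (Resc 1)"
 proof (rule iffD2[OF homotopic_with], goal_cases)
  case (1 h k)
  have "Inl ` topspace B \<subseteq> topspace Cf" by (auto simp: topspace_Cf)
  then have "h (Inl b) = k (Inl b)" if "b \<in> topspace B" for b using 1 that by blast
  then show ?case by (auto simp: Pi_iff)
 next
  case 2
  show ?case
   by (intro exI[of _ "\<lambda>(t, x). Resc t x"] conjI continuous_map_Resc) (auto simp: Resc_0, auto simp: Resc_def)
 qed
qed

lemma Resc_NB: "Resc 1 \<in> NB \<rightarrow> Inl ` topspace B"
proof
 fix x assume x: "x \<in> NB"
 have i: "cp (a, s) \<in> Inl ` topspace B" if "a \<in> topspace A" "s \<in> {0, 1} \<or> a = a0" for a s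
  using that f_in b0 by (auto simp: cone_point_def)
 show "Resc 1 x \<in> Inl ` topspace B"
 proof (cases x)
  case (Inl b)
  then show ?thesis using x by (auto simp: NB_def topspace_Cf Resc_def)
 next
  case (Inr z)
  obtain a s where z: "z = (a, s)" by (cases z)
  have as: "a \<in> topspace A" "0 < s" "s < 1" and c: "s < 1/3 \<or> s > 2/3 \<or> u a < 1"
   using x unfolding Inr z NB_def topspace_Cf by auto
  have kin: "k (min 1 (3 * s), a) \<in> topspace A"
   by (rule funcset_mem[OF cm_funspace[OF k(1)]]) (use as in simp)
  have "clamp01 (3 * s - 1) \<in> {0, 1} \<or> k (min 1 (3 * s), a) = a0"
   using c k(4)[OF as(1)] by (auto simp: clamp01_def min_def max_def)
  then show ?thesis using i[OF kin, of "clamp01 (3 * s - 1)"] unfolding Inr z Resc_def resc_def by simp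
 qed
qed

lemma openin_NB: "openin Cf NB"
proof (subst openin_homotopy_cofibre, intro conjI)
 show "NB \<subseteq> Inl ` topspace B \<union> Inr ` ((topspace A - {a0}) \<times> {0<..<1})" by (auto simp: NB_def topspace_Cf)
 have "{b \<in> topspace B. Inl b \<in> NB} = topspace B" by (auto simp: NB_def topspace_Cf)
 then show "openin B {b \<in> topspace B. Inl b \<in> NB}" by simp
 let ?X = "prod_topology A unit_interval"
 have s: "rcont ?X snd" by (rule cm_full[OF cm_snd])
 have u': "rcont ?X (\<lambda>z. u (fst z))"
  by (rule cm_compose[OF cm_full[OF u(1)] cm_fst])
 have "openin ?X ({z \<in> topspace ?X. snd z \<in> {..<1/3}} \<union> {z \<in> topspace ?X. snd z \<in> {2/3<..}} \<union> {z \<in> topspace ?X. u (fst z) \<in> {..<1}})"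
  by (intro openin_Un openin_pre[OF s] openin_pre[OF u']) auto
 moreover have "({z \<in> topspace ?X. snd z \<in> {..<1/3}} \<union> {z \<in> topspace ?X. snd z \<in> {2/3<..}} \<union> {z \<in> topspace ?X. u (fst z) \<in> {..<1}})
   = {z \<in> topspace ?X. cp z \<in> NB}"
 proof (rule Set.set_eqI)
  fix z
  show "z \<in> ({z \<in> topspace ?X. snd z \<in> {..<1/3}} \<union> {z \<in> topspace ?X. snd z \<in> {2/3<..}} \<union> {z \<in> topspace ?X. u (fst z) \<in> {..<1}})
    \<longleftrightarrow> z \<in> {z \<in> topspace ?X. cp z \<in> NB}"
  proof (cases "z \<in> topspace ?X")
   case True
   obtain a s where z: "z = (a, s)" by (cases z)
   have "cp (a, s) \<in> NB \<longleftrightarrow> s < 1/3 \<or> s > 2/3 \<or> u a < 1"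
    using cp_Cf[OF True] u_a0 unfolding z NB_def by (auto simp: cone_point_def)
   then show ?thesis using True unfolding z by auto
  qed simp
 qed
 ultimately show "openin ?X {z \<in> topspace ?X. cp z \<in> NB}" by (simp only:)
qed

lemma closedin_a0: "closedin A {a0}"
 using closedin_pre[OF u(1), of "{0}"] u(2) by simp

lemma closedin_Inl:
 assumes "closedin B C"
 shows "closedin Cf (Inl ` C)"
proof (rule closedin_Cf)
 have CB: "C \<subseteq> topspace B" using assms by (rule closedin_subset)
 then show "Inl ` C \<subseteq> topspace Cf" by (auto simp: topspace_Cf)
 have "{b \<in> topspace B. (Inl b :: 'b + 'a \<times> real) \<in> Inl ` C} = C" using CB by auto
 then show "closedin B {b \<in> topspace B. (Inl b :: 'b + 'a \<times> real) \<in> Inl ` C}" using assms by (simp only:)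
 let ?X = "prod_topology A unit_interval"
 have f: "cmap A B f" using f by (simp add: based_map_def)
 have "closedin ?X ({z \<in> topspace ?X. fst z \<in> {a0}} \<union> {z \<in> topspace ?X. snd z \<in> {1}})"
  by (intro closedin_Un closedin_pre[OF cm_fst] closedin_pre[OF cm_snd] closedin_a0)
   (auto intro!: closed_subset)
 moreover have "closedin ?X ({z \<in> topspace ?X. f (fst z) \<in> C} \<inter> {z \<in> topspace ?X. snd z \<in> {0}})"
  by (intro closedin_Int closedin_pre[OF cm_compose[OF f cm_fst] assms]
    closedin_pre[OF cm_snd]) (auto intro!: closed_subset)
 ultimately have "closedin ?X ((if b0 \<in> C then {z \<in> topspace ?X. fst z \<in> {a0}} \<union> {z \<in> topspace ?X. snd z \<in> {1}} else {})
    \<union> ({z \<in> topspace ?X. f (fst z) \<in> C} \<inter> {z \<in> topspace ?X. snd z \<in> {0}}))"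
  by (intro closedin_Un) auto
 moreover have "(if b0 \<in> C then {z \<in> topspace ?X. fst z \<in> {a0}} \<union> {z \<in> topspace ?X. snd z \<in> {1}} else {})
    \<union> ({z \<in> topspace ?X. f (fst z) \<in> C} \<inter> {z \<in> topspace ?X. snd z \<in> {0}}) = {z \<in> topspace ?X. cp z \<in> Inl ` C}"
  using f_a0 by (auto simp: cone_point_def split: if_splits)
 ultimately show "closedin ?X {z \<in> topspace ?X. cp z \<in> Inl ` C}" by (simp only:)
qed

lemma homeomorphic_map_Inl: "homeomorphic_map B (subtopology Cf (Inl ` topspace B)) Inl"
proof -
 have "closed_map B Cf Inl" unfolding closed_map_def by (auto intro: closedin_Inl)
 then have "embedding_map B Cf Inl"
  using injective_closed_imp_embedding_map[OF continuous_map_Inl] by simp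
 then show ?thesis by (simp add: embedding_map_def)
qed

end

lemma ndr_cofibreI:
 assumes "nondegenerate_basepoint A a0" "based_map A a0 B b0 f"
 obtains u k where "ndr_cofibre A a0 B b0 f u k"
 using assms unfolding nondegenerate_basepoint_def ndr_cofibre_def ndr_cofibre_axioms_def cofibre_def by blast

lemma contractible_cone:
 assumes "t0 \<in> topspace T"
 shows "contractible_space (homotopy_cofibre T t0 T t0 id)"
proof -
 interpret cofibre T t0 T t0 id using assms by unfold_locales (simp add: based_map_def)
 let ?g = "\<lambda>(t, a, s). cp (a, s + t * (1 - s))"
 let ?h = "\<lambda>(t, x). case_sum (\<lambda>b. ?g (t, b, 0)) (\<lambda>z. ?g (t, z)) x"
 let ?T = "IZ (prod_topology T unit_interval)"
 have "cmap (IZ Cf) Cf ?h"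
 proof (rule continuous_map_homotopy_from_Cf[where \<beta> = "\<lambda>(t, b). cp (b, t)" and \<phi> = ?g])
  show "cmap (IZ T) Cf (\<lambda>(t, b). cp (b, t))"
   unfolding split_beta by (intro cm_compose[OF continuous_map_cp] cm_pair cm_fst cm_snd)
  have "cmap ?T unit_interval (\<lambda>q. snd (snd q) + fst q * (1 - snd (snd q)))"
  proof -
   have "snd (snd q) + fst q * (1 - snd (snd q)) \<in> {0..1}" if "q \<in> topspace ?T" for q
   proof -
    have "fst q * (1 - snd (snd q)) \<le> 1 * (1 - snd (snd q))" using that by (intro mult_right_mono) auto
    then show ?thesis using that by auto
   qed
   moreover have "rcont ?T (\<lambda>q. snd (snd q) + fst q * (1 - snd (snd q)))"
    by (intro cont_arith cont_fst_I cont_const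
      cm_full[OF cont_fst_snd(2)[OF cm_snd]])
   ultimately show ?thesis by (auto simp: cm_in_sub)
  qed
  then show "cmap ?T Cf ?g"
   unfolding split_beta by (intro cm_compose[OF continuous_map_cp] cm_pair cont_fst_snd(1)[OF cm_snd])
 qed (auto simp: cone_point_def)
 moreover have "?h (0, x) = x" if "x \<in> topspace Cf" for x using that by (rule Cf_cases) (simp_all, simp add: cone_point_def)
 moreover have "?h (1, x) = Inl t0" if "x \<in> topspace Cf" for x using that by (auto simp: cone_point_def split: sum.split)
 ultimately have "htp Cf Cf id (\<lambda>_. Inl t0)"
  by (subst homotopic_with) (simp, intro exI[of _ ?h], simp)
 then show ?thesis unfolding contractible_space_def by blast
qed

lemma hom_induced_const:
 assumes m: "m \<noteq> 0" and y: "y \<in> topspace Y" and z: "z \<in> carrier (homology_group m X)"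
 shows "hom_induced m X {} Y {} (\<lambda>_. y) z = \<one>\<^bsub>homology_group m Y\<^esub>"
proof -
 let ?P = "subtopology Y {y}"
 have "contractible_space ?P" using y by (simp add: contractible_space_singleton)
 then have "trivial_group (homology_group m ?P)"
  using trivial_reduced_homology_group_contractible_space un_reduced_homology_group[OF m] by metis
 moreover have "hom_induced m X {} ?P {} (\<lambda>_. y) z \<in> carrier (homology_group m ?P)" by (rule hom_induced_carrier)
 ultimately have 1: "hom_induced m X {} ?P {} (\<lambda>_. y) z = \<one>\<^bsub>homology_group m ?P\<^esub>" by (auto simp: trivial_group_def)
 have "hom_induced m X {} Y {} (id \<circ> (\<lambda>_. y)) z = hom_induced m ?P {} Y {} id (hom_induced m X {} ?P {} (\<lambda>_. y) z)"
  by (rule hom_induced_compose'[symmetric]) (use y in \<open>auto simp: cm_in_sub continuous_map_id_subt\<close>)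
 then show ?thesis unfolding 1 hom_induced_one by (simp add: o_def)
qed

text \<open>The cone on \<open>T\<close> maps to \<open>P\<close> by a relative homeomorphism, so
  the homology of \<open>P\<close> relative to \<open>T\<close> vanishes in degree \<open>m\<close>,
  like the reduced homology of \<open>T\<close> in degree \<open>m - 1\<close>. Thus every class
  comes from \<open>T\<close>, and \<open>q\<close> times it is the image of its transform under
  \<open>d\<close>, which is null homotopic in \<open>P\<close>.\<close>

theorem cofibre_homology_exponent:
 fixes T :: "'t topology" and t0 d
 defines "P \<equiv> homotopy_cofibre T t0 T t0 d"
 assumes nd: "nondegenerate_basepoint T t0" and d: "based_map T t0 T t0 d" and m: "m \<noteq> 0"
  and triv: "trivial_group (reduced_homology_group (m - 1) T)"
  and deg: "\<And>z. z \<in> carrier (homology_group m T) \<Longrightarrow> hom_induced m T {} T {} d z = z [^]\<^bsub>homology_group m T\<^esub> q"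
  and y: "y \<in> carrier (homology_group m P)"
 shows "y [^]\<^bsub>homology_group m P\<^esub> (q::nat) = \<one>\<^bsub>homology_group m P\<^esub>"
proof -
 obtain u k where "ndr_cofibre T t0 T t0 d u k" by (rule ndr_cofibreI[OF nd d])
 then interpret P: ndr_cofibre T t0 T t0 d u k .
 interpret C: ndr_cofibre T t0 T t0 id u k
  using P.u P.k P.a0 by unfold_locales (auto simp: based_map_def)
 let ?CT = "homotopy_cofibre T t0 T t0 id" and ?A = "Inl ` topspace T :: ('t + 't \<times> real) set"
 \<comment> \<open>The identity on the open cone and \<open>d\<close> on its base; hence
   \<open>id\<close> is a section off the base.\<close>
 define D where "D = case_sum (\<lambda>b. Inl (d b)) (Inr :: 't \<times> real \<Rightarrow> 't + 't \<times> real)"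
 have Dcp: "D (C.cp z) = P.cp z" for z using P.f_a0 by (auto simp: D_def cone_point_def)
 have dc: "cmap T T d" using d by (simp add: based_map_def)
 have Dc: "cmap ?CT P D"
 proof -
  have e: "case_sum (\<lambda>b. Inl (d b)) P.cp x = D x" if "x \<in> topspace ?CT" for x
   using that by (rule C.Cf_cases) (simp_all add: D_def cone_point_def)
  have "cmap ?CT P (case_sum (\<lambda>b. Inl (d b)) P.cp)"
   unfolding P_def
  proof (rule C.continuous_map_from_Cf[OF cm_compose[OF P.continuous_map_Inl dc] P.continuous_map_cp])
   fix z assume "z \<in> topspace (prod_topology T unit_interval)"
   then show "case_sum (\<lambda>b. Inl (d b)) P.cp (C.cp z) = P.cp z"
    using e[OF C.cp_Cf] Dcp by metis
  qed
  then show ?thesis by (rule continuous_map_eq) (rule e)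
 qed
 have tops: "topspace ?CT = topspace P" by (simp add: P_def C.topspace_Cf P.topspace_Cf)
 have tr: "trivial_group (rel_H m P ?A)"
 proof -
  have "rel_H m ?CT ?A \<cong> reduced_homology_group (m - 1) (subtopology ?CT ?A)"
   by (rule isomorphic_group_relative_homology_of_contractible[OF contractible_cone])
    (use P.a0 in \<open>auto simp: C.topspace_Cf\<close>)
  moreover have "reduced_homology_group (m - 1) (subtopology ?CT ?A) \<cong> reduced_homology_group (m - 1) T"
   using C.homeomorphic_map_Inl homeomorphic_space_imp_isomorphic_reduced_homology_groups homeomorphic_map_imp_homeomorphic_space homeomorphic_space_sym by metis
  ultimately have tC: "trivial_group (rel_H m ?CT ?A)"
   using triv isomorphic_group_triviality[OF _ group_relative_homology_group group_reduced_homology_group]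
    isomorphic_group_triviality[OF _ group_reduced_homology_group group_reduced_homology_group] by metis
  have "z = \<one>\<^bsub>rel_H m P ?A\<^esub>" if z: "z \<in> carrier (rel_H m P ?A)" for z
  proof -
   have "\<exists>y \<in> carrier (rel_H m ?CT ?A). hom_induced m ?CT ?A P ?A D y = z"
   proof (rule relative_homology_onto[OF Dc _ _ _ _ _ _ _ _ _ _ _ _ _ z, where N = P.NB and N' = C.NB and E = id and R = "P.Resc 1" and R' = "C.Resc 1"])
    show "D \<in> ?A \<rightarrow> ?A" using P.f_in by (auto simp: D_def)
    show "D \<in> C.NB \<rightarrow> P.NB"
     using P.f_in by (auto simp: D_def C.NB_def P.NB_def C.topspace_Cf P.topspace_Cf)
    show "closedin P ?A" unfolding P_def by (rule P.closedin_Inl) simp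
    show "openin P P.NB" unfolding P_def by (rule P.openin_NB)
    show "?A \<subseteq> P.NB" by (auto simp: P.NB_def P.topspace_Cf)
    show "id \<in> P.NB - ?A \<rightarrow> C.NB" by (auto simp: P.NB_def C.NB_def P.topspace_Cf C.topspace_Cf)
    show "D (id x) = x" if "x \<in> topspace P - ?A" for x
     using that by (auto simp: P_def P.topspace_Cf D_def)
    show "homotopic_with (\<lambda>h. h \<in> ?A \<rightarrow> ?A) P P (P.Resc 1) id" unfolding P_def by (rule P.Resc_homotopic)
    show "P.Resc 1 \<in> P.NB \<rightarrow> ?A" by (rule P.Resc_NB)
    show "C.Resc 1 \<in> C.NB \<rightarrow> ?A" by (rule C.Resc_NB)
    show "cmap ?CT ?CT (C.Resc 1)"
     using homotopic_with_imp_continuous_maps[OF C.Resc_homotopic] by blast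
    show "D (C.Resc 1 x) = P.Resc 1 (D x)" if "x \<in> topspace ?CT" for x
     by (cases x) (auto simp: C.Resc_def P.Resc_def C.resc_def P.resc_def Dcp, auto simp: D_def)
    show "cmap (subtopology P (topspace P - ?A)) ?CT id"
     unfolding continuous_map_def
    proof (intro conjI allI impI)
     show "id \<in> topspace (subtopology P (topspace P - ?A)) \<rightarrow> topspace ?CT" by (simp add: tops)
     fix U assume U: "openin ?CT U"
     let ?X = "prod_topology T unit_interval"
     have "openin ?X {z \<in> topspace ?X. C.cp z \<in> U}" using U unfolding openin_homotopy_cofibre by blast
     moreover have "openin ?X ((topspace T - {t0}) \<times> {0<..<1})"
      using P.closedin_a0 by (auto simp: openin_prod_Times_iff intro!: openin_diff open_subset)
     ultimately have o: "openin ?X ({z \<in> topspace ?X. C.cp z \<in> U} \<inter> (topspace T - {t0}) \<times> {0<..<1})" by (rule openin_Int)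
     have "openin P (U - ?A)"
      unfolding P_def
     proof (subst openin_homotopy_cofibre, intro conjI)
      show "U - ?A \<subseteq> ?A \<union> Inr ` ((topspace T - {t0}) \<times> {0<..<1})"
       using openin_subset[OF U] by (auto simp: C.topspace_Cf)
      have "{b \<in> topspace T. Inl b \<in> U - ?A} = {}" by auto
      then show "openin T {b \<in> topspace T. Inl b \<in> U - ?A}" by (simp only: openin_empty)
      have "{z \<in> topspace ?X. P.cp z \<in> U - ?A} = {z \<in> topspace ?X. C.cp z \<in> U} \<inter> (topspace T - {t0}) \<times> {0<..<1}"
      proof (rule Set.set_eqI)
       fix z :: "'t \<times> real"
       obtain a s where z: "z = (a, s)" by (cases z)
       show "z \<in> {z \<in> topspace ?X. P.cp z \<in> U - ?A} \<longleftrightarrow> z \<in> {z \<in> topspace ?X. C.cp z \<in> U} \<inter> (topspace T - {t0}) \<times> {0<..<1}"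
       proof (cases "a \<in> topspace T \<and> a \<noteq> t0 \<and> 0 < s \<and> s < 1")
        case True
        then show ?thesis unfolding z by (auto simp: cone_point_def)
       next
        case False
        then have "z \<in> topspace ?X \<Longrightarrow> P.cp z \<in> ?A" using P.f_in P.b0 unfolding z by (auto simp: cone_point_def)
        then show ?thesis using False unfolding z by auto
       qed
      qed
      then show "openin ?X {z \<in> topspace ?X. P.cp z \<in> U - ?A}" using o by (simp only:)
     qed
     moreover have "{x \<in> topspace (subtopology P (topspace P - ?A)). id x \<in> U} = U - ?A"
      using openin_subset[OF U] tops by auto
     ultimately show "openin (subtopology P (topspace P - ?A)) {x \<in> topspace (subtopology P (topspace P - ?A)). id x \<in> U}"
      using openin_subset[OF U] tops by (auto simp: openin_subtopology intro!: exI[of _ "U - ?A"])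
    qed
   qed
   then show ?thesis using tC by (auto simp: trivial_group_def hom_induced_one)
  qed
  moreover have "\<one>\<^bsub>rel_H m P ?A\<^esub> \<in> carrier (rel_H m P ?A)"
   by (intro monoid.one_closed group.is_monoid group_relative_homology_group)
  ultimately show ?thesis unfolding trivial_group_def using group_relative_homology_group by blast
 qed
 have "hom_induced m P {} P ?A id y \<in> carrier (rel_H m P ?A)" by (rule hom_induced_carrier)
 then have "y \<in> kernel (homology_group m P) (rel_H m P ?A) (hom_induced m P {} P ?A id)"
  using tr y by (auto simp: trivial_group_def kernel_def)
 then obtain w where w: "w \<in> carrier (homology_group m (subtopology P ?A))" "y = hom_induced m (subtopology P ?A) {} P {} id w"
  using homology_exactness_axiom_3[of m P ?A] by auto
 have iso: "hom_induced m T {} (subtopology P ?A) {} Inl \<in> iso (homology_group m T) (homology_group m (subtopology P ?A))"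
  unfolding P_def by (rule homeomorphic_map_homology_iso[OF P.homeomorphic_map_Inl])
 obtain v where v: "v \<in> carrier (homology_group m T)" "w = hom_induced m T {} (subtopology P ?A) {} Inl v"
  using iso_surj[OF iso w(1)] by blast
 have Ic: "cmap T P Inl" unfolding P_def by (rule P.continuous_map_Inl)
 have yv: "y = hom_induced m T {} P {} Inl v"
 proof -
  have "y = hom_induced m T {} P {} (id \<circ> Inl) v"
   unfolding w(2) v(2) by (rule hom_induced_compose') (use Ic in \<open>auto simp: cm_in_sub continuous_map_id_subt\<close>)
  then show ?thesis by simp
 qed
 have "y [^]\<^bsub>homology_group m P\<^esub> q = hom_induced m T {} P {} Inl (v [^]\<^bsub>homology_group m T\<^esub> q)"
  unfolding yv using hom_induced_empty_hom v(1)
  by (metis group_relative_homology_group hom_nat_pow)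
 also have "\<dots> = hom_induced m T {} P {} Inl (hom_induced m T {} T {} d v)" using deg[OF v(1)] by simp
 also have "\<dots> = hom_induced m T {} P {} (Inl \<circ> d) v"
  by (rule hom_induced_compose'[OF dc _ Ic]) auto
 also have "\<dots> = hom_induced m T {} P {} (\<lambda>_. Inl t0) v"
 proof -
  have "htp T P (Inl \<circ> d) (\<lambda>_. Inl t0)"
  proof (subst homotopic_with, simp, intro exI conjI ballI)
   show "cmap (IZ T) P (\<lambda>(t, x). P.cp (x, t))"
    unfolding split_beta P_def by (intro cm_compose[OF P.continuous_map_cp] cm_pair cm_fst cm_snd)
  qed (auto simp: cone_point_def P.f_a0)
  then show ?thesis using homology_homotopy_empty by metis
 qed
 also have "\<dots> = \<one>\<^bsub>homology_group m P\<^esub>"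
  by (rule hom_induced_const[OF m _ v(1)]) (use P.a0 in \<open>auto simp: P_def P.topspace_Cf\<close>)
 finally show ?thesis .
qed

section \<open>Attaching a cell\<close>

lemma topspace_disc: "x \<in> topspace (disc n) \<longleftrightarrow> (\<Sum>i<n. (x i)\<^sup>2) \<le> 1 \<and> (\<forall>i\<ge>n. x i = 0)"
 by (auto simp: disc_def Euclidean_space_def)

lemma topspace_disc_Suc: "x \<in> topspace (disc (Suc m)) \<longleftrightarrow> hw m x \<le> 1 \<and> (\<forall>i>m. x i = 0)"
 unfolding topspace_disc hw_def lessThan_Suc_atMost real_sqrt_le_1_iff by (auto simp: Suc_le_eq)

lemma continuous_map_disc:
 "cmap X (disc n) f \<longleftrightarrow>
   (\<forall>i. rcont X (\<lambda>x. f x i)) \<and> f \<in> topspace X \<rightarrow> topspace (disc n)"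
proof -
 have "disc n = subtopology (powertop_real UNIV) {x. (\<forall>i\<ge>n. x i = 0) \<and> (\<Sum>i<n. (x i)\<^sup>2) \<le> 1}"
  by (auto simp: disc_def Euclidean_space_def subtopology_subtopology intro: arg_cong[where f = "subtopology _"])
 then show ?thesis
  by (auto simp: cm_in_sub continuous_map_componentwise_UNIV topspace_disc Pi_iff)
qed

lemma continuous_map_disc_coord: "cmap X (disc n) f \<Longrightarrow> rcont X (\<lambda>x. f x i)"
 by (simp add: continuous_map_disc)

lemma compact_space_disc: "compact_space (disc n)"
proof -
 let ?S = "{x. (\<forall>i\<ge>n. x i = 0) \<and> (\<Sum>i<n. (x i)\<^sup>2) \<le> (1::real)}"
 have "closed ?S"
  by (intro closed_Collect_conj closed_Collect_all closed_Collect_imp closed_Collect_eq closed_Collect_le continuous_intros open_Collect_const) auto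
 moreover have "\<bar>x i\<bar> \<le> 1" if "x \<in> ?S" for x i
 proof (cases "i < n")
  case True
  then have "(x i)\<^sup>2 \<le> 1" using sum_squares_coord_le[of i "{..<n}" x] that by auto
  then show ?thesis by (simp add: abs_square_le_1)
 qed (use that in auto)
 ultimately have "compact_space (subtopology (powertop_real UNIV) ?S)" by (rule compact_space_cube_closed)
 moreover have "disc n = subtopology (powertop_real UNIV) ?S"
  by (auto simp: disc_def Euclidean_space_def subtopology_subtopology intro: arg_cong[where f = "subtopology _"])
 ultimately show ?thesis by simp
qed

lemma Hausdorff_space_disc: "Hausdorff_space (disc n)"
 by (simp add: disc_def Euclidean_space_def Hausdorff_space_subtopology Hausdorff_space_product_topology)

lemma disc_boundary_Suc: "disc_boundary (Suc m) = sph m"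
 by (auto simp: disc_boundary_def topspace_disc topspace_nsphere lessThan_Suc_atMost Suc_le_eq)

lemma nsphere_hw: "w \<in> sph m \<Longrightarrow> hw m w = 1"
 unfolding hw_def by (simp only: topspace_nsphere real_sqrt_one)

lemma disc_interior_Suc: "disc_interior (Suc m) = topspace (disc (Suc m)) - sph m"
 by (auto simp: disc_interior_def topspace_disc topspace_nsphere lessThan_Suc_atMost Suc_le_eq)

lemma nsphere_subset_disc: "sph m \<subseteq> topspace (disc (Suc m))"
 using disc_boundary_Suc[of m] by (auto simp: disc_boundary_def)

lemma nsphere_eq_subtopology: "nsphere m = subtopology (disc (Suc m)) (sph m)"
proof -
 have "nsphere m = subtopology (Euclidean_space (Suc m)) {x. (\<Sum>i\<le>m. (x i)\<^sup>2) = 1}"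
  by (auto simp: nsphere Euclidean_space_def subtopology_subtopology Suc_le_eq intro!: arg_cong[where f = "subtopology _"])
 moreover have "topspace (disc (Suc m)) \<inter> sph m = sph m"
  using nsphere_subset_disc by blast
 moreover have "sph m = topspace (Euclidean_space (Suc m)) \<inter> {x. (\<Sum>i\<le>m. (x i)\<^sup>2) = 1}"
  by (auto simp: topspace_nsphere topspace_Euclidean_space Suc_le_eq)
 moreover have "{x. (\<Sum>i<Suc m. (x i)\<^sup>2) \<le> 1} \<inter> (topspace (Euclidean_space (Suc m)) \<inter> {x. (\<Sum>i\<le>m. (x i)\<^sup>2) = 1})
   = topspace (Euclidean_space (Suc m)) \<inter> {x. (\<Sum>i\<le>m. (x i)\<^sup>2) = (1::real)}"
  unfolding lessThan_Suc_atMost by auto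
 ultimately show ?thesis
  unfolding disc_def by (metis subtopology_restrict subtopology_subtopology)
qed

lemma continuous_map_disc_nsphere: "cmap (nsphere m) (disc (Suc m)) id"
 using cm_sub[OF continuous_map_id] nsphere_eq_subtopology[of m] by metis

lemma continuous_map_hw_disc: "rcont (disc n) (hw m)"
 unfolding hw_def
 by (rule cont_o[OF continuous_map_sum_squares[OF continuous_map_disc_coord[OF cont_id]]])
  (intro continuous_intros)

lemma hw_scale: "hw m (\<lambda>i. c * x i) = \<bar>c\<bar> * hw m x"
 unfolding hw_def by (simp add: power_mult_distrib real_sqrt_mult flip: sum_distrib_left)

lemma disc_scale:
 assumes "x \<in> topspace (disc (Suc m))" "\<bar>c\<bar> * hw m x \<le> 1"
 shows "(\<lambda>i. c * x i) \<in> topspace (disc (Suc m))"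
 using assms unfolding topspace_disc_Suc hw_scale by simp

text \<open>The disc is cut at radius \<open>1 / c t\<close>: inside, \<open>a\<close> is used on a
  shrunken copy of the disc, outside a map \<open>b\<close> of radius and direction. Letting
  \<open>c\<close> depend on \<open>t\<close> opens a collar in the course of a homotopy.\<close>

lemma collar_glue:
 assumes c: "rcont T c" "\<And>t. t \<in> topspace T \<Longrightarrow> c t \<ge> 1"
  and a: "cmap (prod_topology T (disc (Suc m))) Y a"
  and b: "cmap (prod_topology T (prod_topology euclideanreal (nsphere m))) Y b"
  and ab: "\<And>t w. t \<in> topspace T \<Longrightarrow> w \<in> sph m \<Longrightarrow> a (t, w) = b (t, 1 / c t, w)"
 shows "cmap (prod_topology T (disc (Suc m))) Y
   (\<lambda>(t, x). if c t * hw m x \<le> 1 then a (t, \<lambda>i. c t * x i) else b (t, hw m x, nz m x))"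
proof -
 let ?X = "prod_topology T (disc (Suc m))"
 let ?u = "\<lambda>q. c (fst q) * hw m (snd q)"
 have cq: "rcont ?X (\<lambda>q. c (fst q))" by (rule cm_compose[OF c(1) cm_fst])
 have hq: "rcont ?X (\<lambda>q. hw m (snd q))" by (rule cm_compose[OF continuous_map_hw_disc cm_snd])
 have uc: "rcont ?X ?u" by (intro cont_arith cq hq)
 let ?A = "{q \<in> topspace ?X. ?u q \<in> {..1}}" and ?B = "{q \<in> topspace ?X. ?u q \<in> {1..}}"
 have xc: "rcont ?X (\<lambda>q. snd q i)" for i by (rule continuous_map_disc_coord[OF cm_snd])
 have pos: "hw m (snd q) > 0 \<and> c (fst q) \<ge> 1" if "q \<in> ?B" for q
  using that c(2)[of "fst q"] hw_nonneg[of m "snd q"] by (cases "hw m (snd q) = 0") auto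
 show ?thesis
 proof (rule continuous_map_glue[where A = ?A and B = ?B and f = "\<lambda>q. a (fst q, \<lambda>i. c (fst q) * snd q i)" and g = "\<lambda>q. b (fst q, hw m (snd q), nz m (snd q))"])
  show "closedin ?X ?A" "closedin ?X ?B" by (rule closedin_pre[OF uc]; simp)+
  have "cmap (subtopology ?X ?A) (disc (Suc m)) (\<lambda>q i. c (fst q) * snd q i)"
   unfolding continuous_map_disc
  proof (intro conjI allI)
   show "rcont (subtopology ?X ?A) (\<lambda>q. c (fst q) * snd q i)" for i
    by (intro cm_sub cont_arith cq xc)
   show "(\<lambda>q i. c (fst q) * snd q i) \<in> topspace (subtopology ?X ?A) \<rightarrow> topspace (disc (Suc m))"
   proof
    fix q assume q: "q \<in> topspace (subtopology ?X ?A)"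
    then have "c (fst q) \<ge> 1" "snd q \<in> topspace (disc (Suc m))" "c (fst q) * hw m (snd q) \<le> 1" using c(2) by auto
    then show "(\<lambda>i. c (fst q) * snd q i) \<in> topspace (disc (Suc m))" by (intro disc_scale) auto
   qed
  qed
  then show "cmap (subtopology ?X ?A) Y (\<lambda>q. a (fst q, \<lambda>i. c (fst q) * snd q i))"
   by (intro cm_compose[OF a] cm_pair[OF cm_sub[OF cm_fst]])
  have "cmap (subtopology ?X ?B) (nsphere m) (\<lambda>q. nz m (snd q))"
  proof (rule continuous_map_nz)
   show "rcont (subtopology ?X ?B) (\<lambda>q. snd q i)" for i
    by (rule cm_sub[OF xc])
   show "\<exists>i\<le>m. snd q i \<noteq> 0" if q: "q \<in> topspace (subtopology ?X ?B)" for q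
   proof -
    have "hw m (snd q) \<noteq> 0" using pos[of q] q by auto
    then show ?thesis using hw_zero by blast
   qed
  qed
  then show "cmap (subtopology ?X ?B) Y (\<lambda>q. b (fst q, hw m (snd q), nz m (snd q)))"
   by (intro cm_compose[OF b] cm_pair cm_sub[OF cm_fst]
     cm_sub[OF hq])
  have e: "a (fst q, \<lambda>i. c (fst q) * snd q i) = b (fst q, hw m (snd q), nz m (snd q))"
   if q: "q \<in> ?B" "?u q = 1" for q
  proof -
   have p: "hw m (snd q) > 0" "c (fst q) \<ge> 1" using pos[OF q(1)] by auto
   have t: "fst q \<in> topspace T" "snd q \<in> topspace (disc (Suc m))" using q(1) by auto
   have "(\<lambda>i. c (fst q) * snd q i) = nz m (snd q)"
   proof
    fix i show "c (fst q) * snd q i = nz m (snd q) i"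
    proof (cases "i \<le> m")
     case True
     have "c (fst q) * (hw m (snd q) * nz m (snd q) i) = nz m (snd q) i"
      using q(2) by (simp flip: mult.assoc)
     then show ?thesis using hw_nz[OF True, of "snd q"] by simp
    next
     case False
     then show ?thesis using t(2) by (simp add: topspace_disc_Suc nz_def)
    qed
   qed
   moreover have "hw m (snd q) = 1 / c (fst q)" using q(2) p by (simp add: field_simps)
   ultimately show ?thesis using ab[OF t(1) nz_in, of "snd q"] p by simp
  qed
  show "a (fst q, \<lambda>i. c (fst q) * snd q i) = b (fst q, hw m (snd q), nz m (snd q))" if "q \<in> ?A \<inter> ?B" for q
   using that by (intro e) auto
  show "(case q of (t, x) \<Rightarrow> if c t * hw m x \<le> 1 then a (t, \<lambda>i. c t * x i) else b (t, hw m x, nz m x)) = b (fst q, hw m (snd q), nz m (snd q))"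
   if "q \<in> ?B" for q
   using that e[OF that] by (auto simp: split_beta)
 qed auto
qed

text \<open>The disc as the reduced cone on its boundary sphere: \<open>s\<close> runs along the
  segment from the apex \<open>e1\<close> to \<open>p\<close>. As the apex is itself a boundary
  point, the segment over \<open>e1\<close> is constant.\<close>

definition Cn :: "real \<times> (nat \<Rightarrow> real) \<Rightarrow> nat \<Rightarrow> real" where
 "Cn = (\<lambda>(s, p) i. (1 - s) * e1 i + s * p i)"

lemma Cn_e1: "Cn (0, p) = e1" "Cn (s, e1) = e1" "Cn (1, p) = p"
 by (auto simp: Cn_def fun_eq_iff algebra_simps)

lemma e1_nsphere: "e1 \<in> sph m"
 unfolding topspace_nsphere sum_e1 by simp

lemma Cn_norm:
 assumes "p \<in> sph m"
 shows "(\<Sum>i\<le>m. (Cn (s, p) i)\<^sup>2) = 1 - 2 * s * (1 - s) * (1 - p 0)"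
proof -
 have "(\<Sum>i\<le>m. (Cn (s, p) i)\<^sup>2) = (\<Sum>i\<le>m. (1 - s)\<^sup>2 * (e1 i)\<^sup>2 + 2 * s * (1 - s) * (e1 i * p i) + s\<^sup>2 * (p i)\<^sup>2)"
  by (rule sum.cong) (simp_all add: Cn_def power2_eq_square algebra_simps)
 also have "\<dots> = (1 - s)\<^sup>2 * (\<Sum>i\<le>m. (e1 i)\<^sup>2) + 2 * s * (1 - s) * (\<Sum>i\<le>m. e1 i * p i) + s\<^sup>2 * (\<Sum>i\<le>m. (p i)\<^sup>2)"
  by (simp only: sum.distrib sum_distrib_left)
 also have "\<dots> = (1 - s)\<^sup>2 + 2 * s * (1 - s) * p 0 + s\<^sup>2"
  using assms by (simp only: sum_e1 topspace_nsphere mult_1_right)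
 finally show ?thesis by (simp add: power2_eq_square algebra_simps)
qed

lemma Cn_disc:
 assumes "p \<in> sph m" "s \<in> {0..1}"
 shows "Cn (s, p) \<in> topspace (disc (Suc m))"
proof -
 have "Cn (s, p) i = 0" if "i \<ge> Suc m" for i
  using assms(1) that by (auto simp: Cn_def topspace_nsphere)
 moreover have "2 * s * (1 - s) * (1 - p 0) \<ge> 0" using assms(2) nsphere_0_le(1)[OF assms(1)] by auto
 ultimately show ?thesis using Cn_norm[OF assms(1), of s] unfolding topspace_disc lessThan_Suc_atMost by auto
qed

lemma continuous_map_Cn:
 assumes s: "cmap X unit_interval s" and p: "cmap X (nsphere m) p"
 shows "cmap X (disc (Suc m)) (\<lambda>x. Cn (s x, p x))"
 unfolding continuous_map_disc
proof (intro conjI allI)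
 show "rcont X (\<lambda>x. Cn (s x, p x) i)" for i
  unfolding Cn_def prod.case
  by (intro cont_arith cont_const cm_full[OF s] continuous_map_nsphere_coord[OF p])
 show "(\<lambda>x. Cn (s x, p x)) \<in> topspace X \<rightarrow> topspace (disc (Suc m))"
  using cm_funspace[OF s] cm_funspace[OF p] by (auto intro!: Cn_disc simp: Pi_iff)
qed

text \<open>\<open>Cn (s, p) - e1\<close> is \<open>s\<close> times \<open>p - e1\<close>. As for
  \<open>Sig\<close>, coordinate 0 and the squared length determine \<open>s\<close> and then
  \<open>p\<close>, unless the point is the apex.\<close>

lemma Cn_inj:
 assumes p: "p \<in> sph m" "p' \<in> sph m" and s: "s \<in> {0..1}" "s' \<in> {0..1}"
  and eq: "Cn (s, p) = Cn (s', p')"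
 shows "(s = 0 \<or> p = e1) \<and> (s' = 0 \<or> p' = e1) \<or> s = s' \<and> p = p'"
proof -
 have d: "s * (p i - e1 i) = s' * (p' i - e1 i)" for i
  using fun_cong[OF eq, of i] by (simp add: Cn_def algebra_simps)
 have n: "(\<Sum>i\<le>m. (p i - e1 i)\<^sup>2) = 2 * (1 - p 0)" "(\<Sum>i\<le>m. (p' i - e1 i)\<^sup>2) = 2 * (1 - p' 0)"
  using sum_square_e1_diff p by (auto simp only: topspace_nsphere)
 have "(\<Sum>i\<le>m. (s * (p i - e1 i))\<^sup>2) = (\<Sum>i\<le>m. (s' * (p' i - e1 i))\<^sup>2)" unfolding d ..
 then have q: "s\<^sup>2 * (2 * (1 - p 0)) = s'\<^sup>2 * (2 * (1 - p' 0))"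
  by (simp only: power_mult_distrib sum_distrib_left[symmetric] n)
 have l: "s * (1 - p 0) = s' * (1 - p' 0)" using d[of 0] by (simp add: algebra_simps)
 have "s * (s * (1 - p 0)) = s' * (s' * (1 - p' 0))" using q by (simp add: power2_eq_square algebra_simps)
 then have "s * (s * (1 - p 0)) = s' * (s * (1 - p 0))" unfolding l .
 then have ss: "(s - s') * (s * (1 - p 0)) = 0" by (simp only: left_diff_distrib diff_self)
 have z: "s = 0 \<or> p = e1" if "s * (1 - p 0) = 0" using that nsphere_eq_e1[OF p(1)] by auto
 have z': "s' = 0 \<or> p' = e1" if "s' * (1 - p' 0) = 0" using that nsphere_eq_e1[OF p(2)] by auto
 show ?thesis
 proof (cases "s * (1 - p 0) = 0")
  case True
  then show ?thesis using z z' l by auto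
 next
  case False
  then have "s = s'" "s \<noteq> 0" using ss by auto
  then have "p i = p' i" for i using d[of i] by simp
  then show ?thesis using \<open>s = s'\<close> by blast
 qed
qed

lemma Cn_surj:
 assumes x: "x \<in> topspace (disc (Suc m))"
 shows "\<exists>s p. s \<in> {0..1} \<and> p \<in> sph m \<and> Cn (s, p) = x"
proof (cases "x = e1")
 case True
 then show ?thesis using e1_nsphere Cn_e1(1) by (intro exI[of _ 0] exI[of _ e1]) auto
next
 case False
 let ?N = "\<Sum>i\<le>m. (x i)\<^sup>2"
 have N: "?N \<le> 1" "\<And>i. i > m \<Longrightarrow> x i = 0" using x unfolding topspace_disc lessThan_Suc_atMost by (auto simp: Suc_le_eq)
 have D: "(\<Sum>i\<le>m. (x i - e1 i)\<^sup>2) = ?N - 2 * x 0 + 1"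
 proof -
  have "(\<Sum>i\<le>m. (x i - e1 i)\<^sup>2) = (\<Sum>i\<le>m. (x i)\<^sup>2 - 2 * (e1 i * x i) + (e1 i)\<^sup>2)"
   by (rule sum.cong) (simp_all add: power2_eq_square algebra_simps)
  then show ?thesis by (simp only: sum.distrib sum_subtractf sum_distrib_left[symmetric] sum_e1)
 qed
 have Dpos: "?N - 2 * x 0 + 1 > 0"
 proof -
  obtain i where "x i \<noteq> e1 i" using False by blast
  moreover from this have "i \<le> m" using N(2)[of i] by (cases "i \<le> m") (auto split: if_splits)
  ultimately have "i \<le> m" "x i - e1 i \<noteq> 0" by simp_all
  then show ?thesis using sum_squares_pos[of i m "\<lambda>i. x i - e1 i"] unfolding D by blast
 qed
 have "(x 0)\<^sup>2 \<le> 1" using sum_squares_coord_le[of 0 "{..m}" x] N(1) by auto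
 then have x0: "x 0 \<le> 1" by (simp add: abs_square_le_1 abs_le_iff)
 have x0': "x 0 < 1"
 proof (rule ccontr)
  assume "\<not> x 0 < 1" then have "x 0 = 1" using x0 by simp
  then show False using Dpos N(1) by simp
 qed
 \<comment> \<open>The ray from \<open>e1\<close> through \<open>x\<close> meets the sphere again at
   parameter \<open>c\<close>.\<close>
 define c where "c = 2 * (1 - x 0) / (?N - 2 * x 0 + 1)"
 have c: "c \<ge> 1" using Dpos N(1) by (simp add: c_def)
 define p where "p = (\<lambda>i. e1 i + c * (x i - e1 i))"
 have "(\<Sum>i\<le>m. (p i)\<^sup>2) = (\<Sum>i\<le>m. (e1 i)\<^sup>2 + 2 * c * (e1 i * x i - (e1 i)\<^sup>2) + c\<^sup>2 * (x i - e1 i)\<^sup>2)"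
  by (rule sum.cong) (simp_all add: p_def power2_eq_square algebra_simps)
 also have "\<dots> = 1 + 2 * c * (x 0 - 1) + c\<^sup>2 * (?N - 2 * x 0 + 1)"
  by (simp only: sum.distrib sum_subtractf sum_distrib_left[symmetric] sum_e1 D)
 also have "\<dots> = 1"
  using Dpos by (simp add: c_def power2_eq_square) (simp add: field_simps)
 finally have "p \<in> sph m" using N(2) by (simp add: topspace_nsphere p_def)
 moreover have "Cn (1 / c, p) = x" using c by (auto simp: Cn_def p_def fun_eq_iff field_simps)
 ultimately show ?thesis using c by (intro exI[of _ "1 / c"] exI[of _ p]) auto
qed

text \<open>\<open>W\<close> is a sphere \<open>Y\<close> with one cell attached; \<open>\<kappa>\<close> identifies \<open>Y\<close> with the standard sphere.\<close>

locale two_cell =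
 fixes W :: "'w topology" and Y :: "'w set" and \<kappa> :: "(nat \<Rightarrow> real) \<Rightarrow> 'w" and \<kappa>' :: "'w \<Rightarrow> nat \<Rightarrow> real"
  and \<Phi> :: "(nat \<Rightarrow> real) \<Rightarrow> 'w" and k :: nat
 assumes W: "Hausdorff_space W" and Y: "closedin W Y"
  and \<kappa>: "homeomorphic_maps (nsphere (Suc k)) (subtopology W Y) \<kappa> \<kappa>'"
  and \<Phi>: "cmap (disc (Suc (Suc k))) W \<Phi>"
  and \<Phi>_boundary: "\<And>x. x \<in> sph (Suc k) \<Longrightarrow> \<Phi> x \<in> Y"
  and \<Phi>_interior: "\<And>x. x \<in> disc_interior (Suc (Suc k)) \<Longrightarrow> \<Phi> x \<notin> Y"
  and \<Phi>_inj: "inj_on \<Phi> (disc_interior (Suc (Suc k)))"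
  and W_eq: "topspace W \<subseteq> Y \<union> \<Phi> ` topspace (disc (Suc (Suc k)))"
begin

abbreviation S where "S \<equiv> nsphere (Suc k)"
abbreviation Di where "Di \<equiv> disc (Suc (Suc k))"

definition att :: "(nat \<Rightarrow> real) \<Rightarrow> nat \<Rightarrow> real" where
 "att x = \<kappa>' (\<Phi> x)"

lemma YW: "Y \<subseteq> topspace W" by (rule closedin_subset[OF Y])

lemma \<kappa>_cont: "cmap S W \<kappa>" and \<kappa>'_cont: "cmap (subtopology W Y) S \<kappa>'"
 and \<kappa>_Y: "p \<in> topspace S \<Longrightarrow> \<kappa> p \<in> Y" and \<kappa>'\<kappa>: "p \<in> topspace S \<Longrightarrow> \<kappa>' (\<kappa> p) = p"
 and \<kappa>\<kappa>': "w \<in> Y \<Longrightarrow> \<kappa> (\<kappa>' w) = w" and \<kappa>'_S: "w \<in> Y \<Longrightarrow> \<kappa>' w \<in> topspace S"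
proof -
 have c: "cmap S (subtopology W Y) \<kappa>" "cmap (subtopology W Y) S \<kappa>'"
  and i: "\<And>p. p \<in> topspace S \<Longrightarrow> \<kappa>' (\<kappa> p) = p" "\<And>w. w \<in> topspace (subtopology W Y) \<Longrightarrow> \<kappa> (\<kappa>' w) = w"
  using \<kappa> by (auto simp: homeomorphic_maps_def)
 show "cmap S W \<kappa>" using c(1) by (simp add: cm_in_sub)
 show "p \<in> topspace S \<Longrightarrow> \<kappa> p \<in> Y" using c(1) by (auto simp: cm_in_sub)
 show "cmap (subtopology W Y) S \<kappa>'" by (rule c(2))
 show "p \<in> topspace S \<Longrightarrow> \<kappa>' (\<kappa> p) = p" by (rule i(1))
 have Yt: "w \<in> topspace (subtopology W Y)" if "w \<in> Y" for w using that YW by auto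
 show "w \<in> Y \<Longrightarrow> \<kappa> (\<kappa>' w) = w" by (rule i(2)[OF Yt])
 show "w \<in> Y \<Longrightarrow> \<kappa>' w \<in> topspace S" by (rule funcset_mem[OF cm_funspace[OF c(2)] Yt])
qed

lemma \<kappa>_att: "x \<in> topspace S \<Longrightarrow> \<kappa> (att x) = \<Phi> x"
 by (simp add: att_def \<kappa>\<kappa>' \<Phi>_boundary)

lemma \<Phi>_S: "cmap S (subtopology W Y) \<Phi>"
 using cm_compose[OF \<Phi> continuous_map_disc_nsphere] \<Phi>_boundary by (auto simp: cm_in_sub)

lemma att_cont: "cmap S S att"
 unfolding att_def by (rule cm_compose[OF \<kappa>'_cont \<Phi>_S])

text \<open>\<open>W\<close> is the pushout of sphere and disc, and so is its product with a compact
  Hausdorff space \<open>T\<close>; compatibility along \<open>att\<close> is therefore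
  enough.\<close>

lemma homotopy_on_cells:
 assumes T: "compact_space T" "Hausdorff_space T"
  and gS: "cmap (prod_topology T S) Z gS" and gD: "cmap (prod_topology T Di) Z gD"
  and c: "\<And>t x. t \<in> topspace T \<Longrightarrow> x \<in> topspace S \<Longrightarrow> gD (t, x) = gS (t, att x)"
 obtains G where "cmap (prod_topology T W) Z G"
  "\<And>t p. t \<in> topspace T \<Longrightarrow> p \<in> topspace S \<Longrightarrow> G (t, \<kappa> p) = gS (t, p)"
  "\<And>t x. t \<in> topspace T \<Longrightarrow> x \<in> topspace Di \<Longrightarrow> G (t, \<Phi> x) = gD (t, x)"
proof -
 define G where "G = (\<lambda>(t, w). if w \<in> Y then gS (t, \<kappa>' w) else gD (t, inv_into (disc_interior (Suc (Suc k))) \<Phi> w))"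
 have 1: "G (t, \<kappa> p) = gS (t, p)" if "p \<in> topspace S" for t p using that by (simp add: G_def \<kappa>_Y \<kappa>'\<kappa>)
 have 2: "G (t, \<Phi> x) = gD (t, x)" if "t \<in> topspace T" "x \<in> topspace Di" for t x
 proof (cases "x \<in> topspace S")
  case True
  then show ?thesis using c[OF that(1) True] by (simp add: G_def \<Phi>_boundary att_def)
 next
  case False
  then have i: "x \<in> disc_interior (Suc (Suc k))" using that disc_interior_Suc by blast
  then show ?thesis using \<Phi>_interior[OF i] \<Phi>_inj by (simp add: G_def inv_into_f_f)
 qed
 have "cmap (prod_topology T W) Z G"
 proof (rule continuous_map_on_pushout[where A = "topspace T \<times> Y" and D = "\<lambda>(t, x). (t, \<Phi> x)"])
  show "compact_space (prod_topology T Di)" using T compact_space_disc by (simp add: compact_space_prod_topology)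
  show "Hausdorff_space (prod_topology T W)" using T W by (simp add: Hausdorff_space_prod_topology)
  show "cmap (prod_topology T Di) (prod_topology T W) (\<lambda>(t, x). (t, \<Phi> x))"
   unfolding split_beta by (intro cm_pair cm_fst cm_compose[OF \<Phi> cm_snd])
  show "closedin (prod_topology T W) (topspace T \<times> Y)" using Y by (simp add: closedin_prod_Times_iff)
  show "topspace (prod_topology T W) \<subseteq> topspace T \<times> Y \<union> (\<lambda>(t, x). (t, \<Phi> x)) ` topspace (prod_topology T Di)"
  proof (rule subsetI)
   fix q assume q: "q \<in> topspace (prod_topology T W)"
   obtain t w where [simp]: "q = (t, w)" by (cases q)
   have t: "t \<in> topspace T" and w: "w \<in> Y \<or> (\<exists>x \<in> topspace Di. w = \<Phi> x)" using q W_eq by auto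
   then show "q \<in> topspace T \<times> Y \<union> (\<lambda>(t, x). (t, \<Phi> x)) ` topspace (prod_topology T Di)"
    by (force simp: image_iff)
  qed
  have e: "subtopology (prod_topology T W) (topspace T \<times> Y) = prod_topology T (subtopology W Y)"
   by (simp add: prod_topology_subtopology(2) subtopology_restrict[of T, symmetric] flip: subtopology_Times)
  have "cmap (prod_topology T (subtopology W Y)) Z (\<lambda>q. gS (fst q, \<kappa>' (snd q)))"
   by (intro cm_compose[OF gS] cm_pair cm_fst cm_compose[OF \<kappa>'_cont cm_snd])
  then show "cmap (subtopology (prod_topology T W) (topspace T \<times> Y)) Z G"
   unfolding e by (rule continuous_map_eq) (auto simp: G_def)
  show "cmap (prod_topology T Di) Z (\<lambda>q. G ((\<lambda>(t, x). (t, \<Phi> x)) q))"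
   by (rule continuous_map_eq[OF gD]) (auto simp: 2)
 qed
 then show ?thesis using that 1 2 by blast
qed

lemma topspace_W_cases:
 assumes "w \<in> topspace W"
 obtains p where "p \<in> topspace S" "w = \<kappa> p" | x where "x \<in> topspace Di" "w = \<Phi> x"
 using assms W_eq \<kappa>\<kappa>' \<kappa>'_S by (metis UnE imageE subsetD)

end

locale two_cell_hahc = two_cell W Y \<kappa> \<kappa>' \<Phi> k + hahc_space F z \<mu>
 for W :: "'w topology" and Y \<kappa> \<kappa>' \<Phi> k and F :: "'f topology" and z \<mu>
begin

text \<open>The attaching map is only homotopic to \<open>lmul k d\<close>. The homotopy
  \<open>h\<close> is therefore inserted in a collar of the cell to apply
  \<open>odd_degree_cone_exponent\<close>, and the resulting null homotopy is carried back to
  \<open>W\<close> with the collar traversed in reverse.\<close>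

theorem two_cell_exponent:
 fixes d :: int
 assumes d: "htp S S att (lmul k d)" "odd d"
  and x: "cmap W F x" "x (\<kappa> e1) = z"
 shows "homotopic_with (\<lambda>h. h (\<kappa> e1) = z) W F (power_map z \<mu> (nat \<bar>d\<bar>) \<circ> x) (\<lambda>_. z)"
proof -
 let ?I = unit_interval and ?Z = "Zc k" and ?m = "Suc k" and ?N = "nat \<bar>d\<bar>"
 have I: "compact_space ?I" "Hausdorff_space ?I" by (simp_all add: compact_space_subtopology Hausdorff_space_subtopology)
 have Ir: "rcont ?I (\<lambda>t. t)" by simp
 obtain h where h: "cmap (RD S) S h" "\<And>x. h (0, x) = att x" "\<And>x. h (1, x) = lmul k d x"
  using homotopic_withE[OF d(1)] by metis
 have kh: "cmap (prod_topology ?I (prod_topology euclideanreal S)) W (\<lambda>q. \<kappa> (h (g (fst q) (fst (snd q)), snd (snd q))))"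
  if "rcont (prod_topology ?I (prod_topology euclideanreal S)) (\<lambda>q. g (fst q) (fst (snd q)))" for g
  by (intro cm_compose[OF \<kappa>_cont] cm_compose[OF h(1)] cm_pair that cont_fst_snd(2)[OF cm_snd])
 let ?B = "prod_topology ?I (prod_topology euclideanreal S)"
 have c1: "rcont ?B fst" "rcont ?B (\<lambda>q. fst (snd q))"
  by (rule cont_fst_I, rule cont_fst_snd(1)[OF cm_snd])
 \<comment> \<open>At time 1: \<open>\<Phi>\<close> on the disc of half the radius, then
   \<open>\<kappa>\<close> after the homotopy \<open>h\<close> on the collar, so that the boundary
   is mapped by \<open>\<kappa>\<close> after \<open>lmul k d\<close>.\<close>
 define \<Psi> where "\<Psi> = (\<lambda>(t, x). if (1 + t) * hw ?m x \<le> 1 then \<Phi> (\<lambda>i. (1 + t) * x i)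
   else \<kappa> (h ((1 + t) * hw ?m x - 1, nz ?m x)))"
 have \<Psi>c: "cmap (prod_topology ?I Di) W \<Psi>"
 proof -
  have "cmap (prod_topology ?I Di) W (\<lambda>(t, x). if (1 + t) * hw ?m x \<le> 1 then (\<lambda>q. \<Phi> (snd q)) (t, \<lambda>i. (1 + t) * x i)
    else (\<lambda>q. \<kappa> (h ((\<lambda>t r. (1 + t) * r - 1) (fst q) (fst (snd q)), snd (snd q)))) (t, hw ?m x, nz ?m x))"
  proof (rule collar_glue)
   show "cmap ?B W (\<lambda>q. \<kappa> (h ((\<lambda>t r. (1 + t) * r - 1) (fst q) (fst (snd q)), snd (snd q))))"
    by (rule kh) (intro cont_arith cont_const c1)
   show "rcont ?I (\<lambda>t. 1 + t)" by (intro cont_arith cont_const Ir)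
   show "cmap (prod_topology ?I Di) W (\<lambda>q. \<Phi> (snd q))" by (rule cm_compose[OF \<Phi> cm_snd])
  qed (auto simp: h(2) \<kappa>_att)
  then show ?thesis by (simp add: \<Psi>_def cong: if_cong)
 qed
 have \<Psi>0: "\<Psi> (0, x) = \<Phi> x" if "x \<in> topspace Di" for x using that by (auto simp: \<Psi>_def topspace_disc_Suc)
 have \<Psi>S: "\<Psi> (t, w) = \<kappa> (h (t, w))" if "t \<in> {0..1}" "w \<in> topspace S" for t w
  using that nsphere_hw[OF that(2)] nz_id[OF that(2)] by (auto simp: \<Psi>_def h(2) \<kappa>_att)
 have \<Psi>1S: "\<Psi> (1, lam k (a, y)) = \<kappa> (lam k (of_int d * a, y))" for a y
  using \<Psi>S[of 1 "lam k (a, y)"] lam_nsphere by (simp add: h(3) lmul_lam)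
 \<comment> \<open>The new cell in cone and cube coordinates; on the base \<open>s = 1\<close> it is
   \<open>x (\<kappa> (lam k (d a, y)))\<close>, hence of period \<open>1/|d|\<close> in
   \<open>a\<close>.\<close>
 define Fh where "Fh = (\<lambda>(s, a, y). x (\<Psi> (1, Cn (clamp01 s, lam k (a, y)))))"
 have cl: "cmap X ?I (\<lambda>q. clamp01 (g q))" if "rcont X g" for X :: "'q topology" and g
  using that unfolding cm_in_sub clamp01_def
  by (auto intro!: cont_arith cont_const)
 have "Fh \<in> cmaps (RD (RD ?Z)) (CB (LB (Bc k)) (LBk ?N (Bc k))) (CE (LE {}) (LEk ?N)) F z"
 proof (rule cmapsI)
  show "cmap (RD (RD ?Z)) F Fh"
   unfolding Fh_def split_beta
   by (intro cm_compose[OF x(1)] cm_compose[OF \<Psi>c] cm_pair continuous_map_Cn cl cm_fst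
     cm_compose[OF lam_cont]) (auto intro: cont_fst_snd[OF cm_snd])
  have e: "x (\<Psi> (1, e1)) = z" using \<Psi>1S[of 0 "\<lambda>_. 0"] lam_e1[of "(0, \<lambda>_. 0)" k] x(2) by simp
  have Nd: "of_int d * a \<in> \<int>" if "real ?N * a \<in> \<int>" for a :: real
  proof -
   have "real ?N * a = of_int d * a \<or> real ?N * a = - (of_int d * a)" by (cases "d \<ge> 0") auto
   then show ?thesis using that Ints_minus[of "- (of_int d * a)"] by (metis minus_minus)
  qed
  show "adm (CB (LB (Bc k)) (LBk ?N (Bc k))) (CE (LE {}) (LEk ?N)) z Fh"
  proof (rule admI)
   fix q :: "real \<times> real \<times> (nat \<Rightarrow> real)" assume q: "q \<in> CB (LB (Bc k)) (LBk ?N (Bc k))"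
   obtain s a y where [simp]: "q = (s, a, y)" by (cases q)
   from q consider "s \<le> 0" | "a \<in> \<int> \<or> y \<in> Bc k" | "s \<ge> 1" "real ?N * a \<in> \<int> \<or> y \<in> Bc k"
    by (auto simp: cs_defs)
   then show "Fh q = z"
   proof cases
    case 1
    then show ?thesis by (simp add: Fh_def clamp01_simps Cn_e1 e)
   next
    case 2
    then show ?thesis using lam_e1[of "(a, y)" k] by (simp add: Fh_def Cn_e1 e)
   next
    case 3
    then have "lam k (of_int d * a, y) = e1" using lam_e1[of "(of_int d * a, y)" k] Nd[of a] by auto
    then show ?thesis using 3 by (simp add: Fh_def clamp01_simps Cn_e1 \<Psi>1S x(2))
   qed
  next
   fix q q' :: "real \<times> real \<times> (nat \<Rightarrow> real)" assume q: "(q, q') \<in> CE (LE {}) (LEk ?N)"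
   obtain s a y s' a' y' where [simp]: "q = (s, a, y)" "q' = (s', a', y')" by (cases q, cases q')
   from q have [simp]: "s' = s" "y' = y" and c: "a' - a \<in> \<int> \<or> s \<ge> 1 \<and> real ?N * (a' - a) \<in> \<int>"
    by (auto simp: cs_defs)
   from c show "Fh q = Fh q'"
   proof
    assume "a' - a \<in> \<int>"
    then show ?thesis using lam_shift[of a' a k y] by (simp add: Fh_def)
   next
    assume c: "s \<ge> 1 \<and> real ?N * (a' - a) \<in> \<int>"
    then have "of_int d * a' - of_int d * a \<in> \<int>" using Nd[of "a' - a"] by (simp add: right_diff_distrib)
    from lam_shift[OF this, of k y] show ?thesis using c by (simp add: Fh_def clamp01_simps Cn_e1 \<Psi>1S)
   qed
  qed
 qed
 then have "hmt (RD (RD ?Z)) (CB (LB (Bc k)) (LBk ?N (Bc k))) (CE (LE {}) (LEk ?N)) F z (pw ?N Fh) (\<lambda>_. z)"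
  by (rule odd_degree_cone_exponent) (use d(2) in \<open>simp add: even_nat_iff\<close>)
 then obtain H where H: "cmap (RD (RD (RD ?Z))) F H" "\<And>q. H (0, q) = pw ?N Fh q" "\<And>q. H (1, q) = z"
  and Ha: "\<And>t. adm (CB (LB (Bc k)) (LBk ?N (Bc k))) (CE (LE {}) (LEk ?N)) z (\<lambda>q. H (t, q))"
  by (rule homotopic_withE) blast
 have Hz: "H (t, s, a, y) = z" if "s \<le> 0 \<or> a \<in> \<int> \<or> y \<in> Bc k" for t s a y
  by (rule admD[OF Ha]) (use that in \<open>auto simp: cs_defs\<close>)
 have He: "H (t, s, a, y) = H (t, s, a', y)" if "a' - a \<in> \<int>" for t s a a' y
  by (rule admD2[OF Ha]) (use that in \<open>auto simp: cs_defs\<close>)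
 have d0: "real_of_int d \<noteq> 0" using d(2) by auto
 have Hlam: "H (t, s, a, y) = H (t, s, a', y')"
  if "lam k (a, y) = lam k (a', y')" "y \<in> topspace ?Z" "y' \<in> topspace ?Z" for t s a y a' y'
  using lam_eqD[OF that(1)]
 proof
  assume "a' - a \<in> \<int> \<and> (\<forall>i<k. y i = y' i)"
  moreover from this have "y' = y" using that(2,3) unfolding topspace_Zc by (auto simp: fun_eq_iff) (metis singletonD)
  ultimately show ?thesis using He by simp
 qed (auto simp: Hz)
 have H1lam: "H (t, 1, a / of_int d, y) = H (t, 1, a' / of_int d, y')"
  if "lam k (a, y) = lam k (a', y')" "y \<in> topspace ?Z" "y' \<in> topspace ?Z" for t a y a' y'
 proof -
  have N: "real ?N * (b / of_int d) \<in> \<int>" if "b \<in> \<int>" for b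
  proof -
   have "real ?N * (b / of_int d) = b \<or> real ?N * (b / of_int d) = - b" using d0 by (cases "d \<ge> 0") auto
   then show ?thesis using that by auto
  qed
  have n: "H (t, 1, a / of_int d, y) = z" if "a \<in> \<int> \<or> y \<in> Bc k" for a y
   by (rule admD[OF Ha]) (use that N[of a] in \<open>auto simp: cs_defs\<close>)
  show ?thesis using lam_eqD[OF that(1)]
  proof
   assume *: "a' - a \<in> \<int> \<and> (\<forall>i<k. y i = y' i)"
   then have y: "y' = y" using that(2,3) unfolding topspace_Zc by (auto simp: fun_eq_iff) (metis singletonD)
   have "real ?N * (a' / of_int d - a / of_int d) \<in> \<int>" using N[of "a' - a"] * by (simp add: diff_divide_distrib)
   then show ?thesis unfolding y by (intro admD2[OF Ha]) (auto simp: cs_defs)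
  qed (auto simp: n)
 qed
 \<comment> \<open>At \<open>s = 1\<close> the null homotopy has period \<open>1/|d|\<close>, so
   dividing the periodic coordinate by \<open>d\<close> gives a homotopy on the sphere
   itself.\<close>
 define L where "L = (\<lambda>(t::real, p). (\<lambda>(t, a, y). H (t, 1, a / of_int d, y)) (t, lsec k p))"
 have Lc: "cmap (prod_topology ?I S) F L"
  unfolding L_def
 proof (rule lam_descend[OF I])
  let ?T = "prod_topology ?I (IZ ?Z)"
  have "cmap ?T (RD (RD (RD ?Z))) (\<lambda>q. (fst q, 1, fst (snd q) / of_int d, snd (snd q)))"
   by (intro cm_pair cont_fst_I cont_const cont_unary(2)
     cm_compose[OF cont_fst_I cm_snd] cont_fst_snd(2)[OF cm_snd])
  then show "cmap ?T F (\<lambda>(t, a, y). H (t, 1, a / of_int d, y))"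
   unfolding split_beta by (rule cm_compose[OF H(1)])
 qed (auto intro: H1lam)
 have L: "L (t, lam k (a, y)) = H (t, 1, a / of_int d, y)" if "y \<in> topspace ?Z" for t a and y :: "nat \<Rightarrow> real"
 proof -
  obtain a' y' where q: "lsec k (lam k (a, y)) = (a', y')" by (cases "lsec k (lam k (a, y))")
  have "y' \<in> topspace ?Z" "lam k (a', y') = lam k (a, y)" using lsec[OF lam_nsphere, of k "(a, y)"] q by auto
  then show ?thesis using H1lam[of a' y' a y t] that by (simp add: L_def q)
 qed
 define R where "R = (\<lambda>x. SOME q. q \<in> topspace (prod_topology ?I (IZ ?Z)) \<and> Cn (fst q, lam k (snd q)) = x)"
 have R: "R x \<in> topspace (prod_topology ?I (IZ ?Z))" "Cn (fst (R x), lam k (snd (R x))) = x" if x: "x \<in> topspace Di" for x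
 proof -
  obtain s p where sp: "s \<in> {0..1}" "p \<in> topspace S" "Cn (s, p) = x" using Cn_surj[OF x] by blast
  have "\<exists>q. q \<in> topspace (prod_topology ?I (IZ ?Z)) \<and> Cn (fst q, lam k (snd q)) = x"
   using sp lsec[OF sp(2)] by (intro exI[of _ "(s, lsec k p)"]) (simp add: topspace_prod_topology[of ?I "IZ ?Z"] del: topspace_prod_topology)
  from someI_ex[OF this] show "R x \<in> topspace (prod_topology ?I (IZ ?Z))" "Cn (fst (R x), lam k (snd (R x))) = x"
   unfolding R_def by blast+
 qed
 define L' where "L' = (\<lambda>(t::real, x). H (t, R x))"
 have L': "L' (t, Cn (s, lam k (a, y))) = H (t, s, a, y)" if "s \<in> {0..1}" "y \<in> topspace ?Z" for t s a y
 proof -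
  have "Cn (s, lam k (a, y)) \<in> topspace Di" using Cn_disc[OF lam_nsphere that(1)] by blast
  note r = R[OF this]
  obtain s' a' y' where q: "R (Cn (s, lam k (a, y))) = (s', a', y')" by (cases "R (Cn (s, lam k (a, y)))")
  have r': "s' \<in> {0..1}" "y' \<in> topspace ?Z" "Cn (s', lam k (a', y')) = Cn (s, lam k (a, y))" using r unfolding q by auto
  have z: "H (t, s, a, y) = z" if "s = 0 \<or> lam k (a, y) = e1" for s a y
   using that
  proof
   assume "lam k (a, y) = e1"
   then have "lam k (a, y) = lam k (0, y)" using lam_e1[of "(0, y)" k] by simp
   from lam_eqD[OF this] have "a \<in> \<int> \<or> y \<in> Bc k" using Ints_minus[of "- a"] by auto
   then show ?thesis by (intro Hz) auto
  qed (auto simp: Hz)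
  from Cn_inj[OF lam_nsphere lam_nsphere r'(1) that(1) r'(3)]
  have "H (t, s', a', y') = H (t, s, a, y)" using z[of s' a' y'] z[of s a y] Hlam[of a' y' a y t s] r'(2) that(2) by auto
  then show ?thesis by (simp add: L'_def q)
 qed
 have L'c: "cmap (prod_topology ?I Di) F L'"
 proof (rule continuous_map_on_pushout[where A = "{}" and D = "\<lambda>(t, s, q). (t, Cn (s, lam k q))" and X' = "prod_topology ?I (prod_topology ?I (IZ ?Z))"])
  let ?X = "prod_topology ?I (prod_topology ?I (IZ ?Z))"
  show "compact_space ?X"
   using I by (simp add: compact_space_prod_topology compact_space_Zc)
  show "Hausdorff_space (prod_topology ?I Di)" using I Hausdorff_space_disc by (simp add: Hausdorff_space_prod_topology)
  show "cmap ?X (prod_topology ?I Di) (\<lambda>(t, s, q). (t, Cn (s, lam k q)))"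
   unfolding split_beta
   by (intro cm_pair cm_fst continuous_map_Cn cm_compose[OF lam_cont_IZ]
     cont_fst_snd(1)[OF cm_snd] cont_fst_snd(2)[OF cm_snd])
  show "topspace (prod_topology ?I Di) \<subseteq> {} \<union> (\<lambda>(t, s, q). (t, Cn (s, lam k q))) ` topspace ?X"
  proof (rule subsetI)
   fix w assume w: "w \<in> topspace (prod_topology ?I Di)"
   obtain t x where [simp]: "w = (t, x)" by (cases w)
   have tx: "t \<in> topspace ?I" "x \<in> topspace Di" using w by auto
   have "w = (\<lambda>(t, s, q). (t, Cn (s, lam k q))) (t, R x)" using R(2)[OF tx(2)] by (simp add: split_beta)
   moreover have "(t, R x) \<in> topspace ?X" using R(1)[OF tx(2)] tx(1) unfolding topspace_prod_topology[of ?I "prod_topology ?I (IZ ?Z)"] by blast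
   ultimately show "w \<in> {} \<union> (\<lambda>(t, s, q). (t, Cn (s, lam k q))) ` topspace ?X" by blast
  qed
  have "cmap ?X (RD (RD (RD ?Z))) (\<lambda>q. (fst q, fst (snd q), fst (snd (snd q)), snd (snd (snd q))))"
   by (intro cm_pair cont_fst_I
     cm_compose[OF cont_fst_I cm_snd]
     cm_compose[OF cont_fst_I cont_fst_snd(2)[OF cm_snd]]
     cont_fst_snd(2)[OF cont_fst_snd(2)[OF cm_snd]])
  then have "cmap ?X F (\<lambda>q. H (fst q, fst (snd q), fst (snd (snd q)), snd (snd (snd q))))"
   by (rule cm_compose[OF H(1)])
  then show "cmap ?X F (\<lambda>q. L' ((\<lambda>(t, s, q). (t, Cn (s, lam k q))) q))"
   by (rule continuous_map_eq) (auto simp: L')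
 qed (simp_all add: continuous_map_def)
 have LL': "L' (t, w) = L (t, lmul k d w)" if w: "w \<in> topspace S" for t w
 proof -
  obtain a y where ay: "lsec k w = (a, y)" by (cases "lsec k w")
  have y: "y \<in> topspace ?Z" "lam k (a, y) = w" using lsec[OF w] ay by auto
  have "L' (t, w) = H (t, 1, a, y)" using L'[of 1 y t a] y by (simp add: Cn_e1)
  also have "\<dots> = L (t, lmul k d w)" using L[OF y(1), of t "of_int d * a"] d0 by (simp add: lmul_lam flip: y(2))
  finally show ?thesis .
 qed
 have L0: "L (0, p) = power_map z \<mu> ?N (x (\<kappa> p))" if p: "p \<in> topspace S" for p
 proof -
  obtain a y where ay: "lsec k p = (a, y)" by (cases "lsec k p")
  have y: "y \<in> topspace ?Z" "lam k (a, y) = p" using lsec[OF p] ay by auto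
  have "L (0, p) = pw ?N Fh (1, a / of_int d, y)" using L[OF y(1), of 0 a] y(2) H(2) by simp
  also have "\<dots> = power_map z \<mu> ?N (x (\<kappa> p))"
   using d0 y(2) by (simp add: Fh_def clamp01_simps Cn_e1 \<Psi>1S)
  finally show ?thesis .
 qed
 have L'0: "L' (0, x') = power_map z \<mu> ?N (x (\<Psi> (1, x')))" if x': "x' \<in> topspace Di" for x'
 proof -
  obtain s a y where q: "R x' = (s, a, y)" by (cases "R x'")
  have "s \<in> {0..1}" "Cn (s, lam k (a, y)) = x'" using R[OF x'] q by auto
  then show ?thesis by (simp add: L'_def q H(2) Fh_def clamp01_simps)
 qed
 have e1S: "e1 \<in> topspace S" by (rule e1_nsphere)
 \<comment> \<open>A deformation of the identity of \<open>W\<close> that fixes the sphere; its end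
   uses \<open>\<Psi>\<close> at time 1 on the inner half disc and runs back through
   \<open>h\<close> on the collar.\<close>
 obtain B where B: "cmap (prod_topology ?I W) W B"
  "\<And>t p. t \<in> topspace ?I \<Longrightarrow> p \<in> topspace S \<Longrightarrow> B (t, \<kappa> p) = \<kappa> p"
  "\<And>t x. t \<in> topspace ?I \<Longrightarrow> x \<in> topspace Di \<Longrightarrow> B (t, \<Phi> x) =
    (if (1 + t) * hw ?m x \<le> 1 then \<Psi> (t, \<lambda>i. (1 + t) * x i) else \<kappa> (h ((1 + t) * (1 - hw ?m x), nz ?m x)))"
 proof -
  let ?gD = "\<lambda>(t, x). if (1 + t) * hw ?m x \<le> 1 then \<Psi> (t, \<lambda>i. (1 + t) * x i) else \<kappa> (h ((1 + t) * (1 - hw ?m x), nz ?m x))"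
  have "cmap (prod_topology ?I Di) W (\<lambda>(t, x). if (1 + t) * hw ?m x \<le> 1 then \<Psi> (t, \<lambda>i. (1 + t) * x i)
    else (\<lambda>q. \<kappa> (h ((\<lambda>t r. (1 + t) * (1 - r)) (fst q) (fst (snd q)), snd (snd q)))) (t, hw ?m x, nz ?m x))"
  proof (rule collar_glue)
   show "cmap ?B W (\<lambda>q. \<kappa> (h ((\<lambda>t r. (1 + t) * (1 - r)) (fst q) (fst (snd q)), snd (snd q))))"
    by (rule kh) (intro cont_arith cont_const c1)
   show "rcont ?I (\<lambda>t. 1 + t)" by (intro cont_arith cont_const Ir)
   show "cmap (prod_topology ?I Di) W \<Psi>" by (rule \<Psi>c)
   fix t w assume tw: "t \<in> topspace ?I" "w \<in> topspace S"
   then have "(1 + t) * (1 - 1 / (1 + t)) = t" by (simp add: field_simps)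
   then show "\<Psi> (t, w) = (\<lambda>q. \<kappa> (h ((\<lambda>t r. (1 + t) * (1 - r)) (fst q) (fst (snd q)), snd (snd q)))) (t, 1 / (1 + t), w)"
    using \<Psi>S tw by simp
  qed auto
  then have D: "cmap (prod_topology ?I Di) W ?gD" by (simp cong: if_cong)
  have Sc: "cmap (prod_topology ?I S) W (\<lambda>q. \<kappa> (snd q))" by (rule cm_compose[OF \<kappa>_cont cm_snd])
  have E: "?gD (t, w) = \<kappa> (snd (t, att w))" if "t \<in> topspace ?I" "w \<in> topspace S" for t w
  proof -
   have "\<Psi> (0, w) = \<kappa> (att w)" using \<Psi>S[of 0 w] that by (simp add: h(2))
   then show ?thesis using that nsphere_hw[OF that(2)] nz_id[OF that(2)] by (auto simp: h(2))
  qed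
  show ?thesis
   by (rule homotopy_on_cells[OF I Sc D E]) (assumption, assumption, rule that, auto)
 qed
 \<comment> \<open>The null homotopy on \<open>W\<close>: \<open>L\<close> on the sphere,
   \<open>L'\<close> on the inner half disc, and on the collar \<open>L\<close> along
   \<open>h\<close> from \<open>lmul k d\<close> back to the attaching map. At time 0 it is the
   power of \<open>x\<close> after the end of \<open>B\<close>.\<close>
 obtain M where M: "cmap (prod_topology ?I W) F M"
  "\<And>t p. t \<in> topspace ?I \<Longrightarrow> p \<in> topspace S \<Longrightarrow> M (t, \<kappa> p) = L (t, p)"
  "\<And>t x. t \<in> topspace ?I \<Longrightarrow> x \<in> topspace Di \<Longrightarrow> M (t, \<Phi> x) =
    (if 2 * hw ?m x \<le> 1 then L' (t, \<lambda>i. 2 * x i) else L (t, h (2 * (1 - hw ?m x), nz ?m x)))"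
 proof -
  let ?gD = "\<lambda>(t, x). if 2 * hw ?m x \<le> 1 then L' (t, \<lambda>i. 2 * x i) else L (t, h (2 * (1 - hw ?m x), nz ?m x))"
  have "cmap (prod_topology ?I Di) F (\<lambda>(t, x). if (\<lambda>_. 2) t * hw ?m x \<le> 1 then L' (t, \<lambda>i. (\<lambda>_. 2) t * x i)
    else (\<lambda>q. L (fst q, h (2 * (1 - fst (snd q)), snd (snd q)))) (t, hw ?m x, nz ?m x))"
  proof (rule collar_glue)
   show "cmap ?B F (\<lambda>q. L (fst q, h (2 * (1 - fst (snd q)), snd (snd q))))"
    by (intro cm_compose[OF Lc] cm_compose[OF h(1)] cm_pair cm_fst cont_arith
      cont_const c1 cont_fst_snd(2)[OF cm_snd])
   show "cmap (prod_topology ?I Di) F L'" by (rule L'c)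
  qed (auto simp: LL' h(3))
  then have D: "cmap (prod_topology ?I Di) F ?gD" by (simp cong: if_cong)
  have E: "?gD (t, w) = L (t, att w)" if "t \<in> topspace ?I" "w \<in> topspace S" for t w
   using that nsphere_hw[OF that(2)] nz_id[OF that(2)] by (auto simp: h(2))
  show ?thesis
   by (rule homotopy_on_cells[OF I Lc D E]) (assumption, assumption, rule that, auto)
 qed
 let ?P = "\<lambda>w. power_map z \<mu> ?N (x w)"
 let ?Q = "\<lambda>h. h (\<kappa> e1) = z"
 have P: "cmap W F ?P" by (rule cm_compose[OF power_map_cont x(1)])
 have kW: "\<kappa> e1 \<in> topspace W" using \<kappa>_Y[OF e1S] YW by blast
 have hS: "h (t, p) \<in> topspace S" if "p \<in> topspace S" for t p
  by (rule funcset_mem[OF cm_funspace[OF h(1)]]) (use that in simp)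
 have nzS: "nz ?m x \<in> topspace S" if "\<not> 2 * hw ?m x \<le> 1" for x
  by (rule nz_in) (use that in auto)
 have b1: "homotopic_with ?Q W F ?P (\<lambda>w. M (0, w))"
 proof (rule iffD2[OF homotopic_with], goal_cases)
  case 2
  show ?case
  proof (intro exI[of _ "\<lambda>q. ?P (B q)"] conjI ballI)
   show "cmap (prod_topology ?I W) F (\<lambda>q. ?P (B q))" by (rule cm_compose[OF P B(1)])
   show "?P (B (0, w)) = ?P w" if "w \<in> topspace W" for w
    using that
   proof (rule topspace_W_cases)
    fix x assume x: "x \<in> topspace Di" "w = \<Phi> x"
    then have "hw ?m x \<le> 1" by (simp add: topspace_disc_Suc)
    then show ?thesis using B(3)[of 0 x] x \<Psi>0[OF x(1)] by simp
   qed (simp add: B(2))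
   show "?P (B (1, w)) = M (0, w)" if "w \<in> topspace W" for w
    using that
   proof (rule topspace_W_cases)
    fix p assume "p \<in> topspace S" "w = \<kappa> p"
    then show ?thesis by (simp add: B(2) M(2) L0)
   next
    fix x' assume x': "x' \<in> topspace Di" "w = \<Phi> x'"
    show ?thesis
    proof (cases "2 * hw ?m x' \<le> 1")
     case True
     then have "(\<lambda>i. 2 * x' i) \<in> topspace Di" using disc_scale[OF x'(1), of 2] by simp
     then show ?thesis using True x' by (simp add: B(3) M(3) L'0)
    next
     case False
     then show ?thesis using x' nzS by (simp add: B(3) M(3) L0 hS)
    qed
   qed
   show "?P (B (t, \<kappa> e1)) = z" if "t \<in> {0..1}" for t
    using that e1S by (simp add: B(2) x(2) power_map_z)
  qed
 qed (use kW in auto)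
 have M1: "L (1, p) = z" "L' (1, x) = z" for p x
  by (simp_all add: L_def L'_def split_beta H(3))
 have b2: "homotopic_with ?Q W F (\<lambda>w. M (0, w)) (\<lambda>_. z)"
 proof (rule iffD2[OF homotopic_with], goal_cases)
  case 2
  show ?case
  proof (intro exI[of _ M] conjI ballI M(1) refl)
   show "M (1, w) = z" if "w \<in> topspace W" for w
    using that by (rule topspace_W_cases) (simp_all add: M(2,3) M1)
   show "M (t, \<kappa> e1) = z" if t: "t \<in> {0..1}" for t
   proof -
    have "L (t, lam k (0, \<lambda>_. 0)) = H (t, 1, 0 / of_int d, \<lambda>_. 0)" by (rule L) (simp add: topspace_Zc)
    then have "L (t, e1) = z" using lam_e1[of "(0, \<lambda>_. 0)" k] by (simp add: Hz)
    then show ?thesis using t e1S by (simp add: M(2))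
   qed
  qed
 qed (use kW in auto)
 show ?thesis using htp_trans[OF b1 b2] by (simp add: o_def)
qed

end

text \<open>Pulled back along \<open>lam\<close> to the cube, multiplication of the periodic
  coordinate by \<open>d\<close> multiplies the class by \<open>d\<close>, according to
  \<open>hur_multiple\<close>.\<close>

lemma lmul_degree:
 assumes m: "m \<noteq> 0" and x: "x \<in> carrier (homology_group m (nsphere (Suc k)))"
 shows "hom_induced m (nsphere (Suc k)) {} (nsphere (Suc k)) {} (lmul k d) x
  = x [^]\<^bsub>homology_group m (nsphere (Suc k))\<^esub> (d::int)"
proof -
 let ?S = "nsphere (Suc k)"
 let ?H = "homology_group m ?S" and ?R = "rel_H m ?S {e1}"
 let ?j = "hom_induced m ?S {} ?S {e1} id" and ?l = "hom_induced m ?S {} ?S {} (lmul k d)"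
 have "contractible_space (subtopology ?S {e1})" using e1_nsphere by (simp add: contractible_space_singleton)
 then have "?j \<in> iso (reduced_homology_group m ?S) ?R"
  using e1_nsphere[of "Suc k"] by (intro iso_reduced_homology_by_contractible) auto
 then have iso: "?j \<in> iso ?H ?R" by (simp add: un_reduced_homology_group[OF m])
 have pw: "?j (x [^]\<^bsub>?H\<^esub> d) = ?j x [^]\<^bsub>?R\<^esub> d"
 proof -
  have "?j \<in> hom ?H ?R" using iso by (simp only: iso_iff)
  then show ?thesis by (rule hom_int_pow[OF _ x]) (rule group_relative_homology_group)+
 qed
 have "?j x \<in> carrier ?R" by (rule hom_induced_carrier)
 then obtain c where c: "c \<in> carrier (rel_H m (IZ (Zc k)) (dIZ (Zc k) (Bc k)))"
  "hur m (Zc k) (Bc k) ?S e1 (lam k) c = ?j x"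
  by (rule lam_onto_homology)
 have lamd: "lam k \<in> dIZ (Zc k) (Bc k) \<rightarrow> {e1}"
  using lam_e1 by (auto simp: dIZ_def)
 have "?j (?l x) = hom_induced m ?S {} ?S {e1} (id \<circ> lmul k d) x"
  by (rule hom_induced_compose'[OF continuous_map_lmul]) auto
 also have "\<dots> = hom_induced m ?S {} ?S {e1} (lmul k d \<circ> id) x" by simp
 also have "\<dots> = hom_induced m ?S {e1} ?S {e1} (lmul k d) (?j x)"
  by (rule hom_induced_compose'[symmetric]) (auto simp: continuous_map_lmul lmul_e1)
 also have "\<dots> = hom_induced m (IZ (Zc k)) (dIZ (Zc k) (Bc k)) ?S {e1} (lmul k d \<circ> lam k) c"
  unfolding c(2)[symmetric] hur_def by (rule hom_induced_compose'[OF lam_cont_IZ lamd continuous_map_lmul]) (simp add: lmul_e1)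
 also have "\<dots> = hur m (Zc k) (Bc k) ?S e1 (\<lambda>(x, y). lam k (of_int d * x, y)) c"
  unfolding hur_def by (rule arg_cong[where f = "\<lambda>g. hom_induced m _ _ _ _ g c"]) (auto simp: fun_eq_iff lmul_lam)
 also have "\<dots> = ?j x [^]\<^bsub>?R\<^esub> d"
  using hur_multiple[OF lam_cmaps e1_nsphere c(1)] c(2) by simp
 finally have "?j (?l x) = ?j (x [^]\<^bsub>?H\<^esub> d)" using pw by simp
 moreover have "inj_on ?j (carrier ?H)" using iso by (simp add: iso_iff)
 moreover have "?l x \<in> carrier ?H" by (rule hom_induced_carrier)
 moreover have "x [^]\<^bsub>?H\<^esub> d \<in> carrier ?H"
  by (rule group.int_pow_closed[OF group_relative_homology_group x])
 ultimately show ?thesis by (auto dest: inj_onD)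
qed

lemma homology_nsphere_iso:
 assumes "m \<ge> 1"
 obtains \<psi> where "\<psi> \<in> iso (homology_group (int m) (nsphere m)) integer_group"
 using reduced_homology_group_nsphere(1)[of m] un_reduced_homology_group[of "int m" "nsphere m"] assms
 unfolding is_iso_def by auto

context two_cell
begin

text \<open>\<open>q\<close> times a generator of the homology of the sphere dies in
  \<open>W\<close>, hence is the boundary of a class that comes from the disc. So it is the image
  under the attaching map of a class of the sphere, that is, \<open>d\<close> times that
  class.\<close>

lemma att_degree:
 assumes q: "\<And>y. y \<in> carrier (homology_group (int (Suc k)) W) \<Longrightarrow> y [^]\<^bsub>homology_group (int (Suc k)) W\<^esub> (q::nat) = \<one>\<^bsub>homology_group (int (Suc k)) W\<^esub>"
  and d: "htp S S att (lmul k d)"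
 shows "d dvd int q"
proof -
 let ?m = "int (Suc k)" and ?Y = "subtopology W Y"
 let ?H = "homology_group ?m S"
 obtain \<psi> where \<psi>: "\<psi> \<in> iso ?H integer_group" using homology_nsphere_iso[of "Suc k"] by auto
 then have gh: "group_hom ?H integer_group \<psi>" by (simp add: group_hom_def group_hom_axioms_def iso_def group_relative_homology_group)
 obtain \<gamma> where \<gamma>: "\<gamma> \<in> carrier ?H" "\<psi> \<gamma> = 1" using iso_surj[OF \<psi>, of 1] by auto
 have gH: "group ?H" by (rule group_relative_homology_group)
 define \<gamma>q where "\<gamma>q = \<gamma> [^]\<^bsub>?H\<^esub> q"
 have \<gamma>q: "\<gamma>q \<in> carrier ?H" unfolding \<gamma>q_def by (rule monoid.nat_pow_closed[OF group.is_monoid[OF gH] \<gamma>(1)])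
 have kY: "cmap S ?Y \<kappa>" using \<kappa>_cont \<kappa>_Y by (auto simp: cm_in_sub)
 define u where "u = hom_induced ?m S {} ?Y {} \<kappa> \<gamma>q"
 have u: "u \<in> carrier (homology_group ?m ?Y)" unfolding u_def by (rule hom_induced_carrier)
 have "hom_induced ?m ?Y {} W {} id u = hom_induced ?m S {} W {} (id \<circ> \<kappa>) \<gamma>q"
  unfolding u_def by (rule hom_induced_compose'[OF kY]) (auto simp: continuous_map_id_subt)
 also have "\<dots> = hom_induced ?m S {} W {} \<kappa> \<gamma> [^]\<^bsub>homology_group ?m W\<^esub> q"
  unfolding \<gamma>q_def id_o
  by (rule hom_nat_pow[OF hom_induced_empty_hom \<gamma>(1)]) (simp_all add: group_relative_homology_group)
 also have "\<dots> = \<one>\<^bsub>homology_group ?m W\<^esub>" by (rule q[OF hom_induced_carrier])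
 finally have "u \<in> kernel (homology_group ?m ?Y) (homology_group ?m W) (hom_induced ?m ?Y {} W {} id)"
  using u by (simp add: kernel_def)
 then obtain w where w: "w \<in> carrier (rel_H (?m + 1) W Y)" "u = hom_boundary (?m + 1) W Y w"
  using homology_exactness_axiom_2[of "?m + 1" W Y] by auto
 let ?S' = "topspace S" and ?M = "Suc k"
 have "\<exists>v \<in> carrier (rel_H (?m + 1) Di ?S'). hom_induced (?m + 1) Di ?S' W Y \<Phi> v = w"
 \<comment> \<open>Radial scaling by \<open>1 / max |x| (1/2)\<close> fixes the boundary sphere and
   pushes the points of norm above 1/2 onto it.\<close>
 proof (rule relative_homology_onto_cell[OF compact_space_disc W \<Phi> _ Y W_eq _ _ _ _ _ _ _ _ _ w(1),
    where N' = "{x \<in> topspace Di. hw ?M x \<in> {1/2<..}}" and H = "\<lambda>(t, x) i. ((1 - t) + t * (1 / max (hw ?M x) (1/2))) * x i"])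
  show "\<Phi> \<in> ?S' \<rightarrow> Y" using \<Phi>_boundary by blast
  show "closedin Di ?S'"
  proof -
   have "?S' = {x \<in> topspace Di. hw ?M x \<in> {1}}"
    by (auto simp: topspace_disc_Suc nsphere_hw topspace_nsphere hw_def)
   moreover have "closedin Di {x \<in> topspace Di. hw ?M x \<in> {1}}"
    by (rule closedin_pre[OF continuous_map_hw_disc]) simp
   ultimately show ?thesis by simp
  qed
  show "inj_on \<Phi> (topspace Di - ?S')" using \<Phi>_inj by (simp add: disc_interior_Suc)
  show "\<Phi> x \<notin> Y" if "x \<in> topspace Di - ?S'" for x using \<Phi>_interior that by (simp add: disc_interior_Suc)
  show "openin Di {x \<in> topspace Di. hw ?M x \<in> {1/2<..}}"
   by (rule openin_pre[OF continuous_map_hw_disc]) simp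
  show "?S' \<subseteq> {x \<in> topspace Di. hw ?M x \<in> {1/2<..}}" using nsphere_subset_disc[of ?M] by (auto simp: nsphere_hw)
  show "cmap (IZ Di) Di (\<lambda>(t, x) i. ((1 - t) + t * (1 / max (hw ?M x) (1/2))) * x i)"
   unfolding continuous_map_disc split_beta
  proof (intro conjI allI)
   let ?X = "IZ Di"
   show "rcont ?X (\<lambda>q. ((1 - fst q) + fst q * (1 / max (hw ?M (snd q)) (1/2))) * snd q i)" for i
   proof -
    have "rcont ?X (\<lambda>q. 1 / max (hw ?M (snd q)) (1/2))"
     by (intro continuous_map_real_quotient cont_arith cont_const
       cm_compose[OF continuous_map_hw_disc cm_snd]) auto
    then show ?thesis
     by (intro cont_arith cont_const cont_fst_I continuous_map_disc_coord[OF cm_snd])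
   qed
   show "(\<lambda>q i. ((1 - fst q) + fst q * (1 / max (hw ?M (snd q)) (1/2))) * snd q i) \<in> topspace ?X \<rightarrow> topspace Di"
   proof
    fix q assume q: "q \<in> topspace ?X"
    then have q': "snd q \<in> topspace Di" "0 \<le> fst q" "fst q \<le> 1" by auto
    let ?r = "hw ?M (snd q)" and ?s = "1 / max (hw ?M (snd q)) (1/2)"
    have r: "0 \<le> ?r" "?r \<le> 1" using q'(1) hw_nonneg by (auto simp: topspace_disc_Suc)
    have s: "0 \<le> ?s" "?s * ?r \<le> 1" by (auto simp: max_def)
    have "\<bar>(1 - fst q) + fst q * ?s\<bar> * ?r = (1 - fst q) * ?r + fst q * (?s * ?r)"
    proof -
     have "0 \<le> (1 - fst q) + fst q * ?s" using q' s(1) by (intro add_nonneg_nonneg mult_nonneg_nonneg) auto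
     then show ?thesis by (simp only: abs_of_nonneg distrib_right mult.assoc)
    qed
    also have "\<dots> \<le> 1" using q' r s by (intro convex_bound_le) auto
    finally show "(\<lambda>i. ((1 - fst q) + fst q * ?s) * snd q i) \<in> topspace Di" by (rule disc_scale[OF q'(1)])
   qed
  qed
  show "(\<lambda>(t, x) i. ((1 - t) + t * (1 / max (hw ?M x) (1/2))) * x i) (0, x) = x" for x by simp
  show "(\<lambda>(t, x) i. ((1 - t) + t * (1 / max (hw ?M x) (1/2))) * x i) (1, x) \<in> ?S'"
   if "x \<in> {x \<in> topspace Di. hw ?M x \<in> {1/2<..}}" for x
  proof -
   have x: "x \<in> topspace Di" "hw ?M x > 1/2" using that by auto
   have "(\<lambda>(t, x) i. ((1 - t) + t * (1 / max (hw ?M x) (1/2))) * x i) (1, x) = nz ?M x"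
   proof -
    have "nz ?M x = (\<lambda>i. if i \<le> ?M then x i / hw ?M x else 0)" by (simp only: nz_def hw_def)
    then show ?thesis using x by (auto simp: topspace_disc_Suc fun_eq_iff max_absorb1)
   qed
   then show ?thesis using nz_in[of ?M x] x by simp
  qed
  show "(\<lambda>(t, x) i. ((1 - t) + t * (1 / max (hw ?M x) (1/2))) * x i) (t, x) \<in> topspace Di \<and>
    \<Phi> ((\<lambda>(t, x) i. ((1 - t) + t * (1 / max (hw ?M x) (1/2))) * x i) (t, x)) = \<Phi> x"
   if "t \<in> {0..1}" "x \<in> ?S'" for t x
   using that nsphere_subset_disc[of ?M] by (auto simp: nsphere_hw)
 qed
 then obtain v where v: "v \<in> carrier (rel_H (?m + 1) Di ?S')" "hom_induced (?m + 1) Di ?S' W Y \<Phi> v = w" by blast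
 define x where "x = hom_boundary (?m + 1) Di ?S' v"
 have sub: "subtopology Di ?S' = S" using nsphere_eq_subtopology[of "Suc k"] by simp
 have x: "x \<in> carrier ?H"
  using hom_boundary_carrier[of "?m + 1" Di ?S' v] unfolding x_def sub by simp
 have "\<Phi> \<in> ?S' \<rightarrow> Y" using \<Phi>_boundary by blast
 from fun_cong[OF naturality_hom_induced[OF \<Phi> this, of "?m + 1"], of v]
 have "u = hom_induced ?m S {} ?Y {} \<Phi> x"
  by (simp only: o_apply v(2) w(2) x_def sub add_diff_cancel_right')
 then have "hom_induced ?m ?Y {} S {} \<kappa>' u = hom_induced ?m S {} S {} (\<kappa>' \<circ> \<Phi>) x"
  using hom_induced_compose'[OF \<Phi>_S _ \<kappa>'_cont] by simp
 moreover have "hom_induced ?m ?Y {} S {} \<kappa>' u = \<gamma>q"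
 proof -
  have "hom_induced ?m ?Y {} S {} \<kappa>' u = hom_induced ?m S {} S {} (\<kappa>' \<circ> \<kappa>) \<gamma>q"
   unfolding u_def by (rule hom_induced_compose'[OF kY _ \<kappa>'_cont]) auto
  also have "\<dots> = \<gamma>q" by (rule hom_induced_id_gen) (use \<gamma>q \<kappa>'\<kappa> in \<open>auto intro: continuous_map_compose[OF kY \<kappa>'_cont]\<close>)
  finally show ?thesis .
 qed
 moreover have "hom_induced ?m S {} S {} (\<kappa>' \<circ> \<Phi>) x = x [^]\<^bsub>?H\<^esub> d"
 proof -
  have "\<kappa>' \<circ> \<Phi> = att" by (simp add: fun_eq_iff att_def)
  then show ?thesis using homology_homotopy_empty[OF d] lmul_degree[OF _ x, of d] by simp
 qed
 ultimately have "\<gamma>q = x [^]\<^bsub>?H\<^esub> d" by simp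
 then have "\<psi> \<gamma> [^]\<^bsub>integer_group\<^esub> q = \<psi> x [^]\<^bsub>integer_group\<^esub> d"
  unfolding \<gamma>q_def using group_hom.hom_nat_pow[OF gh \<gamma>(1), of q] group_hom.hom_int_pow[OF gh x, of d] by simp
 then have "int q = d * \<psi> x" by (simp add: \<gamma>(2))
 then show ?thesis by simp
qed

end

text \<open>The ball modulo its boundary, realised as the \<open>m\<close>-sphere: the boundary goes
  to \<open>e1\<close>, the centre to its antipode, and the ball is wrapped around in
  between.\<close>

definition clps :: "nat \<Rightarrow> (nat \<Rightarrow> real) \<Rightarrow> nat \<Rightarrow> real" where
 "clps m x = (\<lambda>i. if i = 0 then 2 * (\<Sum>j<m. (x j)\<^sup>2) - 1
   else if i \<le> m then 2 * sqrt (1 - (\<Sum>j<m. (x j)\<^sup>2)) * x (i - 1) else 0)"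

lemma sum_shift: "(\<Sum>i\<le>m. g i) = g 0 + (\<Sum>i<m. g (Suc i) :: real)"
 unfolding lessThan_Suc_atMost[symmetric] by (rule sum.lessThan_Suc_shift)

lemma clps_nsphere:
 assumes "x \<in> topspace (disc m)"
 shows "clps m x \<in> sph m"
proof -
 let ?r = "\<Sum>j<m. (x j)\<^sup>2"
 have r: "?r \<le> 1" using assms by (simp add: topspace_disc)
 have "(\<Sum>i<m. (clps m x (Suc i))\<^sup>2) = (\<Sum>i<m. 4 * (1 - ?r) * (x i)\<^sup>2)"
  using r by (intro sum.cong) (auto simp: clps_def power_mult_distrib)
 then have "(\<Sum>i\<le>m. (clps m x i)\<^sup>2) = (2 * ?r - 1)\<^sup>2 + 4 * (1 - ?r) * ?r"
  unfolding sum_shift by (simp add: clps_def flip: sum_distrib_left)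
 then show ?thesis by (simp add: topspace_nsphere power2_eq_square algebra_simps) (simp add: clps_def)
qed

lemma continuous_map_clps: "cmap (disc m) (nsphere m) (clps m)"
 unfolding continuous_map_nsphere
proof (intro conjI allI)
 have r: "rcont (disc m) (\<lambda>x. \<Sum>j<m. (x j)\<^sup>2)"
  by (intro continuous_map_sum continuous_map_real_pow continuous_map_disc_coord[OF cont_id]) auto
 have s: "rcont (disc m) (\<lambda>x. sqrt (1 - (\<Sum>j<m. (x j)\<^sup>2)))"
  by (rule cont_o[OF cont_arith(2)[OF cont_const r]]) (intro continuous_intros)
 show "rcont (disc m) (\<lambda>x. clps m x i)" for i
 proof -
  consider "i = 0" | "i \<noteq> 0" "i \<le> m" | "i > m" by linarith
  then show ?thesis
   by cases (simp_all add: clps_def, (intro cont_arith cont_const r s continuous_map_disc_coord[OF cont_id])+)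
 qed
qed (use clps_nsphere in blast)

lemma clps_boundary: "x \<in> disc_boundary m \<Longrightarrow> clps m x = e1"
 by (auto simp: clps_def disc_boundary_def fun_eq_iff)

lemma clps_interior_ne: "x \<in> disc_interior m \<Longrightarrow> clps m x \<noteq> e1"
 by (auto simp: clps_def disc_interior_def fun_eq_iff)

lemma clps_inj: "inj_on (clps m) (disc_interior m)"
proof (rule inj_onI)
 fix x y assume x: "x \<in> disc_interior m" and y: "y \<in> disc_interior m" and e: "clps m x = clps m y"
 have r: "(\<Sum>j<m. (x j)\<^sup>2) = (\<Sum>j<m. (y j)\<^sup>2)" using fun_cong[OF e, of 0] by (simp add: clps_def)
 show "x = y"
 proof
  fix i show "x i = y i"
  proof (cases "i < m")
   case True
   then have "sqrt (1 - (\<Sum>j<m. (x j)\<^sup>2)) * x i = sqrt (1 - (\<Sum>j<m. (x j)\<^sup>2)) * y i"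
    using fun_cong[OF e, of "Suc i"] by (simp add: clps_def r)
   then show ?thesis using x by (simp add: disc_interior_def)
  next
   case False
   then show ?thesis using x y by (simp add: disc_interior_def topspace_disc)
  qed
 qed
qed

lemma clps_surj:
 assumes p: "p \<in> sph m" and m: "m \<ge> 1"
 shows "\<exists>x \<in> topspace (disc m). clps m x = p"
proof (cases "p = e1")
 case True
 obtain k where k: "m = Suc k" using m by (cases m) auto
 have "e1 \<in> disc_boundary m" unfolding k disc_boundary_Suc by (rule e1_nsphere)
 then show ?thesis using clps_boundary True by (intro bexI[of _ e1]) (auto simp: disc_boundary_def)
next
 case False
 define a where "a = sqrt ((1 - p 0) / 2)"
 have p0: "p 0 < 1" using nsphere_0_le(1)[OF p] nsphere_eq_e1[OF p] False by (auto simp: order_less_le)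
 then have a: "a > 0" "a\<^sup>2 = (1 - p 0) / 2" by (auto simp: a_def)
 define x where "x = (\<lambda>i. if i < m then p (Suc i) / (2 * a) else 0)"
 have "(\<Sum>i<m. (p (Suc i))\<^sup>2) = 1 - (p 0)\<^sup>2"
 proof -
  have "(\<Sum>i\<le>m. (p i)\<^sup>2) = 1" using p by (simp only: topspace_nsphere)
  then show ?thesis unfolding sum_shift by simp
 qed
 moreover have "(\<Sum>i<m. (x i)\<^sup>2) = (\<Sum>i<m. (p (Suc i))\<^sup>2) / (4 * a\<^sup>2)"
  unfolding sum_divide_distrib by (rule sum.cong) (auto simp: x_def power_divide power_mult_distrib)
 moreover have "1 - (p 0)\<^sup>2 = (1 + p 0) / 2 * (4 * ((1 - p 0) / 2))" by (simp add: power2_eq_square algebra_simps)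
 ultimately have r: "(\<Sum>i<m. (x i)\<^sup>2) = (1 + p 0) / 2"
 proof -
  assume A: "(\<Sum>i<m. (p (Suc i))\<^sup>2) = 1 - (p 0)\<^sup>2" "(\<Sum>i<m. (x i)\<^sup>2) = (\<Sum>i<m. (p (Suc i))\<^sup>2) / (4 * a\<^sup>2)"
   and B: "1 - (p 0)\<^sup>2 = (1 + p 0) / 2 * (4 * ((1 - p 0) / 2))"
  have "4 * ((1 - p 0) / 2) \<noteq> 0" using p0 by simp
  then show ?thesis unfolding A(2) A(1) B a(2) by (rule nonzero_mult_div_cancel_right)
 qed
 have s: "sqrt (1 - (\<Sum>i<m. (x i)\<^sup>2)) = a" unfolding r a_def by (simp add: field_simps)
 have "x \<in> topspace (disc m)" unfolding topspace_disc r using p0 by (simp add: x_def)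
 moreover have "clps m x i = p i" for i
 proof -
  consider "i = 0" | j where "i = Suc j" "j < m" | "i > m" by (metis not_less_eq old.nat.exhaust)
  then show ?thesis
  proof cases
   case 1
   then show ?thesis unfolding clps_def r by (simp add: field_simps)
  next
   case 2
   then show ?thesis using a(1) unfolding clps_def s by (simp add: x_def)
  next
   case 3
   then show ?thesis using p by (simp add: clps_def topspace_nsphere)
  qed
 qed
 ultimately show ?thesis by (intro bexI[of _ x]) auto
qed

text \<open>Below dimension \<open>k + 1\<close> there is only the point \<open>k0\<close>, so the
  boundary of the first cell collapses and \<open>clps\<close> identifies the closure of that cell
  with a sphere. The second cell is attached to this sphere.\<close>

lemma two_cell_skeleton:
 assumes cw: "cw_structure K C" and C: "{c \<in> C. fst c \<le> Suc (Suc k)} = {c0, c1, c2}"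
  and c0: "fst c0 = 0" "open_cell c0 = {k0}" and c1: "fst c1 = Suc k" and c2: "fst c2 = Suc (Suc k)"
 obtains Y \<kappa> \<kappa>' where "two_cell (skeleton K C (Suc (Suc k))) Y \<kappa> \<kappa>' (snd c2) k" "\<kappa> e1 = k0"
proof -
 let ?m = "Suc k" and ?W = "skeleton K C (Suc (Suc k))"
 let ?\<Phi> = "snd c1" and ?S = "nsphere (Suc k)"
 have inC: "c0 \<in> C" "c1 \<in> C" "c2 \<in> C" using C by auto
 have H: "Hausdorff_space K" and con_emb: "\<forall>c \<in> C. cmap (disc (fst c)) K (snd c) \<and>
       embedding_map (subtopology (disc (fst c)) (disc_interior (fst c))) K (snd c)"
  and disj': "\<forall>c \<in> C. \<forall>c' \<in> C. c \<noteq> c' \<longrightarrow> open_cell c \<inter> open_cell c' = {}"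
  and cov: "(\<Union>c \<in> C. open_cell c) = topspace K"
  and bd': "\<forall>c \<in> C. \<exists>D. finite D \<and> D \<subseteq> {c' \<in> C. fst c' < fst c} \<and>
       snd c ` disc_boundary (fst c) \<subseteq> (\<Union>c' \<in> D. open_cell c')"
  using cw unfolding cw_structure_def by - (elim conjE, assumption)+
 have con: "cmap (disc (fst c)) K (snd c)"
  and emb: "embedding_map (subtopology (disc (fst c)) (disc_interior (fst c))) K (snd c)" if "c \<in> C" for c
  using bspec[OF con_emb that] by simp_all
 have disj: "open_cell c \<inter> open_cell c' = {}" if "c \<in> C" "c' \<in> C" "c \<noteq> c'" for c c'
  using bspec[OF bspec[OF disj' that(1)] that(2)] that(3) by (rule mp)
 have bd: "\<exists>D. finite D \<and> D \<subseteq> {c' \<in> C. fst c' < fst c} \<and>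
       snd c ` disc_boundary (fst c) \<subseteq> (\<Union>c' \<in> D. open_cell c')" if "c \<in> C" for c
  by (rule bspec[OF bd' that])
 have inj: "inj_on (snd c) (disc_interior (fst c))" if "c \<in> C" for c
 proof -
  have "disc_interior (fst c) \<subseteq> topspace (disc (fst c))" by (auto simp: disc_interior_def)
  then show ?thesis using homeomorphic_imp_injective_map[OF emb[OF that, unfolded embedding_map_def]] by (simp add: Int_absorb1)
 qed
 have ne: "c0 \<noteq> c1" "c0 \<noteq> c2" "c1 \<noteq> c2" using c0(1) c1 c2 by auto
 have bd1: "?\<Phi> x = k0" if x: "x \<in> disc_boundary ?m" for x
 proof -
  obtain D where D: "D \<subseteq> {c' \<in> C. fst c' < ?m}" "?\<Phi> ` disc_boundary ?m \<subseteq> (\<Union>c' \<in> D. open_cell c')"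
   using bd[OF inC(2)] unfolding c1 by (elim exE conjE) (rule that)
  have "D \<subseteq> {c0}"
  proof
   fix c assume "c \<in> D"
   then have "c \<in> C" "fst c < ?m" using D(1) by auto
   moreover from this have "c \<in> {c \<in> C. fst c \<le> Suc (Suc k)}" by simp
   then have "c \<in> {c0, c1, c2}" unfolding C .
   ultimately show "c \<in> {c0}" using c1 c2 by auto
  qed
  then have "(\<Union>c' \<in> D. open_cell c') \<subseteq> {k0}" using c0(2) by (auto dest!: subsetD)
  then show ?thesis using D(2) x by blast
 qed
 have part: "topspace (disc (Suc n)) = disc_interior (Suc n) \<union> disc_boundary (Suc n)" for n
  using disc_interior_Suc disc_boundary_Suc nsphere_subset_disc by blast
 have o1: "open_cell c1 = ?\<Phi> ` disc_interior ?m" by (simp add: open_cell_def c1)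
 have o2: "open_cell c2 = snd c2 ` disc_interior (Suc ?m)" by (simp add: open_cell_def c2)
 have k1: "k0 \<notin> open_cell c1" using disj[OF inC(1,2) ne(1)] c0(2) by auto
 have Wt: "(\<Union>c \<in> {c \<in> C. fst c \<le> Suc (Suc k)}. open_cell c) = {k0} \<union> open_cell c1 \<union> open_cell c2"
  unfolding C by (simp add: c0(2) Un_assoc)
 have WK: "{k0} \<union> open_cell c1 \<union> open_cell c2 \<subseteq> topspace K" using cov inC c0(2) by blast
 have W: "?W = subtopology K ({k0} \<union> open_cell c1 \<union> open_cell c2)" unfolding skeleton_def Wt ..
 have HW: "Hausdorff_space ?W" unfolding W using H by (rule Hausdorff_space_subtopology)
 \<comment> \<open>Factors the characteristic map through \<open>clps\<close>; the choice does not
   matter because \<open>clps\<close> identifies boundary points only, and these all go to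
   \<open>k0\<close>.\<close>
 define \<kappa> where "\<kappa> = (\<lambda>p. ?\<Phi> (SOME x. x \<in> topspace (disc ?m) \<and> clps ?m x = p))"
 have \<kappa>: "\<kappa> (clps ?m x) = ?\<Phi> x" if x: "x \<in> topspace (disc ?m)" for x
 proof -
  define y where "y = (SOME y. y \<in> topspace (disc ?m) \<and> clps ?m y = clps ?m x)"
  have y: "y \<in> topspace (disc ?m)" "clps ?m y = clps ?m x"
   using someI[of "\<lambda>y. y \<in> topspace (disc ?m) \<and> clps ?m y = clps ?m x" x] x unfolding y_def by auto
  have "?\<Phi> y = ?\<Phi> x"
  proof (cases "x \<in> disc_boundary ?m")
   case True
   then have "y \<in> disc_boundary ?m" using y clps_boundary[OF True] clps_interior_ne[of y ?m] part[of k] by auto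
   then show ?thesis using bd1 True by simp
  next
   case False
   then have xi: "x \<in> disc_interior ?m" using x part[of k] by auto
   then have "y \<in> disc_interior ?m" using y clps_boundary[of y ?m] clps_interior_ne[OF xi] part[of k] by auto
   then show ?thesis using inj_onD[OF clps_inj[of ?m], of y x] y(2) xi by simp
  qed
  then show ?thesis by (simp add: \<kappa>_def y_def)
 qed
 have \<Phi>in: "?\<Phi> x \<in> {k0} \<union> open_cell c1" if "x \<in> topspace (disc ?m)" for x
  using that part[of k] bd1 o1 by auto
 have \<Phi>c: "cmap (disc ?m) ?W ?\<Phi>"
  unfolding W cm_in_sub using con[OF inC(2)] c1 \<Phi>in by auto
 have \<kappa>c: "cmap ?S ?W \<kappa>"
 proof (rule continuous_map_on_pushout[OF compact_space_disc Hausdorff_space_nsphere continuous_map_clps, where A = "{}"])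
  show "topspace ?S \<subseteq> {} \<union> clps ?m ` topspace (disc ?m)" using clps_surj[of _ ?m] by force
  show "cmap (disc ?m) ?W (\<lambda>x. \<kappa> (clps ?m x))" by (rule continuous_map_eq[OF \<Phi>c]) (simp add: \<kappa>)
 qed (simp_all add: continuous_map_def)
 have \<kappa>inj: "inj_on \<kappa> (topspace ?S)"
 proof (rule inj_onI)
  fix p p' assume p: "p \<in> topspace ?S" "p' \<in> topspace ?S" "\<kappa> p = \<kappa> p'"
  obtain x x' where x: "x \<in> topspace (disc ?m)" "clps ?m x = p" "x' \<in> topspace (disc ?m)" "clps ?m x' = p'"
   using clps_surj[OF p(1)] clps_surj[OF p(2)] by auto
  have e: "?\<Phi> x = ?\<Phi> x'" using p(3) \<kappa>[OF x(1)] \<kappa>[OF x(3)] x by simp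
  show "p = p'"
  proof (cases "x \<in> disc_boundary ?m")
   case True
   then have "?\<Phi> x' = k0" using e bd1 by simp
   then have "x' \<notin> disc_interior ?m" using k1 o1 by blast
   then have "x' \<in> disc_boundary ?m" using x(3) part[of k] by auto
   then show ?thesis using clps_boundary True x by metis
  next
   case False
   then have xi: "x \<in> disc_interior ?m" using x(1) part[of k] by auto
   then have "?\<Phi> x' \<noteq> k0" using e k1 o1 by (metis image_eqI)
   then have "x' \<in> disc_interior ?m" using bd1 x(3) part[of k] by auto
   then have "x = x'" using inj[OF inC(2)] e xi unfolding c1 by (auto dest: inj_onD)
   then show ?thesis using x by simp
  qed
 qed
 let ?Y = "\<kappa> ` topspace ?S"
 have cm: "closed_map ?S ?W \<kappa>" by (rule continuous_imp_closed_map[OF \<kappa>c compact_space_nsphere HW])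
 then have "embedding_map ?S ?W \<kappa>" using injective_closed_imp_embedding_map[OF \<kappa>c _ \<kappa>inj] by blast
 then have "homeomorphic_map ?S (subtopology ?W ?Y) \<kappa>" by (simp add: embedding_map_def)
 then obtain \<kappa>' where \<kappa>': "homeomorphic_maps ?S (subtopology ?W ?Y) \<kappa> \<kappa>'" using homeomorphic_map_maps by blast
 have e1b: "e1 \<in> disc_boundary ?m" unfolding disc_boundary_Suc by (rule e1_nsphere)
 then have ke1: "\<kappa> e1 = k0" using \<kappa>[of e1] clps_boundary[OF e1b] bd1[OF e1b] by (auto simp: disc_boundary_def)
 have Y: "?Y = {k0} \<union> open_cell c1"
 proof
  show "?Y \<subseteq> {k0} \<union> open_cell c1"
  proof (rule image_subsetI)
   fix p assume "p \<in> topspace ?S"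
   then obtain x where "x \<in> topspace (disc ?m)" "clps ?m x = p" using clps_surj[of p ?m] by auto
   then show "\<kappa> p \<in> {k0} \<union> open_cell c1" using \<kappa> \<Phi>in by metis
  qed
  have "?\<Phi> x \<in> ?Y" if "x \<in> disc_interior ?m" for x
  proof -
   have "x \<in> topspace (disc ?m)" using that by (simp add: disc_interior_def)
   then show ?thesis using \<kappa>[of x] clps_nsphere[of x ?m] by (metis image_eqI)
  qed
  then show "{k0} \<union> open_cell c1 \<subseteq> ?Y" using ke1 e1_nsphere[of ?m] unfolding o1 by (metis Un_least empty_subsetI image_eqI image_subsetI insert_subset)
 qed
 have bd2: "snd c2 x \<in> ?Y" if x: "x \<in> disc_boundary (Suc ?m)" for x
 proof -
  obtain D where D: "D \<subseteq> {c' \<in> C. fst c' < Suc ?m}" "snd c2 ` disc_boundary (Suc ?m) \<subseteq> (\<Union>c' \<in> D. open_cell c')"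
   using bd[OF inC(3)] unfolding c2 by (elim exE conjE) (rule that)
  have "D \<subseteq> {c0, c1}"
  proof
   fix c assume "c \<in> D"
   then have "c \<in> C" "fst c < Suc ?m" using D(1) by auto
   moreover from this have "c \<in> {c \<in> C. fst c \<le> Suc (Suc k)}" by simp
   then have "c \<in> {c0, c1, c2}" unfolding C .
   ultimately show "c \<in> {c0, c1}" using c2 by auto
  qed
  then have "(\<Union>c' \<in> D. open_cell c') \<subseteq> {k0} \<union> open_cell c1" using c0(2) by auto
  then show ?thesis using D(2) x unfolding Y by blast
 qed
 have "two_cell ?W ?Y \<kappa> \<kappa>' (snd c2) k"
 proof
  show "Hausdorff_space ?W" by (rule HW)
  show "closedin ?W ?Y" using cm unfolding closed_map_def by blast
  show "homeomorphic_maps ?S (subtopology ?W ?Y) \<kappa> \<kappa>'" by (rule \<kappa>')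
  have i2: "snd c2 x \<in> {k0} \<union> open_cell c1 \<union> open_cell c2" if "x \<in> topspace (disc (Suc ?m))" for x
   using that part[of ?m] bd2[of x] o2 unfolding Y by auto
  show "cmap (disc (Suc (Suc k))) ?W (snd c2)"
   unfolding W cm_in_sub using con[OF inC(3)] c2 i2 by auto
  show "snd c2 x \<in> ?Y" if "x \<in> topspace ?S" for x using bd2 that by (simp add: disc_boundary_Suc)
  show "snd c2 x \<notin> ?Y" if "x \<in> disc_interior (Suc (Suc k))" for x
  proof -
   have "snd c2 x \<in> open_cell c2" using that o2 by blast
   then show ?thesis using disj[OF inC(1,3) ne(2)] disj[OF inC(2,3) ne(3)] c0(2) unfolding Y by blast
  qed
  show "inj_on (snd c2) (disc_interior (Suc (Suc k)))" using inj[OF inC(3)] c2 by simp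
  have "topspace ?W = {k0} \<union> open_cell c1 \<union> open_cell c2" unfolding W using WK by auto
  then show "topspace ?W \<subseteq> ?Y \<union> snd c2 ` topspace (disc (Suc (Suc k)))"
   unfolding Y o2 using part[of ?m] by blast
 qed
 then show ?thesis using that ke1 by blast
qed

section \<open>The homotopy fibre of a power map\<close>

lemma topspace_path_space: "topspace (path_space X) = paths X"
proof -
 define B where "B = {{\<gamma> \<in> paths X. \<gamma> ` C \<subseteq> U} | C U. compact C \<and> C \<subseteq> {0..1} \<and> openin X U}"
 have 1: "paths X \<in> B"
  unfolding B_def by (intro CollectI exI[of _ "{}"]) simp
 have 2: "V \<subseteq> paths X" if "V \<in> B" for V
  using that unfolding B_def mem_Collect_eq by (elim exE conjE) (simp only: Collect_restrict)
 have "topspace (path_space X) = \<Union> B"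
  unfolding path_space_def B_def by (rule topology_generated_by_topspace)
 also have "\<dots> = paths X" by (rule subset_antisym[OF Union_least[OF 2] Union_upper[OF 1]])
 finally show ?thesis .
qed

text \<open>The exponential law. The set of \<open>x\<close> whose path leaves \<open>U\<close> on
  \<open>C\<close> is the projection of a closed set along the compact \<open>C\<close>, hence
  closed.\<close>

lemma continuous_map_path_space:
 assumes G: "cmap (prod_topology X unit_interval) Y G"
 shows "cmap X (path_space Y) (\<lambda>x. restrict (\<lambda>\<tau>. G (x, \<tau>)) {0..1})"
proof -
 let ?g = "\<lambda>x. restrict (\<lambda>\<tau>. G (x, \<tau>)) {0..1}"
 have gp: "?g x \<in> paths Y" if x: "x \<in> topspace X" for x
 proof -
  have "cmap unit_interval Y (\<lambda>\<tau>. G (x, \<tau>))"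
   by (rule cm_compose[OF G]) (intro cm_pair cont_id, use x in simp)
  then have "cmap unit_interval Y (?g x)" by (rule continuous_map_eq) simp
  then show ?thesis by (simp add: paths_def pathin_def)
 qed
 define B where "B = {{\<gamma> \<in> paths Y. \<gamma> ` C \<subseteq> U} | C U. compact C \<and> C \<subseteq> {0..1} \<and> openin Y U}"
 have path_B: "path_space Y = topology_generated_by B" unfolding path_space_def B_def ..
 have "openin X (?g -` V \<inter> topspace X)" if VB: "V \<in> B" for V
 proof -
 have "\<exists>C U. V = {\<gamma> \<in> paths Y. \<gamma> ` C \<subseteq> U} \<and> compact C \<and> C \<subseteq> {0..1} \<and> openin Y U"
  using VB unfolding B_def mem_Collect_eq .
 then obtain C U where V: "V = {\<gamma> \<in> paths Y. \<gamma> ` C \<subseteq> U}" and C: "compact C" "C \<subseteq> {0..1}" and U: "openin Y U"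
  by (elim exE conjE) (rule that)
 let ?XC = "prod_topology X (top_of_set C)"
 have "cmap ?XC (prod_topology X unit_interval) (\<lambda>z. (fst z, snd z))"
 proof (intro cm_pair cm_fst)
  show "cmap ?XC unit_interval snd"
   using cm_snd[of X "top_of_set C"] C(2) by (auto simp: cm_in_sub)
 qed
 then have GC: "cmap ?XC Y G" using cm_compose[OF G] by fastforce
 have "closedin ?XC {z \<in> topspace ?XC. G z \<in> topspace Y - U}"
  by (rule closedin_pre[OF GC]) (use U in auto)
 moreover have "closed_map ?XC X fst"
  by (rule Abstract_Topological_Spaces.closed_map_fst) (use C in \<open>simp add: compact_space_subtopology\<close>)
 ultimately have "closedin X (fst ` {z \<in> topspace ?XC. G z \<in> topspace Y - U})"
  unfolding closed_map_def by blast
 then have "openin X (topspace X - fst ` {z \<in> topspace ?XC. G z \<in> topspace Y - U})" by blast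
 moreover have "topspace X - fst ` {z \<in> topspace ?XC. G z \<in> topspace Y - U} = ?g -` V \<inter> topspace X"
 proof (rule Set.set_eqI)
  fix x
  show "x \<in> topspace X - fst ` {z \<in> topspace ?XC. G z \<in> topspace Y - U} \<longleftrightarrow> x \<in> ?g -` V \<inter> topspace X"
  proof (cases "x \<in> topspace X")
   case True
   have GY: "G (x, \<tau>) \<in> topspace Y" if "\<tau> \<in> C" for \<tau>
    by (rule funcset_mem[OF cm_funspace[OF GC]]) (use True that in simp)
   have "x \<in> fst ` {z \<in> topspace ?XC. G z \<in> topspace Y - U} \<longleftrightarrow> (\<exists>\<tau>\<in>C. G (x, \<tau>) \<notin> U)"
    using True GY by (force simp: image_iff)
   moreover have "?g x \<in> V \<longleftrightarrow> (\<forall>\<tau>\<in>C. G (x, \<tau>) \<in> U)"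
    using gp[OF True] C(2) unfolding V by (auto simp: image_subset_iff subset_eq)
   ultimately show ?thesis using True by simp
  qed simp
 qed
 ultimately show ?thesis by simp
 qed
 moreover have "?g ` topspace X \<subseteq> \<Union> B"
  using gp topspace_path_space[of Y] unfolding path_B topology_generated_by_topspace by (simp add: image_subsetI)
 ultimately show ?thesis unfolding path_B continuous_on_generated_topo_iff by (intro conjI allI impI)
qed

text \<open>Local compactness of the interval: a small closed ball around \<open>\<tau>\<close>
  provides the compact set of a subbasic neighbourhood of the path.\<close>

lemma continuous_map_path_eval: "cmap (prod_topology (path_space Y) unit_interval) Y (\<lambda>(\<gamma>, \<tau>). \<gamma> \<tau>)"
 unfolding continuous_map_def
proof (intro conjI allI impI)
 let ?X = "prod_topology (path_space Y) unit_interval"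
 have pc: "cmap unit_interval Y \<gamma>" if "\<gamma> \<in> paths Y" for \<gamma>
  using that by (simp add: paths_def pathin_def)
 have "\<gamma> \<tau> \<in> topspace Y" if "\<gamma> \<in> paths Y" "\<tau> \<in> {0..1}" for \<gamma> \<tau>
  by (rule funcset_mem[OF cm_funspace[OF pc[OF that(1)]]]) (use that in simp)
 then show "(\<lambda>(\<gamma>, \<tau>). \<gamma> \<tau>) \<in> topspace ?X \<rightarrow> topspace Y" by (auto simp: topspace_path_space)
 fix U assume U: "openin Y U"
 let ?O = "{z \<in> topspace ?X. (case z of (\<gamma>, \<tau>) \<Rightarrow> \<gamma> \<tau>) \<in> U}"
 show "openin ?X ?O"
  unfolding openin_prod_topology_alt
 proof (intro allI impI)
  fix \<gamma> \<tau> assume gt: "(\<gamma>, \<tau>) \<in> ?O"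
  then have g: "\<gamma> \<in> paths Y" "\<tau> \<in> {0..1}" "\<gamma> \<tau> \<in> U" by (auto simp: topspace_path_space)
  have "openin unit_interval {s \<in> topspace unit_interval. \<gamma> s \<in> U}"
   by (rule openin_pre[OF pc[OF g(1)] U])
  then obtain T where T: "open T" "{s \<in> {0..1}. \<gamma> s \<in> U} = {0..1} \<inter> T" by (auto simp: openin_open)
  then obtain \<epsilon> where \<epsilon>: "\<epsilon> > 0" "cball \<tau> \<epsilon> \<subseteq> T" using g open_contains_cball by blast
  let ?C = "cball \<tau> \<epsilon> \<inter> {0..1}" and ?J = "ball \<tau> \<epsilon> \<inter> {0..1}"
  let ?V = "{\<gamma> \<in> paths Y. \<gamma> ` ?C \<subseteq> U}"
  have "openin (path_space Y) ?V"
   unfolding path_space_def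
  proof (rule topology_generated_by_Basis, intro CollectI exI conjI)
   show "compact ?C" by (simp add: compact_Int)
  qed (use U in auto)
  moreover have "openin unit_interval ?J" by (auto simp: openin_open)
  moreover have "\<gamma> \<in> ?V" using g T \<epsilon> by auto
  moreover have "\<tau> \<in> ?J" using g \<epsilon> by simp
  moreover have "?V \<times> ?J \<subseteq> ?O" by (auto simp: topspace_path_space image_subset_iff)
  ultimately show "\<exists>V J. openin (path_space Y) V \<and> openin unit_interval J \<and> \<gamma> \<in> V \<and> \<tau> \<in> J \<and> V \<times> J \<subseteq> ?O"
   by blast
 qed
qed

lemma lam_clamp: "(\<And>i. i < k \<Longrightarrow> clamp01 (y i) = clamp01 (y' i)) \<Longrightarrow> lam k (x, y) = lam k (x, y')"
 by (induction k) auto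

lemma clamp01_in: "clamp01 u \<in> {0..1}" and clamp01_clamp01: "clamp01 (clamp01 u) = clamp01 u"
 by (auto simp: clamp01_def)

lemma continuous_map_clamp01:
 assumes "rcont X g"
 shows "cmap X unit_interval (\<lambda>q. clamp01 (g q))"
 using assms unfolding cm_in_sub clamp01_def
 by (auto intro!: cont_arith cont_const)

text \<open>A map \<open>S\<^sup>M \<rightarrow> S\<close> is a map \<open>S\<^sup>M\<^sup>-\<^sup>1 \<rightarrow> \<Omega>S \<rightarrow> F\<close>. If the \<open>N\<close>-power map of \<open>F\<close> is trivial, the first
 coordinates of a null homotopy form a map \<open>S\<^sup>M \<rightarrow> S\<close> whose \<open>q\<close>-th power is the \<open>N\<close>-th multiple of the
 given map.\<close>

lemma fibre_power_divides:
 fixes S :: "'a topology" and \<mu> :: "('a \<times> (real \<Rightarrow> 'a)) \<times> ('a \<times> (real \<Rightarrow> 'a)) \<Rightarrow> 'a \<times> (real \<Rightarrow> 'a)"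
 assumes S: "ha_space S s0 \<nu>" and F: "ha_space F f0 \<mu>"
  and F_def: "F = homotopy_fibre S S s0 (power_map s0 \<nu> q)" and f0_def: "f0 = fibre_basepoint s0 s0"
  and l: "based_map (nsphere (Suc (Suc j))) e1 S s0 l"
  and null: "null_homotopic F f0 F f0 (power_map f0 \<mu> N)"
  and c: "c \<in> carrier (rel_H p (IZ (Zc (Suc j))) (dIZ (Zc (Suc j)) (Bc (Suc j))))"
 defines "R \<equiv> rel_H p S {s0}"
 shows "\<exists>b \<in> carrier R. hur p (Zc (Suc j)) (Bc (Suc j)) S s0 (l \<circ> lam (Suc j)) c [^]\<^bsub>R\<^esub> N = b [^]\<^bsub>R\<^esub> q"
proof -
 interpret S: ha_space S s0 \<nu> by (rule S)
 interpret F: ha_space F f0 \<mu> by (rule F)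
 let ?m = "Suc j" and ?Z = "Zc j" and ?B = "Bc j" and ?Z' = "Zc (Suc j)" and ?B' = "Bc (Suc j)"
 let ?H = "hur p ?Z' ?B' S s0"
 have lc: "cmap (nsphere (Suc ?m)) S l" and le1: "l e1 = s0" using l by (auto simp: based_map_def)
 \<comment> \<open>The adjoint of \<open>l\<close>, read in the homotopy fibre as loops over the
   fixed point \<open>s0\<close>.\<close>
 define \<alpha> where "\<alpha> = (\<lambda>w :: real \<times> (nat \<Rightarrow> real). (s0, restrict (\<lambda>\<tau>. l (Sig ?m (lam j w) \<tau>)) {0..1}))"
 have \<alpha>: "\<alpha> \<in> cmaps (RD ?Z) (LB ?B) (LE {}) F f0"
 proof (rule cmapsI)
  let ?X = "prod_topology (RD ?Z) unit_interval"
  have "cmap ?X (nsphere (Suc ?m)) (\<lambda>z. Sig ?m (lam j (fst z)) (snd z))"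
   by (intro continuous_map_Sig cm_compose[OF lam_cont cm_fst] cm_full[OF cm_snd])
  then have "cmap ?X S (\<lambda>z. l (Sig ?m (lam j (fst z)) (snd z)))" by (rule cm_compose[OF lc])
  from continuous_map_path_space[OF this]
  have "cmap (RD ?Z) (path_space S) (\<lambda>w. restrict (\<lambda>\<tau>. l (Sig ?m (lam j w) \<tau>)) {0..1})" by simp
  then have "cmap (RD ?Z) (prod_topology S (path_space S)) \<alpha>"
   unfolding \<alpha>_def by (intro cm_pair) (simp add: S.z_in)
  then show "cmap (RD ?Z) F \<alpha>"
   unfolding F_def homotopy_fibre_def cm_in_sub
   by (auto simp: \<alpha>_def Sig_Ints le1 S.power_map_z)
  show "adm (LB ?B) (LE {}) f0 \<alpha>"
  proof (rule admI)
   fix w assume "w \<in> LB ?B"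
   then have "lam j w = e1" by (intro lam_e1) (auto simp: LB_def)
   then show "\<alpha> w = f0" by (simp add: \<alpha>_def f0_def fibre_basepoint_def Sig_e1 le1)
  next
   fix w w' :: "real \<times> (nat \<Rightarrow> real)" assume "(w, w') \<in> LE {}"
   then have "lam j w' = lam j w" using lam_shift by (auto simp: LE_def)
   then show "\<alpha> w = \<alpha> w'" by (simp add: \<alpha>_def)
  qed
 qed
 have "hmt (RD ?Z) (LB ?B) (LE {}) F f0 (power_map f0 \<mu> N \<circ> \<alpha>) ((\<lambda>_. f0) \<circ> \<alpha>)"
  by (rule hmt_post[OF _ \<alpha>]) (use null in \<open>simp add: null_homotopic_def based_homotopic_def\<close>)
 then have "hmt (RD ?Z) (LB ?B) (LE {}) F f0 (\<lambda>(x, d). \<alpha> (real N * x, d)) (\<lambda>_. f0)"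
  using htp_trans[OF F.multiple[OF \<alpha>, of N]] by (simp add: o_def)
 then obtain A where A: "cmap (RD (RD ?Z)) F A" "\<And>w. A (0, w) = (case w of (x, d) \<Rightarrow> \<alpha> (real N * x, d))" "\<And>w. A (1, w) = f0"
  and Aa: "\<And>t. adm (LB ?B) (LE {}) f0 (\<lambda>w. A (t, w))"
  by (rule homotopic_withE) blast
 have Az: "A (t, x, y) = f0" if "x \<in> \<int> \<or> y \<in> ?B" for t x y by (rule admD[OF Aa]) (use that in \<open>auto simp: LB_def\<close>)
 have Ae: "A (t, x, y) = A (t, x', y)" if "x' - x \<in> \<int>" for t x x' y by (rule admD2[OF Aa]) (use that in \<open>auto simp: LE_def\<close>)
 have A_in: "snd (A (t, x, y)) 0 = s0 \<and> snd (A (t, x, y)) 1 = power_map s0 \<nu> q (fst (A (t, x, y)))"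
  if "y \<in> topspace ?Z" for t x y
 proof -
  have "A (t, x, y) \<in> topspace F"
   by (rule funcset_mem[OF cm_funspace[OF A(1)]]) (use that in simp)
  then show ?thesis unfolding F_def homotopy_fibre_def by (auto simp: split_beta)
 qed
 have A12: "cmap (RD (RD ?Z)) S (\<lambda>w. fst (A w))" "cmap (RD (RD ?Z)) (path_space S) (\<lambda>w. snd (A w))"
  using A(1) unfolding F_def homotopy_fibre_def cm_in_sub by (auto intro: cont_fst_snd)
 \<comment> \<open>The path component of the null homotopy as a map on the square with sides
   \<open>t\<close> and \<open>\<tau>\<close>. The side \<open>t = 0\<close> is the
   \<open>N\<close>-th multiple of \<open>l\<close>, the side \<open>\<tau> = 1\<close> is the
   \<open>q\<close>-th power of the first component, and the other two sides are at the
   basepoint.\<close>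
 define \<Gamma> where "\<Gamma> = (\<lambda>t \<tau> x y. snd (A (t, x, y)) (clamp01 \<tau>))"
 define cy where "cy = (\<lambda>y i. if i < j then clamp01 (y i) else 0 :: real)"
 have cyZ: "cy y \<in> topspace ?Z" for y using clamp01_in by (auto simp: cy_def topspace_Zc)
 have cyB: "cy y \<in> ?B" if "y \<in> ?B" for y
 proof -
  obtain i where "i < j" "y i \<le> 0 \<or> y i \<ge> 1" using \<open>y \<in> ?B\<close> unfolding Bc_def by blast
  then have "i < j \<and> (cy y i \<le> 0 \<or> cy y i \<ge> 1)" by (auto simp: cy_def clamp01_simps)
  then show ?thesis unfolding Bc_def by blast
 qed
 have cyl: "lam j (x, cy y) = lam j (x, y)" for x y by (rule lam_clamp) (simp add: cy_def clamp01_clamp01)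
 have \<Gamma>0: "\<Gamma> 0 \<tau> x (cy y) = l (Sig ?m (lam j (real N * x, y)) (clamp01 \<tau>))" for \<tau> x y
  using clamp01_in[of \<tau>] by (simp add: \<Gamma>_def A(2) \<alpha>_def cyl del: atLeastAtMost_iff)
 have \<Gamma>1: "\<Gamma> t 1 x (cy y) = power_map s0 \<nu> q (fst (A (t, x, cy y)))" for t x y
  using A_in[OF cyZ] by (simp add: \<Gamma>_def clamp01_simps)
 have \<Gamma>z: "\<Gamma> t \<tau> x (cy y) = s0" if "t = 1 \<or> \<tau> = 0 \<or> x \<in> \<int> \<or> y \<in> ?B" for t \<tau> x y
 proof (cases "\<tau> = 0")
  case True
  then show ?thesis using A_in[OF cyZ] by (simp add: \<Gamma>_def clamp01_simps)
 next
  case False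
  then have "A (t, x, cy y) = f0" using that Az[of x "cy y"] cyB[of y] by (auto simp: A(3))
  then show ?thesis using clamp01_in[of \<tau>] by (simp add: \<Gamma>_def f0_def fibre_basepoint_def del: atLeastAtMost_iff)
 qed
 \<comment> \<open>The first component of the null homotopy; its time, reversed, becomes the new
   suspension coordinate \<open>y j\<close>.\<close>
 define \<beta> where "\<beta> = (\<lambda>(x, y). fst (A (1 - clamp01 (y j), x, cy y)))"
 have yc: "rcont X (\<lambda>w. f w i)" if "cmap X ?Z' f" for X :: "'x topology" and f i
  by (rule cm_compose[OF continuous_map_Zc_coord that])
 have cyc: "cmap X ?Z (\<lambda>w. cy (f w))" if "cmap X ?Z' f" for X :: "'x topology" and f
 proof -
  have "rcont X (\<lambda>w. cy (f w) i)" for i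
   using cm_full[OF continuous_map_clamp01[OF yc[OF that, of i]]] by (cases "i < j") (simp_all add: cy_def)
  then show ?thesis
   using cyZ unfolding Zc_def cm_in_sub continuous_map_componentwise_UNIV topspace_Zc[unfolded Zc_def]
   by auto
 qed
 have cc: "rcont X (\<lambda>w. clamp01 (f w j))" if "cmap X ?Z' f" for X :: "'x topology" and f
  by (rule cm_full[OF continuous_map_clamp01[OF yc[OF that]]])
 have \<beta>: "\<beta> \<in> cmaps (RD ?Z') (LB ?B') (LE {}) S s0"
 proof (rule cmapsI)
  show "cmap (RD ?Z') S \<beta>"
   unfolding \<beta>_def split_beta
   by (intro cm_compose[OF A12(1)] cm_pair cont_arith cont_const cc cyc
     cm_fst cm_snd)
  show "adm (LB ?B') (LE {}) s0 \<beta>"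
  proof (rule admI)
   fix w assume w: "w \<in> LB ?B'"
   obtain x y where [simp]: "w = (x, y)" by (cases w)
   from w consider "x \<in> \<int> \<or> y \<in> ?B" | "y j \<le> 0" | "y j \<ge> 1" by (auto simp: LB_def Bc_def less_Suc_eq)
   then have "A (1 - clamp01 (y j), x, cy y) = f0 \<or> (y j \<ge> 1 \<and> A (1 - clamp01 (y j), x, cy y) = \<alpha> (real N * x, cy y))"
   proof cases
    case 1
    then show ?thesis using Az cyB by blast
   qed (auto simp: clamp01_simps A)
   then show "\<beta> w = s0" by (auto simp: \<beta>_def f0_def fibre_basepoint_def \<alpha>_def)
  next
   fix w w' :: "real \<times> (nat \<Rightarrow> real)" assume "(w, w') \<in> LE {}"
   then show "\<beta> w = \<beta> w'" by (auto simp: LE_def \<beta>_def intro!: arg_cong[where f = fst] Ae)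
  qed
 qed
 \<comment> \<open>Paths in the square, from the side \<open>t = 0\<close> (at \<open>s = 0\<close>)
   over the antidiagonal (at \<open>s = 1/2\<close>) to the side \<open>\<tau> = 1\<close> (at
   \<open>s = 1\<close>). One end lies on the trivial sides, the other at the corner
   \<open>t = 0\<close>, \<open>\<tau> = 1\<close>, where the loop closes.\<close>
 let ?T = "\<lambda>s y. (1 - clamp01 (y j)) * min 1 (2 * s)" and ?U = "\<lambda>s y. (1 - clamp01 (y j)) * max 0 (2 * s - 1) + clamp01 (y j)"
 have G: "l \<circ> lam (Suc j) \<in> cmaps (RD ?Z') (LB ?B') (LE {}) S s0"
  by (rule cmaps_post[where u = l], rule lam_cmaps, rule lc, rule le1)
 have hom: "hmt (RD ?Z') (LB ?B') (LE {}) S s0 (\<lambda>(x, y). (l \<circ> lam (Suc j)) (of_int (int N) * x, y)) (S.pw q \<beta>)"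
 proof (rule hmtI[where h = "\<lambda>(s, x, y). \<Gamma> (?T s y) (?U s y) x (cy y)"])
  let ?X = "RD (RD ?Z')"
  have f: "rcont ?X fst" "cmap ?X ?Z' (\<lambda>w. snd (snd w))" "rcont ?X (\<lambda>w. fst (snd w))"
   by (intro cm_fst cont_fst_snd(2)[OF cm_snd] cont_fst_snd(1)[OF cm_snd])+
  have "cmap ?X (path_space S) (\<lambda>w. snd (A (?T (fst w) (snd (snd w)), fst (snd w), cy (snd (snd w)))))"
   by (intro cm_compose[OF A12(2)] cm_pair cont_arith cont_const cc cyc f)
  moreover have "cmap ?X unit_interval (\<lambda>w. clamp01 (?U (fst w) (snd (snd w))))"
   by (intro continuous_map_clamp01 cont_arith cont_const cc f)
  ultimately have "cmap ?X S (\<lambda>w. (\<lambda>(\<gamma>, \<tau>). \<gamma> \<tau>)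
    (snd (A (?T (fst w) (snd (snd w)), fst (snd w), cy (snd (snd w)))), clamp01 (?U (fst w) (snd (snd w)))))"
   by (intro cm_compose[OF continuous_map_path_eval] cm_pair)
  then show "cmap ?X S (\<lambda>(s, x, y). \<Gamma> (?T s y) (?U s y) x (cy y))"
   unfolding \<Gamma>_def split_beta fst_conv snd_conv .
  show "(\<lambda>(s, x, y). \<Gamma> (?T s y) (?U s y) x (cy y)) (0, w) = (\<lambda>(x, y). (l \<circ> lam (Suc j)) (of_int (int N) * x, y)) w" for w
   by (cases w) (simp add: \<Gamma>0 clamp01_clamp01)
  show "(\<lambda>(s, x, y). \<Gamma> (?T s y) (?U s y) x (cy y)) (1, w) = S.pw q \<beta> w" for w
   by (cases w) (simp add: \<Gamma>1 \<beta>_def)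
  fix s :: real assume s: "s \<in> {0..1}"
  show "adm (LB ?B') (LE {}) s0 (\<lambda>w. (\<lambda>(s, x, y). \<Gamma> (?T s y) (?U s y) x (cy y)) (s, w))"
  proof (rule admI)
   fix w assume w: "w \<in> LB ?B'"
   obtain x y where [simp]: "w = (x, y)" by (cases w)
   from w consider "x \<in> \<int> \<or> y \<in> ?B" | "y j \<le> 0" | "y j \<ge> 1" by (auto simp: LB_def Bc_def less_Suc_eq)
   then have "\<Gamma> (?T s y) (?U s y) x (cy y) = s0"
   proof cases
    case 1
    then show ?thesis by (intro \<Gamma>z) blast
   next
    case 2
    then have "?T s y = 1 \<or> ?U s y = 0" by (simp add: clamp01_simps min_def max_def)
    then show ?thesis by (intro \<Gamma>z) blast
   next
    case 3
    then have "\<Gamma> (?T s y) (?U s y) x (cy y) = \<Gamma> 0 1 x (cy y)" by (simp add: clamp01_simps)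
    also have "\<dots> = s0" unfolding \<Gamma>0 by (simp add: clamp01_simps Sig_Ints le1)
    finally show ?thesis .
   qed
   then show "(\<lambda>(s, x, y). \<Gamma> (?T s y) (?U s y) x (cy y)) (s, w) = s0" by simp
  next
   fix w w' :: "real \<times> (nat \<Rightarrow> real)" assume "(w, w') \<in> LE {}"
   then show "(\<lambda>(s, x, y). \<Gamma> (?T s y) (?U s y) x (cy y)) (s, w) = (\<lambda>(s, x, y). \<Gamma> (?T s y) (?U s y) x (cy y)) (s, w')"
    unfolding \<Gamma>_def by (auto simp: LE_def intro!: fun_cong[OF arg_cong[where f = snd]] Ae)
  qed
 qed
 have "?H (l \<circ> lam (Suc j)) c [^]\<^bsub>R\<^esub> (int N) = ?H (\<lambda>(x, y). (l \<circ> lam (Suc j)) (of_int (int N) * x, y)) c"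
  unfolding R_def by (rule hur_multiple[OF G S.z_in c, symmetric])
 also have "\<dots> = ?H (S.pw q \<beta>) c" using hur_homotopy[OF hom] by metis
 also have "\<dots> = ?H (\<lambda>(x, d). \<beta> (of_int (int q) * x, d)) c"
  using hur_homotopy[OF S.multiple[OF \<beta>, of q]] by simp
 also have "\<dots> = ?H \<beta> c [^]\<^bsub>R\<^esub> (int q)" unfolding R_def by (rule hur_multiple[OF \<beta> S.z_in c])
 finally have "?H (l \<circ> lam (Suc j)) c [^]\<^bsub>R\<^esub> N = ?H \<beta> c [^]\<^bsub>R\<^esub> q" by (simp only: int_pow_int)
 moreover have "?H \<beta> c \<in> carrier R" unfolding R_def hur_def by (rule hom_induced_carrier)
 ultimately show ?thesis by blast
qed

section \<open>Homology of p-local spheres, and the two bounds on the exponent\<close>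

lemma p_local_torsion_free:
 assumes p: "prime p" and H: "p_local_group p H" "Group.group H"
 shows "coprime k p \<Longrightarrow> y \<in> carrier H \<Longrightarrow> y [^]\<^bsub>H\<^esub> (k::nat) = \<one>\<^bsub>H\<^esub> \<Longrightarrow> y = \<one>\<^bsub>H\<^esub>"
proof (induction k arbitrary: y rule: less_induct)
 case (less k)
 interpret group H by (rule H)
 consider "k = 0" | "k = 1" | "k > 1" by linarith
 then show ?case
 proof cases
  case 1
  then show ?thesis using less.prems(1) p by simp
 next
  case 2
  then show ?thesis using less.prems by simp
 next
  case 3
  then obtain q where q: "prime q" "q dvd k" using prime_factor_nat by (metis less_irrefl)
  then obtain k' where k: "k = q * k'" by blast
  have "q \<noteq> p"
  proof
   assume "q = p"
   then have "is_unit p" using coprime_common_divisor[OF less.prems(1), of p] q(2) by simp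
   then show False using p by simp
  qed
  then have "bij_betw (\<lambda>x. x [^]\<^bsub>H\<^esub> q) (carrier H) (carrier H)" using H(1) q(1) by (simp add: p_local_group_def)
  then have inj: "inj_on (\<lambda>x. x [^]\<^bsub>H\<^esub> q) (carrier H)" by (simp add: bij_betw_def)
  have "(y [^]\<^bsub>H\<^esub> k') [^]\<^bsub>H\<^esub> q = \<one>\<^bsub>H\<^esub> [^]\<^bsub>H\<^esub> q"
   using less.prems k by (simp add: nat_pow_pow mult.commute)
  then have "y [^]\<^bsub>H\<^esub> k' = \<one>\<^bsub>H\<^esub>" using inj_onD[OF inj, of "y [^]\<^bsub>H\<^esub> k'" "\<one>\<^bsub>H\<^esub>"] less.prems(2) by simp
  moreover have "k' < k" using n_less_m_mult_n[of k' q] prime_gt_1_nat[OF q(1)] k 3 by (cases "k' = 0") auto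
  moreover have "coprime k' p" using less.prems(1) k by simp
  ultimately show ?thesis using less.IH less.prems(2) by blast
 qed
qed

text \<open>Every element has a power, with exponent prime to \<open>p\<close>, in the image of a
  trivial group; a p-local group has no such torsion.\<close>

lemma p_local_sphere_trivial_homology:
 assumes p: "prime p" and T: "p_local_sphere p m T t0" and k: "k \<noteq> int m"
 shows "trivial_group (reduced_homology_group k T)"
proof -
 let ?H = "reduced_homology_group k T" and ?G = "reduced_homology_group k (nsphere m)"
 obtain l where "p_localising_hom p ?G ?H (hom_induced k (nsphere m) {} T {} l)"
  using T unfolding p_local_sphere_def by blast
 then obtain h where h: "p_localising_hom p ?G ?H h" by blast
 interpret H: group ?H by simp
 have G: "carrier ?G = {\<one>\<^bsub>?G\<^esub>}" using reduced_homology_group_nsphere(2)[OF k] by (simp add: trivial_group_def)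
 have "h \<in> hom ?G ?H" using h by (simp add: p_localising_hom_def)
 then have h1: "h \<one>\<^bsub>?G\<^esub> = \<one>\<^bsub>?H\<^esub>" by (rule hom_one) simp_all
 have "y = \<one>\<^bsub>?H\<^esub>" if y: "y \<in> carrier ?H" for y
 proof -
  obtain n :: nat where n: "coprime n p" "y [^]\<^bsub>?H\<^esub> n \<in> h ` carrier ?G"
   using h y unfolding p_localising_hom_def by blast
  then have "y [^]\<^bsub>?H\<^esub> n = \<one>\<^bsub>?H\<^esub>" unfolding G using h1 by simp
  moreover have "p_local_group p ?H" using h by (simp add: p_localising_hom_def)
  ultimately show ?thesis using p_local_torsion_free[OF p _ H.is_group n(1) y] by blast
 qed
 then show ?thesis unfolding trivial_group_def using H.is_group H.one_closed by blast
qed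

lemma (in hahc_space) H_map_const: "H_map F z \<mu> F z \<mu> (\<lambda>_. z)"
 unfolding H_map_def based_map_def based_homotopic_def split_beta
 using z_in by (simp add: mu_zz)

lemma (in ha_space) pw_mult_null:
 assumes f: "f \<in> cmaps D B E F z" and n: "hmt D B E F z (pw a f) (\<lambda>_. z)"
 shows "hmt D B E F z (pw (a * b) f) (\<lambda>_. z)"
proof -
 interpret M: Group.monoid "hmonoid D B E" by (rule monoid_hmonoid)
 have z: "(\<lambda>_. z) \<in> cmaps D B E F z" by (rule cmaps_const[OF z_in])
 have "hclass D B E (pw (a * b) f) = (hclass D B E f [^]\<^bsub>hmonoid D B E\<^esub> a) [^]\<^bsub>hmonoid D B E\<^esub> b"
  unfolding hclass_pw[OF f] by (rule M.nat_pow_pow[OF hclass_in[OF f], symmetric])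
 also have "\<dots> = hclass D B E (\<lambda>_. z)"
  using hclass_eqI[OF n] by (simp add: hclass_pw[OF f, symmetric] hmonoid_one[symmetric])
 finally show ?thesis by (rule hclass_eqD[OF z])
qed

text \<open>Both the \<open>q\<close>-power map and the constant map are H-maps, so by uniqueness in the universal property it
 suffices to compare them on the bottom two cells.\<close>

lemma (in hahc_space) power_map_null_if_universal:
 assumes univ: "universal_space p P p0 F z \<mu> i"
  and n: "based_homotopic P p0 F z (power_map z \<mu> q \<circ> i) (\<lambda>_. z)"
 shows "null_homotopic F z F z (power_map z \<mu> q)"
proof -
 have loc: "p_local_HAHC_space p F z \<mu>" and i: "based_map P p0 F z i" using univ by (simp_all add: universal_space_def)
 have c: "based_map P p0 F z (\<lambda>_. z)" using i by (simp add: based_map_def)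
 obtain g where g: "\<And>g'. H_map F z \<mu> F z \<mu> g' \<Longrightarrow> based_homotopic P p0 F z (g' \<circ> i) (\<lambda>_. z) \<Longrightarrow> based_homotopic F z F z g' g"
  using univ loc c unfolding universal_space_def by blast
 have "based_homotopic P p0 F z ((\<lambda>_. z) \<circ> i) (\<lambda>_. z)"
  using c by (simp add: based_homotopic_def based_map_def o_def)
 then have "based_homotopic F z F z (\<lambda>_. z) g" by (rule g[OF H_map_const])
 moreover have "based_homotopic F z F z (power_map z \<mu> q) g" by (rule g[OF H_map_power_map n])
 ultimately show ?thesis
  unfolding null_homotopic_def based_homotopic_def by (metis htp_trans homotopic_with_sym)
qed

text \<open>The cell argument runs on the skeleton \<open>?W\<close>; from the Moore space only the
  annihilation of the \<open>m\<close>-th homology by \<open>q\<close> is carried over, along the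
  equivalence \<open>e\<close>. The degree of the attaching map then divides \<open>q\<close>, and
  \<open>pw_mult_null\<close> passes from this degree to its multiple \<open>q\<close>.\<close>

lemma Moore_space_exponent:
 fixes T :: "'t topology" and t0 d k
 defines "P \<equiv> homotopy_cofibre T t0 T t0 d" and "m \<equiv> Suc k"
 assumes p: "prime p" and T: "p_local_sphere p m T t0" and deg: "sphere_map_of_degree m T t0 q d" and q: "odd q"
  and F: "hahc_space F z \<mu>" and two: "bottom_two_cells m P p0 F z i"
 shows "based_homotopic P p0 F z (power_map z \<mu> q \<circ> i) (\<lambda>_. z)"
proof -
 interpret hahc_space F z \<mu> by (rule F)
 from two obtain K :: "'a topology" and C k0 c0 c1 c2 e h where cw: "cw_structure K C"
  and C: "{c \<in> C. fst c \<le> Suc (Suc k)} = {c0, c1, c2}" and c: "fst c0 = 0" "open_cell c0 = {k0}" "fst c1 = Suc k" "fst c2 = Suc (Suc k)"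
  and e: "based_map P p0 (skeleton K C (Suc (Suc k))) k0 e" "homotopy_equivalence P (skeleton K C (Suc (Suc k))) e"
  and h: "based_map K k0 F z h" and i: "based_homotopic P p0 F z i (h \<circ> e)"
  unfolding bottom_two_cells_def m_def by (elim exE conjE) (rule that)
 let ?W = "skeleton K C (Suc (Suc k))" and ?m = "int (Suc k)"
 obtain Y \<kappa> \<kappa>' where "two_cell ?W Y \<kappa> \<kappa>' (snd c2) k" and k0: "\<kappa> e1 = k0"
  by (rule two_cell_skeleton[OF cw C c])
 then interpret W: two_cell ?W Y \<kappa> \<kappa>' "snd c2" k by simp
 interpret W: two_cell_hahc ?W Y \<kappa> \<kappa>' "snd c2" k F z \<mu> by unfold_locales
 have H_P: "y [^]\<^bsub>homology_group ?m P\<^esub> q = \<one>\<^bsub>homology_group ?m P\<^esub>" if y: "y \<in> carrier (homology_group ?m P)" for y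
  unfolding P_def
 proof (rule cofibre_homology_exponent)
  show "nondegenerate_basepoint T t0" using T by (simp add: p_local_sphere_def p_local_space_def)
  show "based_map T t0 T t0 d" using deg by (simp add: sphere_map_of_degree_def)
  show "trivial_group (reduced_homology_group (?m - 1) T)" by (rule p_local_sphere_trivial_homology[OF p T]) (simp add: m_def)
  show "hom_induced ?m T {} T {} d z = z [^]\<^bsub>homology_group ?m T\<^esub> q" if "z \<in> carrier (homology_group ?m T)" for z
   using deg that un_reduced_homology_group[of ?m T] by (simp add: sphere_map_of_degree_def m_def)
 qed (use y in \<open>simp_all add: P_def\<close>)
 have H_W: "y [^]\<^bsub>homology_group ?m ?W\<^esub> q = \<one>\<^bsub>homology_group ?m ?W\<^esub>" if y: "y \<in> carrier (homology_group ?m ?W)" for y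
 proof -
  obtain g where eg: "cmap P ?W e" "cmap ?W P g" "htp ?W ?W (e \<circ> g) id"
   using e(2) unfolding homotopy_equivalence_def by blast
  define x where "x = hom_induced ?m ?W {} P {} g y"
  have x: "x \<in> carrier (homology_group ?m P)" unfolding x_def by (rule hom_induced_carrier)
  have "hom_induced ?m P {} ?W {} e x = hom_induced ?m ?W {} ?W {} (e \<circ> g) y"
   unfolding x_def by (rule hom_induced_compose'[OF eg(2) _ eg(1)]) auto
  also have "\<dots> = hom_induced ?m ?W {} ?W {} id y" using homology_homotopy_empty[OF eg(3)] by simp
  also have "\<dots> = y" by (rule hom_induced_id[OF y])
  finally have y': "y = hom_induced ?m P {} ?W {} e x" ..
  have "y [^]\<^bsub>homology_group ?m ?W\<^esub> q = hom_induced ?m P {} ?W {} e (x [^]\<^bsub>homology_group ?m P\<^esub> q)"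
   unfolding y' by (rule hom_nat_pow[OF hom_induced_empty_hom x, symmetric]) (simp_all add: group_relative_homology_group)
  then show ?thesis unfolding H_P[OF x] hom_induced_one .
 qed
 obtain d0 where d0: "htp (nsphere (Suc k)) (nsphere (Suc k)) W.att (lmul k d0)"
  using hopf[OF W.att_cont] by blast
 have dq: "d0 dvd int q" by (rule W.att_degree[OF H_W d0])
 have odd: "odd d0" using dq q by (metis dvd_trans even_of_nat)
 have hc: "cmap K F h" "h k0 = z" using h by (auto simp: based_map_def)
 have hW: "cmap ?W F h" unfolding skeleton_def by (rule cm_sub[OF hc(1)])
 have adm: "adm {k0} {} z = (\<lambda>h. h k0 = z)" by (auto simp: adm_def fun_eq_iff)
 have hm: "h \<in> cmaps ?W {k0} {} F z" unfolding cmaps_def adm using hW hc(2) by simp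
 have "hmt ?W {k0} {} F z (pw (nat \<bar>d0\<bar>) h) (\<lambda>_. z)"
  using W.two_cell_exponent[OF d0 odd hW] hc(2) unfolding k0 adm by simp
 moreover obtain b where b: "q = nat \<bar>d0\<bar> * b"
 proof -
  have "nat \<bar>d0\<bar> dvd q" using dq by (simp add: nat_abs_dvd_iff)
  then show ?thesis using that by blast
 qed
 ultimately have "hmt ?W {k0} {} F z (pw q h) (\<lambda>_. z)" using pw_mult_null[OF hm] by simp
 then have n: "homotopic_with (\<lambda>h. h k0 = z) ?W F (pw q h) (\<lambda>_. z)" unfolding adm .
 have e': "cmap P ?W e" "e p0 = k0" using e(1) by (auto simp: based_map_def)
 have 1: "homotopic_with (\<lambda>h. h p0 = z) P F (pw q h \<circ> e) ((\<lambda>_. z) \<circ> e)"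
  by (rule homotopic_with_compose_continuous_map_right[OF n e'(1)]) (simp add: e'(2))
 have 2: "homotopic_with (\<lambda>h. h p0 = z) P F (power_map z \<mu> q \<circ> i) (power_map z \<mu> q \<circ> (h \<circ> e))"
  by (rule homotopic_with_compose_continuous_map_left[OF i[unfolded based_homotopic_def] power_map_cont]) (simp add: power_map_z)
 show ?thesis
  using htp_trans[OF 2] 1 unfolding based_homotopic_def by (simp add: o_def)
qed

text \<open>If \<open>p ^ a\<close> times the image of a generator is \<open>p ^ r\<close> times
  \<open>b\<close>, some multiple \<open>n\<close> of \<open>b\<close> with \<open>n\<close> prime
  to \<open>p\<close> comes from the sphere. Up to torsion, which the integers lack, this gives
  \<open>p ^ a * n = p ^ r * \<psi> x\<close>.\<close>

lemma p_local_sphere_degree_divides: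
 assumes p: "prime p" and S: "p_local_sphere p (Suc m) S s0"
  and div: "\<And>l c. based_map (nsphere (Suc m)) e1 S s0 l \<Longrightarrow>
    c \<in> carrier (rel_H (int (Suc m)) (IZ (Zc m)) (dIZ (Zc m) (Bc m))) \<Longrightarrow>
    \<exists>b \<in> carrier (rel_H (int (Suc m)) S {s0}).
     hur (int (Suc m)) (Zc m) (Bc m) S s0 (l \<circ> lam m) c [^]\<^bsub>rel_H (int (Suc m)) S {s0}\<^esub> (p ^ a)
      = b [^]\<^bsub>rel_H (int (Suc m)) S {s0}\<^esub> (p ^ r)"
 shows "r \<le> a"
proof (rule ccontr)
 assume "\<not> r \<le> a"
 then obtain t where t: "r = a + Suc t" by (metis add_Suc_right less_iff_Suc_add not_le)
 let ?m = "int (Suc m)" and ?X = "nsphere (Suc m)"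
 let ?H = "homology_group ?m S" and ?R = "rel_H ?m S {s0}" and ?G = "homology_group ?m ?X"
 obtain l where l: "based_map ?X e1 S s0 l"
  and loc': "p_localising_hom p (reduced_homology_group ?m ?X) (reduced_homology_group ?m S) (hom_induced ?m ?X {} S {} l)"
  using S unfolding p_local_sphere_def by blast
 have loc: "p_localising_hom p ?G ?H (hom_induced ?m ?X {} S {} l)"
  using loc' un_reduced_homology_group[of ?m ?X] un_reduced_homology_group[of ?m S] by simp
 let ?l = "hom_induced ?m ?X {} S {} l"
 have lc: "cmap ?X S l" "l e1 = s0" and s0: "s0 \<in> topspace S" using l by (auto simp: based_map_def)
 interpret H: group ?H by (simp add: group_relative_homology_group)
 interpret G: group ?G by (simp add: group_relative_homology_group)
 interpret R: group ?R by (rule group_relative_homology_group)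
 interpret l: group_hom ?G ?H ?l
  by (simp add: group_hom_def group_hom_axioms_def G.is_group H.is_group hom_induced_empty_hom)
 obtain \<psi> where \<psi>: "\<psi> \<in> iso ?G integer_group" using homology_nsphere_iso[of "Suc m"] by auto
 then interpret \<psi>: group_hom ?G integer_group \<psi>
  by (simp add: group_hom_def group_hom_axioms_def iso_def G.is_group)
 obtain \<gamma> where \<gamma>: "\<gamma> \<in> carrier ?G" "\<psi> \<gamma> = 1" using iso_surj[OF \<psi>, of 1] by auto
 let ?jX = "hom_induced ?m ?X {} ?X {e1} id" and ?j = "hom_induced ?m S {} S {s0} id"
 have j: "?j \<in> iso ?H ?R"
 proof -
  have "contractible_space (subtopology S {s0})" using s0 by (simp add: contractible_space_singleton)
  then have "?j \<in> iso (reduced_homology_group ?m S) ?R"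
   using s0 by (intro iso_reduced_homology_by_contractible) auto
  then show ?thesis by (simp add: un_reduced_homology_group)
 qed
 have "?jX \<gamma> \<in> carrier (rel_H ?m ?X {e1})" by (rule hom_induced_carrier)
 then obtain c where c: "c \<in> carrier (rel_H ?m (IZ (Zc m)) (dIZ (Zc m) (Bc m)))"
  "hur ?m (Zc m) (Bc m) ?X e1 (lam m) c = ?jX \<gamma>"
  by (rule lam_onto_homology)
 have "hur ?m (Zc m) (Bc m) S s0 (l \<circ> lam m) c = hom_induced ?m ?X {e1} S {s0} l (?jX \<gamma>)"
  unfolding c(2)[symmetric] hur_def
  by (rule hom_induced_compose'[symmetric, OF lam_cont_IZ _ lc(1)]) (use lam_e1 lc(2) in \<open>auto simp: dIZ_def\<close>)
 also have "\<dots> = hom_induced ?m ?X {} S {s0} (l \<circ> id) \<gamma>"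
  by (rule hom_induced_compose') (use lc in auto)
 also have "\<dots> = hom_induced ?m ?X {} S {s0} (id \<circ> l) \<gamma>" by simp
 also have "\<dots> = ?j (?l \<gamma>)" by (rule hom_induced_compose'[symmetric, OF lc(1)]) auto
 finally have hc: "hur ?m (Zc m) (Bc m) S s0 (l \<circ> lam m) c = ?j (?l \<gamma>)" .
 obtain b' where b': "b' \<in> carrier ?R" "?j (?l \<gamma>) [^]\<^bsub>?R\<^esub> (p ^ a) = b' [^]\<^bsub>?R\<^esub> (p ^ r)"
  using div[OF l c(1)] unfolding hc by blast
 obtain b where b: "b \<in> carrier ?H" "?j b = b'" using iso_surj[OF j b'(1)] by blast
 have lg: "?l \<gamma> \<in> carrier ?H" by (rule hom_induced_carrier)
 have jh: "?j \<in> hom ?H ?R" "inj_on ?j (carrier ?H)" using j by (simp_all only: iso_iff)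
 have "?j (?l \<gamma> [^]\<^bsub>?H\<^esub> (p ^ a)) = ?j (b [^]\<^bsub>?H\<^esub> (p ^ r))"
  using b'(2) hom_nat_pow[OF jh(1) lg H.is_group R.is_group] hom_nat_pow[OF jh(1) b(1) H.is_group R.is_group] b(2) by simp
 then have eq: "?l \<gamma> [^]\<^bsub>?H\<^esub> (p ^ a) = b [^]\<^bsub>?H\<^esub> (p ^ r)"
  using inj_onD[OF jh(2)] H.nat_pow_closed[OF lg] H.nat_pow_closed[OF b(1)] by blast
 obtain n :: nat where n: "coprime n p" "b [^]\<^bsub>?H\<^esub> n \<in> ?l ` carrier ?G"
  using loc b(1) unfolding p_localising_hom_def by blast
 then obtain x where x: "x \<in> carrier ?G" "?l x = b [^]\<^bsub>?H\<^esub> n" by force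
 have "?l (\<gamma> [^]\<^bsub>?G\<^esub> (p ^ a * n)) = (?l \<gamma> [^]\<^bsub>?H\<^esub> (p ^ a)) [^]\<^bsub>?H\<^esub> n"
  unfolding l.hom_nat_pow[OF \<gamma>(1)] H.nat_pow_pow[OF lg] ..
 also have "\<dots> = (b [^]\<^bsub>?H\<^esub> n) [^]\<^bsub>?H\<^esub> (p ^ r)"
  unfolding eq H.nat_pow_pow[OF b(1)] by (simp only: mult.commute)
 also have "\<dots> = ?l (x [^]\<^bsub>?G\<^esub> (p ^ r))" unfolding l.hom_nat_pow[OF x(1)] x(2) ..
 finally have le: "?l (\<gamma> [^]\<^bsub>?G\<^esub> (p ^ a * n)) = ?l (x [^]\<^bsub>?G\<^esub> (p ^ r))" .
 define w where "w = \<gamma> [^]\<^bsub>?G\<^esub> (p ^ a * n) \<otimes>\<^bsub>?G\<^esub> inv\<^bsub>?G\<^esub> (x [^]\<^bsub>?G\<^esub> (p ^ r))"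
 have gp: "\<gamma> [^]\<^bsub>?G\<^esub> (p ^ a * n) \<in> carrier ?G" "x [^]\<^bsub>?G\<^esub> (p ^ r) \<in> carrier ?G"
  using \<gamma>(1) x(1) G.nat_pow_closed by blast+
 have w: "w \<in> carrier ?G" unfolding w_def by (rule G.m_closed[OF gp(1) G.inv_closed[OF gp(2)]])
 have "?l w = \<one>\<^bsub>?H\<^esub>"
  unfolding w_def l.hom_mult[OF gp(1) G.inv_closed[OF gp(2)]] l.hom_inv[OF gp(2)] le
  by (rule H.r_inv) (rule hom_induced_carrier)
 then obtain n' :: nat where n': "coprime n' p" "w [^]\<^bsub>?G\<^esub> n' = \<one>\<^bsub>?G\<^esub>"
  using loc w unfolding p_localising_hom_def by blast
 have "\<psi> w = int (p ^ a * n) - int (p ^ r) * \<psi> x"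
  unfolding w_def \<psi>.hom_mult[OF gp(1) G.inv_closed[OF gp(2)]] \<psi>.hom_inv[OF gp(2)]
   \<psi>.hom_nat_pow[OF \<gamma>(1)] \<psi>.hom_nat_pow[OF x(1)] \<gamma>(2) by simp
 moreover have "int n' * \<psi> w = 0"
  using \<psi>.hom_nat_pow[OF w, of n'] unfolding n'(2) \<psi>.hom_one by simp
 moreover have "n' \<noteq> 0" using n'(1) p by (metis coprime_0_left_iff not_prime_unit)
 ultimately have "int (p ^ a * n) = int (p ^ r) * \<psi> x" by simp
 then have "int (p ^ a) * int n = int (p ^ a) * (int p * (int p ^ t * \<psi> x))"
  unfolding t by (simp add: power_add mult.assoc)
 moreover have "int (p ^ a) \<noteq> 0" using p by (simp add: prime_gt_0_nat)
 ultimately have "int n = int p * (int p ^ t * \<psi> x)" by (simp only: mult_cancel_left) blast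
 then have "int p dvd int n" by simp
 then have "p dvd n" by simp
 then have "is_unit p" using coprime_common_divisor[OF n(1), of p] by simp
 then show False using p by simp
qed

theorem proposition1p3:
  fixes p n r :: nat
    and S :: "'a topology" and s0 :: 'a and \<nu> :: "'a \<times> 'a \<Rightarrow> 'a"
    and T :: "'b topology" and t0 :: 'b and d :: "'b \<Rightarrow> 'b"
    and P :: "('b + 'b \<times> real) topology" and p0 :: "'b + 'b \<times> real"
    and F :: "('a \<times> (real \<Rightarrow> 'a)) topology" and f0 :: "'a \<times> (real \<Rightarrow> 'a)"
    and \<mu> :: "('a \<times> (real \<Rightarrow> 'a)) \<times> ('a \<times> (real \<Rightarrow> 'a)) \<Rightarrow> 'a \<times> (real \<Rightarrow> 'a)"
    and i :: "'b + 'b \<times> real \<Rightarrow> 'a \<times> (real \<Rightarrow> 'a)"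
  assumes "prime p" and "p > 3" and "n \<ge> 1" and "r \<ge> 1"
    and "p_local_sphere p (2 * n + 1) S s0"
    and "H_space S s0 \<nu>" and "homotopy_associative S s0 \<nu>"
    and "F = homotopy_fibre S S s0 (power_map s0 \<nu> (p ^ r))" and "f0 = fibre_basepoint s0 s0"
    and "p_local_sphere p (2 * n) T t0"
    and "sphere_map_of_degree (2 * n) T t0 (p ^ r) d"
    and "P = homotopy_cofibre T t0 T t0 d" and "p0 = Inl t0"
    and "bottom_two_cells (2 * n) P p0 F f0 i"
    and "universal_space p P p0 F f0 \<mu> i"
  shows "H_exp p F f0 \<mu> = p ^ r
         \<and> null_homotopic F f0 F f0 (power_map f0 \<mu> (p ^ r))
         \<and> (\<forall>l < r. \<not> null_homotopic F f0 F f0 (power_map f0 \<mu> (p ^ l)))"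
proof -
 have "p_local_HAHC_space p F f0 \<mu>" using assms(15) by (simp add: universal_space_def)
 then interpret F: hahc_space F f0 \<mu>
  by unfold_locales (simp_all add: p_local_HAHC_space_def)
 interpret S: ha_space S s0 \<nu> by unfold_locales (rule assms)+
 \<comment> \<open>\<open>T\<close> is a \<open>(j + 1)\<close>-sphere and \<open>S\<close> a
   \<open>(j + 2)\<close>-sphere, so \<open>lam j\<close> and \<open>lam (Suc j)\<close> are their
   cube coordinates before localisation.\<close>
 obtain j where j: "2 * n = Suc j" using assms(3) by (cases "2 * n") auto
 have "odd p" using assms(1,2) prime_odd_nat by simp
 then have odd: "odd (p ^ r)" by simp
 have up: "null_homotopic F f0 F f0 (power_map f0 \<mu> (p ^ r))"
 proof (rule F.power_map_null_if_universal[OF assms(15)])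
  show "based_homotopic P p0 F f0 (power_map f0 \<mu> (p ^ r) \<circ> i) (\<lambda>_. f0)"
   unfolding assms(12)
   by (rule Moore_space_exponent[of p j, OF assms(1) _ _ odd F.hahc_space_axioms])
    (use assms(10,11,14) in \<open>simp_all add: j assms(12)\<close>)
 qed
 have low: "r \<le> a" if a: "null_homotopic F f0 F f0 (power_map f0 \<mu> (p ^ a))" for a
 proof (rule p_local_sphere_degree_divides[OF assms(1), of "Suc j" S s0])
  show "p_local_sphere p (Suc (Suc j)) S s0" using assms(5) j by simp
  show "\<exists>b \<in> carrier (relative_homology_group (int (Suc (Suc j))) S {s0}).
     hur (int (Suc (Suc j))) (Zc (Suc j)) (Bc (Suc j)) S s0 (l \<circ> lam (Suc j)) c [^]\<^bsub>relative_homology_group (int (Suc (Suc j))) S {s0}\<^esub> (p ^ a)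
      = b [^]\<^bsub>relative_homology_group (int (Suc (Suc j))) S {s0}\<^esub> (p ^ r)"
   if "based_map (nsphere (Suc (Suc j))) e1 S s0 l"
    "c \<in> carrier (relative_homology_group (int (Suc (Suc j))) (IZ (Zc (Suc j))) (dIZ (Zc (Suc j)) (Bc (Suc j))))" for l c
   by (rule fibre_power_divides[OF S.ha_space_axioms F.ha_space_axioms assms(8,9) that(1) a that(2)])
 qed
 have "(LEAST k. null_homotopic F f0 F f0 (power_map f0 \<mu> (p ^ k))) = r"
  by (rule Least_equality) (rule up, rule low)
 then show ?thesis using up low unfolding H_exp_def by (auto simp: not_le[symmetric])
qed

end
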